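(* Let $\mathbb K$ be an algebraically closed field of characteristic $3$. Let $\mathfrak e_7=\mathfrak g(A)$ with purely even Cartan matrix $$A=\begin{pmatrix}2&0&-1&0&0&0&0\\0&2&0&-1&0&0&0\\-1&0&2&-1&0&0&0\\0&-1&-1&2&-1&0&0\\0&0&0&-1&2&-1&0\\0&0&0&0&-1&2&-1\\0&0&0&0&0&-1&2\end{pmatrix}.$$ Let $\mathfrak{el}(5;3)=\mathfrak g(\widetilde A)$ be the Elduque Lie superalgebra with Cartan matrix $$\widetilde A=\begin{pmatrix}2&0&-1&0&0\\0&0&-1&0&0\\-1&-1&2&-1&0\\0&0&-1&2&-1\\0&0&0&-1&0\end{pmatrix}$$ in which indices $2,5$ are odd and indices $1,3,4$ are even. Then the semisimplification of $\mathfrak e_7$, as an object in $\mathrm{Rep}\,\alpha_3$ under the adjoint action of $e_1+e_7$, is (isomorphic as a Lie superalgebra to) $\mathfrak{el}(5;3)$.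
   Context: **Contragredient Lie superalgebras.** Lie superalgebras in characteristic $3$ are required to satisfy $[x,[x,x]]=0$ for odd $x$. Let $A=(a_{ij})$ be an $n\times n$ integer matrix (a Cartan matrix) with a parity $\mathrm{par}(i)\in\mathbb Z/2$ for each index; let $\overline A=(\overline a_{ij})$ be its reduction mod $3$, of rank $s$. Let $\widetilde{\mathfrak h}$ be a $\mathbb K$-vector space of dimension $2n-s$ with linearly independent $h_1,\dots,h_n\in\widetilde{\mathfrak h}$ and linearly independent $\alpha_1,\dots,\alpha_n\in\widetilde{\mathfrak h}^*$ such that $\alpha_j(h_i)=\overline a_{ij}$. $\widetilde{\mathfrak g}(A)$ is the Lie superalgebra generated by $\widetilde{\mathfrak h}$ (even) and $e_i,f_i$ ($1\le i\le n$) of parity $\mathrm{par}(i)$, with relations $[e_i,f_j]=\delta_{ij}h_i$, $[h,e_j]=\alpha_j(h)e_j$, $[h,f_j]=-\alpha_j(h)f_j$, $[\widetilde{\mathfrak h},\widetilde{\mathfrak h}]=0$. It is graded by the free abelian group $Q=\bigoplus_k\mathbb Z\alpha_k$ with $\deg e_i=\alpha_i$, $\deg f_i=-\alpha_i$, $\deg h=0$. $\mathfrak g(A)=\widetilde{\mathfrak g}(A)/\mathfrak r$, where $\mathfrak r$ is the largest $Q$-graded ideal meeting $\widetilde{\mathfrak h}$ trivially; images of $e_i,f_i,h_i$ keep their names. If all parities are $0$, $\mathfrak g(A)$ is a Lie algebra. **Semisimplification.** $\mathrm{Rep}\,\alpha_3$ (representations of the Frobenius kernel of $\mathbb G_a$)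 is the symmetric tensor category of finite-dimensional $\mathbb K[t]/(t^3)$-modules, with $t$ acting on $V\otimes W$ by $t\otimes1+1\otimes t$ and the flip as braiding. Its indecomposables are $J_1,J_2,J_3$, where $t$ acts on $J_n=\mathbb K^n$ as one nilpotent Jordan block. A Lie algebra $\mathfrak g$ with a derivation $d$, $d^3=0$, is a Lie algebra in $\mathrm{Rep}\,\alpha_3$ with $t$ acting by $d$; "under the adjoint action of $x$" means $d=\mathrm{ad}\,x$. The semisimplification functor $V\mapsto\overline V$ is the quotient of $\mathrm{Rep}\,\alpha_3$ by negligible morphisms ($u:V\to W$ with $\mathrm{tr}(u\circ v)=0$ for all $v:W\to V$), with target the Verlinde category $\mathrm{Ver}_3$, whose simple objects are $L_1=\overline{J_1}$, $L_2=\overline{J_2}$ ($\overline{J_3}=0$); $\mathrm{Ver}_3$ is identified with super vector spaces, $L_1$ being an even line and $L_2$ an odd line, so $\overline{\mathfrak g}$ is a Lie superalgebra. Explicitly, decompose $\mathfrak g$ into Jordan blocks $x_i$ ($i\le n_1$), $x_i\mapsto x_i'$ ($n_1<i\le n_1+n_2$), and blocks $x_i\mapsto x_i'\mapsto x_i''$ (arrows are the action of $d$). Then $\overline{\mathfrak g}$ has basis $y_i$ ($i\le n_1+n_2$), even for $i\le n_1$ and odd for $i>n_1$; the coefficient of $y_k$ in $[y_i,y_j]$ is the coefficient of $x_k$ in $[x_i,x_j]$ if the parities of $y_i,y_j,y_k$ are compatible and $y_i,y_j$ are not both odd; it is the coefficient of $x_k$ in $-[x_i,x_j']+[x_i',x_j]$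 if $i,j>n_1$, $k\le n_1$; and $0$ otherwise. *)

theory Defs
  imports
    "HOL-Library.Poly_Mapping"
    "HOL-Library.Z2"
    "HOL-Algebra.QuotRing"
    "Jordan_Normal_Form.DL_Rank"
begin

hide_const (open) Multiset.mult Modules.module_hom

section \<open>Superalgebras over a field\<close>

text \<open>The ground field is a type of class field, used as the ring \<open>class_ring\<close>. The multiplication
  of the record is the (super) bracket, and \<open>part 0\<close>, \<open>part 1\<close> are the even and odd subspaces.
  The unit field inherited from the ring record is never used.\<close>

record ('k, 'a) superalgebra = "('k, 'a) module" +
  part :: "bit \<Rightarrow> 'a set"

text \<open>The Koszul sign \<open>(-1) ^ (i j)\<close>.\<close>

definition ksign :: "bit \<Rightarrow> bit \<Rightarrow> 'k :: field" where
  "ksign i j = (if i = 1 \<and> j = 1 then - 1 else 1)"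

text \<open>Everything that has to vanish in a Lie superalgebra, including the condition
  \<open>[x, [x, x]] = 0\<close> for odd \<open>x\<close>, which does not follow from the Jacobi identity in
  characteristic 3.\<close>

definition lie_identities :: "('k :: field, 'a, 'm) superalgebra_scheme \<Rightarrow> 'a set" where
  "lie_identities L =
     {(x \<otimes>\<^bsub>L\<^esub> y) \<oplus>\<^bsub>L\<^esub> (ksign i j \<odot>\<^bsub>L\<^esub> (y \<otimes>\<^bsub>L\<^esub> x)) | i j x y. x \<in> part L i \<and> y \<in> part L j} \<union>
     {(x \<otimes>\<^bsub>L\<^esub> (y \<otimes>\<^bsub>L\<^esub> z)) \<ominus>\<^bsub>L\<^esub> (((x \<otimes>\<^bsub>L\<^esub> y) \<otimes>\<^bsub>L\<^esub> z) \<oplus>\<^bsub>L\<^esub> (ksign i j \<odot>\<^bsub>L\<^esub> (y \<otimes>\<^bsub>L\<^esub> (x \<otimes>\<^bsub>L\<^esub> z))))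
        | i j x y z. x \<in> part L i \<and> y \<in> part L j \<and> z \<in> carrier L} \<union>
     {x \<otimes>\<^bsub>L\<^esub> (x \<otimes>\<^bsub>L\<^esub> x) | x. x \<in> part L 1}"

locale lie_superalgebra =
  fixes L :: "('k :: field, 'a, 'm) superalgebra_scheme" (structure)
  assumes vs: "vectorspace class_ring L"
    and part_subspace: "subspace class_ring (part L i) L"
    and part_direct: "x \<in> carrier L \<Longrightarrow> \<exists>!p. p \<in> part L 0 \<times> part L 1 \<and> x = fst p \<oplus> snd p"
    and br_part: "x \<in> part L i \<Longrightarrow> y \<in> part L j \<Longrightarrow> x \<otimes> y \<in> part L (i + j)"
    and br_left: "x \<in> carrier L \<Longrightarrow> (\<lambda>y. x \<otimes> y) \<in> module_hom class_ring L L"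
    and br_right: "y \<in> carrier L \<Longrightarrow> (\<lambda>x. x \<otimes> y) \<in> module_hom class_ring L L"
    and lie: "lie_identities L \<subseteq> {\<zero>}"

definition lie_superalgebra_iso ::
    "('k :: field, 'a, 'm) superalgebra_scheme \<Rightarrow> ('k, 'b, 'n) superalgebra_scheme \<Rightarrow> ('a \<Rightarrow> 'b) set" where
  "lie_superalgebra_iso L M =
     {f \<in> module_hom class_ring L M. bij_betw f (carrier L) (carrier M) \<and>
        (\<forall>x\<in>carrier L. \<forall>y\<in>carrier L. f (x \<otimes>\<^bsub>L\<^esub> y) = f x \<otimes>\<^bsub>M\<^esub> f y) \<and>
        (\<forall>i. f ` part L i = part M i)}"

definition isomorphic_lie_superalgebras ::
    "('k :: field, 'a, 'm) superalgebra_scheme \<Rightarrow> ('k, 'b, 'n) superalgebra_scheme \<Rightarrow> bool" where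
  "isomorphic_lie_superalgebras L M \<longleftrightarrow>
     lie_superalgebra L \<and> lie_superalgebra M \<and> lie_superalgebra_iso L M \<noteq> {}"

subsection \<open>Ideals and quotients\<close>

definition algebra_ideal :: "('k :: field, 'a, 'm) superalgebra_scheme \<Rightarrow> 'a set \<Rightarrow> bool" where
  "algebra_ideal L J \<longleftrightarrow> subspace class_ring J L \<and>
     (\<forall>x\<in>carrier L. \<forall>y\<in>J. x \<otimes>\<^bsub>L\<^esub> y \<in> J \<and> y \<otimes>\<^bsub>L\<^esub> x \<in> J)"

definition ideal_generated :: "('k :: field, 'a, 'm) superalgebra_scheme \<Rightarrow> 'a set \<Rightarrow> 'a set" where
  "ideal_generated L S = \<Inter> {J. algebra_ideal L J \<and> S \<subseteq> J}"

definition quotient_superalgebra ::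
    "('k :: field, 'a, 'm) superalgebra_scheme \<Rightarrow> 'a set \<Rightarrow> ('k, 'a set) superalgebra" where
  "quotient_superalgebra L J =
     \<lparr>carrier = carrier (L Quot J), mult = mult (L Quot J), one = one (L Quot J),
      zero = zero (L Quot J), add = add (L Quot J),
      smult = (\<lambda>c X. \<Union>x\<in>X. J +>\<^bsub>L\<^esub> (c \<odot>\<^bsub>L\<^esub> x)),
      part = (\<lambda>i. (\<lambda>x. J +>\<^bsub>L\<^esub> x) ` part L i)\<rparr>"

section \<open>Lie superalgebras given by generators and relations\<close>

text \<open>Nonassociative words over a set of generators; the free nonassociative algebra consists of
  their finitely supported linear combinations.\<close>

datatype 'g word = Gen 'g | Br "'g word" "'g word"

fun word_sum :: "('g \<Rightarrow> 'q :: plus) \<Rightarrow> 'g word \<Rightarrow> 'q" where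
  "word_sum p (Gen g) = p g"
| "word_sum p (Br s t) = word_sum p s + word_sum p t"

definition free_superalgebra ::
    "'g set \<Rightarrow> ('g \<Rightarrow> bit) \<Rightarrow> ('k :: field, 'g word \<Rightarrow>\<^sub>0 'k) superalgebra" where
  "free_superalgebra X p =
     \<lparr>carrier = {a. \<forall>t\<in>Poly_Mapping.keys a. set_word t \<subseteq> X},
      mult = (\<lambda>a b. \<Sum>s\<in>Poly_Mapping.keys a. \<Sum>t\<in>Poly_Mapping.keys b.
                Poly_Mapping.single (Br s t) (Poly_Mapping.lookup a s * Poly_Mapping.lookup b t)),
      one = undefined, zero = 0, add = (+),
      smult = (\<lambda>c. Poly_Mapping.map ((*) c)),
      part = (\<lambda>i. {a. \<forall>t\<in>Poly_Mapping.keys a. set_word t \<subseteq> X \<and> word_sum p t = i})\<rparr>"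

definition gen :: "'g \<Rightarrow> ('g word \<Rightarrow>\<^sub>0 'k :: field)" where
  "gen g = Poly_Mapping.single (Gen g) 1"

definition presentation_ideal ::
    "'g set \<Rightarrow> ('g \<Rightarrow> bit) \<Rightarrow> ('g word \<Rightarrow>\<^sub>0 'k :: field) set \<Rightarrow> ('g word \<Rightarrow>\<^sub>0 'k) set" where
  "presentation_ideal X p S =
     ideal_generated (free_superalgebra X p) (lie_identities (free_superalgebra X p) \<union> S)"

definition presented_lie_superalgebra ::
    "'g set \<Rightarrow> ('g \<Rightarrow> bit) \<Rightarrow> ('g word \<Rightarrow>\<^sub>0 'k :: field) set \<Rightarrow>
       ('k, ('g word \<Rightarrow>\<^sub>0 'k) set) superalgebra" where
  "presented_lie_superalgebra X p S =
     quotient_superalgebra (free_superalgebra X p) (presentation_ideal X p S)"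

section \<open>Contragredient Lie superalgebras\<close>

text \<open>Indices run over \<open>0, \<dots>, n - 1\<close>. A realization of an integer \<open>n \<times> n\<close> matrix \<open>A\<close> consists
  of a space \<open>H\<close> of dimension \<open>2 n - s\<close>, where \<open>s\<close> is the rank of \<open>A\<close> over the field, elements \<open>h i\<close>
  of \<open>H\<close> and linear forms \<open>\<alpha> j\<close> on \<open>H\<close>. The coercion \<open>of_int\<close> is the reduction of the entries
  modulo the characteristic.\<close>

definition linear_form :: "('k :: field, 'a, 'm) module_scheme \<Rightarrow> ('a \<Rightarrow> 'k) \<Rightarrow> bool" where
  "linear_form V \<phi> \<longleftrightarrow>
     (\<forall>x\<in>carrier V. \<forall>y\<in>carrier V. \<phi> (x \<oplus>\<^bsub>V\<^esub> y) = \<phi> x + \<phi> y) \<and>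
     (\<forall>c. \<forall>x\<in>carrier V. \<phi> (c \<odot>\<^bsub>V\<^esub> x) = c * \<phi> x)"

definition realization ::
    "nat \<Rightarrow> int mat \<Rightarrow> ('k :: field, 'h) module \<Rightarrow> (nat \<Rightarrow> 'h) \<Rightarrow> (nat \<Rightarrow> 'h \<Rightarrow> 'k) \<Rightarrow> bool" where
  "realization n A H h \<alpha> \<longleftrightarrow> A \<in> carrier_mat n n \<and>
     vectorspace class_ring H \<and> vectorspace.fin_dim class_ring H \<and>
     vectorspace.dim class_ring H = 2 * n - vec_space.rank n (map_mat of_int A :: 'k mat) \<and>
     h ` {..<n} \<subseteq> carrier H \<and> inj_on h {..<n} \<and> \<not> module.lin_dep class_ring H (h ` {..<n}) \<and>
     (\<forall>j<n. linear_form H (\<alpha> j)) \<and>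
     (\<forall>c. (\<forall>x\<in>carrier H. (\<Sum>j<n. c j * \<alpha> j x) = 0) \<longrightarrow> (\<forall>j<n. c j = 0)) \<and>
     (\<forall>i<n. \<forall>j<n. \<alpha> j (h i) = of_int (A $$ (i, j)))"

text \<open>Generators: a symbol for every element of the torus \<open>H\<close>, and the symbols for \<open>e i\<close>, \<open>f i\<close>.\<close>

datatype 'h chevalley = GH 'h | GE nat | GF nat

definition chevalley_gens :: "nat \<Rightarrow> ('k, 'h) module \<Rightarrow> 'h chevalley set" where
  "chevalley_gens n H = GH ` carrier H \<union> GE ` {..<n} \<union> GF ` {..<n}"

fun chevalley_parity :: "(nat \<Rightarrow> bit) \<Rightarrow> 'h chevalley \<Rightarrow> bit" where
  "chevalley_parity par (GH x) = 0"
| "chevalley_parity par (GE i) = par i"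
| "chevalley_parity par (GF i) = par i"

text \<open>The root lattice, free abelian on the simple roots, is a subgroup of \<open>nat \<Rightarrow>\<^sub>0 int\<close>.\<close>

fun chevalley_degree :: "'h chevalley \<Rightarrow> (nat \<Rightarrow>\<^sub>0 int)" where
  "chevalley_degree (GH x) = 0"
| "chevalley_degree (GE i) = Poly_Mapping.single i 1"
| "chevalley_degree (GF i) = Poly_Mapping.single i (- 1)"

text \<open>The first two families express that \<open>x \<mapsto> GH x\<close> is linear on \<open>H\<close>.\<close>

definition chevalley_relations ::
    "nat \<Rightarrow> (nat \<Rightarrow> bit) \<Rightarrow> ('k :: field, 'h) module \<Rightarrow> (nat \<Rightarrow> 'h) \<Rightarrow> (nat \<Rightarrow> 'h \<Rightarrow> 'k) \<Rightarrow>
       ('h chevalley word \<Rightarrow>\<^sub>0 'k) set" where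
  "chevalley_relations n par H h \<alpha> =
     (let G = free_superalgebra (chevalley_gens n H) (chevalley_parity par);
          hh = (\<lambda>x. gen (GH x)); e = (\<lambda>i. gen (GE i)); f = (\<lambda>i. gen (GF i)) in
      {hh (x \<oplus>\<^bsub>H\<^esub> y) - (hh x + hh y) | x y. x \<in> carrier H \<and> y \<in> carrier H} \<union>
      {hh (c \<odot>\<^bsub>H\<^esub> x) - (c \<odot>\<^bsub>G\<^esub> hh x) | c x. x \<in> carrier H} \<union>
      {hh x \<otimes>\<^bsub>G\<^esub> hh y | x y. x \<in> carrier H \<and> y \<in> carrier H} \<union>
      {(hh x \<otimes>\<^bsub>G\<^esub> e j) - (\<alpha> j x \<odot>\<^bsub>G\<^esub> e j) | x j. x \<in> carrier H \<and> j < n} \<union>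
      {(hh x \<otimes>\<^bsub>G\<^esub> f j) + (\<alpha> j x \<odot>\<^bsub>G\<^esub> f j) | x j. x \<in> carrier H \<and> j < n} \<union>
      {(e i \<otimes>\<^bsub>G\<^esub> f j) - (if i = j then hh (h i) else 0) | i j. i < n \<and> j < n})"

definition contragredient_tilde ::
    "nat \<Rightarrow> (nat \<Rightarrow> bit) \<Rightarrow> ('k :: field, 'h) module \<Rightarrow> (nat \<Rightarrow> 'h) \<Rightarrow> (nat \<Rightarrow> 'h \<Rightarrow> 'k) \<Rightarrow>
       ('k, ('h chevalley word \<Rightarrow>\<^sub>0 'k) set) superalgebra" where
  "contragredient_tilde n par H h \<alpha> =
     presented_lie_superalgebra (chevalley_gens n H) (chevalley_parity par)
       (chevalley_relations n par H h \<alpha>)"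

definition to_tilde ::
    "nat \<Rightarrow> (nat \<Rightarrow> bit) \<Rightarrow> ('k :: field, 'h) module \<Rightarrow> (nat \<Rightarrow> 'h) \<Rightarrow> (nat \<Rightarrow> 'h \<Rightarrow> 'k) \<Rightarrow>
       ('h chevalley word \<Rightarrow>\<^sub>0 'k) \<Rightarrow> ('h chevalley word \<Rightarrow>\<^sub>0 'k) set" where
  "to_tilde n par H h \<alpha> a =
     presentation_ideal (chevalley_gens n H) (chevalley_parity par) (chevalley_relations n par H h \<alpha>)
       +>\<^bsub>free_superalgebra (chevalley_gens n H) (chevalley_parity par)\<^esub> a"

definition tilde_component ::
    "nat \<Rightarrow> (nat \<Rightarrow> bit) \<Rightarrow> ('k :: field, 'h) module \<Rightarrow> (nat \<Rightarrow> 'h) \<Rightarrow> (nat \<Rightarrow> 'h \<Rightarrow> 'k) \<Rightarrow>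
       (nat \<Rightarrow>\<^sub>0 int) \<Rightarrow> ('h chevalley word \<Rightarrow>\<^sub>0 'k) set set" where
  "tilde_component n par H h \<alpha> q =
     to_tilde n par H h \<alpha> `
       {a. \<forall>t\<in>Poly_Mapping.keys a. set_word t \<subseteq> chevalley_gens n H \<and> word_sum chevalley_degree t = q}"

definition tilde_graded_ideal ::
    "nat \<Rightarrow> (nat \<Rightarrow> bit) \<Rightarrow> ('k :: field, 'h) module \<Rightarrow> (nat \<Rightarrow> 'h) \<Rightarrow> (nat \<Rightarrow> 'h \<Rightarrow> 'k) \<Rightarrow>
       ('h chevalley word \<Rightarrow>\<^sub>0 'k) set set \<Rightarrow> bool" where
  "tilde_graded_ideal n par H h \<alpha> J \<longleftrightarrow>
     algebra_ideal (contragredient_tilde n par H h \<alpha>) J \<and>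
     J = LinearCombinations.module.span class_ring (contragredient_tilde n par H h \<alpha>)
           (\<Union>q. J \<inter> tilde_component n par H h \<alpha> q)"

definition tilde_torus ::
    "nat \<Rightarrow> (nat \<Rightarrow> bit) \<Rightarrow> ('k :: field, 'h) module \<Rightarrow> (nat \<Rightarrow> 'h) \<Rightarrow> (nat \<Rightarrow> 'h \<Rightarrow> 'k) \<Rightarrow>
       ('h chevalley word \<Rightarrow>\<^sub>0 'k) set set" where
  "tilde_torus n par H h \<alpha> = (\<lambda>x. to_tilde n par H h \<alpha> (gen (GH x))) ` carrier H"

definition max_graded_ideal ::
    "nat \<Rightarrow> (nat \<Rightarrow> bit) \<Rightarrow> ('k :: field, 'h) module \<Rightarrow> (nat \<Rightarrow> 'h) \<Rightarrow> (nat \<Rightarrow> 'h \<Rightarrow> 'k) \<Rightarrow>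
       ('h chevalley word \<Rightarrow>\<^sub>0 'k) set set" where
  "max_graded_ideal n par H h \<alpha> =
     (GREATEST J. tilde_graded_ideal n par H h \<alpha> J \<and>
        J \<inter> tilde_torus n par H h \<alpha> = {\<zero>\<^bsub>contragredient_tilde n par H h \<alpha>\<^esub>})"

definition contragredient ::
    "nat \<Rightarrow> (nat \<Rightarrow> bit) \<Rightarrow> ('k :: field, 'h) module \<Rightarrow> (nat \<Rightarrow> 'h) \<Rightarrow> (nat \<Rightarrow> 'h \<Rightarrow> 'k) \<Rightarrow>
       ('k, ('h chevalley word \<Rightarrow>\<^sub>0 'k) set set) superalgebra" where
  "contragredient n par H h \<alpha> =
     quotient_superalgebra (contragredient_tilde n par H h \<alpha>) (max_graded_ideal n par H h \<alpha>)"

definition contragredient_e ::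
    "nat \<Rightarrow> (nat \<Rightarrow> bit) \<Rightarrow> ('k :: field, 'h) module \<Rightarrow> (nat \<Rightarrow> 'h) \<Rightarrow> (nat \<Rightarrow> 'h \<Rightarrow> 'k) \<Rightarrow>
       nat \<Rightarrow> ('h chevalley word \<Rightarrow>\<^sub>0 'k) set set" where
  "contragredient_e n par H h \<alpha> i =
     max_graded_ideal n par H h \<alpha> +>\<^bsub>contragredient_tilde n par H h \<alpha>\<^esub>
       to_tilde n par H h \<alpha> (gen (GE i))"

section \<open>Semisimplification\<close>

text \<open>An object of the category of representations is a finite-dimensional space \<open>V\<close> with an
  endomorphism \<open>t\<close> such that \<open>t^3 = 0\<close>.\<close>

definition alpha3_object :: "('k :: field, 'a, 'm) module_scheme \<Rightarrow> ('a \<Rightarrow> 'a) \<Rightarrow> bool" where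
  "alpha3_object V t \<longleftrightarrow> vectorspace class_ring V \<and> vectorspace.fin_dim class_ring V \<and>
     t \<in> module_hom class_ring V V \<and> (\<forall>x\<in>carrier V. t (t (t x)) = \<zero>\<^bsub>V\<^esub>)"

definition alpha3_hom ::
    "('k :: field, 'a, 'm) module_scheme \<Rightarrow> ('a \<Rightarrow> 'a) \<Rightarrow>
     ('k, 'b, 'n) module_scheme \<Rightarrow> ('b \<Rightarrow> 'b) \<Rightarrow> ('a \<Rightarrow> 'b) set" where
  "alpha3_hom V s W t = {u \<in> module_hom class_ring V W. \<forall>x\<in>carrier V. u (s x) = t (u x)}"

text \<open>A basis \<open>b 0, \<dots>, b (n - 1)\<close> with its dual basis of linear forms. The trace computed from it
  does not depend on the choice.\<close>

definition dual_bases ::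
    "('k :: field, 'a, 'm) module_scheme \<Rightarrow> nat \<Rightarrow> (nat \<Rightarrow> 'a) \<Rightarrow> (nat \<Rightarrow> 'a \<Rightarrow> 'k) \<Rightarrow> bool" where
  "dual_bases V n b \<phi> \<longleftrightarrow>
     (\<forall>i<n. b i \<in> carrier V \<and> linear_form V (\<phi> i)) \<and>
     (\<forall>i<n. \<forall>j<n. \<phi> i (b j) = (if i = j then 1 else 0)) \<and>
     (\<forall>x\<in>carrier V. x = (\<Oplus>\<^bsub>V\<^esub>i\<in>{..<n}. \<phi> i x \<odot>\<^bsub>V\<^esub> b i))"

definition vs_trace :: "('k :: field, 'a, 'm) module_scheme \<Rightarrow> ('a \<Rightarrow> 'a) \<Rightarrow> 'k" where
  "vs_trace V f = (THE c. \<exists>n b \<phi>. dual_bases V n b \<phi> \<and> c = (\<Sum>i<n. \<phi> i (f (b i))))"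

definition negligible ::
    "('k :: field, 'a, 'm) module_scheme \<Rightarrow> ('a \<Rightarrow> 'a) \<Rightarrow>
     ('k, 'b, 'n) module_scheme \<Rightarrow> ('b \<Rightarrow> 'b) \<Rightarrow> ('a \<Rightarrow> 'b) \<Rightarrow> bool" where
  "negligible V s W t u \<longleftrightarrow> (\<forall>v\<in>alpha3_hom W t V s. vs_trace W (u \<circ> v) = 0)"

text \<open>The indecomposable \<open>J_n\<close> is \<open>module_vec\<close> of dimension \<open>n\<close> with the shift \<open>b_0 \<mapsto> b_1 \<mapsto> \<dots> \<mapsto> 0\<close>.
  Evaluation at \<open>b_0\<close> identifies \<open>Hom (J_n, V)\<close> with the kernel of \<open>t^n\<close>; the inverse sends \<open>x\<close> to
  \<open>jordan_hom V t n x\<close>.\<close>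

definition jordan_shift :: "nat \<Rightarrow> 'k :: field vec \<Rightarrow> 'k vec" where
  "jordan_shift n c = vec n (\<lambda>i. if i = 0 then 0 else c $ (i - 1))"

definition jordan_hom ::
    "('k :: field, 'a, 'm) module_scheme \<Rightarrow> ('a \<Rightarrow> 'a) \<Rightarrow> nat \<Rightarrow> 'a \<Rightarrow> 'k vec \<Rightarrow> 'a" where
  "jordan_hom V t n x = (\<lambda>c. \<Oplus>\<^bsub>V\<^esub>i\<in>{..<n}. (c $ i) \<odot>\<^bsub>V\<^esub> (t ^^ i) x)"

definition hom_space :: "('k :: field, 'a, 'm) module_scheme \<Rightarrow> ('a \<Rightarrow> 'a) \<Rightarrow> nat \<Rightarrow> 'a set" where
  "hom_space V t n = {x \<in> carrier V. (t ^^ n) x = \<zero>\<^bsub>V\<^esub>}"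

definition negligible_space :: "('k :: field, 'a, 'm) module_scheme \<Rightarrow> ('a \<Rightarrow> 'a) \<Rightarrow> nat \<Rightarrow> 'a set" where
  "negligible_space V t n =
     {x \<in> hom_space V t n.
        negligible (module_vec TYPE('k) n) (jordan_shift n) V t (jordan_hom V t n x)}"

definition alpha3_lie_algebra ::
    "('k :: field, 'a, 'm) superalgebra_scheme \<Rightarrow> ('a \<Rightarrow> 'a) \<Rightarrow> bool" where
  "alpha3_lie_algebra L d \<longleftrightarrow> lie_superalgebra L \<and> part L 1 = {\<zero>\<^bsub>L\<^esub>} \<and> alpha3_object L d \<and>
     (\<forall>x\<in>carrier L. \<forall>y\<in>carrier L. d (x \<otimes>\<^bsub>L\<^esub> y) = (d x \<otimes>\<^bsub>L\<^esub> y) \<oplus>\<^bsub>L\<^esub> (x \<otimes>\<^bsub>L\<^esub> d y))"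

text \<open>The identification of the Verlinde category with super vector spaces sends an object \<open>V\<close> to the
  even space \<open>Hom (L_1, V)\<close> plus the odd space \<open>Hom (L_2, V)\<close>, and morphisms in the Verlinde category
  are morphisms of representations modulo negligible ones. For a Lie algebra, \<open>u : J_a \<rightarrow> L\<close> and
  \<open>v : J_b \<rightarrow> L\<close> (\<open>a, b \<le> 2\<close>) have as bracket the composite of \<open>u \<otimes> v\<close> and the bracket of \<open>L\<close>,
  precomposed with the inclusion of the non-negligible summand of \<open>J_a \<otimes> J_b\<close>. For \<open>a = b = 2\<close> this
  summand is the line spanned by \<open>b_1 \<otimes> b_0 - b_0 \<otimes> b_1\<close>, which gives \<open>[d y, y'] - [y, d y']\<close>.
  If \<open>x_i\<close>, \<open>x_i \<mapsto> x_i'\<close>, \<open>x_i \<mapsto> x_i' \<mapsto> x_i''\<close> is a Jordan basis of \<open>L\<close>, the tops \<open>x_i\<close> of the blocks of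
  sizes 1 and 2 give bases of the even and of the odd part, and the structure constants are those of
  \<open>[x_i, x_j]\<close>, respectively \<open>- [x_i, x_j'] + [x_i', x_j]\<close> for two odd elements.\<close>

definition hom_superalgebra ::
    "('k :: field, 'a, 'm) superalgebra_scheme \<Rightarrow> ('a \<Rightarrow> 'a) \<Rightarrow> ('k, 'a \<times> 'a) superalgebra" where
  "hom_superalgebra L d =
     \<lparr>carrier = hom_space L d 1 \<times> hom_space L d 2,
      mult = (\<lambda>(x, y) (x', y').
        ((x \<otimes>\<^bsub>L\<^esub> x') \<oplus>\<^bsub>L\<^esub> ((d y \<otimes>\<^bsub>L\<^esub> y') \<ominus>\<^bsub>L\<^esub> (y \<otimes>\<^bsub>L\<^esub> d y')), (x \<otimes>\<^bsub>L\<^esub> y') \<oplus>\<^bsub>L\<^esub> (y \<otimes>\<^bsub>L\<^esub> x'))),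
      one = undefined, zero = (\<zero>\<^bsub>L\<^esub>, \<zero>\<^bsub>L\<^esub>),
      add = (\<lambda>(x, y) (x', y'). (x \<oplus>\<^bsub>L\<^esub> x', y \<oplus>\<^bsub>L\<^esub> y')),
      smult = (\<lambda>c (x, y). (c \<odot>\<^bsub>L\<^esub> x, c \<odot>\<^bsub>L\<^esub> y)),
      part = (\<lambda>i. if i = 0 then hom_space L d 1 \<times> {\<zero>\<^bsub>L\<^esub>} else {\<zero>\<^bsub>L\<^esub>} \<times> hom_space L d 2)\<rparr>"

definition semisimplification ::
    "('k :: field, 'a, 'm) superalgebra_scheme \<Rightarrow> ('a \<Rightarrow> 'a) \<Rightarrow> ('k, ('a \<times> 'a) set) superalgebra" where
  "semisimplification L d =
     quotient_superalgebra (hom_superalgebra L d) (negligible_space L d 1 \<times> negligible_space L d 2)"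

section \<open>The two Cartan matrices\<close>

definition cartan_e7 :: "int mat" where
  "cartan_e7 = mat_of_rows_list 7
     [[ 2,  0, -1,  0,  0,  0,  0],
      [ 0,  2,  0, -1,  0,  0,  0],
      [-1,  0,  2, -1,  0,  0,  0],
      [ 0, -1, -1,  2, -1,  0,  0],
      [ 0,  0,  0, -1,  2, -1,  0],
      [ 0,  0,  0,  0, -1,  2, -1],
      [ 0,  0,  0,  0,  0, -1,  2]]"

definition cartan_el53 :: "int mat" where
  "cartan_el53 = mat_of_rows_list 5
     [[ 2,  0, -1,  0,  0],
      [ 0,  0, -1,  0,  0],
      [-1, -1,  2, -1,  0],
      [ 0,  0, -1,  2, -1],
      [ 0,  0,  0, -1,  0]]"

definition parity_e7 :: "nat \<Rightarrow> bit" where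
  "parity_e7 i = 0"

text \<open>With indices starting at 1, the odd ones are 2 and 5.\<close>

definition parity_el53 :: "nat \<Rightarrow> bit" where
  "parity_el53 i = (if i = 1 \<or> i = 4 then 1 else 0)"

end

theory Submission
  imports Defs "HOL-Library.Product_Plus"
begin

text \<open>The algebra \<open>g(A)\<close> of type \<open>E_7\<close> is the Lie algebra of the root lattice (torus plus root vectors, with
  a bilinear sign), because that algebra is generated by Chevalley generators and has no homogeneous vector
  outside the torus killed by the opposite component. Put \<open>E = ad (e_1 + e_7)\<close>, the sum of two commuting
  root vectors; it belongs to an \<open>sl_2\<close> whose weights on the algebra are at most 2 in absolute value.
  In characteristic 3 the blocks of \<open>E\<close> of size 3 start in weight \<open>-2\<close>, those of size 2 in weight \<open>-1\<close>, and those
  of size 1 fill the kernel \<open>C0\<close> of \<open>E\<close> in weight 0. So the semisimplification is \<open>C0 + C1\<close> with \<open>C1\<close> the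
  weight \<open>-1\<close> part. Forgetting the coordinates of roots at the simple roots 1 and 7 grades it by the root
  lattice of the 5 remaining nodes, with components of dimension 1 away from degree 0, and explicit
  Chevalley generators satisfy the relations of the second Cartan matrix. Generation and the absence of
  further graded ideals are finite checks over the 66 degrees. Both Cartan matrices have determinant 2,
  so the tori have dimension \<open>n\<close>.\<close>

text \<open>Characteristic 3 enters in two ways. The constants 2 = -1 and 4 = 1 are invertible, so
  the usual identities for \<open>F E\<close> and \<open>F F E E\<close> still make \<open>E\<close>
  injective on weight -1 and \<open>E E\<close> injective on weight -2. And 3 = 0 is what makes the
  symmetric pairing [E y, z] - [y, E z] on \<open>C1\<close> satisfy the super Jacobi identity. That
  identity yields only 3 [y, [y, y]] = 0, so the cubic condition needs its own argument.
  Negligibility is a statement about traces against all morphisms; it is first turned into one about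
  linear forms. The kernels of \<open>E\<close> and \<open>E E\<close> also contain higher weights,
  but passing to the component of lowest possible weight is multiplicative, and its kernel is
  exactly the negligible part. For contragredient algebras the obstacle is to compute a largest
  graded ideal inside a presented algebra. It suffices to know that the degree 0 part is toral: a
  homogeneous element surviving in the model could be bracketed into the torus. The two sides are
  never compared directly; each is mapped isomorphically to one explicit algebra, and the Lie axioms
  are pulled back.\<close>

lemma subspace_iff:
  "subspace class_ring W V \<longleftrightarrow> vectorspace class_ring V \<and> W \<subseteq> carrier V \<and> \<zero>\<^bsub>V\<^esub> \<in> W \<and>
     (\<forall>x\<in>W. \<forall>y\<in>W. x \<oplus>\<^bsub>V\<^esub> y \<in> W) \<and> (\<forall>c. \<forall>x\<in>W. c \<odot>\<^bsub>V\<^esub> x \<in> W)"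
  unfolding subspace_def submodule_def vectorspace_def by (auto simp: class_ring_simps)

lemma module_hom_iff:
  "f \<in> module_hom class_ring V W \<longleftrightarrow> f \<in> carrier V \<rightarrow> carrier W \<and>
     (\<forall>x\<in>carrier V. \<forall>y\<in>carrier V. f (x \<oplus>\<^bsub>V\<^esub> y) = f x \<oplus>\<^bsub>W\<^esub> f y) \<and>
     (\<forall>c. \<forall>x\<in>carrier V. f (c \<odot>\<^bsub>V\<^esub> x) = c \<odot>\<^bsub>W\<^esub> f x)"
  unfolding LinearCombinations.module_hom_def by (auto simp: class_ring_simps)

section \<open>Bilinear algebras, their ideals and quotients\<close>

text \<open>Only bilinearity is assumed, because ideals, quotients and homomorphisms are needed
  where no Lie identity is available yet: for the free algebra, for its quotients before they are
  identified, and for the pairs of Hom spaces.\<close>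

locale nonassoc_algebra =
  fixes L :: "('k :: field, 'a, 'm) superalgebra_scheme" (structure)
  assumes vs: "vectorspace class_ring L"
    and br_left: "x \<in> carrier L \<Longrightarrow> (\<lambda>y. x \<otimes> y) \<in> module_hom class_ring L L"
    and br_right: "y \<in> carrier L \<Longrightarrow> (\<lambda>x. x \<otimes> y) \<in> module_hom class_ring L L"

lemma (in lie_superalgebra) is_nonassoc_algebra: "nonassoc_algebra L"
  using vs br_left br_right by (rule nonassoc_algebra.intro)

context nonassoc_algebra begin

sublocale V: vectorspace class_ring L by (rule vs)

lemma smult_closed [simp]: "x \<in> carrier L \<Longrightarrow> c \<odot> x \<in> carrier L"
  using V.smult_closed by (simp add: class_ring_simps)

lemma br_closed [simp]: "x \<in> carrier L \<Longrightarrow> y \<in> carrier L \<Longrightarrow> x \<otimes> y \<in> carrier L"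
  using br_left[of x] by (auto simp: module_hom_iff)

lemma br_add_right:
  "x \<in> carrier L \<Longrightarrow> y \<in> carrier L \<Longrightarrow> z \<in> carrier L \<Longrightarrow> x \<otimes> (y \<oplus> z) = (x \<otimes> y) \<oplus> (x \<otimes> z)"
  using br_left[of x] by (auto simp: module_hom_iff)

lemma br_add_left:
  "x \<in> carrier L \<Longrightarrow> y \<in> carrier L \<Longrightarrow> z \<in> carrier L \<Longrightarrow> (y \<oplus> z) \<otimes> x = (y \<otimes> x) \<oplus> (z \<otimes> x)"
  using br_right[of x] by (auto simp: module_hom_iff)

lemma br_smult_right: "x \<in> carrier L \<Longrightarrow> y \<in> carrier L \<Longrightarrow> x \<otimes> (c \<odot> y) = c \<odot> (x \<otimes> y)"
  using br_left[of x] by (auto simp: module_hom_iff)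

lemma br_smult_left: "x \<in> carrier L \<Longrightarrow> y \<in> carrier L \<Longrightarrow> (c \<odot> y) \<otimes> x = c \<odot> (y \<otimes> x)"
  using br_right[of x] by (auto simp: module_hom_iff)

lemma smult_zero_left [simp]: "x \<in> carrier L \<Longrightarrow> 0 \<odot> x = \<zero>"
  using V.smult_l_null by (simp add: class_ring_simps)

lemma smult_one [simp]: "x \<in> carrier L \<Longrightarrow> 1 \<odot> x = x"
  using V.smult_one by (simp add: class_ring_simps)

lemma smult_minus_one: "x \<in> carrier L \<Longrightarrow> (- 1) \<odot> x = \<ominus> x"
  using V.smult_l_minus[of 1 x] by (simp add: class_ring_simps)

lemma smult_add: "x \<in> carrier L \<Longrightarrow> y \<in> carrier L \<Longrightarrow> c \<odot> (x \<oplus> y) = (c \<odot> x) \<oplus> (c \<odot> y)"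
  using V.smult_r_distr by (simp add: class_ring_simps)

lemma add_smult: "x \<in> carrier L \<Longrightarrow> (b + c) \<odot> x = (b \<odot> x) \<oplus> (c \<odot> x)"
  using V.smult_l_distr[of b c x] by (simp add: class_ring_simps)

lemma smult_smult: "x \<in> carrier L \<Longrightarrow> b \<odot> (c \<odot> x) = (b * c) \<odot> x"
  using V.smult_assoc1[of b c x] by (simp add: class_ring_simps)

lemma smult_zero_right [simp]: "c \<odot> \<zero> = \<zero>"
  using V.smult_r_null by (simp add: class_ring_simps)

lemma br_zero_left [simp]: "x \<in> carrier L \<Longrightarrow> \<zero> \<otimes> x = \<zero>"
  using br_smult_left[of x \<zero> 0] by simp

lemma br_zero_right [simp]: "x \<in> carrier L \<Longrightarrow> x \<otimes> \<zero> = \<zero>"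
  using br_smult_right[of x \<zero> 0] by simp

end

locale nonassoc_ideal = nonassoc_algebra +
  fixes J
  assumes J: "algebra_ideal L J"
begin

abbreviation Q where "Q \<equiv> quotient_superalgebra L J"

lemma J_sub: "J \<subseteq> carrier L" and J_zero [simp]: "\<zero> \<in> J"
  and J_add: "x \<in> J \<Longrightarrow> y \<in> J \<Longrightarrow> x \<oplus> y \<in> J"
  and J_smult: "x \<in> J \<Longrightarrow> c \<odot> x \<in> J"
  using J by (auto simp: algebra_ideal_def subspace_iff)

lemma J_br: "x \<in> carrier L \<Longrightarrow> y \<in> J \<Longrightarrow> x \<otimes> y \<in> J" "x \<in> carrier L \<Longrightarrow> y \<in> J \<Longrightarrow> y \<otimes> x \<in> J"
  using J by (auto simp: algebra_ideal_def)

lemma J_carrier [simp]: "x \<in> J \<Longrightarrow> x \<in> carrier L"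
  using J_sub by auto

lemma J_uminus: "x \<in> J \<Longrightarrow> \<ominus> x \<in> J"
  using J_smult[of x "- 1"] by (simp add: smult_minus_one)

sublocale S: abelian_subgroup J L
proof (rule abelian_subgroupI3)
  show "additive_subgroup J L"
  proof (rule additive_subgroupI, rule subgroup.intro)
    show "\<And>x. x \<in> J \<Longrightarrow> inv\<^bsub>add_monoid L\<^esub> x \<in> J"
      using J_uminus unfolding a_inv_def by auto
    show "J \<subseteq> carrier (add_monoid L)" "\<one>\<^bsub>add_monoid L\<^esub> \<in> J" by auto
    show "\<And>x y. x \<in> J \<Longrightarrow> y \<in> J \<Longrightarrow> x \<otimes>\<^bsub>add_monoid L\<^esub> y \<in> J" using J_add by auto
  qed
qed (rule V.abelian_group_axioms)

lemma coset_eq: "x \<in> carrier L \<Longrightarrow> y \<in> carrier L \<Longrightarrow> J +> x = J +> y \<longleftrightarrow> x \<ominus> y \<in> J"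
proof -
  assume x: "x \<in> carrier L" and y: "y \<in> carrier L"
  have "J +> x = J +> y \<longleftrightarrow> x \<in> J +> y"
    using S.a_repr_independence' S.a_repr_independenceD x y by metis
  also have "\<dots> \<longleftrightarrow> x \<ominus> y \<in> J"
    using S.a_rcos_module[OF y x] by (simp add: a_minus_def)
  finally show ?thesis .
qed

lemma in_coset: "x \<in> carrier L \<Longrightarrow> y \<in> J +> x \<longleftrightarrow> y \<in> carrier L \<and> y \<ominus> x \<in> J"
  using S.a_rcos_module[of x y] S.a_elemrcos_carrier[of x y] by (auto simp: a_minus_def)

lemma coset_mem_iff: "x \<in> carrier L \<Longrightarrow> J +> x = J \<longleftrightarrow> x \<in> J"
  using S.a_rcos_self[of x] S.a_rcos_const[of x] by auto

lemma quotient_carrier: "carrier Q = (\<lambda>x. J +> x) ` carrier L"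
  by (auto simp: quotient_superalgebra_def FactRing_def A_RCOSETS_def' )

lemma quotient_part: "part Q i = (\<lambda>x. J +> x) ` part L i"
  by (simp add: quotient_superalgebra_def)

lemma quotient_zero: "\<zero>\<^bsub>Q\<^esub> = J"
  by (simp add: quotient_superalgebra_def FactRing_def)

lemma quotient_add:
  "x \<in> carrier L \<Longrightarrow> y \<in> carrier L \<Longrightarrow> (J +> x) \<oplus>\<^bsub>Q\<^esub> (J +> y) = J +> (x \<oplus> y)"
  by (simp add: quotient_superalgebra_def FactRing_def S.a_rcos_sum)

lemma br_congruent:
  assumes "x \<in> carrier L" "y \<in> carrier L" "x' \<in> J +> x" "y' \<in> J +> y"
  shows "J +> (x' \<otimes> y') = J +> (x \<otimes> y)"
proof -
  have c: "x' \<in> carrier L" "y' \<in> carrier L" and d: "x' \<ominus> x \<in> J" "y' \<ominus> y \<in> J"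
    using assms by (auto simp: in_coset)
  have e: "x' = (x' \<ominus> x) \<oplus> x" "y' = (y' \<ominus> y) \<oplus> y"
    using assms c by (simp_all add: a_minus_def V.a_assoc V.l_neg)
  have "x' \<otimes> y' = ((x' \<ominus> x) \<otimes> y') \<oplus> ((x \<otimes> (y' \<ominus> y)) \<oplus> (x \<otimes> y))"
    using assms c e by (metis br_add_left br_add_right V.minus_closed)
  then have "(x' \<otimes> y') \<ominus> (x \<otimes> y) = ((x' \<ominus> x) \<otimes> y') \<oplus> (x \<otimes> (y' \<ominus> y))"
    using assms c by (simp add: a_minus_def V.a_assoc V.r_neg)
  then show ?thesis
    using coset_eq[of "x' \<otimes> y'" "x \<otimes> y"] assms c d J_br J_add by simp
qed

lemma quotient_br:
  assumes "x \<in> carrier L" "y \<in> carrier L"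
  shows "(J +> x) \<otimes>\<^bsub>Q\<^esub> (J +> y) = J +> (x \<otimes> y)"
proof -
  \<comment> \<open>The product in \<open>L Quot J\<close> is a union over all pairs of
    representatives; by congruence every member is the same coset.\<close>
  have "(\<Union>a\<in>J +> x. \<Union>b\<in>J +> y. J +> (a \<otimes> b)) = (\<Union>a\<in>J +> x. \<Union>b\<in>J +> y. J +> (x \<otimes> y))"
    using br_congruent[OF assms] by (intro SUP_cong) auto
  also have "\<dots> = J +> (x \<otimes> y)"
    using assms S.a_rcos_self by auto
  finally show ?thesis
    by (simp add: quotient_superalgebra_def FactRing_def rcoset_mult_def)
qed

lemma quotient_smult:
  assumes "x \<in> carrier L"
  shows "c \<odot>\<^bsub>Q\<^esub> (J +> x) = J +> (c \<odot> x)"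
proof -
  have "J +> (c \<odot> y) = J +> (c \<odot> x)" if "y \<in> J +> x" for y
  proof -
    have y: "y \<in> carrier L" "y \<ominus> x \<in> J" using that assms by (auto simp: in_coset)
    have "(c \<odot> y) \<ominus> (c \<odot> x) = c \<odot> (y \<ominus> x)"
      using assms y by (simp add: a_minus_def smult_add smult_smult flip: smult_minus_one)
    then show ?thesis using coset_eq[of "c \<odot> y" "c \<odot> x"] y assms J_smult by simp
  qed
  then have "(\<Union>y\<in>J +> x. J +> (c \<odot> y)) = (\<Union>y\<in>J +> x. J +> (c \<odot> x))"
    by (intro SUP_cong) auto
  then show ?thesis
    using assms S.a_rcos_self by (auto simp: quotient_superalgebra_def)
qed

lemma quotient_abelian_group: "abelian_group Q"
proof (rule abelian_groupI)
  fix X assume "X \<in> carrier Q"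
  then obtain x where x: "x \<in> carrier L" "X = J +> x" by (auto simp: quotient_carrier)
  show "\<exists>Y\<in>carrier Q. Y \<oplus>\<^bsub>Q\<^esub> X = \<zero>\<^bsub>Q\<^esub>"
    using x by (intro bexI[of _ "J +> (\<ominus> x)"])
      (auto simp: quotient_carrier quotient_add quotient_zero V.l_neg V.a_coset_add_zero[OF J_sub])
  show "\<zero>\<^bsub>Q\<^esub> \<oplus>\<^bsub>Q\<^esub> X = X"
    using x quotient_add[of \<zero> x] by (simp add: quotient_zero V.a_coset_add_zero[OF J_sub])
next
  show "\<zero>\<^bsub>Q\<^esub> \<in> carrier Q"
    using V.a_coset_add_zero[OF J_sub] V.zero_closed by (auto simp: quotient_carrier quotient_zero image_iff)
next
  fix X Y assume "X \<in> carrier Q" "Y \<in> carrier Q"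
  then obtain x y where "x \<in> carrier L" "X = J +> x" "y \<in> carrier L" "Y = J +> y"
    by (auto simp: quotient_carrier)
  then show "X \<oplus>\<^bsub>Q\<^esub> Y \<in> carrier Q" "X \<oplus>\<^bsub>Q\<^esub> Y = Y \<oplus>\<^bsub>Q\<^esub> X"
    by (auto simp: quotient_carrier quotient_add V.a_comm[of x y])
next
  fix X Y Z assume "X \<in> carrier Q" "Y \<in> carrier Q" "Z \<in> carrier Q"
  then obtain x y z where "x \<in> carrier L" "X = J +> x" "y \<in> carrier L" "Y = J +> y"
      "z \<in> carrier L" "Z = J +> z"
    by (auto simp: quotient_carrier)
  then show "(X \<oplus>\<^bsub>Q\<^esub> Y) \<oplus>\<^bsub>Q\<^esub> Z = X \<oplus>\<^bsub>Q\<^esub> (Y \<oplus>\<^bsub>Q\<^esub> Z)"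
    by (simp add: quotient_add V.a_assoc)
qed

lemma quotient_vectorspace: "vectorspace class_ring Q"
proof -
  have "module class_ring Q"
    by (rule moduleI[OF domain.axioms(1)[OF field.axioms(1)[OF class_field]] quotient_abelian_group])
       (auto simp: quotient_carrier quotient_smult quotient_add class_ring_simps smult_add add_smult
          smult_smult)
  then show ?thesis by (simp add: vectorspace_def class_field)
qed

lemma quotient_nonassoc_algebra: "nonassoc_algebra Q"
  by (rule nonassoc_algebra.intro)
     (auto simp: module_hom_iff quotient_vectorspace quotient_carrier quotient_smult quotient_add
        quotient_br br_add_left br_add_right br_smult_left br_smult_right)

end

text \<open>Every property of the source is verified in \<open>M\<close> and pulled back by
  injectivity. A quotient with a bijection onto a known Lie superalgebra thus needs no verification
  of Lie identities of its own.\<close>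

lemma lie_superalgebra_isoI:
  assumes L: "nonassoc_algebra L" and M: "lie_superalgebra M"
    and f: "f \<in> module_hom class_ring L M" and bij: "bij_betw f (carrier L) (carrier M)"
    and mult: "\<And>x y. x \<in> carrier L \<Longrightarrow> y \<in> carrier L \<Longrightarrow> f (x \<otimes>\<^bsub>L\<^esub> y) = f x \<otimes>\<^bsub>M\<^esub> f y"
    and part_sub: "\<And>i. part L i \<subseteq> carrier L"
    and part: "\<And>i. f ` part L i = part M i"
  shows "lie_superalgebra L" "f \<in> lie_superalgebra_iso L M"
proof -
  interpret L: nonassoc_algebra L by (rule L)
  interpret M: lie_superalgebra M by (rule M)
  interpret M: nonassoc_algebra M by (rule M.is_nonassoc_algebra)
  have c [simp]: "f x \<in> carrier M" if "x \<in> carrier L" for x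
    using f that by (auto simp: module_hom_iff)
  have add: "f (x \<oplus>\<^bsub>L\<^esub> y) = f x \<oplus>\<^bsub>M\<^esub> f y" if "x \<in> carrier L" "y \<in> carrier L" for x y
    using f that by (auto simp: module_hom_iff)
  have smult: "f (k \<odot>\<^bsub>L\<^esub> x) = k \<odot>\<^bsub>M\<^esub> f x" if "x \<in> carrier L" for k x
    using f that by (auto simp: module_hom_iff)
  have zero: "f \<zero>\<^bsub>L\<^esub> = \<zero>\<^bsub>M\<^esub>"
    using smult[of "\<zero>\<^bsub>L\<^esub>" 0] by simp
  have minus: "f (x \<ominus>\<^bsub>L\<^esub> y) = f x \<ominus>\<^bsub>M\<^esub> f y" if "x \<in> carrier L" "y \<in> carrier L" for x y
    using that by (simp add: a_minus_def add smult flip: L.smult_minus_one M.smult_minus_one)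
  have inj: "x = y" if "f x = f y" "x \<in> carrier L" "y \<in> carrier L" for x y
    using bij that by (auto simp: bij_betw_def inj_on_def)
  have part_iff: "f x \<in> part M i \<longleftrightarrow> x \<in> part L i" if "x \<in> carrier L" for x i
    using part[of i, symmetric] part_sub[of i] inj that by auto
  have M_sub: "part M i \<subseteq> carrier M" for i
    using M.part_subspace by (auto simp: subspace_iff)
  have zero_iff: "x = \<zero>\<^bsub>L\<^esub>" if "f x = \<zero>\<^bsub>M\<^esub>" "x \<in> carrier L" for x
    using inj[of x "\<zero>\<^bsub>L\<^esub>"] that zero by simp
  note ps = subsetD[OF part_sub]
  show "lie_superalgebra L"
  proof (rule lie_superalgebra.intro)
    show "vectorspace class_ring L" by (rule L.vs)
    show "subspace class_ring (part L i) L" for i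
    proof -
      have "\<zero>\<^bsub>L\<^esub> \<in> part L i"
        using M.part_subspace[of i] part_iff[of "\<zero>\<^bsub>L\<^esub>" i] zero by (simp add: subspace_iff)
      moreover have "x \<oplus>\<^bsub>L\<^esub> y \<in> part L i" if "x \<in> part L i" "y \<in> part L i" for x y
        using M.part_subspace[of i] part_iff[of "x \<oplus>\<^bsub>L\<^esub> y" i] part_iff[of x i] part_iff[of y i]
          ps[OF that(1)] ps[OF that(2)] add that by (simp add: subspace_iff)
      moreover have "k \<odot>\<^bsub>L\<^esub> x \<in> part L i" if "x \<in> part L i" for x k
        using M.part_subspace[of i] part_iff[of "k \<odot>\<^bsub>L\<^esub> x" i] part_iff[of x i]
          ps[OF that(1)] smult that by (simp add: subspace_iff)
      ultimately show ?thesis using L.vs part_sub by (simp add: subspace_iff)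
    qed
    show "x \<otimes>\<^bsub>L\<^esub> y \<in> part L (i + j)" if "x \<in> part L i" "y \<in> part L j" for x y i j
      using M.br_part[of "f x" i "f y" j] that part_iff[of x i] part_iff[of y j]
        part_iff[of "x \<otimes>\<^bsub>L\<^esub> y" "i + j"] mult ps[OF that(1)] ps[OF that(2)] by simp
    show "(\<lambda>y. x \<otimes>\<^bsub>L\<^esub> y) \<in> module_hom class_ring L L" if "x \<in> carrier L" for x
      by (rule L.br_left[OF that])
    show "(\<lambda>x. x \<otimes>\<^bsub>L\<^esub> y) \<in> module_hom class_ring L L" if "y \<in> carrier L" for y
      by (rule L.br_right[OF that])
    show "\<exists>!p. p \<in> part L 0 \<times> part L 1 \<and> x = fst p \<oplus>\<^bsub>L\<^esub> snd p" if x: "x \<in> carrier L" for x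
    proof -
      obtain p where p: "p \<in> part M 0 \<times> part M 1" "f x = fst p \<oplus>\<^bsub>M\<^esub> snd p"
        and u: "\<And>q. q \<in> part M 0 \<times> part M 1 \<Longrightarrow> f x = fst q \<oplus>\<^bsub>M\<^esub> snd q \<Longrightarrow> q = p"
        using M.part_direct[of "f x"] x by (metis c)
      obtain a b where ab: "a \<in> part L 0" "b \<in> part L 1" "p = (f a, f b)"
              proof -
        have "fst p \<in> f ` part L 0" "snd p \<in> f ` part L 1" using p(1) by (auto simp: part)
        then show ?thesis using that by (metis imageE prod.collapse)
      qed
      show ?thesis
      proof (rule ex1I[of _ "(a, b)"])
        show "(a, b) \<in> part L 0 \<times> part L 1 \<and> x = fst (a, b) \<oplus>\<^bsub>L\<^esub> snd (a, b)"
        proof -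
          have "f x = f (a \<oplus>\<^bsub>L\<^esub> b)"
            using ab(3) p(2) add[OF ps[OF ab(1)] ps[OF ab(2)]] by simp
          then show ?thesis
            using inj[OF _ x L.V.a_closed[OF ps[OF ab(1)] ps[OF ab(2)]]] ab by simp
        qed
        fix q assume q: "q \<in> part L 0 \<times> part L 1 \<and> x = fst q \<oplus>\<^bsub>L\<^esub> snd q"
        then have qc: "fst q \<in> carrier L" "snd q \<in> carrier L" using ps by auto
        have "(f (fst q), f (snd q)) = p"
          using q qc by (intro u) (auto simp: add part_iff)
        then show "q = (a, b)"
          using ab qc ps[of a] ps[of b] by (auto intro!: prod_eqI inj)
      qed
    qed
    show "lie_identities L \<subseteq> {\<zero>\<^bsub>L\<^esub>}"
    proof
      fix w assume "w \<in> lie_identities L"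
      then have "w \<in> carrier L \<and> f w \<in> lie_identities M"
        unfolding lie_identities_def
      proof (elim UnE CollectE exE conjE, goal_cases)
        case (1 i j x y)
        then have "f x \<in> part M i" "f y \<in> part M j" "x \<in> carrier L" "y \<in> carrier L"
          using ps by (auto simp: part_iff)
        then show ?case using 1 by (auto simp: add smult mult)
      next
        case (2 i j x y z)
        then have "f x \<in> part M i" "f y \<in> part M j" "x \<in> carrier L" "y \<in> carrier L" "f z \<in> carrier M"
          using ps by (auto simp: part_iff)
        then show ?case using 2
          by (simp only: minus add smult mult L.br_closed L.smult_closed L.V.a_closed
              L.V.minus_closed) blast
      next
        case (3 x)
        then have "f x \<in> part M 1" "x \<in> carrier L" using ps by (auto simp: part_iff)
        then show ?case using 3 by (auto simp: mult)
      qed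
      then show "w \<in> {\<zero>\<^bsub>L\<^esub>}" using M.lie zero_iff by blast
    qed
  qed
  show "f \<in> lie_superalgebra_iso L M"
    using f bij mult part by (simp add: lie_superalgebra_iso_def)
qed

section \<open>Finitely supported functions with linear and bilinear extensions\<close>

text \<open>The scalar multiplication of the whole type supplies the axioms, and the carrier only
  has to be closed. The other two conclusions replace the negation and subtraction of the record by
  those of the type.\<close>

lemma vectorspace_of_scale:
  fixes V :: "('k :: field, 'v :: ab_group_add, 'm) module_scheme"
  assumes sc: "Vector_Spaces.vector_space sc"
    and V: "add V = (+)" "\<zero>\<^bsub>V\<^esub> = 0" "smult V = sc"
    and closed: "0 \<in> carrier V" "\<And>x y. x \<in> carrier V \<Longrightarrow> y \<in> carrier V \<Longrightarrow> x + y \<in> carrier V"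
      "\<And>c x. x \<in> carrier V \<Longrightarrow> sc c x \<in> carrier V"
  shows "vectorspace class_ring V"
    and "x \<in> carrier V \<Longrightarrow> \<ominus>\<^bsub>V\<^esub> x = - x"
    and "x \<in> carrier V \<Longrightarrow> y \<in> carrier V \<Longrightarrow> x \<ominus>\<^bsub>V\<^esub> y = x - y"
proof -
  interpret sc: Vector_Spaces.vector_space sc by (rule sc)
  have neg: "- x \<in> carrier V" if "x \<in> carrier V" for x
    using closed(3)[OF that, of "- 1"] by simp
  have g: "abelian_group V"
  proof (rule abelian_groupI)
    show "\<exists>y\<in>carrier V. y \<oplus>\<^bsub>V\<^esub> x = \<zero>\<^bsub>V\<^esub>" if "x \<in> carrier V" for x
      using neg[OF that] V by (intro bexI[of _ "- x"]) auto
  qed (use V closed in \<open>auto simp: add_ac\<close>)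
  then have m: "module class_ring V"
    by (rule moduleI[OF domain.axioms(1)[OF field.axioms(1)[OF class_field]]])
       (use V closed in \<open>auto simp: class_ring_simps sc.scale_right_distrib sc.scale_left_distrib\<close>)
  then show "vectorspace class_ring V" by (simp add: vectorspace_def class_field)
  show inv: "\<ominus>\<^bsub>V\<^esub> x = - x" if "x \<in> carrier V" for x
    by (rule abelian_group.minus_equality[OF g]) (use V neg that in auto)
  show "x \<ominus>\<^bsub>V\<^esub> y = x - y" if "x \<in> carrier V" "y \<in> carrier V"
    using that inv V by (simp add: a_minus_def)
qed

abbreviation keys :: "('i \<Rightarrow>\<^sub>0 'k :: zero) \<Rightarrow> 'i set" where "keys \<equiv> Poly_Mapping.keys"
abbreviation lookup :: "('i \<Rightarrow>\<^sub>0 'k :: zero) \<Rightarrow> 'i \<Rightarrow> 'k" where "lookup \<equiv> Poly_Mapping.lookup"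
abbreviation single :: "'i \<Rightarrow> 'k :: zero \<Rightarrow> 'i \<Rightarrow>\<^sub>0 'k" where "single \<equiv> Poly_Mapping.single"

abbreviation pm_scale :: "'k :: field \<Rightarrow> ('i \<Rightarrow>\<^sub>0 'k) \<Rightarrow> ('i \<Rightarrow>\<^sub>0 'k)" (infixr \<open>*\<^sub>p\<close> 75) where
  "c *\<^sub>p x \<equiv> Poly_Mapping.map ((*) c) x"

lemma lookup_scale [simp]: "lookup (c *\<^sub>p x) i = c * lookup x i"
  by transfer (auto simp: when_def)

lemma map_zero_fun [simp]: "Poly_Mapping.map (\<lambda>a. 0) x = 0"
  by (rule poly_mapping_eqI) (transfer, simp)

global_interpretation pm: Vector_Spaces.vector_space pm_scale
  by unfold_locales (auto intro!: poly_mapping_eqI simp: lookup_add algebra_simps)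

lemma scale_single [simp]: "c *\<^sub>p single i d = single i (c * d)"
  by (auto intro!: poly_mapping_eqI simp: lookup_single when_def)

lemma keys_scale: "keys (c *\<^sub>p x) \<subseteq> keys x"
  by (auto simp: in_keys_iff)

lemma poly_mapping_sum_single: "x = (\<Sum>i\<in>keys x. single i (lookup x i))"
  by (rule poly_mapping_eqI) (simp add: lookup_sum lookup_single when_def in_keys_iff)

lemma pm_induct [consumes 1, case_names zero single add]:
  fixes x :: "'i \<Rightarrow>\<^sub>0 'k :: comm_monoid_add"
  assumes "keys x \<subseteq> S" "P 0" "\<And>c i. i \<in> S \<Longrightarrow> P (single i c)"
    and "\<And>x y. P x \<Longrightarrow> P y \<Longrightarrow> P (x + y)"
  shows "P x"
proof -
  have "P (\<Sum>i\<in>I. single i (lookup x i))" if "finite I" "I \<subseteq> keys x" for I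
    using that assms by (induction I) auto
  then show ?thesis using poly_mapping_sum_single[of x] by (metis finite_keys order_refl)
qed

definition lin_ext :: "('i \<Rightarrow> ('j \<Rightarrow>\<^sub>0 'k)) \<Rightarrow> ('i \<Rightarrow>\<^sub>0 'k :: field) \<Rightarrow> ('j \<Rightarrow>\<^sub>0 'k)" where
  "lin_ext g x = (\<Sum>i\<in>keys x. lookup x i *\<^sub>p g i)"

lemma lin_ext_superset:
  "finite I \<Longrightarrow> keys x \<subseteq> I \<Longrightarrow> lin_ext g x = (\<Sum>i\<in>I. lookup x i *\<^sub>p g i)"
  unfolding lin_ext_def by (rule sum.mono_neutral_left) (auto simp: in_keys_iff)

lemma lin_ext_zero [simp]: "lin_ext g 0 = 0"
  by (simp add: lin_ext_def)

lemma lin_ext_single [simp]: "lin_ext g (single i c) = c *\<^sub>p g i"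
  by (simp add: lin_ext_def)

lemma lin_ext_add: "lin_ext g (x + y) = lin_ext g x + lin_ext g y"
proof -
  have "finite (keys x \<union> keys y)" by simp
  then show ?thesis
    using keys_add[of x y]
    by (simp add: lin_ext_superset[of "keys x \<union> keys y"] lookup_add pm.scale_left_distrib sum.distrib)
qed

lemma lin_ext_scale: "lin_ext g (c *\<^sub>p x) = c *\<^sub>p lin_ext g x"
  using keys_scale[of c x]
  by (simp add: lin_ext_superset[of "keys x"] pm.scale_sum_right)

lemma lin_ext_uminus: "lin_ext g (- x) = - lin_ext g x"
  using lin_ext_scale[of g "- 1" x] by simp

lemma lin_ext_diff: "lin_ext g (x - y) = lin_ext g x - lin_ext g y"
  using lin_ext_add[of g x "- y"] by (simp add: lin_ext_uminus)

lemma lin_ext_fun_zero [simp]: "lin_ext (\<lambda>i. 0) x = 0"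
  by (simp add: lin_ext_def)

lemma lin_ext_fun_add: "lin_ext (\<lambda>i. g i + h i) x = lin_ext g x + lin_ext h x"
  by (simp add: lin_ext_def pm.scale_right_distrib sum.distrib)

lemma lin_ext_fun_scale: "lin_ext (\<lambda>i. c *\<^sub>p g i) x = c *\<^sub>p lin_ext g x"
  by (simp add: lin_ext_def pm.scale_sum_right mult.commute)

lemma keys_lin_ext:
  assumes "\<And>i. i \<in> keys x \<Longrightarrow> keys (g i) \<subseteq> S"
  shows "keys (lin_ext g x) \<subseteq> S"
proof -
  have "keys (lin_ext g x) \<subseteq> (\<Union>i\<in>keys x. keys (lookup x i *\<^sub>p g i))"
    unfolding lin_ext_def by (rule keys_sum)
  then show ?thesis using assms keys_scale by fastforce
qed

definition bilin_ext ::
    "('i \<Rightarrow> 'i \<Rightarrow> ('j \<Rightarrow>\<^sub>0 'k)) \<Rightarrow> ('i \<Rightarrow>\<^sub>0 'k :: field) \<Rightarrow> ('i \<Rightarrow>\<^sub>0 'k) \<Rightarrow> ('j \<Rightarrow>\<^sub>0 'k)" where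
  "bilin_ext b x y = lin_ext (\<lambda>i. lin_ext (b i) y) x"

lemma bilin_ext_simps [simp]:
  "bilin_ext b (single i c) (single j d) = (c * d) *\<^sub>p b i j"
  "bilin_ext b 0 y = 0" "bilin_ext b x 0 = 0"
  by (simp_all add: bilin_ext_def)

lemma bilin_ext_add_left: "bilin_ext b (x + y) z = bilin_ext b x z + bilin_ext b y z"
  and bilin_ext_add_right: "bilin_ext b z (x + y) = bilin_ext b z x + bilin_ext b z y"
  by (simp_all add: bilin_ext_def lin_ext_add lin_ext_fun_add)

lemma bilin_ext_scale_left: "bilin_ext b (c *\<^sub>p x) z = c *\<^sub>p bilin_ext b x z"
  and bilin_ext_scale_right: "bilin_ext b z (c *\<^sub>p x) = c *\<^sub>p bilin_ext b z x"
  by (simp_all add: bilin_ext_def lin_ext_scale lin_ext_fun_scale)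

lemma bilin_ext_uminus_left: "bilin_ext b (- x) z = - bilin_ext b x z"
  and bilin_ext_uminus_right: "bilin_ext b z (- x) = - bilin_ext b z x"
  using bilin_ext_scale_left[of b "- 1" x z] bilin_ext_scale_right[of b z "- 1" x] by simp_all

lemma bilin_ext_diff_left: "bilin_ext b (x - y) z = bilin_ext b x z - bilin_ext b y z"
  and bilin_ext_diff_right: "bilin_ext b z (x - y) = bilin_ext b z x - bilin_ext b z y"
  using bilin_ext_add_left[of b x "- y" z] bilin_ext_add_right[of b z x "- y"]
  by (simp_all add: bilin_ext_uminus_left bilin_ext_uminus_right)

lemmas bilin_ext_linear = bilin_ext_add_left bilin_ext_add_right bilin_ext_scale_left
  bilin_ext_scale_right bilin_ext_uminus_left bilin_ext_uminus_right bilin_ext_diff_left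
  bilin_ext_diff_right

lemma keys_bilin_ext:
  assumes "\<And>i j. i \<in> keys x \<Longrightarrow> j \<in> keys y \<Longrightarrow> keys (b i j) \<subseteq> S"
  shows "keys (bilin_ext b x y) \<subseteq> S"
  unfolding bilin_ext_def using assms by (intro keys_lin_ext) auto

subsection \<open>Free nonassociative algebras\<close>

lemma free_mult:
  "mult (free_superalgebra X p) = bilin_ext (\<lambda>s t. single (Br s t) (1 :: 'k :: field))"
  by (simp add: free_superalgebra_def bilin_ext_def lin_ext_def fun_eq_iff pm.scale_sum_right)

lemma free_simps:
  "carrier (free_superalgebra X p) = {a. keys a \<subseteq> {t. set_word t \<subseteq> X}}"
  "\<zero>\<^bsub>free_superalgebra X p\<^esub> = 0"
  "add (free_superalgebra X p) = (+)"
  "smult (free_superalgebra X p) = pm_scale"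
  "part (free_superalgebra X p) i = {a. keys a \<subseteq> {t. set_word t \<subseteq> X \<and> word_sum p t = i}}"
  by (auto simp: free_superalgebra_def)

lemma keys_sub_closed:
  "keys x \<subseteq> S \<Longrightarrow> keys y \<subseteq> S \<Longrightarrow> keys (x + y) \<subseteq> S"
  "keys x \<subseteq> S \<Longrightarrow> keys y \<subseteq> S \<Longrightarrow> keys (x - y) \<subseteq> S"
  "keys x \<subseteq> S \<Longrightarrow> keys (c *\<^sub>p x) \<subseteq> S"
  using keys_add[of x y] keys_scale[of c x] keys_diff[of x y] by auto

lemma free_vectorspace: "vectorspace class_ring (free_superalgebra X p)"
  by (rule vectorspace_of_scale[OF pm.vector_space_axioms])
     (simp_all add: free_simps keys_sub_closed)

lemma free_minus:
  "a \<in> carrier (free_superalgebra X p) \<Longrightarrow> b \<in> carrier (free_superalgebra X p) \<Longrightarrow>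
     a \<ominus>\<^bsub>free_superalgebra X p\<^esub> b = a - b"
  by (rule vectorspace_of_scale[OF pm.vector_space_axioms])
     (simp_all add: free_simps keys_sub_closed)

lemma free_nonassoc_algebra: "nonassoc_algebra (free_superalgebra X p)"
proof -
  have "keys (bilin_ext (\<lambda>s t. single (Br s t) (1 :: 'k :: field)) a b) \<subseteq> {t. set_word t \<subseteq> X}"
    if "keys a \<subseteq> {t. set_word t \<subseteq> X}" "keys b \<subseteq> {t. set_word t \<subseteq> X}" for a b
    using that by (intro keys_bilin_ext) auto
  then show ?thesis
    by (intro nonassoc_algebra.intro free_vectorspace)
       (auto simp: module_hom_iff free_mult free_simps bilin_ext_linear)
qed

primrec word_eval :: "('k :: field, 'a, 'm) superalgebra_scheme \<Rightarrow> ('g \<Rightarrow> 'a) \<Rightarrow> 'g word \<Rightarrow> 'a" where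
  "word_eval M \<rho> (Gen g) = \<rho> g"
| "word_eval M \<rho> (Br s t) = word_eval M \<rho> s \<otimes>\<^bsub>M\<^esub> word_eval M \<rho> t"

definition free_eval ::
    "('k :: field, 'a, 'm) superalgebra_scheme \<Rightarrow> ('g \<Rightarrow> 'a) \<Rightarrow> ('g word \<Rightarrow>\<^sub>0 'k) \<Rightarrow> 'a" where
  "free_eval M \<rho> a = (\<Oplus>\<^bsub>M\<^esub>t\<in>keys a. lookup a t \<odot>\<^bsub>M\<^esub> word_eval M \<rho> t)"

locale free_evaluation = nonassoc_algebra M
  for M :: "('k :: field, 'a, 'm) superalgebra_scheme" (structure) +
  fixes X :: "'g set" and \<rho> :: "'g \<Rightarrow> 'a"
  assumes gens: "g \<in> X \<Longrightarrow> \<rho> g \<in> carrier M"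
begin

lemma word_eval_closed [simp]: "set_word t \<subseteq> X \<Longrightarrow> word_eval M \<rho> t \<in> carrier M"
  by (induction t) (auto intro: gens)

lemma free_eval_superset:
  assumes "finite T" "keys a \<subseteq> T" "\<And>t. t \<in> T \<Longrightarrow> set_word t \<subseteq> X"
  shows "free_eval M \<rho> a = (\<Oplus>t\<in>T. lookup a t \<odot> word_eval M \<rho> t)"
  unfolding free_eval_def
  by (rule V.add.finprod_mono_neutral_cong_left) (use assms in \<open>auto simp: in_keys_iff\<close>)

lemma free_eval_closed [simp]:
  "keys a \<subseteq> {t. set_word t \<subseteq> X} \<Longrightarrow> free_eval M \<rho> a \<in> carrier M"
  unfolding free_eval_def by (rule V.finsum_closed) auto

lemma free_eval_zero [simp]: "free_eval M \<rho> 0 = \<zero>"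
  by (simp add: free_eval_def)

lemma free_eval_add:
  assumes "keys a \<subseteq> {t. set_word t \<subseteq> X}" "keys b \<subseteq> {t. set_word t \<subseteq> X}"
  shows "free_eval M \<rho> (a + b) = free_eval M \<rho> a \<oplus> free_eval M \<rho> b"
proof -
  have T: "finite (keys a \<union> keys b)" "\<And>t. t \<in> keys a \<union> keys b \<Longrightarrow> set_word t \<subseteq> X"
    using assms by auto
  have "free_eval M \<rho> (a + b) =
      (\<Oplus>t\<in>keys a \<union> keys b. (lookup a t \<odot> word_eval M \<rho> t) \<oplus> (lookup b t \<odot> word_eval M \<rho> t))"
    using free_eval_superset[OF T(1) keys_add T(2)]
    by (simp add: lookup_add) (intro V.add.finprod_cong', use T in \<open>auto simp: add_smult\<close>)
  also have "\<dots> = free_eval M \<rho> a \<oplus> free_eval M \<rho> b"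
    using free_eval_superset[of "keys a \<union> keys b" a] free_eval_superset[of "keys a \<union> keys b" b] T(2)
    by (subst V.finsum_addf) auto
  finally show ?thesis .
qed

lemma free_eval_single [simp]:
  "set_word t \<subseteq> X \<Longrightarrow> free_eval M \<rho> (single t c) = c \<odot> word_eval M \<rho> t"
  by (simp add: free_eval_def)

lemma free_eval_scale:
  assumes "keys a \<subseteq> {t. set_word t \<subseteq> X}"
  shows "free_eval M \<rho> (c *\<^sub>p a) = c \<odot> free_eval M \<rho> a"
  using assms
proof -
  \<comment> \<open>The support condition is carried along in the induction, because the case of a
    sum does not provide it for the summands.\<close>
  have "free_eval M \<rho> (c *\<^sub>p a) = c \<odot> free_eval M \<rho> a \<and> keys a \<subseteq> {t. set_word t \<subseteq> X}"
    using assms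
    by (induction rule: pm_induct)
       (auto simp: pm.scale_right_distrib free_eval_add keys_sub_closed smult_add smult_smult
          keys_scale[THEN subset_trans] smult_zero_right)
  then show ?thesis ..
qed

lemma free_eval_mult:
  assumes "keys a \<subseteq> {t. set_word t \<subseteq> X}" "keys b \<subseteq> {t. set_word t \<subseteq> X}"
  shows "free_eval M \<rho> (a \<otimes>\<^bsub>free_superalgebra X p\<^esub> b) = free_eval M \<rho> a \<otimes> free_eval M \<rho> b"
proof -
  let ?W = "{t. set_word t \<subseteq> X}" and ?b = "bilin_ext (\<lambda>s t. single (Br s t) (1 :: 'k))"
  have k: "keys (?b x y) \<subseteq> ?W" if "keys x \<subseteq> ?W" "keys y \<subseteq> ?W" for x y
    using that by (intro keys_bilin_ext) auto
  have 1: "free_eval M \<rho> (?b (single s c) b) = free_eval M \<rho> (single s c) \<otimes> free_eval M \<rho> b \<and> keys b \<subseteq> ?W"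
    if "s \<in> ?W" for s c
    using assms(2)
  proof (induction rule: pm_induct)
    case (single d t)
    then show ?case using that by (simp add: br_smult_left br_smult_right smult_smult mult.commute)
  next
    case (add x y)
    moreover have "keys (single s c) \<subseteq> ?W" using that by simp
    ultimately show ?case
      using that by (simp add: bilin_ext_linear free_eval_add k br_add_right keys_sub_closed)
  qed (use that in auto)
  have "free_eval M \<rho> (?b a b) = free_eval M \<rho> a \<otimes> free_eval M \<rho> b \<and> keys a \<subseteq> ?W"
    using assms(1)
  proof (induction rule: pm_induct)
    case (add x y)
    then show ?case
      using assms(2) by (simp add: bilin_ext_linear free_eval_add k br_add_left keys_sub_closed)
  qed (use 1 assms(2) in auto)
  then show ?thesis by (simp add: free_mult)
qed

end

lemma algebra_ideal_ideal_generated: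
  assumes "nonassoc_algebra L" "S \<subseteq> carrier L"
  shows "algebra_ideal L (ideal_generated L S)" "S \<subseteq> ideal_generated L S"
proof -
  interpret nonassoc_algebra L by fact
  \<comment> \<open>The whole carrier is a member of the family that is intersected, so the
    generated ideal stays inside \<open>L\<close>.\<close>
  have "algebra_ideal L (carrier L)"
    using vs by (auto simp: algebra_ideal_def subspace_iff)
  then have "carrier L \<in> {J. algebra_ideal L J \<and> S \<subseteq> J}" using assms by auto
  then show "algebra_ideal L (ideal_generated L S)"
    unfolding algebra_ideal_def ideal_generated_def subspace_iff
    by (intro conjI vs) (blast, auto simp: algebra_ideal_def subspace_iff)
qed (auto simp: ideal_generated_def)

lemma ideal_generated_subset: "algebra_ideal L J \<Longrightarrow> S \<subseteq> J \<Longrightarrow> ideal_generated L S \<subseteq> J"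
  by (auto simp: ideal_generated_def)

subsection \<open>Homomorphisms out of a quotient\<close>

text \<open>The map induced on cosets: the image of a coset is a singleton as soon as the ideal lies
  in the kernel of \<phi>.\<close>

definition quot_map :: "('a \<Rightarrow> 'b) \<Rightarrow> 'a set \<Rightarrow> 'b" where
  "quot_map \<phi> X = the_elem (\<phi> ` X)"

locale nonassoc_hom = L: nonassoc_algebra L + M: nonassoc_algebra M
  for L :: "('k :: field, 'a, 'm) superalgebra_scheme" and M :: "('k, 'b, 'n) superalgebra_scheme" +
  fixes \<phi>
  assumes hom: "\<phi> \<in> module_hom class_ring L M"
    and mult: "x \<in> carrier L \<Longrightarrow> y \<in> carrier L \<Longrightarrow> \<phi> (x \<otimes>\<^bsub>L\<^esub> y) = \<phi> x \<otimes>\<^bsub>M\<^esub> \<phi> y"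
begin

lemma closed [simp]: "x \<in> carrier L \<Longrightarrow> \<phi> x \<in> carrier M"
  and add: "x \<in> carrier L \<Longrightarrow> y \<in> carrier L \<Longrightarrow> \<phi> (x \<oplus>\<^bsub>L\<^esub> y) = \<phi> x \<oplus>\<^bsub>M\<^esub> \<phi> y"
  and smult: "x \<in> carrier L \<Longrightarrow> \<phi> (c \<odot>\<^bsub>L\<^esub> x) = c \<odot>\<^bsub>M\<^esub> \<phi> x"
  using hom by (auto simp: module_hom_iff)

lemma zero [simp]: "\<phi> \<zero>\<^bsub>L\<^esub> = \<zero>\<^bsub>M\<^esub>"
  using smult[of "\<zero>\<^bsub>L\<^esub>" 0] by simp

lemma minus: "x \<in> carrier L \<Longrightarrow> y \<in> carrier L \<Longrightarrow> \<phi> (x \<ominus>\<^bsub>L\<^esub> y) = \<phi> x \<ominus>\<^bsub>M\<^esub> \<phi> y"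
  by (simp add: a_minus_def add smult flip: L.smult_minus_one M.smult_minus_one)

lemma kernel_ideal: "algebra_ideal L {x \<in> carrier L. \<phi> x = \<zero>\<^bsub>M\<^esub>}"
  unfolding algebra_ideal_def subspace_iff using L.vs by (auto simp: add smult mult)

end

locale nonassoc_quotient_hom = nonassoc_hom L M \<phi> + nonassoc_ideal L J for L M \<phi> J +
  assumes ker: "x \<in> J \<Longrightarrow> \<phi> x = \<zero>\<^bsub>M\<^esub>"
begin

lemma quot_map_coset [simp]: "x \<in> carrier L \<Longrightarrow> quot_map \<phi> (J +>\<^bsub>L\<^esub> x) = \<phi> x"
proof -
  assume x: "x \<in> carrier L"
  have "\<phi> y = \<phi> x" if "y \<in> J +>\<^bsub>L\<^esub> x" for y
  proof -
    have y: "y \<in> carrier L" "y \<ominus>\<^bsub>L\<^esub> x \<in> J" using that x by (auto simp: in_coset)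
    have "\<phi> y = \<phi> ((y \<ominus>\<^bsub>L\<^esub> x) \<oplus>\<^bsub>L\<^esub> x)"
      using x y by (simp add: a_minus_def L.V.a_assoc L.V.l_neg)
    also have "\<dots> = \<phi> x" using x y ker[OF y(2)] by (subst add) auto
    finally show ?thesis .
  qed
  moreover have "x \<in> J +>\<^bsub>L\<^esub> x" by (rule S.a_rcos_self[OF x])
  ultimately have "\<phi> ` (J +>\<^bsub>L\<^esub> x) = {\<phi> x}" by blast
  then show ?thesis by (simp add: quot_map_def)
qed

lemma quot_map_hom: "nonassoc_hom (quotient_superalgebra L J) M (quot_map \<phi>)"
proof (intro nonassoc_hom.intro nonassoc_hom_axioms.intro)
  show "nonassoc_algebra (quotient_superalgebra L J)" by (rule quotient_nonassoc_algebra)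
  show "nonassoc_algebra M" by (rule M.nonassoc_algebra_axioms)
  show "quot_map \<phi> \<in> module_hom class_ring (quotient_superalgebra L J) M"
    by (auto simp: module_hom_iff quotient_carrier quotient_add quotient_smult add smult)
qed (auto simp: quotient_carrier quotient_br mult)

lemma quot_map_iso:
  assumes M: "lie_superalgebra M" and onto: "\<phi> ` carrier L = carrier M"
    and ker': "\<And>x. x \<in> carrier L \<Longrightarrow> \<phi> x = \<zero>\<^bsub>M\<^esub> \<Longrightarrow> x \<in> J"
    and part: "\<And>i. part L i \<subseteq> carrier L" "\<And>i. \<phi> ` part L i = part M i"
  shows "lie_superalgebra (quotient_superalgebra L J)"
    "quot_map \<phi> \<in> lie_superalgebra_iso (quotient_superalgebra L J) M"
proof -
  interpret q: nonassoc_hom Q M "quot_map \<phi>" by (rule quot_map_hom)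
  have "inj_on (quot_map \<phi>) (carrier Q)"
  proof (rule inj_onI)
    fix X Y assume "X \<in> carrier Q" "Y \<in> carrier Q" and eq: "quot_map \<phi> X = quot_map \<phi> Y"
    then obtain x y where xy: "x \<in> carrier L" "X = J +>\<^bsub>L\<^esub> x" "y \<in> carrier L" "Y = J +>\<^bsub>L\<^esub> y"
      by (auto simp: quotient_carrier)
    with eq have "\<phi> (x \<ominus>\<^bsub>L\<^esub> y) = \<zero>\<^bsub>M\<^esub>" by (simp add: minus)
    then show "X = Y" using xy ker'[of "x \<ominus>\<^bsub>L\<^esub> y"] by (simp add: coset_eq)
  qed
  moreover have "quot_map \<phi> ` carrier Q = carrier M"
    using onto by (auto simp: quotient_carrier image_image)
  ultimately have bij: "bij_betw (quot_map \<phi>) (carrier Q) (carrier M)"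
    by (simp add: bij_betw_def)
  have p: "part Q i \<subseteq> carrier Q" for i
    using part(1)[of i] by (auto simp: quotient_part quotient_carrier)
  have pi: "quot_map \<phi> ` part Q i = part M i" for i
  proof -
    have "quot_map \<phi> ` part Q i = \<phi> ` part L i"
      using part(1)[of i] by (auto simp: quotient_part image_image intro!: image_cong)
    then show ?thesis using part(2) by simp
  qed
  show "lie_superalgebra (quotient_superalgebra L J)"
    "quot_map \<phi> \<in> lie_superalgebra_iso (quotient_superalgebra L J) M"
    using lie_superalgebra_isoI[OF quotient_nonassoc_algebra M q.hom bij q.mult p pi] by auto
qed

end

subsection \<open>Recognition of contragredient Lie superalgebras\<close>

text \<open>A graded Lie superalgebra \<open>M\<close> generated by Chevalley generators in which no homogeneous
  element of nonzero degree is annihilated by the opposite component is the contragredient one: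
  the kernel of the evaluation map is then the largest graded ideal avoiding the torus.\<close>

locale contragredient_model =
  fixes n :: nat and par :: "nat \<Rightarrow> bit" and H :: "('k :: field, 'h) module" and h :: "nat \<Rightarrow> 'h"
    and \<alpha> :: "nat \<Rightarrow> 'h \<Rightarrow> 'k" and M :: "('k, 'a, 'm) superalgebra_scheme" (structure)
    and \<tau> :: "'h \<Rightarrow> 'a" and e f :: "nat \<Rightarrow> 'a"
    and D :: "(nat \<Rightarrow>\<^sub>0 int) \<Rightarrow> 'a set" and P :: "(nat \<Rightarrow>\<^sub>0 int) \<Rightarrow> 'a \<Rightarrow> 'a"
  assumes H: "vectorspace class_ring H" and h: "i < n \<Longrightarrow> h i \<in> carrier H"
    and M: "lie_superalgebra M"
    and torus_hom: "\<tau> \<in> module_hom class_ring H M"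
    and torus_part: "x \<in> carrier H \<Longrightarrow> \<tau> x \<in> part M 0"
    and torus_inj: "x \<in> carrier H \<Longrightarrow> \<tau> x = \<zero> \<Longrightarrow> x = \<zero>\<^bsub>H\<^esub>"
    and e_part: "i < n \<Longrightarrow> e i \<in> part M (par i)" and f_part: "i < n \<Longrightarrow> f i \<in> part M (par i)"
    and rel_hh: "x \<in> carrier H \<Longrightarrow> y \<in> carrier H \<Longrightarrow> \<tau> x \<otimes> \<tau> y = \<zero>"
    and rel_he: "x \<in> carrier H \<Longrightarrow> j < n \<Longrightarrow> \<tau> x \<otimes> e j = \<alpha> j x \<odot> e j"
    and rel_hf: "x \<in> carrier H \<Longrightarrow> j < n \<Longrightarrow> \<tau> x \<otimes> f j = (- \<alpha> j x) \<odot> f j"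
    and rel_ef: "i < n \<Longrightarrow> j < n \<Longrightarrow> e i \<otimes> f j = (if i = j then \<tau> (h i) else \<zero>)"
    and generated: "subspace class_ring U M \<Longrightarrow> \<tau> ` carrier H \<subseteq> U \<Longrightarrow> e ` {..<n} \<subseteq> U \<Longrightarrow>
      f ` {..<n} \<subseteq> U \<Longrightarrow> (\<And>u v. u \<in> U \<Longrightarrow> v \<in> U \<Longrightarrow> u \<otimes> v \<in> U) \<Longrightarrow> carrier M \<subseteq> U"
    and D_subspace: "subspace class_ring (D q) M"
    and D_torus: "x \<in> carrier H \<Longrightarrow> \<tau> x \<in> D 0"
    and D_e: "i < n \<Longrightarrow> e i \<in> D (single i 1)" and D_f: "i < n \<Longrightarrow> f i \<in> D (single i (- 1))"
    and D_br: "u \<in> D q \<Longrightarrow> v \<in> D r \<Longrightarrow> u \<otimes> v \<in> D (q + r)"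
    and P_hom: "P q \<in> module_hom class_ring M M"
    and P_D: "u \<in> D r \<Longrightarrow> P q u = (if q = r then u else \<zero>)"
    and separated: "q \<noteq> 0 \<Longrightarrow> u \<in> D q \<Longrightarrow> u \<noteq> \<zero> \<Longrightarrow> \<exists>v\<in>D (- q). v \<otimes> u \<noteq> \<zero>"
begin

abbreviation "X \<equiv> chevalley_gens n H"
abbreviation "F \<equiv> free_superalgebra X (chevalley_parity par) :: ('k, 'h chevalley word \<Rightarrow>\<^sub>0 'k) superalgebra"
abbreviation "W \<equiv> {t :: 'h chevalley word. set_word t \<subseteq> X}"
abbreviation "I \<equiv> presentation_ideal X (chevalley_parity par) (chevalley_relations n par H h \<alpha>)
  :: ('h chevalley word \<Rightarrow>\<^sub>0 'k) set"
abbreviation "G \<equiv> contragredient_tilde n par H h \<alpha>"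
abbreviation fbr (infixl \<open>\<star>\<close> 70) where "a \<star> b \<equiv> a \<otimes>\<^bsub>F\<^esub> b"

sublocale L: lie_superalgebra M by (rule M)
sublocale nonassoc_algebra M by (rule L.is_nonassoc_algebra)
sublocale HV: vectorspace class_ring H by (rule H)

definition \<rho> :: "'h chevalley \<Rightarrow> 'a" where
  "\<rho> g = (case g of GH x \<Rightarrow> \<tau> x | GE i \<Rightarrow> e i | GF i \<Rightarrow> f i)"

abbreviation "\<phi> \<equiv> free_eval M \<rho>"

lemma rho_simps [simp]: "\<rho> (GH x) = \<tau> x" "\<rho> (GE i) = e i" "\<rho> (GF i) = f i"
  by (simp_all add: \<rho>_def)

lemma gens_simps [simp]: "GH x \<in> X \<longleftrightarrow> x \<in> carrier H" "GE i \<in> X \<longleftrightarrow> i < n" "GF i \<in> X \<longleftrightarrow> i < n"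
  by (auto simp: chevalley_gens_def)

lemma part_carrier: "x \<in> part M i \<Longrightarrow> x \<in> carrier M"
  using L.part_subspace[of i] by (auto simp: subspace_iff)

lemma rho_part: "g \<in> X \<Longrightarrow> \<rho> g \<in> part M (chevalley_parity par g)"
  by (cases g) (auto simp: torus_part e_part f_part)

sublocale free_evaluation M X \<rho>
  by unfold_locales (rule part_carrier[OF rho_part])

sublocale ev: nonassoc_hom F M \<phi>
  by (intro nonassoc_hom.intro nonassoc_hom_axioms.intro free_nonassoc_algebra nonassoc_algebra_axioms)
     (auto simp: module_hom_iff free_simps free_eval_add free_eval_scale free_eval_mult)

lemma word_eval_part: "t \<in> W \<Longrightarrow> word_eval M \<rho> t \<in> part M (word_sum (chevalley_parity par) t)"
proof (induction t)
  case (Br s t)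
  then show ?case using L.br_part[of "word_eval M \<rho> s" _ "word_eval M \<rho> t"] by simp
qed (simp add: rho_part)

lemma eval_subspace:
  assumes "subspace class_ring U M" "keys a \<subseteq> T" "T \<subseteq> W" "\<And>t. t \<in> T \<Longrightarrow> word_eval M \<rho> t \<in> U"
  shows "\<phi> a \<in> U"
proof -
  have "\<phi> a \<in> U \<and> keys a \<subseteq> W"
    using assms(2)
    by (induction rule: pm_induct)
       (use assms(1,3,4) in \<open>auto simp: subspace_iff free_eval_add keys_sub_closed\<close>)
  then show ?thesis ..
qed

lemma eval_part: "a \<in> part F i \<Longrightarrow> \<phi> a \<in> part M i"
  by (rule eval_subspace[OF L.part_subspace, where T = "{t \<in> W. word_sum (chevalley_parity par) t = i}"])
     (use word_eval_part in \<open>auto simp: free_simps\<close>)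

lemma part_carrier_free: "a \<in> part F i \<Longrightarrow> a \<in> carrier F"
  by (auto simp: free_simps)

lemma D_word: "t \<in> W \<Longrightarrow> word_eval M \<rho> t \<in> D (word_sum chevalley_degree t)"
proof (induction t)
  case (Gen g)
  then show ?case by (cases g) (auto simp: D_torus D_e D_f)
qed (auto simp: D_br)

lemma eval_D: "keys a \<subseteq> {t \<in> W. word_sum chevalley_degree t = q} \<Longrightarrow> \<phi> a \<in> D q"
  by (rule eval_subspace[OF D_subspace, where T = "{t \<in> W. word_sum chevalley_degree t = q}"])
     (use D_word in auto)

text \<open>The image is a subalgebra containing the torus and the Chevalley generators, so the
  hypothesis \<open>generated\<close> applies to it.\<close>

lemma eval_onto: "\<phi> ` carrier F = carrier M"
proof
  show "carrier M \<subseteq> \<phi> ` carrier F"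
  proof (rule generated)
    have z: "\<zero> \<in> \<phi> ` carrier F" by (rule rev_image_eqI[of 0]) (auto simp: free_simps)
    have a: "x \<oplus> y \<in> \<phi> ` carrier F" if "x \<in> \<phi> ` carrier F" "y \<in> \<phi> ` carrier F" for x y
      using that by (auto simp flip: ev.add)
    have s: "c \<odot> x \<in> \<phi> ` carrier F" if "x \<in> \<phi> ` carrier F" for x c
      using that by (auto simp flip: ev.smult)
    show "subspace class_ring (\<phi> ` carrier F) M"
      using vs z a s ev.closed by (auto simp: subspace_iff simp del: ev.closed)
    show "x \<otimes> y \<in> \<phi> ` carrier F" if "x \<in> \<phi> ` carrier F" "y \<in> \<phi> ` carrier F" for x y
      using that by (auto simp flip: ev.mult)
    have g: "\<rho> g \<in> \<phi> ` carrier F" if "g \<in> X" for g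
      using that by (intro rev_image_eqI[of "single (Gen g) 1"]) (auto simp: free_simps gens)
    show "\<tau> ` carrier H \<subseteq> \<phi> ` carrier F" "e ` {..<n} \<subseteq> \<phi> ` carrier F" "f ` {..<n} \<subseteq> \<phi> ` carrier F"
      using g[of "GH _"] g[of "GE _"] g[of "GF _"] by auto
  qed
qed auto

text \<open>A preimage of an element of parity i need not be of parity i. It is cut into its two
  parity parts, and uniqueness of the decomposition in \<open>M\<close> makes the part of the wrong
  parity evaluate to zero.\<close>

lemma eval_part_image: "\<phi> ` part F i = part M i"
proof
  show "part M i \<subseteq> \<phi> ` part F i"
  proof
    fix u assume u: "u \<in> part M i"
    obtain a where a: "a \<in> carrier F" "u = \<phi> a"
      using u part_carrier eval_onto by blast
    define r where "r j = lin_ext (\<lambda>t. if word_sum (chevalley_parity par) t = j then single t 1 else 0) a" for j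
    have r: "r j \<in> part F j" for j
      using a unfolding r_def by (auto simp: free_simps intro!: keys_lin_ext split: if_splits)
    have "r 0 + r 1 = lin_ext (\<lambda>t. single t 1) a"
      unfolding r_def lin_ext_fun_add[symmetric] by (intro arg_cong[where f = "\<lambda>g. lin_ext g a"]) auto
    also have "\<dots> = a"
      by (simp add: lin_ext_def flip: poly_mapping_sum_single)
    finally have "u = \<phi> (r 0) \<oplus> \<phi> (r 1)"
      using a ev.add[OF part_carrier_free[OF r] part_carrier_free[OF r], of 0 1] by (simp add: free_simps)
    moreover have p: "\<phi> (r j) \<in> part M j" "\<zero> \<in> part M j" for j
      using eval_part[OF r] L.part_subspace by (simp_all add: subspace_iff)
    ultimately have 1: "(\<phi> (r 0), \<phi> (r 1)) \<in> part M 0 \<times> part M 1 \<and>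
        u = fst (\<phi> (r 0), \<phi> (r 1)) \<oplus> snd (\<phi> (r 0), \<phi> (r 1))"
      by simp
    define w where "w = (if i = 0 then (u, \<zero>) else (\<zero>, u))"
    have 2: "w \<in> part M 0 \<times> part M 1 \<and> u = fst w \<oplus> snd w"
      using u p(2) part_carrier[OF u] by (cases i) (auto simp: w_def)
    have "w = (\<phi> (r 0), \<phi> (r 1))"
      using L.part_direct[OF part_carrier[OF u]] 1 2 by blast
    then have "(if i = 0 then (u, \<zero>) else (\<zero>, u)) = (\<phi> (r 0), \<phi> (r 1))"
      by (simp add: w_def)
    then have "u = \<phi> (r i)" by (cases i) (auto split: if_splits)
    then show "u \<in> \<phi> ` part F i" using r by blast
  qed
qed (auto dest: eval_part)

lemma gen_carrier [simp]: "g \<in> X \<Longrightarrow> gen g \<in> carrier F"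
  by (simp add: gen_def free_simps)

lemma eval_gen [simp]: "g \<in> X \<Longrightarrow> \<phi> (gen g) = \<rho> g"
  by (simp add: gen_def gens)

lemma free_closed [simp]:
  "a \<in> carrier F \<Longrightarrow> b \<in> carrier F \<Longrightarrow> a + b \<in> carrier F"
  "a \<in> carrier F \<Longrightarrow> b \<in> carrier F \<Longrightarrow> a - b \<in> carrier F"
  "a \<in> carrier F \<Longrightarrow> c *\<^sub>p a \<in> carrier F"
  "a \<in> carrier F \<Longrightarrow> - a \<in> carrier F"
  "0 \<in> carrier F"
  by (simp_all add: free_simps keys_sub_closed)

lemma eval_linear:
  "a \<in> carrier F \<Longrightarrow> b \<in> carrier F \<Longrightarrow> \<phi> (a + b) = \<phi> a \<oplus> \<phi> b"
  "a \<in> carrier F \<Longrightarrow> b \<in> carrier F \<Longrightarrow> \<phi> (a - b) = \<phi> a \<ominus> \<phi> b"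
  "a \<in> carrier F \<Longrightarrow> \<phi> (c *\<^sub>p a) = c \<odot> \<phi> a"
  using ev.add[of a b] ev.minus[of a b] ev.smult[of a c] by (simp_all add: free_minus free_simps)

text \<open>Evaluation preserves parity, so an instance of an identity in the free algebra evaluates
  to an instance of the same identity in \<open>M\<close>.\<close>

lemma lie_identities_kernel: "lie_identities F \<subseteq> {a \<in> carrier F. \<phi> a = \<zero>}"
proof
  fix a assume "a \<in> lie_identities F"
  then have "a \<in> carrier F \<and> \<phi> a \<in> lie_identities M"
    unfolding lie_identities_def
  proof (elim UnE CollectE exE conjE, goal_cases)
    case (1 i j x y)
    then have "\<phi> x \<in> part M i" "\<phi> y \<in> part M j" "x \<in> carrier F" "y \<in> carrier F"
      using eval_part part_carrier_free by auto
    then show ?case using 1 by (auto simp: ev.add ev.smult ev.mult)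
  next
    case (2 i j x y z)
    then have "\<phi> x \<in> part M i" "\<phi> y \<in> part M j" "x \<in> carrier F" "y \<in> carrier F" "\<phi> z \<in> carrier M"
      using eval_part part_carrier_free by auto
    then show ?case using 2
      by (simp only: ev.minus ev.add ev.smult ev.mult ev.L.br_closed ev.L.smult_closed ev.L.V.a_closed
          ev.L.V.minus_closed) blast
  next
    case (3 x)
    then have "\<phi> x \<in> part M 1" "x \<in> carrier F" using eval_part part_carrier_free by auto
    then show ?case using 3 by (auto simp: ev.mult)
  qed
  then show "a \<in> {a \<in> carrier F. \<phi> a = \<zero>}" using L.lie by blast
qed

lemma torus_linear:
  "x \<in> carrier H \<Longrightarrow> \<tau> x \<in> carrier M"
  "x \<in> carrier H \<Longrightarrow> y \<in> carrier H \<Longrightarrow> \<tau> (x \<oplus>\<^bsub>H\<^esub> y) = \<tau> x \<oplus> \<tau> y"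
  "x \<in> carrier H \<Longrightarrow> \<tau> (c \<odot>\<^bsub>H\<^esub> x) = c \<odot> \<tau> x"
  using torus_hom by (auto simp: module_hom_iff)

lemma ef_carrier [simp]: "i < n \<Longrightarrow> e i \<in> carrier M" "i < n \<Longrightarrow> f i \<in> carrier M"
  using e_part f_part part_carrier by blast+

lemma minus_self [simp]: "u \<in> carrier M \<Longrightarrow> u \<ominus> u = \<zero>"
  by (simp add: a_minus_def V.r_neg)

lemma chevalley_relations_kernel:
  "chevalley_relations n par H h \<alpha> \<subseteq> {a \<in> carrier F. \<phi> a = \<zero>}"
proof
  fix a assume "a \<in> chevalley_relations n par H h \<alpha>"
  then show "a \<in> {a \<in> carrier F. \<phi> a = \<zero>}"
    unfolding chevalley_relations_def Let_def
  proof (elim UnE CollectE exE conjE, goal_cases)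
    case (1 x y)
    then show ?case by (simp add: eval_linear torus_linear)
  next
    case (2 c x)
    then show ?case by (simp add: eval_linear torus_linear free_simps(4))
  next
    case (3 x y)
    then show ?case by (simp add: ev.mult rel_hh)
  next
    case (4 x j)
    then show ?case by (simp add: eval_linear ev.mult rel_he free_simps(4))
  next
    case (5 x j)
    then have "((- \<alpha> j x) \<odot> f j) \<oplus> (\<alpha> j x \<odot> f j) = \<zero>"
      by (simp flip: add_smult)
    then show ?case using 5 by (simp add: eval_linear ev.mult rel_hf free_simps(4))
  next
    case (6 i j)
    then show ?case by (auto simp: eval_linear ev.mult rel_ef torus_linear h)
  qed
qed

lemma relations_carrier: "lie_identities F \<union> chevalley_relations n par H h \<alpha> \<subseteq> carrier F"
  using lie_identities_kernel chevalley_relations_kernel by blast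

lemma I_ideal: "algebra_ideal F I"
  and relations_sub: "lie_identities F \<subseteq> I" "chevalley_relations n par H h \<alpha> \<subseteq> I"
  using algebra_ideal_ideal_generated[OF free_nonassoc_algebra relations_carrier]
  by (simp_all add: presentation_ideal_def)

lemma I_kernel: "I \<subseteq> {a \<in> carrier F. \<phi> a = \<zero>}"
  unfolding presentation_ideal_def
  by (rule ideal_generated_subset[OF ev.kernel_ideal])
     (use lie_identities_kernel chevalley_relations_kernel in auto)

sublocale FQ: nonassoc_quotient_hom F M \<phi> I
  by (intro nonassoc_quotient_hom.intro nonassoc_ideal.intro ev.nonassoc_hom_axioms
      nonassoc_ideal_axioms.intro nonassoc_quotient_hom_axioms.intro I_ideal free_nonassoc_algebra)
     (use I_kernel in auto)

end

section \<open>Triangular decomposition modulo the relations\<close>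

context contragredient_model begin

lemma I_closed:
  "a \<in> I \<Longrightarrow> a \<in> carrier F" "0 \<in> I" "a \<in> I \<Longrightarrow> b \<in> I \<Longrightarrow> a + b \<in> I" "a \<in> I \<Longrightarrow> c *\<^sub>p a \<in> I"
  using FQ.J_sub FQ.J_zero FQ.J_add[of a b] FQ.J_smult[of a c] by (auto simp: free_simps)

lemma I_uminus: "a \<in> I \<Longrightarrow> - a \<in> I"
  using I_closed(4)[of a "- 1"] by simp

text \<open>Congruence modulo the relations. Calculating with representatives in the free algebra,
  and not with cosets, keeps words, supports and degrees visible.\<close>

definition eqI (infix \<open>\<approx>\<close> 50) where
  "a \<approx> b \<longleftrightarrow> a \<in> carrier F \<and> b \<in> carrier F \<and> a - b \<in> I"

lemma eqI_refl [simp]: "a \<in> carrier F \<Longrightarrow> a \<approx> a"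
  by (simp add: eqI_def I_closed)

lemma eqI_sym: "a \<approx> b \<Longrightarrow> b \<approx> a"
  using I_uminus[of "a - b"] by (simp add: eqI_def)

lemma eqI_trans [trans]: "a \<approx> b \<Longrightarrow> b \<approx> c \<Longrightarrow> a \<approx> c"
  using I_closed(3)[of "a - b" "b - c"] by (simp add: eqI_def)

lemma eqI_add: "a \<approx> b \<Longrightarrow> a' \<approx> b' \<Longrightarrow> a + a' \<approx> b + b'"
  using I_closed(3)[of "a - b" "a' - b'"] by (simp add: eqI_def algebra_simps)

lemma eqI_scale: "a \<approx> b \<Longrightarrow> c *\<^sub>p a \<approx> c *\<^sub>p b"
  using I_closed(4)[of "a - b" c] by (simp add: eqI_def pm.scale_right_diff_distrib)

lemma eqI_diff: "a \<approx> b \<Longrightarrow> a' \<approx> b' \<Longrightarrow> a - a' \<approx> b - b'"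
  using eqI_add[of a b "(- 1) *\<^sub>p a'" "(- 1) *\<^sub>p b'"] eqI_scale[of a' b' "- 1"] by simp

lemma br_linear:
  "(a + b) \<star> d = a \<star> d + b \<star> d" "d \<star> (a + b) = d \<star> a + d \<star> b"
  "(c *\<^sub>p a) \<star> d = c *\<^sub>p (a \<star> d)" "d \<star> (c *\<^sub>p a) = c *\<^sub>p (d \<star> a)"
  "(a - b) \<star> d = a \<star> d - b \<star> d" "d \<star> (a - b) = d \<star> a - d \<star> b"
  by (simp_all add: free_mult bilin_ext_linear)

lemma eqI_br:
  assumes "a \<approx> b" "a' \<approx> b'"
  shows "a \<star> a' \<approx> b \<star> b'"
proof -
  have "(a - b) \<star> a' \<in> I" "b \<star> (a' - b') \<in> I"
    using assms FQ.J_br by (auto simp: eqI_def)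
  then have "(a - b) \<star> a' + b \<star> (a' - b') \<in> I" by (rule I_closed)
  then show ?thesis using assms by (simp add: eqI_def br_linear)
qed

lemma eqI_zero: "a \<approx> 0 \<longleftrightarrow> a \<in> I"
  using I_closed by (auto simp: eqI_def)

lemma eqI_skew:
  assumes "a \<in> part F i" "b \<in> part F j"
  shows "a \<star> b \<approx> (- ksign i j) *\<^sub>p (b \<star> a)"
proof -
  have "a \<star> b + ksign i j *\<^sub>p (b \<star> a) \<in> lie_identities F"
    using assms unfolding lie_identities_def free_simps(3,4) by blast
  then show ?thesis
    using relations_sub part_carrier_free[OF assms(1)] part_carrier_free[OF assms(2)]
    by (auto simp: eqI_def)
qed

lemma eqI_jacobi:
  assumes "a \<in> part F i" "b \<in> part F j" "d \<in> carrier F"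
  shows "a \<star> (b \<star> d) \<approx> (a \<star> b) \<star> d + ksign i j *\<^sub>p (b \<star> (a \<star> d))"
proof -
  note c = part_carrier_free[OF assms(1)] part_carrier_free[OF assms(2)] assms(3)
  have "a \<star> (b \<star> d) \<ominus>\<^bsub>F\<^esub> ((a \<star> b) \<star> d \<oplus>\<^bsub>F\<^esub> (ksign i j \<odot>\<^bsub>F\<^esub> (b \<star> (a \<star> d)))) \<in> lie_identities F"
    using assms unfolding lie_identities_def by blast
  then have "a \<star> (b \<star> d) - ((a \<star> b) \<star> d + ksign i j *\<^sub>p (b \<star> (a \<star> d))) \<in> I"
    using relations_sub c by (auto simp: free_minus free_simps(3,4))
  then show ?thesis using c by (auto simp: eqI_def)
qed

lemma eqI_jacobi':
  assumes "a \<in> part F i" "b \<in> part F j" "d \<in> carrier F"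
  shows "(a \<star> b) \<star> d \<approx> a \<star> (b \<star> d) - ksign i j *\<^sub>p (b \<star> (a \<star> d))"
  using eqI_sym[OF eqI_diff[OF eqI_jacobi[OF assms] eqI_refl[of "ksign i j *\<^sub>p (b \<star> (a \<star> d))"]]]
    assms part_carrier_free[OF assms(1)] part_carrier_free[OF assms(2)] by simp

abbreviation hh where "hh x \<equiv> gen (GH x) :: 'h chevalley word \<Rightarrow>\<^sub>0 'k"

lemma chevalley_relationsI:
  "x \<in> carrier H \<Longrightarrow> y \<in> carrier H \<Longrightarrow> hh (x \<oplus>\<^bsub>H\<^esub> y) - (hh x + hh y) \<in> chevalley_relations n par H h \<alpha>"
  "x \<in> carrier H \<Longrightarrow> hh (c \<odot>\<^bsub>H\<^esub> x) - c *\<^sub>p hh x \<in> chevalley_relations n par H h \<alpha>"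
  "x \<in> carrier H \<Longrightarrow> y \<in> carrier H \<Longrightarrow> hh x \<star> hh y \<in> chevalley_relations n par H h \<alpha>"
  "x \<in> carrier H \<Longrightarrow> j < n \<Longrightarrow>
     hh x \<star> gen (GE j) - \<alpha> j x *\<^sub>p gen (GE j) \<in> chevalley_relations n par H h \<alpha>"
  "x \<in> carrier H \<Longrightarrow> j < n \<Longrightarrow>
     hh x \<star> gen (GF j) + \<alpha> j x *\<^sub>p gen (GF j) \<in> chevalley_relations n par H h \<alpha>"
  "i < n \<Longrightarrow> j < n \<Longrightarrow>
     gen (GE i) \<star> gen (GF j) - (if i = j then hh (h i) else 0) \<in> chevalley_relations n par H h \<alpha>"
  unfolding chevalley_relations_def Let_def free_simps(4) by blast+

lemma relation_eqI: "a - b \<in> chevalley_relations n par H h \<alpha> \<Longrightarrow> a \<in> carrier F \<Longrightarrow> b \<in> carrier F \<Longrightarrow> a \<approx> b"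
  using relations_sub by (auto simp: eqI_def)

lemma eqI_hh_add: "x \<in> carrier H \<Longrightarrow> y \<in> carrier H \<Longrightarrow> hh (x \<oplus>\<^bsub>H\<^esub> y) \<approx> hh x + hh y"
  by (rule relation_eqI) (simp_all add: chevalley_relationsI)

lemma eqI_hh_scale: "x \<in> carrier H \<Longrightarrow> hh (c \<odot>\<^bsub>H\<^esub> x) \<approx> c *\<^sub>p hh x"
  by (rule relation_eqI) (simp_all add: chevalley_relationsI)

lemma eqI_hh_hh: "x \<in> carrier H \<Longrightarrow> y \<in> carrier H \<Longrightarrow> hh x \<star> hh y \<approx> 0"
  by (rule relation_eqI) (simp_all add: chevalley_relationsI)

lemma eqI_he: "x \<in> carrier H \<Longrightarrow> j < n \<Longrightarrow> hh x \<star> gen (GE j) \<approx> \<alpha> j x *\<^sub>p gen (GE j)"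
  by (rule relation_eqI) (simp_all add: chevalley_relationsI)

lemma eqI_hf: "x \<in> carrier H \<Longrightarrow> j < n \<Longrightarrow> hh x \<star> gen (GF j) \<approx> (- \<alpha> j x) *\<^sub>p gen (GF j)"
  by (rule relation_eqI) (simp_all add: chevalley_relationsI)

lemma eqI_ef: "i < n \<Longrightarrow> j < n \<Longrightarrow> gen (GE i) \<star> gen (GF j) \<approx> (if i = j then hh (h i) else 0)"
  using chevalley_relationsI(6)[of i j] by (intro relation_eqI) (auto simp: h)

lemma hh_zero: "hh \<zero>\<^bsub>H\<^esub> \<approx> 0"
  using eqI_hh_scale[of "\<zero>\<^bsub>H\<^esub>" 0] HV.smult_l_null[of "\<zero>\<^bsub>H\<^esub>"] by (simp add: class_ring_simps)

lemma gen_part: "g \<in> X \<Longrightarrow> gen g \<in> part F (chevalley_parity par g)"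
  by (simp add: gen_def free_simps)

text \<open>Up to signs the relations are symmetric in the raising and lowering generators. Carrying
  an ordered pair of generator families treats both halves of the triangular decomposition by one
  argument.\<close>

definition opp :: "(nat \<Rightarrow> 'h chevalley) \<Rightarrow> (nat \<Rightarrow> 'h chevalley) \<Rightarrow> bool" where
  "opp A B \<longleftrightarrow> A = GE \<and> B = GF \<or> A = GF \<and> B = GE"

lemma opp_X: "opp A B \<Longrightarrow> i < n \<Longrightarrow> A i \<in> X" "opp A B \<Longrightarrow> i < n \<Longrightarrow> B i \<in> X"
  by (auto simp: opp_def)

lemma opp_parity: "opp A B \<Longrightarrow> chevalley_parity par (A i) = par i"
  by (auto simp: opp_def)

lemma opp_sym: "opp A B \<Longrightarrow> opp B A"
  by (auto simp: opp_def)

lemma opp_ha: assumes "opp A B" "x \<in> carrier H" "i < n"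
  shows "\<exists>c. hh x \<star> gen (A i) \<approx> c *\<^sub>p gen (A i)"
  using assms eqI_he eqI_hf unfolding opp_def by blast

lemma opp_ah: assumes "opp A B" "x \<in> carrier H" "i < n"
  shows "\<exists>c. gen (A i) \<star> hh x \<approx> c *\<^sub>p gen (A i)"
proof -
  obtain c where c: "hh x \<star> gen (A i) \<approx> c *\<^sub>p gen (A i)" using opp_ha[OF assms] by blast
  have "gen (A i) \<star> hh x \<approx> (- ksign (par i) 0) *\<^sub>p (hh x \<star> gen (A i))"
    using eqI_skew[OF gen_part[OF opp_X(1)[OF assms(1,3)]] gen_part[of "GH x"]] assms
    by (simp add: opp_parity[OF assms(1)])
  also have "\<dots> \<approx> (- ksign (par i) 0) *\<^sub>p (c *\<^sub>p gen (A i))"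
    by (rule eqI_scale[OF c])
  finally have "gen (A i) \<star> hh x \<approx> (- ksign (par i) 0 * c) *\<^sub>p gen (A i)" by simp
  then show ?thesis by blast
qed

lemma opp_ba: assumes "opp A B" "i < n" "j < n"
  shows "\<exists>y\<in>carrier H. gen (B j) \<star> gen (A i) \<approx> hh y"
proof -
  have ef: "\<exists>y\<in>carrier H. gen (GE i) \<star> gen (GF j) \<approx> hh y" if "i < n" "j < n" for i j
  proof (cases "i = j")
    case True
    then show ?thesis using eqI_ef[OF that] h that by auto
  next
    case False
    then have "gen (GE i) \<star> gen (GF j) \<approx> hh \<zero>\<^bsub>H\<^esub>"
      using eqI_trans[OF _ eqI_sym[OF hh_zero]] eqI_ef[OF that] by simp
    then show ?thesis by blast
  qed
  have "\<exists>y\<in>carrier H. gen (GF j) \<star> gen (GE i) \<approx> hh y" if ij: "i < n" "j < n" for i j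
  proof -
    obtain y where y: "y \<in> carrier H" "gen (GE i) \<star> gen (GF j) \<approx> hh y" using ef[OF ij] by blast
    let ?s = "- ksign (par j) (par i) :: 'k"
    have "gen (GF j) \<star> gen (GE i) \<approx> ?s *\<^sub>p (gen (GE i) \<star> gen (GF j))"
      using eqI_skew[OF gen_part[of "GF j"] gen_part[of "GE i"]] ij by simp
    also have "\<dots> \<approx> ?s *\<^sub>p hh y" by (rule eqI_scale[OF y(2)])
    also have "\<dots> \<approx> hh (?s \<odot>\<^bsub>H\<^esub> y)" by (rule eqI_sym[OF eqI_hh_scale[OF y(1)]])
    finally show ?thesis using y by auto
  qed
  then show ?thesis using ef assms unfolding opp_def by blast
qed

text \<open>\<open>tri A z\<close>: combinations, modulo relations, of right-normed brackets of \<open>z\<close> generators \<open>A i\<close>.\<close>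

inductive tri :: "(nat \<Rightarrow> 'h chevalley) \<Rightarrow> int \<Rightarrow> ('h chevalley word \<Rightarrow>\<^sub>0 'k) \<Rightarrow> bool" for A where
  zero: "z > 0 \<Longrightarrow> tri A z 0"
| gen: "i < n \<Longrightarrow> tri A 1 (gen (A i))"
| step: "tri A z a \<Longrightarrow> i < n \<Longrightarrow> tri A (z + 1) (gen (A i) \<star> a)"
| add: "tri A z a \<Longrightarrow> tri A z b \<Longrightarrow> tri A z (a + b)"
| scale: "tri A z a \<Longrightarrow> tri A z (c *\<^sub>p a)"
| eqv: "tri A z a \<Longrightarrow> a \<approx> b \<Longrightarrow> tri A z b"

lemma tri_carrier: "tri A z a \<Longrightarrow> opp A B \<Longrightarrow> a \<in> carrier F \<and> z > 0"
  by (induction rule: tri.induct) (auto simp: opp_X eqI_def)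

text \<open>Torus elements act diagonally on the generators and, by the Jacobi identity, as even
  derivations; hence they preserve the brackets of a given height.\<close>

lemma tri_hh: "tri A z a \<Longrightarrow> opp A B \<Longrightarrow> x \<in> carrier H \<Longrightarrow> tri A z (hh x \<star> a)"
proof (induction rule: tri.induct)
  case (zero z)
  then show ?case by (simp add: free_mult tri.zero)
next
  case (gen i)
  obtain c where "hh x \<star> gen (A i) \<approx> c *\<^sub>p gen (A i)" using opp_ha gen by blast
  then show ?case using tri.eqv[OF tri.scale[OF tri.gen]] gen eqI_sym by blast
next
  case (step z a i)
  obtain c where c: "hh x \<star> gen (A i) \<approx> c *\<^sub>p gen (A i)" using opp_ha step by blast
  have a: "a \<in> carrier F" using tri_carrier step by blast
  have "hh x \<star> (gen (A i) \<star> a) \<approx> (hh x \<star> gen (A i)) \<star> a + gen (A i) \<star> (hh x \<star> a)"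
    using eqI_jacobi[OF gen_part[of "GH x"] gen_part[OF opp_X(1)] a] step by (simp add: ksign_def)
  also have "\<dots> \<approx> (c *\<^sub>p gen (A i)) \<star> a + gen (A i) \<star> (hh x \<star> a)"
    using step a by (intro eqI_add eqI_br c) (auto simp: opp_X)
  finally have "hh x \<star> (gen (A i) \<star> a) \<approx> c *\<^sub>p (gen (A i) \<star> a) + gen (A i) \<star> (hh x \<star> a)"
    by (simp add: br_linear)
  moreover have "tri A (z + 1) (c *\<^sub>p (gen (A i) \<star> a) + gen (A i) \<star> (hh x \<star> a))"
    using step by (intro tri.add tri.scale tri.step) auto
  ultimately show ?case using tri.eqv eqI_sym by blast
next
  case (add z a b)
  then show ?case by (simp add: br_linear tri.add)
next
  case (scale z a c)
  then show ?case by (simp add: br_linear tri.scale)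
next
  case (eqv z a b)
  then show ?case using tri.eqv[OF eqv.IH eqI_br[OF eqI_refl]] by simp
qed

text \<open>In [B j, [A i, a]] the Jacobi identity leaves [[B j, A i], a], where the inner bracket
  is toral and keeps the height, and [A i, [B j, a]], which is covered by induction. Height 1 is
  separate, because lowering it gives a torus element and not a combination of brackets of
  generators \<open>A i\<close>.\<close>

lemma tri_lower: "tri A z a \<Longrightarrow> opp A B \<Longrightarrow> j < n \<Longrightarrow>
    (if z = 1 then \<exists>x\<in>carrier H. gen (B j) \<star> a \<approx> hh x else tri A (z - 1) (gen (B j) \<star> a))"
proof (induction rule: tri.induct)
  case (zero z)
  then show ?case using eqI_sym[OF hh_zero] by (auto simp: free_mult intro: tri.zero)
next
  case (gen i)
  then show ?case using opp_ba by simp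
next
  case (step z a i)
  have a: "a \<in> carrier F" "z > 0" using tri_carrier step by blast+
  obtain y where y: "y \<in> carrier H" "gen (B j) \<star> gen (A i) \<approx> hh y" using opp_ba step by blast
  let ?k = "ksign (par j) (par i) :: 'k"
  have "gen (B j) \<star> (gen (A i) \<star> a) \<approx>
      (gen (B j) \<star> gen (A i)) \<star> a + ?k *\<^sub>p (gen (A i) \<star> (gen (B j) \<star> a))"
    using eqI_jacobi[OF gen_part[OF opp_X(2)[OF step.prems]]
        gen_part[OF opp_X(1)[OF step.prems(1) step.hyps(2)]] a(1)]
    by (simp add: opp_parity[OF step.prems(1)] opp_parity[OF opp_sym[OF step.prems(1)]])
  also have "\<dots> \<approx> hh y \<star> a + ?k *\<^sub>p (gen (A i) \<star> (gen (B j) \<star> a))"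
    using step a by (intro eqI_add eqI_br y(2)) (auto simp: opp_X)
  finally have 1: "gen (B j) \<star> (gen (A i) \<star> a) \<approx> hh y \<star> a + ?k *\<^sub>p (gen (A i) \<star> (gen (B j) \<star> a))" .
  have "tri A z (gen (A i) \<star> (gen (B j) \<star> a))"
  proof (cases "z = 1")
    \<comment> \<open>Here [B j, a] is toral, so bracketing it with \<open>A i\<close> gives back a
      multiple of \<open>A i\<close>.\<close>
    case True
    then obtain x where x: "x \<in> carrier H" "gen (B j) \<star> a \<approx> hh x" using step by auto
    obtain c where c: "gen (A i) \<star> hh x \<approx> c *\<^sub>p gen (A i)" using opp_ah x step by blast
    have "gen (A i) \<star> (gen (B j) \<star> a) \<approx> gen (A i) \<star> hh x"
      using step by (intro eqI_br x(2)) (auto simp: opp_X)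
    also note c
    finally show ?thesis using tri.eqv[OF tri.scale[OF tri.gen]] step eqI_sym True by blast
  next
    case False
    then show ?thesis using step tri.step[of A "z - 1"] by simp
  qed
  then have "tri A z (hh y \<star> a + ?k *\<^sub>p (gen (A i) \<star> (gen (B j) \<star> a)))"
    using step y by (intro tri.add tri.scale tri_hh) auto
  then show ?case using a tri.eqv[OF _ eqI_sym[OF 1]] by simp
next
  case (add z a b)
  show ?case
  proof (cases "z = 1")
    case True
    then obtain x y where "x \<in> carrier H" "gen (B j) \<star> a \<approx> hh x" "y \<in> carrier H" "gen (B j) \<star> b \<approx> hh y"
      using add by auto
    then have "gen (B j) \<star> (a + b) \<approx> hh (x \<oplus>\<^bsub>H\<^esub> y)" "x \<oplus>\<^bsub>H\<^esub> y \<in> carrier H"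
      using eqI_trans[OF eqI_add eqI_sym[OF eqI_hh_add]] by (auto simp: br_linear)
    then show ?thesis using True by auto
  qed (use add in \<open>auto simp: br_linear intro: tri.add\<close>)
next
  case (scale z a c)
  show ?case
  proof (cases "z = 1")
    case True
    then obtain x where "x \<in> carrier H" "gen (B j) \<star> a \<approx> hh x"
      using scale by auto
    then have "gen (B j) \<star> (c *\<^sub>p a) \<approx> hh (c \<odot>\<^bsub>H\<^esub> x)" "c \<odot>\<^bsub>H\<^esub> x \<in> carrier H"
      using eqI_trans[OF eqI_scale eqI_sym[OF eqI_hh_scale]] by (auto simp: br_linear)
    then show ?thesis using True by auto
  qed (use scale in \<open>auto simp: br_linear intro: tri.scale\<close>)
next
  case (eqv z a b)
  then have "gen (B j) \<star> a \<approx> gen (B j) \<star> b" by (intro eqI_br) (auto simp: opp_X)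
  then show ?case
  proof (cases "z = 1")
    case True
    then obtain x where "x \<in> carrier H" "gen (B j) \<star> a \<approx> hh x" using eqv by auto
    then show ?thesis
      using True eqI_trans[OF eqI_sym[OF \<open>gen (B j) \<star> a \<approx> gen (B j) \<star> b\<close>]] by auto
  next
    case False
    then show ?thesis using eqv tri.eqv[OF _ \<open>gen (B j) \<star> a \<approx> gen (B j) \<star> b\<close>] by simp
  qed
qed

text \<open>The part of height z in the triangular decomposition: brackets of the generators
  \<open>A i\<close>, the torus, or brackets of the generators \<open>B i\<close>, according to the
  sign of z. Only spanning is asserted, not directness of the sum.\<close>

definition tri_sum :: "(nat \<Rightarrow> 'h chevalley) \<Rightarrow> (nat \<Rightarrow> 'h chevalley) \<Rightarrow> int \<Rightarrow> ('h chevalley word \<Rightarrow>\<^sub>0 'k) \<Rightarrow> bool" where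
  "tri_sum A B z a \<longleftrightarrow> (if z > 0 then tri A z a else if z < 0 then tri B (- z) a
     else \<exists>x\<in>carrier H. a \<approx> hh x)"

lemma tri_sum_swap: "tri_sum A B z a \<longleftrightarrow> tri_sum B A (- z) a"
  by (simp add: tri_sum_def)

lemma tri_sum_cases:
  assumes "tri_sum A B z a"
  obtains "z > 0" "tri A z a" | "z < 0" "tri B (- z) a" | x where "z = 0" "x \<in> carrier H" "a \<approx> hh x"
  using assms unfolding tri_sum_def by (cases "z > 0"; cases "z < 0") force+

lemma tri_sumI:
  "tri A z a \<Longrightarrow> z > 0 \<Longrightarrow> tri_sum A B z a" "tri B (- z) a \<Longrightarrow> z < 0 \<Longrightarrow> tri_sum A B z a"
  "x \<in> carrier H \<Longrightarrow> a \<approx> hh x \<Longrightarrow> z = 0 \<Longrightarrow> tri_sum A B z a"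
  unfolding tri_sum_def by auto

lemma tri_sum_cong: "tri_sum A B z a \<Longrightarrow> a \<approx> b \<Longrightarrow> tri_sum A B z b"
  by (elim tri_sum_cases) (blast intro: tri_sumI tri.eqv eqI_trans eqI_sym)+

lemma tri_sum_add:
  assumes "tri_sum A B z a" "tri_sum A B z b"
  shows "tri_sum A B z (a + b)"
  using assms(1)
proof (cases rule: tri_sum_cases)
  case (3 x)
  then obtain y where y: "y \<in> carrier H" "b \<approx> hh y" using assms(2) by (auto simp: tri_sum_def)
  show ?thesis
    by (rule tri_sumI(3)[OF _ eqI_trans[OF eqI_add[OF 3(3) y(2)] eqI_sym[OF eqI_hh_add]]]) (use 3 y in auto)
qed (use assms(2) in \<open>auto simp: tri_sum_def intro: tri.add\<close>)

lemma tri_sum_scale: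
  assumes "tri_sum A B z a"
  shows "tri_sum A B z (c *\<^sub>p a)"
  using assms
proof (cases rule: tri_sum_cases)
  case (3 x)
  show ?thesis
    by (rule tri_sumI(3)[OF _ eqI_trans[OF eqI_scale[OF 3(3)] eqI_sym[OF eqI_hh_scale]]]) (use 3 in auto)
qed (auto intro: tri_sumI tri.scale)

lemma tri_sum_carrier: "tri_sum A B z a \<Longrightarrow> opp A B \<Longrightarrow> a \<in> carrier F"
  using tri_carrier[of A z a B] tri_carrier[of B "- z" a A] opp_sym[of A B]
  by (auto simp: tri_sum_def eqI_def split: if_splits)

text \<open>The generator \<open>A i\<close> prolongs brackets of its own family by definition,
  sends a torus element to a multiple of itself, and acts on brackets of the opposite family through
  \<open>tri_lower\<close>.\<close>

lemma tri_sum_raise: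
  assumes "tri_sum A B z a" "opp A B" "i < n"
  shows "tri_sum A B (z + 1) (gen (A i) \<star> a)"
proof -
  consider "z > 0" | "z = 0" | "z < 0" by linarith
  then show ?thesis
  proof cases
    case 1
    then show ?thesis using assms tri.step by (simp add: tri_sum_def)
  next
    case 2
    then obtain x where x: "x \<in> carrier H" "a \<approx> hh x" using assms by (auto simp: tri_sum_def)
    obtain c where c: "gen (A i) \<star> hh x \<approx> c *\<^sub>p gen (A i)" using opp_ah x assms by blast
    have "gen (A i) \<star> a \<approx> gen (A i) \<star> hh x"
      using assms by (intro eqI_br x(2)) (auto simp: opp_X)
    also note c
    finally have "tri A 1 (gen (A i) \<star> a)"
      using tri.eqv[OF tri.scale[OF tri.gen]] assms eqI_sym by blast
    then show ?thesis using 2 by (simp add: tri_sum_def)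
  next
    case 3
    then show ?thesis
      using tri_lower[of B "- z" a A i] assms opp_sym by (auto simp: tri_sum_def split: if_splits)
  qed
qed

lemma tri_sum_hh:
  assumes "tri_sum A B z a" "opp A B" "x \<in> carrier H"
  shows "tri_sum A B z (hh x \<star> a)"
proof (cases "z = 0")
  case True
  then obtain y where "y \<in> carrier H" "a \<approx> hh y" using assms by (auto simp: tri_sum_def)
  then have "hh x \<star> a \<approx> 0" "y \<in> carrier H"
    using eqI_trans[OF eqI_br[OF eqI_refl] eqI_hh_hh] assms by auto
  then show ?thesis using True eqI_trans[OF _ eqI_sym[OF hh_zero]] by (auto simp: tri_sum_def)
next
  case False
  then show ?thesis
    using assms tri_hh[of A z a B x] tri_hh[of B "- z" a A x] opp_sym[of A B]
    by (auto simp: tri_sum_def split: if_splits)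
qed

primrec gen_height :: "'h chevalley \<Rightarrow> int" where
  "gen_height (GH x) = 0" | "gen_height (GE i) = 1" | "gen_height (GF i) = - 1"

lemma single_Br: "single (Br s t) (1 :: 'k) = single s 1 \<star> single t 1"
  by (simp add: free_mult)

lemma word_part: "t \<in> W \<Longrightarrow> single t 1 \<in> part F (word_sum (chevalley_parity par) t)"
  by (simp add: free_simps)

text \<open>The bracket with a compound word is the supercommutator of the brackets with its two
  factors, so stability under generators gives stability under all words.\<close>

lemma tri_sum_word: "t \<in> W \<Longrightarrow> tri_sum GE GF z a \<Longrightarrow> tri_sum GE GF (z + word_sum gen_height t) (single t 1 \<star> a)"
proof (induction t arbitrary: z a)
  case (Gen g)
  have o: "opp GE GF" by (simp add: opp_def)
  show ?case
  proof (cases g)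
    case (GH x)
    then show ?thesis using Gen tri_sum_hh[OF Gen(2) o] by (simp add: gen_def)
  next
    case (GE i)
    then show ?thesis using Gen tri_sum_raise[OF Gen(2) o] by (simp add: gen_def)
  next
    case (GF i)
    then show ?thesis
      using Gen tri_sum_raise[of GF GE "- z" a i] opp_sym[OF o] tri_sum_swap[of GE GF] by (simp add: gen_def)
  qed
next
  case (Br s t)
  have st: "s \<in> W" "t \<in> W" using Br by auto
  have a: "a \<in> carrier F" using tri_sum_carrier[OF Br(4)] by (simp add: opp_def)
  let ?z = "z + word_sum gen_height (Br s t)"
  let ?k = "ksign (word_sum (chevalley_parity par) s) (word_sum (chevalley_parity par) t) :: 'k"
  have "tri_sum GE GF ?z (single s 1 \<star> (single t 1 \<star> a))"
    using Br.IH(1)[OF st(1) Br.IH(2)[OF st(2) Br(4)]] by (simp add: add_ac)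
  moreover have "tri_sum GE GF ?z (single t 1 \<star> (single s 1 \<star> a))"
    using Br.IH(2)[OF st(2) Br.IH(1)[OF st(1) Br(4)]] by (simp add: add_ac)
  ultimately have "tri_sum GE GF ?z (single s 1 \<star> (single t 1 \<star> a) + (- ?k) *\<^sub>p (single t 1 \<star> (single s 1 \<star> a)))"
    by (intro tri_sum_add tri_sum_scale)
  moreover have "single (Br s t) 1 \<star> a \<approx>
      single s 1 \<star> (single t 1 \<star> a) + (- ?k) *\<^sub>p (single t 1 \<star> (single s 1 \<star> a))"
    using eqI_jacobi'[OF word_part[OF st(1)] word_part[OF st(2)] a] by (simp add: single_Br)
  ultimately show ?case using tri_sum_cong eqI_sym by blast
qed

lemma word_tri_sum: "t \<in> W \<Longrightarrow> tri_sum GE GF (word_sum gen_height t) (single t 1)"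
proof (induction t)
  case (Gen g)
  then show ?case
  proof (cases g)
    case (GH x)
    then have x: "x \<in> carrier H" using Gen by simp
    show ?thesis
      using tri_sumI(3)[OF x eqI_refl[OF gen_carrier] refl, of GE GF] x GH by (simp add: gen_def)
  qed (auto simp: tri_sum_def tri.gen simp flip: gen_def)
next
  case (Br s t)
  then show ?case
    using tri_sum_word[of s "word_sum gen_height t" "single t 1"] by (simp add: single_Br add_ac)
qed

text \<open>Height factors through degree, as the sum of the coordinates; in particular degree 0
  implies height 0.\<close>

lemma word_height:
  "word_sum gen_height t = (\<Sum>i\<in>keys (word_sum chevalley_degree t). lookup (word_sum chevalley_degree t) i)"
proof -
  have s: "(\<Sum>i\<in>keys (p + q). lookup (p + q) i) = (\<Sum>i\<in>keys p. lookup p i) + (\<Sum>i\<in>keys q. lookup q i)"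
    for p q :: "nat \<Rightarrow>\<^sub>0 int"
  proof -
    have *: "(\<Sum>i\<in>keys r. lookup r i) = (\<Sum>i\<in>keys p \<union> keys q. lookup r i)"
      if "keys r \<subseteq> keys p \<union> keys q" for r
      using that by (intro sum.mono_neutral_left) (auto simp: in_keys_iff)
    show ?thesis
      unfolding *[OF keys_add] *[OF Un_upper1] *[OF Un_upper2] by (simp add: lookup_add sum.distrib)
  qed
  show ?thesis
  proof (induction t)
    case (Gen g)
    then show ?case by (cases g) auto
  qed (simp add: s)
qed

text \<open>Degree 0 implies height 0, and the height 0 part of the triangular decomposition is the
  torus. So an ideal meeting the torus trivially has no nonzero element of degree 0.\<close>

lemma degree_zero_torus:
  assumes "keys a \<subseteq> {t \<in> W. word_sum chevalley_degree t = 0}"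
  shows "\<exists>x\<in>carrier H. a \<approx> hh x"
proof -
  have "tri_sum GE GF 0 a"
    using assms
  proof (induction rule: pm_induct)
    case zero
    then show ?case using eqI_sym[OF hh_zero] by (auto simp: tri_sum_def)
  next
    case (single c t)
    then have "tri_sum GE GF 0 (single t 1)" using word_tri_sum[of t] by (simp add: word_height)
    then show ?case using tri_sum_scale[of GE GF 0 "single t 1" c] by simp
  qed (rule tri_sum_add)
  then show ?thesis by (simp add: tri_sum_def)
qed

section \<open>The largest graded ideal avoiding the torus\<close>

definition restrict :: "(nat \<Rightarrow>\<^sub>0 int) \<Rightarrow> ('h chevalley word \<Rightarrow>\<^sub>0 'k) \<Rightarrow> ('h chevalley word \<Rightarrow>\<^sub>0 'k)" where
  "restrict q = lin_ext (\<lambda>t. if word_sum chevalley_degree t = q then single t 1 else 0)"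

lemma keys_restrict: "a \<in> carrier F \<Longrightarrow> keys (restrict q a) \<subseteq> {t \<in> W. word_sum chevalley_degree t = q}"
  unfolding restrict_def by (rule keys_lin_ext) (auto simp: free_simps split: if_splits)

lemma restrict_carrier [simp]: "a \<in> carrier F \<Longrightarrow> restrict q a \<in> carrier F"
  using keys_restrict[of a q] by (auto simp: free_simps)

lemma sum_restrict: "(\<Sum>q\<in>word_sum chevalley_degree ` keys a. restrict q a) = a"
proof (rule poly_mapping_eqI)
  fix t
  have "lookup (restrict q a) t = (if word_sum chevalley_degree t = q then lookup a t else 0)" for q
  proof -
    have "lookup (restrict q a) t = (\<Sum>s\<in>keys a. if s = t \<and> word_sum chevalley_degree t = q then lookup a t else 0)"
      unfolding restrict_def lin_ext_def lookup_sum
      by (rule sum.cong) (auto simp: lookup_single when_def)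
    then show ?thesis by (cases "word_sum chevalley_degree t = q") (auto simp: in_keys_iff)
  qed
  then show "lookup (\<Sum>q\<in>word_sum chevalley_degree ` keys a. restrict q a) t = lookup a t"
    by (auto simp: lookup_sum in_keys_iff)
qed

text \<open>Evaluation intertwines homogeneous parts in the free algebra with the projections of the
  model. This is the reason why its kernel is graded.\<close>

lemma eval_restrict: "a \<in> carrier F \<Longrightarrow> \<phi> (restrict q a) = P q (\<phi> a)"
proof -
  assume "a \<in> carrier F"
  then have "keys a \<subseteq> W" by (simp add: free_simps)
  then have "\<phi> (restrict q a) = P q (\<phi> a) \<and> a \<in> carrier F"
  proof (induction rule: pm_induct)
    case zero
    have "P q \<zero> = \<zero>" using P_D[of \<zero> 0] D_subspace[of 0] by (auto simp: subspace_iff)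
    then show ?case by (simp add: restrict_def)
  next
    case (single c t)
    have P: "P q (c \<odot> word_eval M \<rho> t) = c \<odot> P q (word_eval M \<rho> t)"
      using P_hom[of q] single by (auto simp: module_hom_iff)
    show ?case
      using single P_D[OF D_word[OF single], of q] P by (auto simp: restrict_def free_simps)
  next
    case (add a b)
    have "\<phi> (restrict q (a + b)) = \<phi> (restrict q a) \<oplus> \<phi> (restrict q b)"
    proof -
      have "restrict q (a + b) = restrict q a + restrict q b" by (simp add: restrict_def lin_ext_add)
      then show ?thesis using add eval_linear(1)[of "restrict q a" "restrict q b"] by simp
    qed
    then show ?case using add P_hom[of q] ev.closed by (auto simp: module_hom_iff eval_linear)
  qed
  then show ?thesis ..
qed

abbreviation \<pi> where "\<pi> a \<equiv> I +>\<^bsub>F\<^esub> a"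

lemma G_eq: "G = quotient_superalgebra F I"
  by (simp add: contragredient_tilde_def presented_lie_superalgebra_def)

lemma to_tilde_eq: "to_tilde n par H h \<alpha> a = \<pi> a"
  by (simp add: to_tilde_def)

lemma pi_eq: "a \<in> carrier F \<Longrightarrow> b \<in> carrier F \<Longrightarrow> \<pi> a = \<pi> b \<longleftrightarrow> a \<approx> b"
  by (simp add: FQ.coset_eq eqI_def free_minus)

sublocale G: nonassoc_hom G M "quot_map \<phi>"
  unfolding G_eq by (rule FQ.quot_map_hom)

definition K where "K = {X \<in> carrier G. quot_map \<phi> X = \<zero>}"

lemma K_ideal: "algebra_ideal G K"
  unfolding K_def by (rule G.kernel_ideal)

lemma pi_K: "a \<in> carrier F \<Longrightarrow> \<pi> a \<in> K \<longleftrightarrow> \<phi> a = \<zero>"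
  unfolding K_def G_eq by (auto simp: FQ.quotient_carrier)

lemma tilde_component_eq: "tilde_component n par H h \<alpha> q =
    \<pi> ` {a. keys a \<subseteq> {t \<in> W. word_sum chevalley_degree t = q}}"
  unfolding tilde_component_def to_tilde_eq by (intro image_cong) auto

lemma tilde_torus_eq: "tilde_torus n par H h \<alpha> = (\<lambda>x. \<pi> (hh x)) ` carrier H"
  unfolding tilde_torus_def to_tilde_eq ..

lemma tilde_zero: "\<zero>\<^bsub>G\<^esub> = I"
  unfolding G_eq by (rule FQ.quotient_zero)

lemma zero_torus: "\<zero>\<^bsub>G\<^esub> \<in> tilde_torus n par H h \<alpha>"
  using hh_zero FQ.coset_mem_iff[of "hh \<zero>\<^bsub>H\<^esub>"]
  by (auto simp: tilde_torus_eq tilde_zero eqI_zero intro!: rev_image_eqI[of "\<zero>\<^bsub>H\<^esub>"])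

lemma span_subset:
  assumes "subspace class_ring U G" "S \<subseteq> U"
  shows "LinearCombinations.module.span class_ring G S \<subseteq> U"
  using assms G.L.V.span_is_subset by (simp add: subspace_def)

text \<open>If a representative evaluates to 0, so do its homogeneous parts by
  \<open>eval_restrict\<close>, and there are only finitely many of them.\<close>

lemma graded_ideal_K: "tilde_graded_ideal n par H h \<alpha> K"
  unfolding tilde_graded_ideal_def
proof (intro conjI K_ideal equalityI)
  let ?S = "\<Union>q. K \<inter> tilde_component n par H h \<alpha> q"
  have sub: "?S \<subseteq> carrier G" by (auto simp: K_def)
  show "LinearCombinations.module.span class_ring G ?S \<subseteq> K"
    using K_ideal by (intro span_subset) (auto simp: algebra_ideal_def)
  interpret s: submodule class_ring "LinearCombinations.module.span class_ring G ?S" G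
    by (rule G.L.V.span_is_submodule[OF sub])
  show "K \<subseteq> LinearCombinations.module.span class_ring G ?S"
  proof
    fix Y assume Y: "Y \<in> K"
    then obtain a where a: "a \<in> carrier F" "Y = \<pi> a"
      by (auto simp: K_def G_eq FQ.quotient_carrier)
    have z: "\<phi> a = \<zero>" using Y a pi_K by simp
    have Pz: "P q \<zero> = \<zero>" for q using P_D[of \<zero> 0] D_subspace[of 0] by (auto simp: subspace_iff)
    have q: "\<pi> (restrict q a) \<in> LinearCombinations.module.span class_ring G ?S" for q
    proof -
      have "\<pi> (restrict q a) \<in> K" using a z Pz by (simp add: pi_K eval_restrict)
      moreover have "\<pi> (restrict q a) \<in> tilde_component n par H h \<alpha> q"
        using keys_restrict[OF a(1)] by (auto simp: tilde_component_eq)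
      ultimately show ?thesis using G.L.V.in_own_span[OF sub] by blast
    qed
    have "\<pi> (\<Sum>q\<in>Q. restrict q a) \<in> LinearCombinations.module.span class_ring G ?S \<and>
        (\<Sum>q\<in>Q. restrict q a) \<in> carrier F" if "finite Q" for Q
      using that
    proof (induction Q)
      case empty
      have "\<pi> 0 = \<zero>\<^bsub>G\<^esub>" using FQ.coset_mem_iff[of 0] by (simp add: tilde_zero I_closed)
      then show ?case using s.zero_closed by simp
    next
      case (insert r Q)
      have "\<pi> (restrict r a + (\<Sum>q\<in>Q. restrict q a)) = \<pi> (restrict r a) \<oplus>\<^bsub>G\<^esub> \<pi> (\<Sum>q\<in>Q. restrict q a)"
        using insert a FQ.quotient_add[of "restrict r a" "\<Sum>q\<in>Q. restrict q a"] by (simp add: free_simps(3) G_eq)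
      then show ?case using insert a q s.m_closed by simp
    qed
    from this[of "word_sum chevalley_degree ` keys a"]
    show "Y \<in> LinearCombinations.module.span class_ring G ?S"
      using a by (simp add: sum_restrict)
  qed
qed

lemma K_torus: "K \<inter> tilde_torus n par H h \<alpha> = {\<zero>\<^bsub>G\<^esub>}"
proof
  show "K \<inter> tilde_torus n par H h \<alpha> \<subseteq> {\<zero>\<^bsub>G\<^esub>}"
  proof
    fix Y assume "Y \<in> K \<inter> tilde_torus n par H h \<alpha>"
    then obtain x where x: "x \<in> carrier H" "Y = \<pi> (hh x)" "\<tau> x = \<zero>"
      by (auto simp: tilde_torus_eq pi_K)
    then have "x = \<zero>\<^bsub>H\<^esub>" by (simp add: torus_inj)
    then show "Y \<in> {\<zero>\<^bsub>G\<^esub>}"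
      using x hh_zero FQ.coset_mem_iff[of "hh x"] by (simp add: tilde_zero eqI_zero)
  qed
  show "{\<zero>\<^bsub>G\<^esub>} \<subseteq> K \<inter> tilde_torus n par H h \<alpha>"
    using zero_torus K_ideal by (auto simp: algebra_ideal_def subspace_iff)
qed

text \<open>A homogeneous element of the ideal with nonzero value in the model has nonzero degree.
  By \<open>separated\<close> some element of opposite degree brackets it to something with nonzero
  value. This bracket lies in the ideal and has degree 0, so it is toral and must vanish: a
  contradiction.\<close>

lemma graded_ideal_le_K:
  assumes J: "tilde_graded_ideal n par H h \<alpha> J" "J \<inter> tilde_torus n par H h \<alpha> = {\<zero>\<^bsub>G\<^esub>}"
  shows "J \<subseteq> K"
proof -
  have ideal: "algebra_ideal G J" using J by (simp add: tilde_graded_ideal_def)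
  have torus: "\<phi> a = \<zero>"
    if "keys a \<subseteq> {t \<in> W. word_sum chevalley_degree t = 0}" "\<pi> a \<in> J" for a
  proof -
    from degree_zero_torus[OF that(1)] obtain x where x: "x \<in> carrier H" "a \<approx> hh x" by blast
    have a: "a \<in> carrier F" using that by (auto simp: free_simps)
    have "\<pi> a = \<pi> (hh x)" using x a pi_eq by simp
    then have "\<pi> a \<in> J \<inter> tilde_torus n par H h \<alpha>" using that x by (auto simp: tilde_torus_eq)
    then have "\<pi> a = I" using J by (simp add: tilde_zero)
    then have "a \<in> I" using a FQ.coset_mem_iff by simp
    then show ?thesis using I_kernel by blast
  qed
  have "J \<inter> tilde_component n par H h \<alpha> q \<subseteq> K" for q
  proof
    fix Y assume "Y \<in> J \<inter> tilde_component n par H h \<alpha> q"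
    then obtain a where a: "keys a \<subseteq> {t \<in> W. word_sum chevalley_degree t = q}" "Y = \<pi> a" "\<pi> a \<in> J"
      by (auto simp: tilde_component_eq)
    then have ac: "a \<in> carrier F" by (auto simp: free_simps)
    have "\<phi> a = \<zero>"
    proof (rule ccontr)
      assume nz: "\<phi> a \<noteq> \<zero>"
      with torus a have "q \<noteq> 0" by blast
      then obtain v where v: "v \<in> D (- q)" "v \<otimes> \<phi> a \<noteq> \<zero>"
        using separated[OF _ eval_D[OF a(1)] nz] by blast
      then have "v \<in> carrier M" using D_subspace[of "- q"] by (auto simp: subspace_iff)
      then obtain b where b: "b \<in> carrier F" "v = \<phi> b" using eval_onto by blast
      \<comment> \<open>An arbitrary preimage of v is replaced by its part of degree -q, which still
        evaluates to v, so that the bracket with a has degree 0.\<close>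
      define b' where "b' = restrict (- q) b"
      have b': "b' \<in> carrier F" "\<phi> b' = v" "keys b' \<subseteq> {t \<in> W. word_sum chevalley_degree t = - q}"
        using b v keys_restrict[of b "- q"] P_D[OF v(1)] by (simp_all add: b'_def eval_restrict)
      have "keys (b' \<star> a) \<subseteq> {t \<in> W. word_sum chevalley_degree t = 0}"
        unfolding free_mult using a b' by (intro keys_bilin_ext) force
      moreover have "\<pi> b' \<in> carrier G" using b' by (auto simp: G_eq FQ.quotient_carrier)
      then have "\<pi> b' \<otimes>\<^bsub>G\<^esub> \<pi> a \<in> J" using ideal a by (auto simp: algebra_ideal_def)
      then have "\<pi> (b' \<star> a) \<in> J" using b' ac FQ.quotient_br[of b' a] by (simp add: G_eq)
      ultimately have "\<phi> (b' \<star> a) = \<zero>" by (rule torus)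
      then show False using v b' ac by (simp add: ev.mult)
    qed
    then show "Y \<in> K" using a ac by (simp add: pi_K)
  qed
  then have "LinearCombinations.module.span class_ring G (\<Union>q. J \<inter> tilde_component n par H h \<alpha> q) \<subseteq> K"
    using K_ideal by (intro span_subset) (auto simp: algebra_ideal_def)
  then show ?thesis using J by (simp add: tilde_graded_ideal_def)
qed

lemma max_graded_ideal_eq: "max_graded_ideal n par H h \<alpha> = K"
  unfolding max_graded_ideal_def
  by (rule Greatest_equality) (use graded_ideal_K K_torus graded_ideal_le_K in auto)

sublocale GQ: nonassoc_quotient_hom G M "quot_map \<phi>" K
  by (intro nonassoc_quotient_hom.intro nonassoc_ideal.intro G.nonassoc_hom_axioms
      nonassoc_ideal_axioms.intro nonassoc_quotient_hom_axioms.intro K_ideal G.L.nonassoc_algebra_axioms)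
     (simp add: K_def)

lemma contragredient_eq: "contragredient n par H h \<alpha> = quotient_superalgebra G K"
  by (simp add: contragredient_def max_graded_ideal_eq)

definition \<Phi> where "\<Phi> = quot_map (quot_map \<phi>)"

theorem contragredient_iso:
  "lie_superalgebra (contragredient n par H h \<alpha>)"
  "\<Phi> \<in> lie_superalgebra_iso (contragredient n par H h \<alpha>) M"
proof -
  have 1: "quot_map \<phi> ` carrier G = carrier M"
    using eval_onto by (auto simp: G_eq FQ.quotient_carrier image_image)
  have 2: "part G i \<subseteq> carrier G" for i
    using part_carrier_free by (auto simp: G_eq FQ.quotient_carrier FQ.quotient_part)
  have 3: "quot_map \<phi> ` part G i = part M i" for i
  proof -
    have "quot_map \<phi> ` part G i = \<phi> ` part F i"
      using part_carrier_free by (auto simp: G_eq FQ.quotient_part image_image intro!: image_cong)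
    then show ?thesis using eval_part_image by simp
  qed
  have 4: "Y \<in> K" if "Y \<in> carrier G" "quot_map \<phi> Y = \<zero>" for Y
    unfolding K_def using that by blast
  show "lie_superalgebra (contragredient n par H h \<alpha>)"
    unfolding contragredient_eq by (rule GQ.quot_map_iso(1)[OF M 1 4 2 3])
  show "\<Phi> \<in> lie_superalgebra_iso (contragredient n par H h \<alpha>) M"
    unfolding contragredient_eq \<Phi>_def by (rule GQ.quot_map_iso(2)[OF M 1 4 2 3])
qed

lemma contragredient_e:
  assumes "i < n"
  shows "contragredient_e n par H h \<alpha> i \<in> carrier (contragredient n par H h \<alpha>)"
    "\<Phi> (contragredient_e n par H h \<alpha> i) = e i"
proof -
  have E: "gen (GE i) \<in> carrier F" using assms by simp
  then have c: "\<pi> (gen (GE i)) \<in> carrier G" unfolding G_eq FQ.quotient_carrier by (rule imageI)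
  have eq: "contragredient_e n par H h \<alpha> i = K +>\<^bsub>G\<^esub> \<pi> (gen (GE i))"
    by (simp add: contragredient_e_def max_graded_ideal_eq to_tilde_eq)
  show "contragredient_e n par H h \<alpha> i \<in> carrier (contragredient n par H h \<alpha>)"
    unfolding contragredient_eq GQ.quotient_carrier eq by (rule imageI[OF c])
  show "\<Phi> (contragredient_e n par H h \<alpha> i) = e i"
    unfolding \<Phi>_def eq GQ.quot_map_coset[OF c] FQ.quot_map_coset[OF E] using assms by simp
qed

end

section \<open>Traces and negligible morphisms out of J_1 and J_2\<close>

lemma linear_form_finsum:
  assumes V: "vectorspace class_ring V" and l: "linear_form V l" and A: "finite A"
    and b: "\<And>i. i \<in> A \<Longrightarrow> b i \<in> carrier V"
  shows "l (\<Oplus>\<^bsub>V\<^esub>i\<in>A. c i \<odot>\<^bsub>V\<^esub> b i) = (\<Sum>i\<in>A. c i * l (b i))"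
proof -
  interpret vectorspace class_ring V by (rule V)
  have sc: "k \<odot>\<^bsub>V\<^esub> x \<in> carrier V" if "x \<in> carrier V" for k x
    using smult_closed[of k x] that by (simp add: class_ring_simps)
  have z: "l \<zero>\<^bsub>V\<^esub> = 0"
  proof -
    have "l (0 \<odot>\<^bsub>V\<^esub> \<zero>\<^bsub>V\<^esub>) = 0 * l \<zero>\<^bsub>V\<^esub>" using l zero_closed unfolding linear_form_def by blast
    then show ?thesis using smult_l_null[of "\<zero>\<^bsub>V\<^esub>"] by (simp add: class_ring_simps)
  qed
  show ?thesis
    using A b
  proof (induction A)
    case (insert i A)
    have "(\<lambda>i. c i \<odot>\<^bsub>V\<^esub> b i) \<in> A \<rightarrow> carrier V" using insert sc by auto
    moreover have "c i \<odot>\<^bsub>V\<^esub> b i \<in> carrier V" using insert sc by auto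
    ultimately show ?case
      using insert l by (simp add: finsum_insert linear_form_def)
  qed (simp add: z)
qed

lemma linear_form_comp:
  "linear_form V l \<Longrightarrow> f \<in> module_hom class_ring V V \<Longrightarrow> linear_form V (\<lambda>x. l (f x))"
  unfolding linear_form_def module_hom_iff by (auto simp: Pi_iff)

lemma dual_bases_expand:
  assumes V: "vectorspace class_ring V" and b: "dual_bases V n b \<phi>"
    and l: "linear_form V l" and x: "x \<in> carrier V"
  shows "l x = (\<Sum>i<n. \<phi> i x * l (b i))"
proof -
  have "l x = l (\<Oplus>\<^bsub>V\<^esub>i\<in>{..<n}. \<phi> i x \<odot>\<^bsub>V\<^esub> b i)"
    using b x by (auto simp: dual_bases_def)
  also have "\<dots> = (\<Sum>i<n. \<phi> i x * l (b i))"
    using b by (intro linear_form_finsum[OF V l]) (auto simp: dual_bases_def)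
  finally show ?thesis .
qed

text \<open>Expanding one basis in another and exchanging the sums shows that the value does not
  depend on the basis, which justifies the definite description in \<open>vs_trace\<close>.\<close>

lemma vs_trace_eq:
  assumes V: "vectorspace class_ring V" and b: "dual_bases V n b \<phi>"
    and f: "f \<in> module_hom class_ring V V"
  shows "vs_trace V f = (\<Sum>i<n. \<phi> i (f (b i)))"
  unfolding vs_trace_def
proof (rule the_equality)
  fix c assume "\<exists>m b' \<phi>'. dual_bases V m b' \<phi>' \<and> c = (\<Sum>i<m. \<phi>' i (f (b' i)))"
  then obtain m b' \<phi>' where b': "dual_bases V m b' \<phi>'" and c: "c = (\<Sum>j<m. \<phi>' j (f (b' j)))"
    by blast
  have f': "linear_form V (\<lambda>x. l (f x))" if "linear_form V l" for l
    by (rule linear_form_comp[OF that f])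
  have "c = (\<Sum>j<m. \<Sum>i<n. \<phi> i (b' j) * \<phi>' j (f (b i)))"
    unfolding c using b' by (intro sum.cong dual_bases_expand[OF V b f']) (auto simp: dual_bases_def)
  also have "\<dots> = (\<Sum>i<n. \<Sum>j<m. \<phi>' j (f (b i)) * \<phi> i (b' j))"
    by (subst sum.swap) (simp add: mult.commute)
  also have "\<dots> = (\<Sum>i<n. \<phi> i (f (b i)))"
    using b f
    by (intro sum.cong dual_bases_expand[OF V b', symmetric]) (auto simp: dual_bases_def module_hom_iff)
  finally show "c = (\<Sum>i<n. \<phi> i (f (b i)))" .
qed (use b in blast)

text \<open>A composite through J_1 or J_2 is a sum of at most two maps of the form x to l(x) w,
  each contributing l(w) to the trace.\<close>

lemma vs_trace_rank2:
  assumes V: "vectorspace class_ring V" and b: "dual_bases V n b \<phi>"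
    and l: "linear_form V l" "linear_form V l'" and w: "w \<in> carrier V" "w' \<in> carrier V"
    and f: "\<And>x. x \<in> carrier V \<Longrightarrow> f x = (l x \<odot>\<^bsub>V\<^esub> w) \<oplus>\<^bsub>V\<^esub> (l' x \<odot>\<^bsub>V\<^esub> w')"
  shows "vs_trace V f = l w + l' w'"
proof -
  interpret vectorspace class_ring V by (rule V)
  have sc: "k \<odot>\<^bsub>V\<^esub> x \<in> carrier V" if "x \<in> carrier V" for k x
    using smult_closed[of k x] that by (simp add: class_ring_simps)
  have sl: "(k + k') \<odot>\<^bsub>V\<^esub> x = (k \<odot>\<^bsub>V\<^esub> x) \<oplus>\<^bsub>V\<^esub> (k' \<odot>\<^bsub>V\<^esub> x)" if "x \<in> carrier V" for k k' x
    using smult_l_distr[of k k' x] that by (simp add: class_ring_simps)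
  have sr: "k \<odot>\<^bsub>V\<^esub> (x \<oplus>\<^bsub>V\<^esub> y) = (k \<odot>\<^bsub>V\<^esub> x) \<oplus>\<^bsub>V\<^esub> (k \<odot>\<^bsub>V\<^esub> y)"
    if "x \<in> carrier V" "y \<in> carrier V" for k x y
    using smult_r_distr[of k x y] that by (simp add: class_ring_simps)
  have ss: "k \<odot>\<^bsub>V\<^esub> (k' \<odot>\<^bsub>V\<^esub> x) = (k * k') \<odot>\<^bsub>V\<^esub> x" if "x \<in> carrier V" for k k' x
    using smult_assoc1[of k k' x] that by (simp add: class_ring_simps)
  have "f \<in> module_hom class_ring V V"
    unfolding module_hom_iff using l w
    by (auto simp: f sc sl sr ss linear_form_def a_ac)
  then have "vs_trace V f = (\<Sum>i<n. \<phi> i (f (b i)))" by (rule vs_trace_eq[OF V b])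
  also have "\<dots> = (\<Sum>i<n. \<phi> i w * l (b i)) + (\<Sum>i<n. \<phi> i w' * l' (b i))"
    unfolding sum.distrib[symmetric] using b w
    by (intro sum.cong) (auto simp: dual_bases_def f linear_form_def sc)
  also have "\<dots> = l w + l' w'"
    using dual_bases_expand[OF V b l(1) w(1)] dual_bases_expand[OF V b l(2) w(2)] by simp
  finally show ?thesis .
qed

text \<open>Negligibility can be tested on linear forms: a morphism from \<open>V\<close> to \<open>J_n\<close> is determined by its
  last coordinate, a form vanishing on the image of \<open>t^n\<close>.\<close>

lemma negligible_space_1:
  fixes V :: "('k :: field, 'a, 'm) module_scheme"
  assumes V: "vectorspace class_ring V" and b: "dual_bases V n b \<phi>"
    and t: "t \<in> module_hom class_ring V V"
  shows "x \<in> negligible_space V t 1 \<longleftrightarrow> x \<in> carrier V \<and> t x = \<zero>\<^bsub>V\<^esub> \<and>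
    (\<forall>l. linear_form V l \<longrightarrow> (\<forall>y\<in>carrier V. l (t y) = 0) \<longrightarrow> l x = 0)"
proof -
  interpret vectorspace class_ring V by (rule V)
  have sc: "k \<odot>\<^bsub>V\<^esub> x \<in> carrier V" if "x \<in> carrier V" for k x
    using smult_closed[of k x] that by (simp add: class_ring_simps)
  have lz: "linear_form V (\<lambda>x. 0)" by (simp add: linear_form_def)
  have z0: "0 \<odot>\<^bsub>V\<^esub> x = \<zero>\<^bsub>V\<^esub>" if "x \<in> carrier V" for x
    using smult_l_null that by (simp add: class_ring_simps)
  define J where "J = module_vec TYPE('k) 1"
  define u where "u = jordan_hom V t 1 x"
  have set1: "{..<1 :: nat} = {0}" by auto
  have u: "u c = c $ 0 \<odot>\<^bsub>V\<^esub> x" if "x \<in> carrier V" for c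
    unfolding u_def jordan_hom_def set1 using that sc by (subst finsum_insert) auto
  have "negligible J (jordan_shift 1) V t u \<longleftrightarrow>
      (\<forall>l. linear_form V l \<longrightarrow> (\<forall>y\<in>carrier V. l (t y) = 0) \<longrightarrow> l x = 0)" if x: "x \<in> carrier V"
  proof
    assume neg: "negligible J (jordan_shift 1) V t u"
    show "\<forall>l. linear_form V l \<longrightarrow> (\<forall>y\<in>carrier V. l (t y) = 0) \<longrightarrow> l x = 0"
    proof (intro allI impI)
      fix l assume l: "linear_form V l" "\<forall>y\<in>carrier V. l (t y) = 0"
      \<comment> \<open>A form vanishing on the image of t is the same thing as a morphism to J_1,
        on which t acts by zero.\<close>
      define v where "v y = vec 1 (\<lambda>i. l y)" for y
      have "v \<in> alpha3_hom V t J (jordan_shift 1)"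
        using l unfolding alpha3_hom_def module_hom_iff
        by (auto simp: J_def module_vec_simps v_def linear_form_def jordan_shift_def intro!: eq_vecI)
      then have "vs_trace V (u \<circ> v) = 0" using neg by (simp add: negligible_def)
      \<comment> \<open>The formula for rank two is applied with the zero form in the second
        place.\<close>
      moreover have "vs_trace V (u \<circ> v) = l x + 0"
        by (rule vs_trace_rank2[OF V b l(1) lz x x]) (simp add: u[OF x] v_def sc x z0)
      ultimately show "l x = 0" by simp
    qed
  next
    assume forms: "\<forall>l. linear_form V l \<longrightarrow> (\<forall>y\<in>carrier V. l (t y) = 0) \<longrightarrow> l x = 0"
    show "negligible J (jordan_shift 1) V t u"
      unfolding negligible_def
    proof
      fix v assume v: "v \<in> alpha3_hom V t J (jordan_shift 1)"
      define l where "l y = v y $ 0" for y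
      have vc: "dim_vec (v y) = 1" if "y \<in> carrier V" for y
        using v that by (auto simp: alpha3_hom_def module_hom_iff J_def module_vec_simps Pi_iff)
      have l: "linear_form V l"
        using v unfolding alpha3_hom_def module_hom_iff linear_form_def
        by (auto simp: J_def module_vec_simps l_def vc)
      moreover have "l (t y) = 0" if "y \<in> carrier V" for y
        using v that by (auto simp: alpha3_hom_def l_def jordan_shift_def)
      ultimately have "l x = 0" using forms by blast
      moreover have "vs_trace V (u \<circ> v) = l x + 0"
        by (rule vs_trace_rank2[OF V b l lz x x]) (simp add: u[OF x] l_def sc x z0)
      ultimately show "vs_trace V (u \<circ> v) = 0" by simp
    qed
  qed
  then show ?thesis
    by (auto simp: negligible_space_def hom_space_def J_def u_def)
qed

text \<open>A morphism from V to J_2 is given by its second coordinate l, a form vanishing on the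
  image of t^2; compatibility with the shift forces the first coordinate to be l composed with t.
  Both coordinates contribute l (t x) to the trace, so 2 has to be invertible.\<close>

lemma negligible_space_2:
  fixes V :: "('k :: field, 'a, 'm) module_scheme"
  assumes V: "vectorspace class_ring V" and b: "dual_bases V n b \<phi>"
    and t: "t \<in> module_hom class_ring V V" and two: "(2 :: 'k) \<noteq> 0"
  shows "x \<in> negligible_space V t 2 \<longleftrightarrow> x \<in> carrier V \<and> t (t x) = \<zero>\<^bsub>V\<^esub> \<and>
    (\<forall>l. linear_form V l \<longrightarrow> (\<forall>y\<in>carrier V. l (t (t y)) = 0) \<longrightarrow> l (t x) = 0)"
proof -
  interpret vectorspace class_ring V by (rule V)
  have sc: "k \<odot>\<^bsub>V\<^esub> x \<in> carrier V" if "x \<in> carrier V" for k x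
    using smult_closed[of k x] that by (simp add: class_ring_simps)
  have tc: "t x \<in> carrier V" if "x \<in> carrier V" for x
    using t that by (auto simp: module_hom_iff)
  define J where "J = module_vec TYPE('k) 2"
  define u where "u = jordan_hom V t 2 x"
  have set2: "{..<2 :: nat} = {0, 1}" by auto
  have u: "u c = (c $ 0 \<odot>\<^bsub>V\<^esub> x) \<oplus>\<^bsub>V\<^esub> (c $ 1 \<odot>\<^bsub>V\<^esub> t x)" if "x \<in> carrier V" for c
    unfolding u_def jordan_hom_def set2 using that sc tc by (subst finsum_insert) auto
  have lt: "linear_form V (\<lambda>y. l (t y))" if "linear_form V l" for l
    by (rule linear_form_comp[OF that t])
  have "negligible J (jordan_shift 2) V t u \<longleftrightarrow>
      (\<forall>l. linear_form V l \<longrightarrow> (\<forall>y\<in>carrier V. l (t (t y)) = 0) \<longrightarrow> l (t x) = 0)" if x: "x \<in> carrier V"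
  proof
    assume neg: "negligible J (jordan_shift 2) V t u"
    show "\<forall>l. linear_form V l \<longrightarrow> (\<forall>y\<in>carrier V. l (t (t y)) = 0) \<longrightarrow> l (t x) = 0"
    proof (intro allI impI)
      fix l assume l: "linear_form V l" "\<forall>y\<in>carrier V. l (t (t y)) = 0"
      define v where "v y = vec 2 (\<lambda>i. if i = 0 then l (t y) else l y)" for y
      have lin: "l (x \<oplus>\<^bsub>V\<^esub> y) = l x + l y" "l (k \<odot>\<^bsub>V\<^esub> x) = k * l x"
        "l (t (x \<oplus>\<^bsub>V\<^esub> y)) = l (t x) + l (t y)" "l (t (k \<odot>\<^bsub>V\<^esub> x)) = k * l (t x)"
        if "x \<in> carrier V" "y \<in> carrier V" for x y k
        using l(1) lt[OF l(1)] that by (simp_all add: linear_form_def)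
      have "v \<in> alpha3_hom V t J (jordan_shift 2)"
        using l(2) unfolding alpha3_hom_def module_hom_iff
        by (simp add: J_def module_vec_simps) (auto simp: v_def lin jordan_shift_def intro!: eq_vecI)
      then have "vs_trace V (u \<circ> v) = 0" using neg by (simp add: negligible_def)
      moreover have "vs_trace V (u \<circ> v) = l (t x) + l (t x)"
        by (rule vs_trace_rank2[OF V b lt[OF l(1)] l(1) x tc[OF x]]) (simp add: u[OF x] v_def)
      ultimately have "2 * l (t x) = 0" by simp
      then show "l (t x) = 0" using two by simp
    qed
  next
    assume forms: "\<forall>l. linear_form V l \<longrightarrow> (\<forall>y\<in>carrier V. l (t (t y)) = 0) \<longrightarrow> l (t x) = 0"
    show "negligible J (jordan_shift 2) V t u"
      unfolding negligible_def
    proof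
      fix v assume v: "v \<in> alpha3_hom V t J (jordan_shift 2)"
      define l where "l y = v y $ 1" for y
      have vc: "dim_vec (v y) = 2" if "y \<in> carrier V" for y
        using v that by (auto simp: alpha3_hom_def module_hom_iff J_def module_vec_simps Pi_iff)
      have l: "linear_form V l"
        using v unfolding alpha3_hom_def module_hom_iff linear_form_def
        by (auto simp: J_def module_vec_simps l_def vc)
      have vt: "v (t y) = jordan_shift 2 (v y)" if "y \<in> carrier V" for y
        using v that by (auto simp: alpha3_hom_def)
      have v0: "v y $ 0 = l (t y)" if "y \<in> carrier V" for y
        using vt[OF that] by (simp add: l_def jordan_shift_def)
      have "l (t (t y)) = 0" if "y \<in> carrier V" for y
        using v0[OF tc[OF that]] vt[OF that] by (simp add: jordan_shift_def)
      with l forms have "l (t x) = 0" by blast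
      moreover have "vs_trace V (u \<circ> v) = l (t x) + l (t x)"
        by (rule vs_trace_rank2[OF V b lt[OF l] l x tc[OF x]]) (simp add: u[OF x] v0 l_def)
      ultimately show "vs_trace V (u \<circ> v) = 0" by simp
    qed
  qed
  then show ?thesis
    by (auto simp: negligible_space_def hom_space_def J_def u_def numeral_2_eq_2)
qed

subsection \<open>The Lie algebra of a positive definite even lattice\<close>

datatype 'q lattice_index = T nat | R 'q

text \<open>The data of the Frenkel-Kac construction. The sign \<open>sg\<close> is
  bimultiplicative, its commutator is the parity of \<open>ip\<close>, and it is -1 on a root paired
  with itself; \<open>cf\<close> gives coordinates with respect to the simple roots
  \<open>al\<close>.\<close>

locale even_lattice =
  fixes n :: nat and ip :: "'q :: ab_group_add \<Rightarrow> 'q \<Rightarrow> int" and sg :: "'q \<Rightarrow> 'q \<Rightarrow> int"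
    and al :: "nat \<Rightarrow> 'q" and cf :: "'q \<Rightarrow> nat \<Rightarrow> int"
  assumes ip_add: "ip (x + y) z = ip x z + ip y z" and ip_commute: "ip x y = ip y x"
    and ip_pos: "x \<noteq> 0 \<Longrightarrow> ip x x > 0"
    and sg_add_left: "sg (x + y) z = sg x z * sg y z" and sg_add_right: "sg z (x + y) = sg z x * sg z y"
    and sg_sq: "sg x y * sg x y = 1"
    and sg_self: "ip x x = 2 \<Longrightarrow> sg x x = - 1"
    and sg_swap: "sg x y * sg y x = (if even (ip x y) then 1 else - 1)"
    and cf_add: "cf (x + y) i = cf x i + cf y i"
    and cf_al: "i < n \<Longrightarrow> j < n \<Longrightarrow> cf (al i) j = (if i = j then 1 else 0)"
    and ip_cf: "ip x y = (\<Sum>i<n. cf x i * ip (al i) y)"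
    and al_root: "i < n \<Longrightarrow> ip (al i) (al i) = 2"
    and al_nonpos: "i < n \<Longrightarrow> j < n \<Longrightarrow> i \<noteq> j \<Longrightarrow> ip (al i) (al j) \<le> 0"
begin

abbreviation "\<Delta> \<equiv> {x. ip x x = 2}"

lemma ip_zero [simp]: "ip 0 z = 0" "ip z 0 = 0"
  using ip_add[of 0 0 z] ip_commute by auto

lemma ip_add_right: "ip z (x + y) = ip z x + ip z y"
  using ip_add ip_commute by metis

lemma ip_minus [simp]: "ip (- x) z = - ip x z" "ip z (- x) = - ip z x"
  using ip_add[of x "- x" z] ip_add_right[of z x "- x"] by auto

lemma ip_diff: "ip (x - y) z = ip x z - ip y z" "ip z (x - y) = ip z x - ip z y"
  using ip_add[of x "- y" z] ip_add_right[of z x "- y"] by auto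

lemma sg_zero [simp]: "sg 0 z = 1" "sg z 0 = 1"
  using sg_add_left[of 0 0 z] sg_add_right[of z 0 0] sg_sq[of 0 z] sg_sq[of z 0] by auto

lemma sg_minus [simp]: "sg (- x) z = sg x z" "sg z (- x) = sg z x"
proof -
  have "sg x z * sg x z * sg (- x) z = sg x z * 1" using sg_add_left[of x "- x" z] by (simp add: mult.assoc)
  then show "sg (- x) z = sg x z" by (simp add: sg_sq)
  have "sg z x * sg z x * sg z (- x) = sg z x * 1" using sg_add_right[of z x "- x"] by (simp add: mult.assoc)
  then show "sg z (- x) = sg z x" by (simp add: sg_sq)
qed

lemma sg_cases: "sg x y = 1 \<or> sg x y = - 1"
  using sg_sq[of x y] by (auto simp: zmult_eq_1_iff)

lemma cf_zero [simp]: "cf 0 i = 0"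
  using cf_add[of 0 0 i] by simp

lemma cf_minus [simp]: "cf (- x) i = - cf x i"
  using cf_add[of x "- x" i] by simp

lemma cf_diff: "cf (x - y) i = cf x i - cf y i"
  using cf_add[of x "- y" i] by simp

text \<open>The lengths of x + y and x - y are 4 + 2 (x, y) and 4 - 2 (x, y). Their positivity
  yields the Cauchy-Schwarz bound together with its equality cases.\<close>

lemma root_sum: assumes "ip x x = 2" "ip y y = 2"
  shows "ip (x + y) (x + y) = 2 \<longleftrightarrow> ip x y = - 1" "x + y = 0 \<longleftrightarrow> ip x y = - 2" "x = y \<longleftrightarrow> ip x y = 2"
    "\<bar>ip x y\<bar> \<le> 2"
proof -
  have s: "ip (x + y) (x + y) = 4 + 2 * ip x y" and d: "ip (x - y) (x - y) = 4 - 2 * ip x y"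
    using assms by (simp_all add: ip_add ip_add_right ip_diff ip_commute[of y x])
  show "ip (x + y) (x + y) = 2 \<longleftrightarrow> ip x y = - 1" using s by auto
  show "x + y = 0 \<longleftrightarrow> ip x y = - 2" using s ip_pos[of "x + y"] by fastforce
  show "x = y \<longleftrightarrow> ip x y = 2" using d ip_pos[of "x - y"] assms by fastforce
  have "ip z z \<ge> 0" for z using ip_pos[of z] by (cases "z = 0") auto
  from this[of "x + y"] this[of "x - y"] show "\<bar>ip x y\<bar> \<le> 2" using s d by linarith
qed

definition hv :: "'q \<Rightarrow> 'q lattice_index \<Rightarrow>\<^sub>0 'k :: field" where
  "hv a = (\<Sum>i<n. single (T i) (of_int (cf a i)))"

text \<open>The Frenkel-Kac bracket on basis vectors. As \<open>sg a (- a) = sg a a = - 1\<close>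
  for a root, opposite roots bracket to \<open>- hv a\<close>, which is the source of the minus sign
  in the lowering generators below. Indices outside the basis bracket to 0, which makes the bilinear
  extension total.\<close>

fun br :: "'q lattice_index \<Rightarrow> 'q lattice_index \<Rightarrow> ('q lattice_index \<Rightarrow>\<^sub>0 'k :: field)" where
  "br (T i) (T j) = 0"
| "br (T i) (R b) = (if i < n \<and> b \<in> \<Delta> then single (R b) (of_int (ip (al i) b)) else 0)"
| "br (R b) (T i) = (if i < n \<and> b \<in> \<Delta> then single (R b) (- of_int (ip (al i) b)) else 0)"
| "br (R a) (R b) = (if a \<in> \<Delta> \<and> b \<in> \<Delta> then
     if a + b \<in> \<Delta> then single (R (a + b)) (of_int (sg a b))
     else if a + b = 0 then of_int (sg a b) *\<^sub>p hv a else 0 else 0)"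

abbreviation bk :: "('q lattice_index \<Rightarrow>\<^sub>0 'k :: field) \<Rightarrow> ('q lattice_index \<Rightarrow>\<^sub>0 'k) \<Rightarrow> ('q lattice_index \<Rightarrow>\<^sub>0 'k)" where
  "bk \<equiv> bilin_ext br"

lemma hv_add: "hv (a + b) = hv a + hv b"
  by (simp add: hv_def cf_add single_add sum.distrib)

lemma hv_minus: "hv (- a) = - hv a"
  by (simp add: hv_def single_uminus sum_negf)

lemma hv_zero [simp]: "hv 0 = 0"
  by (simp add: hv_def)

lemma bk_sum_left: "bk (\<Sum>i\<in>A. x i) y = (\<Sum>i\<in>A. bk (x i) y)"
  by (induction A rule: infinite_finite_induct) (auto simp: bilin_ext_linear)

lemma bk_hv: "bk (hv a) (single (R b) c) = (if b \<in> \<Delta> then single (R b) (of_int (ip a b) * c) else 0)"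
proof -
  have "bk (hv a) (single (R b) c) =
      (\<Sum>i<n. if b \<in> \<Delta> then single (R b) (of_int (cf a i * ip (al i) b) * c) else 0)"
    unfolding hv_def bk_sum_left by (rule sum.cong) (auto simp: mult_ac)
  also have "\<dots> = (if b \<in> \<Delta> then single (R b) (of_int (ip a b) * c) else 0)"
  proof -
    have "(\<Sum>i<n. single (R b) (of_int (cf a i * ip (al i) b) * c)) = single (R b) (of_int (ip a b) * c)"
      by (rule poly_mapping_eqI)
         (auto simp: lookup_sum lookup_single when_def ip_cf[of a b] sum_distrib_right)
    then show ?thesis by simp
  qed
  finally show ?thesis .
qed

lemma br_skew: "br s t = - br t s"
proof (cases s; cases t)
  fix a b assume st: "s = R a" "t = R b"
  consider "ip a a \<noteq> 2 \<or> ip b b \<noteq> 2" | "ip a a = 2" "ip b b = 2" "ip a b = - 1"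
    | "ip a a = 2" "ip b b = 2" "ip a b = - 2" | "ip a a = 2" "ip b b = 2" "ip a b \<noteq> - 1" "ip a b \<noteq> - 2"
    by blast
  then show ?thesis
  proof cases
    case 2
    then have "sg a b = - sg b a"
      using sg_swap[of a b] sg_cases[of a b] sg_cases[of b a] by auto
    moreover have "ip b a = - 1" using 2 ip_commute by metis
    ultimately show ?thesis using st 2 root_sum(1)[of a b] root_sum(1)[of b a]
      by (simp add: add.commute single_uminus)
  next
    case 3
    then have "b = - a" using root_sum(2)[of a b] by (simp add: eq_neg_iff_add_eq_0 add.commute)
    then show ?thesis using st 3 by (simp add: hv_minus)
  next
    case 4
    then show ?thesis using st root_sum[of a b] root_sum[of b a] ip_commute[of a b] by simp
  qed (use st in auto)
qed (auto simp: single_uminus)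

lemma bk_skew: "bk x y = - bk y x"
proof -
  have 1: "bk (single s c) y = - bk y (single s c)" for s c
    using subset_UNIV[of "keys y"]
    by (induction y rule: pm_induct) (auto simp: bilin_ext_linear br_skew[of s] mult.commute)
  show ?thesis
    using subset_UNIV[of "keys x"]
    by (induction x rule: pm_induct) (auto simp: bilin_ext_linear 1)
qed

definition rt :: "'q \<Rightarrow> 'q lattice_index \<Rightarrow>\<^sub>0 'k :: field" where "rt a = single (R a) 1"

lemma single_R: "single (R a) c = c *\<^sub>p rt a"
  by (simp add: rt_def)

lemma bk_rt: "ip a a = 2 \<Longrightarrow> ip b b = 2 \<Longrightarrow> bk (rt a) (rt b) =
    (if ip a b = - 1 then of_int (sg a b) *\<^sub>p rt (a + b) else if ip a b = - 2 then - hv a else 0)"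
proof -
  assume r: "ip a a = 2" "ip b b = 2"
  have "sg a b = - 1" if "a + b = 0"
  proof -
    have "b = - a" using that by (simp add: eq_neg_iff_add_eq_0 add.commute)
    then show ?thesis using sg_self[of a] r by simp
  qed
  then show ?thesis using root_sum[of a b] r by (auto simp: rt_def)
qed

lemma bk_hv_rt: "bk (hv a) (rt b) = (if ip b b = 2 then of_int (ip a b) *\<^sub>p rt b else 0)"
  by (simp add: rt_def bk_hv)

lemma bk_rt_hv: "ip a a = 2 \<Longrightarrow> bk (rt a) (hv b) = - (of_int (ip b a) *\<^sub>p rt a)"
  using bk_skew[of "rt a" "hv b"] by (simp add: bk_hv_rt)

lemmas bk_rules = bk_rt bk_hv_rt bk_rt_hv bilin_ext_linear

text \<open>One term passes through the torus and is (a, b) times the vector of a. For pairing 1 or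
  -1 exactly one other term survives and cancels it, the product of its two signs being determined
  by bimultiplicativity. For pairing 2 or -2 the roots lie on one line.\<close>

lemma jacobi_opposite:
  assumes "ip a a = 2" "ip b b = 2"
  shows "bk (rt a) (bk (rt b) (rt (- b))) + bk (rt b) (bk (rt (- b)) (rt a)) +
    bk (rt (- b)) (bk (rt a) (rt b)) = (0 :: 'q lattice_index \<Rightarrow>\<^sub>0 'k :: field)"
proof -
  have s: "ip b a = ip a b" by (rule ip_commute)
  have 1: "bk (rt a) (bk (rt b) (rt (- b))) = (of_int (ip a b) *\<^sub>p rt a :: 'q lattice_index \<Rightarrow>\<^sub>0 'k)"
    using assms s by (simp add: bk_rules)
  have "ip a b = - 2 \<or> ip a b = - 1 \<or> ip a b = 0 \<or> ip a b = 1 \<or> ip a b = 2"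
    using root_sum(4)[OF assms] by linarith
  then consider "ip a b = - 2" "a = - b" | "ip a b = - 1" | "ip a b = 0" | "ip a b = 1" | "ip a b = 2" "a = b"
    using root_sum(2,3)[OF assms] eq_neg_iff_add_eq_0[of a b] by fastforce
  then show ?thesis
  proof cases
    case 1
    then show ?thesis using assms by (simp add: bk_rules hv_minus)
  next
    case 2
    have sw: "sg a b * sg b a = - 1" using sg_swap[of a b] 2 by simp
    have sg: "sg a b * sg b (a + b) = 1"
      using sw sg_self[of b] assms by (simp add: sg_add_right flip: mult.assoc)
    have "ip (a + b) (a + b) = 2" using 2 root_sum(1)[OF assms] by simp
    moreover have "ip b (a + b) = 1" using 2 assms s by (simp add: ip_add_right)
    ultimately have "bk (rt (- b)) (bk (rt a) (rt b)) = (of_int (sg a b * sg b (a + b)) *\<^sub>p rt a :: 'q lattice_index \<Rightarrow>\<^sub>0 'k)"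
      using assms 2 by (simp add: bk_rules)
    moreover have "bk (rt b) (bk (rt (- b)) (rt a)) = (0 :: 'q lattice_index \<Rightarrow>\<^sub>0 'k)"
      using assms 2 s by (simp add: bk_rules)
    ultimately show ?thesis unfolding 1 sg using 2 by simp
  next
    case 3
    then show ?thesis using assms s by (simp add: bk_rules)
  next
    case 4
    have "sg b (a - b) = sg b a * sg b b" using sg_add_right[of b a "- b"] by simp
    then have sg: "sg b a * sg b (a - b) = - 1"
      using sg_sq[of b a] sg_self[of b] assms by (simp flip: mult.assoc)
    have "ip (a - b) (a - b) = 2" "ip b (a - b) = - 1" using 4 assms s by (simp_all add: ip_diff)
    then have "bk (rt b) (bk (rt (- b)) (rt a)) = (of_int (sg b a * sg b (a - b)) *\<^sub>p rt a :: 'q lattice_index \<Rightarrow>\<^sub>0 'k)"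
      using assms 4 s by (simp add: bk_rules)
    moreover have "bk (rt (- b)) (bk (rt a) (rt b)) = (0 :: 'q lattice_index \<Rightarrow>\<^sub>0 'k)"
      using assms 4 s by (simp add: bk_rules)
    ultimately show ?thesis unfolding 1 sg using 4 by simp
  next
    case 5
    then show ?thesis using assms by (simp add: bk_rules hv_minus)
  qed
qed

text \<open>Two terms land in the root space of a + b + c. They cancel because \<open>sg\<close>
  anticommutes on a, b, whose pairing is odd, and commutes on the orthogonal pair b, c.\<close>

lemma jacobi_orthogonal:
  assumes r: "ip a a = 2" "ip b b = 2" "ip c c = 2" and i: "ip b c = 0" "ip a b = - 1" "ip a c = - 1"
  shows "bk (rt a) (bk (rt b) (rt c)) + bk (rt b) (bk (rt c) (rt a)) +
    bk (rt c) (bk (rt a) (rt b)) = (0 :: 'q lattice_index \<Rightarrow>\<^sub>0 'k :: field)"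
proof -
  have s: "ip b a = - 1" "ip c a = - 1" "ip c b = 0" using i ip_commute by metis+
  have ab: "ip (a + b) (a + b) = 2" "ip c (a + b) = - 1" and ca: "ip (c + a) (c + a) = 2" "ip b (c + a) = - 1"
    using r i s by (simp_all add: ip_add ip_add_right)
  have sg: "sg c a * sg b (c + a) + sg a b * sg c (a + b) = 0"
    using sg_swap[of a b] sg_swap[of b c] i sg_cases[of a b] sg_cases[of b a] sg_cases[of b c] sg_cases[of c b]
    by (auto simp: sg_add_right)
  have "bk (rt b) (bk (rt c) (rt a)) = (of_int (sg c a * sg b (c + a)) *\<^sub>p rt (a + b + c) :: 'q lattice_index \<Rightarrow>\<^sub>0 'k)"
    using r i s ca by (simp add: bk_rules add_ac)
  moreover have "bk (rt c) (bk (rt a) (rt b)) = (of_int (sg a b * sg c (a + b)) *\<^sub>p rt (a + b + c) :: 'q lattice_index \<Rightarrow>\<^sub>0 'k)"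
    using r i s ab by (simp add: bk_rules add_ac)
  moreover have "bk (rt a) (bk (rt b) (rt c)) = (0 :: 'q lattice_index \<Rightarrow>\<^sub>0 'k)"
    using r i s by (simp add: bk_rules)
  ultimately show ?thesis
    using sg by (simp add: add_eq_0_iff2 flip: pm.scale_left_distrib of_int_add of_int_mult)
qed

text \<open>The sum of the pairings determines the length of a + b + c. Without an opposite pair, a
  nonzero term forces a + b + c to be zero or a root. In the root case the pairings add up to -2,
  and without the values 2 and -2 this means that two of them are -1 and one is 0, the case of
  \<open>jacobi_orthogonal\<close> up to rotation.\<close>

lemma jacobi_roots:
  assumes r: "ip a a = 2" "ip b b = 2" "ip c c = 2"
  shows "bk (rt a) (bk (rt b) (rt c)) + bk (rt b) (bk (rt c) (rt a)) +
    bk (rt c) (bk (rt a) (rt b)) = (0 :: 'q lattice_index \<Rightarrow>\<^sub>0 'k :: field)"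
proof -
  have s: "ip b a = ip a b" "ip c a = ip a c" "ip c b = ip b c" using ip_commute by metis+
  have S: "ip (a + b + c) (a + b + c) = 6 + 2 * (ip a b + ip b c + ip a c)"
    using r s by (simp add: ip_add ip_add_right)
  have le: "\<bar>ip a b\<bar> \<le> 2" "\<bar>ip b c\<bar> \<le> 2" "\<bar>ip a c\<bar> \<le> 2" using root_sum(4) r by blast+
  have eq: "b = c" if "ip b c = 2" using that root_sum(3) r by blast
  have eq': "a = b" if "ip a b = 2" using that root_sum(3) r by blast
  have eq'': "a = c" if "ip a c = 2" using that root_sum(3) r by blast
  consider (ab) "ip a b = - 2" | (bc) "ip b c = - 2" | (ac) "ip a c = - 2"
    | (none) "ip a b \<noteq> - 2" "ip b c \<noteq> - 2" "ip a c \<noteq> - 2" by blast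
  then show ?thesis
  proof cases
    case ab
    then have "b = - a" using root_sum(2)[of a b] r by (simp add: eq_neg_iff_add_eq_0 add.commute)
    then show ?thesis using jacobi_opposite[OF r(3,1), where ?'k = 'k] by (simp add: add_ac)
  next
    case bc
    then have "c = - b" using root_sum(2)[of b c] r by (simp add: eq_neg_iff_add_eq_0 add.commute)
    then show ?thesis using jacobi_opposite[OF r(1,2), where ?'k = 'k] by simp
  next
    case ac
    then have "a = - c" using root_sum(2)[of a c] r by (simp add: eq_neg_iff_add_eq_0 add.commute)
    then show ?thesis using jacobi_opposite[OF r(2,3), where ?'k = 'k] by (simp add: add_ac)
  next
    case none
    have nz: "a + b \<noteq> 0" "b + c \<noteq> 0" "c + a \<noteq> 0"
      using none root_sum(2)[of a b] root_sum(2)[of b c] root_sum(2)[of c a] r s by auto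
    consider (zero) "a + b + c = 0" | (root) "ip (a + b + c) (a + b + c) = 2"
      | (other) "a + b + c \<noteq> 0" "ip (a + b + c) (a + b + c) \<noteq> 2" by blast
    then show ?thesis
    proof cases
      case zero
      have iz: "ip z a + ip z b + ip z c = 0" for z using zero ip_add_right[of z] by (metis ip_zero(2))
      have i: "ip a b = - 1" "ip b c = - 1" "ip c a = - 1"
        using iz[of a] iz[of b] iz[of c] r s by linarith+
      have sum: "b + c = - a" "c + a = - b" "a + b = - c"
        using zero by (simp_all add: eq_neg_iff_add_eq_0 add_ac)
      \<comment> \<open>Bimultiplicativity applied to the zero vector makes the signs around the
        triangle equal.\<close>
      have "sg b (a + b + c) = 1" "sg (a + b + c) a = 1" using zero by simp_all
      then have "sg b a * sg b b * sg b c = 1" "sg a a * sg b a * sg c a = 1"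
        by (simp_all only: sg_add_left sg_add_right)
      then have sg: "sg b c = sg a b" "sg c a = sg a b"
        using sg_swap[of a b] i sg_self[of a] sg_self[of b] r sg_cases[of a b] sg_cases[of b a] by auto
      have n: "bk (rt x) (bk (rt y) (rt z)) = (- (of_int (sg a b) *\<^sub>p hv x) :: 'q lattice_index \<Rightarrow>\<^sub>0 'k)"
        if "ip x x = 2" "ip y y = 2" "ip z z = 2" "ip y z = - 1" "y + z = - x" "sg y z = sg a b" for x y z
        using that by (simp add: bk_rules)
      have "hv a + hv b + hv c = (0 :: 'q lattice_index \<Rightarrow>\<^sub>0 'k)"
        using zero by (simp flip: hv_add)
      then have "of_int (sg a b) *\<^sub>p (hv a + hv b + hv c) = (0 :: 'q lattice_index \<Rightarrow>\<^sub>0 'k)" by simp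
      then have "- (of_int (sg a b) *\<^sub>p hv a + of_int (sg a b) *\<^sub>p hv b + of_int (sg a b) *\<^sub>p hv c) =
          (0 :: 'q lattice_index \<Rightarrow>\<^sub>0 'k)"
        by (simp add: pm.scale_right_distrib)
      then show ?thesis
        unfolding n[OF r i(2) sum(1) sg(1)] n[OF r(2,3,1) i(3) sum(2) sg(2)] n[OF r(3,1,2) i(1) sum(3) refl]
        by (simp only: minus_add_distrib)
    next
      case root
      then have sum: "ip a b + ip b c + ip a c = - 2" using S by simp
      \<comment> \<open>If two of the roots agree, the total -2 makes their common pairing with the
        third root equal to -2, which is excluded.\<close>
      have "ip a b \<noteq> 2"
        using sum eq' none by auto
      moreover have "ip b c \<noteq> 2"
        using sum eq none by auto
      moreover have "ip a c \<noteq> 2"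
        using sum eq'' none s by auto
      moreover have "x = - 1 \<or> x = 0 \<or> x = 1" if "\<bar>x\<bar> \<le> 2" "x \<noteq> 2" "x \<noteq> - 2" for x :: int
        using that by arith
      ultimately have "ip a b = - 1 \<or> ip a b = 0 \<or> ip a b = 1" "ip b c = - 1 \<or> ip b c = 0 \<or> ip b c = 1"
        "ip a c = - 1 \<or> ip a c = 0 \<or> ip a c = 1"
        using none le by blast+
      then consider "ip b c = 0" "ip a b = - 1" "ip a c = - 1" | "ip a c = 0" "ip a b = - 1" "ip b c = - 1"
        | "ip a b = 0" "ip a c = - 1" "ip b c = - 1"
        using sum by (elim disjE) simp_all
      then show ?thesis
      proof cases
        case 1
        then show ?thesis using jacobi_orthogonal[of a b c, where ?'k = 'k] r by simp
      next
        case 2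
        then show ?thesis using jacobi_orthogonal[of b c a, where ?'k = 'k] r s by (simp add: add_ac)
      next
        case 3
        then show ?thesis using jacobi_orthogonal[of c a b, where ?'k = 'k] r s by (simp add: add_ac)
      qed
    next
      case other
      have "bk (rt x) (bk (rt y) (rt z)) = (0 :: 'q lattice_index \<Rightarrow>\<^sub>0 'k)"
        if "ip x x = 2" "ip y y = 2" "ip z z = 2" "x + y + z = a + b + c" "y + z \<noteq> 0" for x y z
      proof (cases "ip y z = - 1")
        case True
        then have yz: "ip (y + z) (y + z) = 2" using that root_sum(1) by blast
        have "ip x (y + z) \<noteq> - 1" "ip x (y + z) \<noteq> - 2"
          using root_sum(1,2)[OF that(1) yz] other that(4) by (simp_all add: add.assoc)
        then show ?thesis using True that yz by (simp add: bk_rules)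
      next
        case False
        then show ?thesis using that root_sum(2)[of y z] by (simp add: bk_rt)
      qed
      from this[of a b c] this[of b c a] this[of c a b] show ?thesis
        using r nz by (simp add: add_ac)
    qed
  qed
qed

lemma bk_sum_right: "bk y (\<Sum>i\<in>A. x i) = (\<Sum>i\<in>A. bk y (x i))"
  by (induction A rule: infinite_finite_induct) (auto simp: bilin_ext_linear)

text \<open>The Jacobi sum in cyclic form. Its invariance under rotation lets one extend linearly in
  the first argument only, rotating the others into that place.\<close>

definition cyc :: "('q lattice_index \<Rightarrow>\<^sub>0 'k :: field) \<Rightarrow> ('q lattice_index \<Rightarrow>\<^sub>0 'k) \<Rightarrow> ('q lattice_index \<Rightarrow>\<^sub>0 'k) \<Rightarrow> ('q lattice_index \<Rightarrow>\<^sub>0 'k)" where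
  "cyc x y z = bk x (bk y z) + bk y (bk z x) + bk z (bk x y)"

lemma cyc_rotate: "cyc x y z = cyc y z x"
  by (simp add: cyc_def add_ac)

lemma cyc_linear: "cyc (x + x') y z = cyc x y z + cyc x' y z" "cyc (c *\<^sub>p x) y z = c *\<^sub>p cyc x y z" "cyc 0 y z = 0"
  by (simp_all add: cyc_def bilin_ext_linear algebra_simps pm.scale_right_distrib)

definition tv :: "nat \<Rightarrow> 'q lattice_index \<Rightarrow>\<^sub>0 'k :: field" where "tv i = single (T i) 1"

lemma bk_tv: "bk (tv i) (tv j) = 0"
  "ip b b = 2 \<Longrightarrow> bk (tv i) (rt b) = (if i < n then of_int (ip (al i) b) *\<^sub>p rt b else 0)"
  "ip b b = 2 \<Longrightarrow> bk (rt b) (tv i) = (if i < n then - (of_int (ip (al i) b) *\<^sub>p rt b) else 0)"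
  "bk (tv i) (hv b) = 0" "bk (hv b) (tv i) = 0"
  by (simp_all add: tv_def rt_def hv_def bk_sum_right bk_sum_left single_uminus)

lemma br_non_root: "s = R a \<Longrightarrow> ip a a \<noteq> 2 \<Longrightarrow> br s t = 0"
  by (cases t) auto

lemma bk_non_root:
  fixes y :: "'q lattice_index \<Rightarrow>\<^sub>0 'k :: field"
  assumes "ip a a \<noteq> 2"
  shows "bk (single (R a) c) y = 0" "bk y (single (R a) c) = 0"
proof -
  show 1: "bk (single (R a) c) y = 0" for y :: "'q lattice_index \<Rightarrow>\<^sub>0 'k"
    using subset_UNIV[of "keys y"]
    by (induction y rule: pm_induct) (auto simp: bilin_ext_linear br_non_root[OF refl assms])
  show "bk y (single (R a) c) = 0" using bk_skew[of y "single (R a) c"] 1 by simp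
qed

lemma cyc_basis: "cyc (single s 1) (single t 1) (single u 1) = (0 :: 'q lattice_index \<Rightarrow>\<^sub>0 'k :: field)"
proof -
  \<comment> \<open>Every triple containing both kinds of basis vectors can be rotated so that a
    torus vector comes first and a root vector last.\<close>
  have TR: "cyc (tv i) y (rt b) = (0 :: 'q lattice_index \<Rightarrow>\<^sub>0 'k)"
    if "ip b b = 2" "y = tv j \<or> y = rt a \<and> ip a a = 2" for i j a b y
  proof -
    from that(2) consider "y = tv j" | "y = rt a" "ip a a = 2" by blast
    then show ?thesis
    proof cases
      case 1
      then show ?thesis using that by (simp add: cyc_def bk_tv bilin_ext_linear mult.commute)
    next
      case 2
      have ba: "ip b a = ip a b" by (rule ip_commute)
      have sum: "ip (al i) (a + b) = ip (al i) a + ip (al i) b" by (rule ip_add_right)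
      have "b = - a" if "ip a b = - 2"
        using root_sum(2)[of a b] 2(2) \<open>ip b b = 2\<close> that by (simp add: eq_neg_iff_add_eq_0 add.commute)
      then consider "ip a b = - 1" "ip (a + b) (a + b) = 2" | "b = - a" "ip a b = - 2"
        | "ip a b \<noteq> - 1" "ip a b \<noteq> - 2"
        using root_sum(1)[of a b] 2(2) \<open>ip b b = 2\<close> by auto
      then show ?thesis
      proof cases
        case 1
        have "sg a b * sg b a = - 1" using sg_swap[of a b] 1 by simp
        then have "sg b a = - sg a b" using sg_cases[of a b] sg_cases[of b a] by auto
        then show ?thesis using that 2 1 ba sum
          by (simp add: cyc_def bk_tv bk_rules add.commute[of b a] distrib_left flip: pm.scale_left_distrib)
            (simp add: mult.commute pm.scale_left_distrib)
      qed (use that 2 ba in \<open>auto simp: cyc_def bk_tv bk_rules hv_minus\<close>)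
    qed
  qed
  have N: "cyc x y z = 0" if "ip a a \<noteq> 2" "single (R a) 1 \<in> {x, y, z}" for x y z :: "'q lattice_index \<Rightarrow>\<^sub>0 'k" and a
    using that by (auto simp: cyc_def bk_non_root)
  have key: "cyc x y z = (0 :: 'q lattice_index \<Rightarrow>\<^sub>0 'k)"
    if "x \<in> X" "y \<in> X" "z \<in> X" and X: "X = range tv \<union> rt ` \<Delta>" for x y z X
  proof -
    have c: "(\<exists>i. x = tv i) \<or> (\<exists>a. x = rt a \<and> ip a a = 2)" if "x \<in> X" for x
      using that X by auto
    from c[OF that(1)] c[OF that(2)] c[OF that(3)] show ?thesis
    proof (elim disjE exE conjE, goal_cases)
      case 1
      then show ?case by (simp add: cyc_def bk_tv)
    next
      case (4 i a b)
      then show ?case using TR by blast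
    next
      case (2 i j a)
      then show ?case using TR by blast
    next
      case (3 i a j)
      then show ?case using TR cyc_rotate by metis
    next
      case (5 a i j)
      then show ?case using TR cyc_rotate by metis
    next
      case (6 a i b)
      then show ?case using TR cyc_rotate by metis
    next
      case (7 a b i)
      then show ?case using TR cyc_rotate by metis
    next
      case (8 a b c)
      then show ?case using jacobi_roots[of a b c] by (simp add: cyc_def)
    qed
  qed
  have X: "single s 1 \<in> range tv \<union> rt ` \<Delta> \<or> (\<exists>a. s = R a \<and> ip a a \<noteq> 2)" for s
    by (cases s) (auto simp: tv_def rt_def)
  from X[of s] X[of t] X[of u] show ?thesis
    using N[of _ "single s 1" "single t 1" "single u 1"] key[OF _ _ _ refl] by blast
qed

lemma jacobi:
  fixes x y z :: "'q lattice_index \<Rightarrow>\<^sub>0 'k :: field"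
  shows "cyc x y z = 0"
proof -
  have ext: "cyc a y z = 0" if "\<And>s. cyc (single s 1) y z = 0" for a y z :: "'q lattice_index \<Rightarrow>\<^sub>0 'k"
    using subset_UNIV[of "keys a"]
  proof (induction a rule: pm_induct)
    case (single c s)
    then show ?case using cyc_linear(2)[of c "single s 1" y z] that[of s] by simp
  qed (simp_all add: cyc_linear)
  have 1: "cyc a (single t 1) (single u 1) = 0" for a :: "'q lattice_index \<Rightarrow>\<^sub>0 'k" and t u
    by (rule ext) (rule cyc_basis)
  have 2: "cyc b (single u 1) a = 0" for a b :: "'q lattice_index \<Rightarrow>\<^sub>0 'k" and u
    by (rule ext, subst cyc_rotate[symmetric], rule 1)
  show ?thesis
    by (rule ext, subst cyc_rotate, subst cyc_rotate[symmetric], subst cyc_rotate[symmetric], rule 2)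
qed

lemma jacobi': "bk x (bk y z) = bk (bk x y) z + bk y (bk x z)"
  using jacobi[of x y z] bk_skew[of z x] bk_skew[of z "bk x y"]
  by (simp add: cyc_def bilin_ext_linear algebra_simps)

end

section \<open>The lattice algebra, its gradings and its Chevalley generators\<close>

lemma vectorspace_pm:
  assumes "carrier V = {x. keys x \<subseteq> S}" "add V = (+)" "\<zero>\<^bsub>V\<^esub> = 0" "smult V = pm_scale"
  shows "vectorspace class_ring V" "x \<in> carrier V \<Longrightarrow> y \<in> carrier V \<Longrightarrow> x \<ominus>\<^bsub>V\<^esub> y = x - y"
  using vectorspace_of_scale[OF pm.vector_space_axioms assms(2-4)] by (simp_all add: assms(1) keys_sub_closed)

lemma subspace_pm:
  assumes "vectorspace class_ring V" "add V = (+)" "\<zero>\<^bsub>V\<^esub> = 0" "smult V = pm_scale"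
    and "U \<subseteq> carrier V" "0 \<in> U" "\<And>x y. x \<in> U \<Longrightarrow> y \<in> U \<Longrightarrow> x + y \<in> U" "\<And>c x. x \<in> U \<Longrightarrow> c *\<^sub>p x \<in> U"
  shows "subspace class_ring U V"
  using assms by (simp add: subspace_iff)

text \<open>Any additive map on the lattice grades the algebra, with the torus in degree 0. It is
  used for the root degree, for the weight of an \<open>sl_2\<close> and for the degree that forgets
  two nodes.\<close>

primrec index_degree :: "('q \<Rightarrow> 'd) \<Rightarrow> 'q lattice_index \<Rightarrow> 'd :: ab_group_add" where
  "index_degree g (T i) = 0" | "index_degree g (R a) = g a"

context even_lattice begin

definition basis :: "'q lattice_index set" where
  "basis = T ` {..<n} \<union> R ` \<Delta>"

lemma keys_hv: "keys (hv a) \<subseteq> basis"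
  unfolding hv_def by (rule order_trans[OF keys_sum]) (auto simp: basis_def)

lemma keys_br: "keys (br s t :: 'q lattice_index \<Rightarrow>\<^sub>0 'k :: field) \<subseteq> basis"
proof (cases s; cases t)
  fix a b assume st: "s = R a" "t = R b"
  have "keys (of_int (sg a b) *\<^sub>p hv a :: 'q lattice_index \<Rightarrow>\<^sub>0 'k) \<subseteq> basis"
    by (rule keys_sub_closed(3)[OF keys_hv])
  moreover have "R x \<in> basis" if "ip x x = 2" for x using that by (simp add: basis_def)
  ultimately show ?thesis using st by simp
qed (auto simp: basis_def split: if_splits)

lemma keys_bk: "keys (bk x y) \<subseteq> basis"
  by (rule keys_bilin_ext[OF keys_br])

definition lattice_algebra :: "('k :: field, 'q lattice_index \<Rightarrow>\<^sub>0 'k) superalgebra" where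
  "lattice_algebra = \<lparr>carrier = {x. keys x \<subseteq> basis}, mult = bk, one = undefined, zero = 0,
     add = (+), smult = pm_scale, part = (\<lambda>i. if i = 0 then {x. keys x \<subseteq> basis} else {0})\<rparr>"

lemma lattice_algebra_simps [simp]:
  "carrier lattice_algebra = {x. keys x \<subseteq> basis}" "mult lattice_algebra = bk"
  "\<zero>\<^bsub>lattice_algebra\<^esub> = 0" "add lattice_algebra = (+)" "smult lattice_algebra = pm_scale"
  "part lattice_algebra i = (if i = 0 then {x. keys x \<subseteq> basis} else {0})"
  by (simp_all add: lattice_algebra_def)

lemma lattice_algebra_vectorspace: "vectorspace class_ring lattice_algebra"
  by (rule vectorspace_pm(1)) simp_all

lemma lattice_algebra_minus:
  "keys x \<subseteq> basis \<Longrightarrow> keys y \<subseteq> basis \<Longrightarrow> x \<ominus>\<^bsub>lattice_algebra\<^esub> y = x - y"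
  by (rule vectorspace_pm(2)) simp_all

lemma lattice_subspace:
  assumes "U \<subseteq> {x. keys x \<subseteq> basis}" "0 \<in> U" "\<And>x y. x \<in> U \<Longrightarrow> y \<in> U \<Longrightarrow> x + y \<in> U"
    "\<And>c x. x \<in> U \<Longrightarrow> c *\<^sub>p x \<in> U"
  shows "subspace class_ring U lattice_algebra"
  using assms by (intro subspace_pm lattice_algebra_vectorspace) auto

lemma lattice_algebra_lie: "lie_superalgebra (lattice_algebra :: ('k :: field, _) superalgebra)"
proof (rule lie_superalgebra.intro)
  let ?L = "lattice_algebra :: ('k, _) superalgebra"
  show "vectorspace class_ring ?L" by (rule lattice_algebra_vectorspace)
  show "subspace class_ring (part ?L i) ?L" for i
    by (rule lattice_subspace) (simp_all add: keys_sub_closed split: if_splits)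
  show "\<exists>!p. p \<in> part ?L 0 \<times> part ?L 1 \<and> x = fst p \<oplus>\<^bsub>?L\<^esub> snd p" if "x \<in> carrier ?L" for x
    using that by (intro ex1I[of _ "(x, 0)"]) auto
  show "x \<otimes>\<^bsub>?L\<^esub> y \<in> part ?L (i + j)" if "x \<in> part ?L i" "y \<in> part ?L j" for x y i j
    using that keys_bk[of x y] by (cases i; cases j) simp_all
  show "(\<lambda>y. x \<otimes>\<^bsub>?L\<^esub> y) \<in> module_hom class_ring ?L ?L" if "x \<in> carrier ?L" for x
    using keys_bk by (auto simp: module_hom_iff bilin_ext_linear)
  show "(\<lambda>x. x \<otimes>\<^bsub>?L\<^esub> y) \<in> module_hom class_ring ?L ?L" if "y \<in> carrier ?L" for y
    using keys_bk by (auto simp: module_hom_iff bilin_ext_linear)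
  show "lie_identities ?L \<subseteq> {\<zero>\<^bsub>?L\<^esub>}"
  proof
    fix w assume "w \<in> lie_identities ?L"
    then show "w \<in> {\<zero>\<^bsub>?L\<^esub>}"
      unfolding lie_identities_def
    proof (elim UnE CollectE exE conjE, goal_cases)
      case (1 i j x y)
      then show ?case using bk_skew[of x y] by (auto simp: ksign_def split: if_splits)
    next
      case (2 i j x y z)
      then have "w = bk x (bk y z) - (bk (bk x y) z + ksign i j *\<^sub>p bk y (bk x z))"
        by (simp add: lattice_algebra_minus[OF keys_bk keys_sub_closed(1)[OF keys_bk keys_sub_closed(3)[OF keys_bk]]])
      then show ?case using 2 jacobi'[of x y z] by (auto simp: ksign_def split: if_splits)
    next
      case (3 x)
      then show ?case by simp
    qed
  qed
qed

definition dg :: "'q \<Rightarrow> (nat \<Rightarrow>\<^sub>0 int)" where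
  "dg a = (\<Sum>i<n. single i (cf a i))"

lemma lookup_dg: "lookup (dg a) i = (if i < n then cf a i else 0)"
  by (simp add: dg_def lookup_sum lookup_single when_def)

lemma dg_add: "dg (a + b) = dg a + dg b" and dg_minus: "dg (- a) = - dg a" and dg_zero [simp]: "dg 0 = 0"
  by (auto intro!: poly_mapping_eqI simp: lookup_dg lookup_add cf_add)

text \<open>A vector whose coordinates vanish pairs to 0 with itself by \<open>ip_cf\<close>, so
  positivity applies to the difference.\<close>

lemma cf_eqI: assumes "\<And>i. i < n \<Longrightarrow> cf a i = cf b i" shows "a = b"
proof -
  have "ip (a - b) (a - b) = 0" using assms by (subst ip_cf) (simp add: cf_diff)
  then show ?thesis using ip_pos[of "a - b"] by (cases "a - b = 0") auto
qed

lemma dg_inj: "dg a = dg b \<longleftrightarrow> a = b"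
proof
  assume "dg a = dg b"
  then have "lookup (dg a) i = lookup (dg b) i" for i by simp
  then show "a = b" by (intro cf_eqI) (metis lookup_dg)
qed simp

lemma dg_al: "i < n \<Longrightarrow> dg (al i) = single i 1"
  by (intro poly_mapping_eqI) (auto simp: lookup_dg cf_al lookup_single when_def)

abbreviation ideg :: "'q lattice_index \<Rightarrow> (nat \<Rightarrow>\<^sub>0 int)" where "ideg \<equiv> index_degree dg"

text \<open>Descent on the sum of the absolute values of the coordinates.\<close>

lemma root_induct [consumes 1, case_names pos neg raise lower]:
  assumes "ip a a = 2"
    and pos: "\<And>i. i < n \<Longrightarrow> Q (al i)" and neg: "\<And>i. i < n \<Longrightarrow> Q (- al i)"
    and raise: "\<And>i b. i < n \<Longrightarrow> ip b b = 2 \<Longrightarrow> ip (al i) b = - 1 \<Longrightarrow> Q b \<Longrightarrow> Q (al i + b)"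
    and lower: "\<And>i b. i < n \<Longrightarrow> ip b b = 2 \<Longrightarrow> ip (- al i) b = - 1 \<Longrightarrow> Q b \<Longrightarrow> Q (- al i + b)"
  shows "Q a"
  using assms(1)
proof (induction "\<Sum>j<n. nat \<bar>cf a j\<bar>" arbitrary: a rule: less_induct)
  case less
  \<comment> \<open>Since the square length is positive, some simple root has a coefficient and a
    pairing with a of the same sign. Moving a by this simple root brings the coefficient closer to
    zero.\<close>
  have "(\<Sum>i<n. cf a i * ip (al i) a) > 0" using less.prems ip_cf[of a a] by simp
  then obtain i where i: "i < n" "cf a i * ip (al i) a > 0"
    by (meson lessThan_iff not_le sum_nonpos)
  note r = root_sum[OF al_root[OF i(1)] less.prems]
  have dec: "(\<Sum>j<n. nat \<bar>cf b j\<bar>) < (\<Sum>j<n. nat \<bar>cf a j\<bar>)"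
    if "\<And>j. j < n \<Longrightarrow> j \<noteq> i \<Longrightarrow> cf b j = cf a j" "\<bar>cf b i\<bar> < \<bar>cf a i\<bar>" for b
  proof (rule sum_strict_mono_ex1)
    show "\<forall>j\<in>{..<n}. nat \<bar>cf b j\<bar> \<le> nat \<bar>cf a j\<bar>"
    proof
      fix j assume "j \<in> {..<n}"
      then show "nat \<bar>cf b j\<bar> \<le> nat \<bar>cf a j\<bar>" using that by (cases "j = i") auto
    qed
    show "\<exists>j\<in>{..<n}. nat \<bar>cf b j\<bar> < nat \<bar>cf a j\<bar>" using that(2) i(1) by (intro bexI[of _ i]) auto
  qed simp
  consider "ip (al i) a = 2" | "ip (al i) a = - 2" | "ip (al i) a = 1" "cf a i > 0" | "ip (al i) a = - 1" "cf a i < 0"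
  proof -
    have "ip (al i) a = - 2 \<or> ip (al i) a = - 1 \<or> ip (al i) a = 0 \<or> ip (al i) a = 1 \<or> ip (al i) a = 2"
      using r(4) by linarith
    then show ?thesis using i(2) that by (auto simp: zero_less_mult_iff)
  qed
  then show ?case
  proof cases
    case 1
    then have "a = al i" using r(3) by simp
    then show ?thesis using pos i by simp
  next
    case 2
    then have "a = - al i" using r(2) by (simp add: eq_neg_iff_add_eq_0 add.commute)
    then show ?thesis using neg i by simp
  next
    case 3
    have "ip (a - al i) (a - al i) = 2" "ip (al i) (a - al i) = - 1"
      using 3 less.prems al_root[OF i(1)] ip_commute[of a "al i"] by (simp_all add: ip_diff)
    moreover have "Q (a - al i)"
      using 3 i calculation(1) by (intro less.hyps dec) (auto simp: cf_diff cf_al)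
    ultimately show ?thesis using raise[of i "a - al i"] i by simp
  next
    case 4
    have "ip (a + al i) (a + al i) = 2" "ip (- al i) (a + al i) = - 1"
      using 4 less.prems al_root[OF i(1)] ip_commute[of a "al i"] by (simp_all add: ip_add ip_add_right)
    moreover have "Q (a + al i)"
      using 4 i calculation(1) by (intro less.hyps dec) (auto simp: cf_add cf_al)
    ultimately show ?thesis using lower[of i "a + al i"] i by (simp add: add.commute)
  qed
qed

lemma keys_hv_torus: "keys (hv a) \<subseteq> T ` {..<n}"
  unfolding hv_def by (rule order_trans[OF keys_sum]) auto

text \<open>Two root vectors reach the torus only when the roots are opposite, and then their
  degrees cancel.\<close>

lemma index_degree_br:
  assumes g: "\<And>a b. g (a + b) = g a + g b" and u: "u \<in> keys (br s t :: 'q lattice_index \<Rightarrow>\<^sub>0 'k :: field)"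
  shows "index_degree g u = index_degree g s + index_degree g t"
proof (cases s; cases t)
  fix a b assume st: "s = R a" "t = R b"
  show ?thesis
  proof (cases "ip a a = 2 \<and> ip b b = 2 \<and> ip (a + b) (a + b) \<noteq> 2")
    case True
    then have "a + b = 0" "u \<in> keys (of_int (sg a b) *\<^sub>p hv a :: 'q lattice_index \<Rightarrow>\<^sub>0 'k)"
      using st u by (simp_all split: if_splits)
    moreover have "g 0 = 0" using g[of 0 0] by simp
    ultimately have "index_degree g u = 0" "g (a + b) = 0"
      using keys_scale[of "of_int (sg a b) :: 'k" "hv a"] keys_hv_torus[of a] by fastforce+
    then show ?thesis using st by (simp add: g)
  next
    case False
    then have "u = R (a + b)" using st u by (simp split: if_splits)
    then show ?thesis using st by (simp add: g)
  qed
next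
  fix i b assume "s = T i" "t = R b"
  then show ?thesis using u by (simp split: if_splits)
next
  fix i b assume "s = R b" "t = T i"
  then show ?thesis using u by (simp split: if_splits)
next
  fix i j assume "s = T i" "t = T j"
  then show ?thesis using u by simp
qed

end

definition pm_component :: "'i set \<Rightarrow> ('i \<Rightarrow> 'd) \<Rightarrow> 'd \<Rightarrow> ('i \<Rightarrow>\<^sub>0 'k :: zero) set" where
  "pm_component S \<delta> q = {x. keys x \<subseteq> {s \<in> S. \<delta> s = q}}"

definition pm_proj :: "('i \<Rightarrow> 'd) \<Rightarrow> 'd \<Rightarrow> ('i \<Rightarrow>\<^sub>0 'k :: field) \<Rightarrow> ('i \<Rightarrow>\<^sub>0 'k)" where
  "pm_proj \<delta> q = lin_ext (\<lambda>s. if \<delta> s = q then single s 1 else 0)"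

lemma lookup_pm_proj: "lookup (pm_proj \<delta> q x) s = (if \<delta> s = q then lookup x s else 0)"
proof -
  have "lookup (pm_proj \<delta> q x) s = (\<Sum>t\<in>keys x. if t = s \<and> \<delta> s = q then lookup x s else 0)"
    unfolding pm_proj_def lin_ext_def lookup_sum by (rule sum.cong) (auto simp: lookup_single when_def)
  then show ?thesis by (cases "\<delta> s = q") (auto simp: in_keys_iff)
qed

lemma pm_proj_linear: "pm_proj \<delta> q (x + y) = pm_proj \<delta> q x + pm_proj \<delta> q y"
  "pm_proj \<delta> q (c *\<^sub>p x) = c *\<^sub>p pm_proj \<delta> q x" "pm_proj \<delta> q 0 = 0"
  "pm_proj \<delta> q (x - y) = pm_proj \<delta> q x - pm_proj \<delta> q y"
  by (simp_all add: pm_proj_def lin_ext_add lin_ext_scale lin_ext_diff)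

lemma keys_pm_proj: "keys (pm_proj \<delta> q x) = {s \<in> keys x. \<delta> s = q}"
  unfolding set_eq_iff by (simp add: in_keys_iff lookup_pm_proj)

lemma pm_proj_component: "x \<in> pm_component S \<delta> r \<Longrightarrow> pm_proj \<delta> q x = (if q = r then x else 0)"
  by (rule poly_mapping_eqI) (auto simp: lookup_pm_proj pm_component_def in_keys_iff)

context even_lattice begin

lemma bk_component:
  assumes "\<And>a b. g (a + b) = g a + g b"
    and "x \<in> pm_component basis (index_degree g) q" "y \<in> pm_component basis (index_degree g) r"
  shows "bk x y \<in> pm_component basis (index_degree g) (q + r)"
proof -
  have "keys (bk x y) \<subseteq> {s. index_degree g s = q + r}"
  proof (rule keys_bilin_ext)
    fix s t assume "s \<in> keys x" "t \<in> keys y"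
    then have "index_degree g s = q" "index_degree g t = r" using assms(2,3) by (auto simp: pm_component_def)
    then show "keys (br s t) \<subseteq> {s. index_degree g s = q + r}" using index_degree_br[OF assms(1)] by auto
  qed
  then show ?thesis using keys_bk[of x y] by (auto simp: pm_component_def)
qed

text \<open>The coordinates dual to \<open>h\<close> identify the given torus with the one of the
  lattice algebra. The sign in the lowering generators compensates the bracket \<open>- hv a\<close>
  of opposite roots. The hypothesis \<open>nz\<close> says that no root dies modulo the
  characteristic, so \<open>hv a\<close> is nonzero and the vector of a is separated by that of
  -a.\<close>

lemma lattice_contragredient_model:
  fixes H :: "('k :: field, 'h) module"
  assumes H: "vectorspace class_ring H" and c: "dual_bases H n h c"
    and alpha: "\<And>j. j < n \<Longrightarrow> linear_form H (\<alpha> j)"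
    and cartan: "\<And>i j. i < n \<Longrightarrow> j < n \<Longrightarrow> \<alpha> j (h i) = of_int (ip (al i) (al j))"
    and nz: "\<And>a. ip a a = 2 \<Longrightarrow> \<exists>i<n. (of_int (cf a i) :: 'k) \<noteq> 0"
    and par: "\<And>i. par i = 0"
  shows "contragredient_model n par H h \<alpha> lattice_algebra (\<lambda>x. \<Sum>i<n. c i x *\<^sub>p tv i)
    (\<lambda>i. rt (al i)) (\<lambda>i. - rt (- al i)) (pm_component basis ideg) (pm_proj ideg)"
    (is "contragredient_model n par H h \<alpha> ?L ?\<tau> ?e ?f ?D ?P")
proof -
  interpret HV: vectorspace class_ring H by (rule H)
  have h: "i < n \<Longrightarrow> h i \<in> carrier H" and cl: "i < n \<Longrightarrow> linear_form H (c i)"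
    and ch: "i < n \<Longrightarrow> j < n \<Longrightarrow> c i (h j) = (if i = j then 1 else 0)" for i j
    using c by (auto simp: dual_bases_def)
  have aln: "ip (- al i) (- al i) = 2" if "i < n" for i using al_root[OF that] by simp
  have kr: "keys (rt a) \<subseteq> basis" if "ip a a = 2" for a
    using that by (simp add: rt_def basis_def)
  have kt: "keys (tv i) \<subseteq> basis" if "i < n" for i
    using that by (simp add: tv_def basis_def)
  have \<tau>k: "keys (?\<tau> x) \<subseteq> basis \<inter> {s. ideg s = 0}" for x
    by (rule order_trans[OF keys_sum]) (auto simp: tv_def basis_def split: if_splits)
  have \<tau>l: "lookup (?\<tau> x) (T i) = c i x" if "i < n" for x i
    using that by (simp add: lookup_sum tv_def lookup_single when_def)
  have \<tau>h: "?\<tau> (h i) = tv i" if "i < n" for i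
  proof -
    have "?\<tau> (h i) = (\<Sum>j<n. if j = i then tv j else 0)" using that ch by (intro sum.cong) auto
    then show ?thesis using that by simp
  qed
  have act: "bk (?\<tau> x) (rt b) = (\<Sum>i<n. c i x * of_int (ip (al i) b)) *\<^sub>p rt b" if "ip b b = 2" for x b
    using that by (simp add: bk_sum_left bilin_ext_linear bk_tv pm.scale_sum_left)
  have ax: "(\<Sum>i<n. c i x * of_int (ip (al i) (al j))) = \<alpha> j x" if "x \<in> carrier H" "j < n" for x j
  proof -
    have "(\<Sum>i<n. c i x * of_int (ip (al i) (al j))) = (\<Sum>i<n. c i x * \<alpha> j (h i))"
      using that cartan by (intro sum.cong) auto
    then show ?thesis using dual_bases_expand[OF H c alpha[OF that(2)] that(1)] by simp
  qed
  show ?thesis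
  proof (rule contragredient_model.intro)
    show "?\<tau> \<in> module_hom class_ring H ?L"
      using \<tau>k cl by (auto simp: module_hom_iff linear_form_def pm.scale_left_distrib sum.distrib pm.scale_sum_right)
    show "x = \<zero>\<^bsub>H\<^esub>" if "x \<in> carrier H" "?\<tau> x = \<zero>\<^bsub>?L\<^esub>" for x
    proof -
      have "c i x = 0" if "i < n" for i
        using \<tau>l[OF that, of x] \<open>?\<tau> x = \<zero>\<^bsub>?L\<^esub>\<close> by simp
      moreover have "x = (\<Oplus>\<^bsub>H\<^esub>i\<in>{..<n}. c i x \<odot>\<^bsub>H\<^esub> h i)" using c that by (auto simp: dual_bases_def)
      moreover have "(\<Oplus>\<^bsub>H\<^esub>i\<in>{..<n}. c i x \<odot>\<^bsub>H\<^esub> h i) = (\<Oplus>\<^bsub>H\<^esub>i\<in>{..<n}. \<zero>\<^bsub>H\<^esub>)"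
        using calculation(1) HV.smult_l_null h by (intro HV.finsum_cong') (auto simp: class_ring_simps)
      ultimately show ?thesis by simp
    qed
    show "?\<tau> x \<otimes>\<^bsub>?L\<^esub> ?\<tau> y = \<zero>\<^bsub>?L\<^esub>" for x y
      by (simp add: bk_sum_left bk_sum_right bilin_ext_linear bk_tv)
    show "?\<tau> x \<otimes>\<^bsub>?L\<^esub> ?e j = \<alpha> j x \<odot>\<^bsub>?L\<^esub> ?e j" if "x \<in> carrier H" "j < n" for x j
      using act[OF al_root[OF that(2)]] ax[OF that] by simp
    show "?\<tau> x \<otimes>\<^bsub>?L\<^esub> ?f j = (- \<alpha> j x) \<odot>\<^bsub>?L\<^esub> ?f j" if "x \<in> carrier H" "j < n" for x j
      using act[OF aln[OF that(2)]] ax[OF that] by (simp add: bilin_ext_linear sum_negf)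
    show "?e i \<otimes>\<^bsub>?L\<^esub> ?f j = (if i = j then ?\<tau> (h i) else \<zero>\<^bsub>?L\<^esub>)" if ij: "i < n" "j < n" for i j
    proof (cases "i = j")
      case True
      have "bk (rt (al i)) (rt (- al i)) = (- hv (al i) :: 'q lattice_index \<Rightarrow>\<^sub>0 'k)"
        using al_root[OF ij(1)] by (simp add: bk_rt)
      moreover have "hv (al i) = (tv i :: 'q lattice_index \<Rightarrow>\<^sub>0 'k)"
      proof -
        have "hv (al i) = (\<Sum>j<n. if j = i then tv j else 0 :: 'q lattice_index \<Rightarrow>\<^sub>0 'k)"
          unfolding hv_def using ij by (intro sum.cong) (auto simp: cf_al tv_def)
        then show ?thesis using ij by simp
      qed
      ultimately show ?thesis using True \<tau>h ij by (simp add: bilin_ext_linear)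
    next
      case False
      \<comment> \<open>The pairing of \<open>al i\<close> with \<open>- al j\<close> is
        nonnegative, hence neither -1 nor -2.\<close>
      then have "bk (rt (al i)) (rt (- al j)) = (0 :: 'q lattice_index \<Rightarrow>\<^sub>0 'k)"
        using al_nonpos[OF ij] al_root ij by (simp add: bk_rt)
      then show ?thesis using False by (simp add: bilin_ext_linear)
    qed
    show "carrier ?L \<subseteq> U"
      if U: "subspace class_ring U ?L" "?\<tau> ` carrier H \<subseteq> U" "?e ` {..<n} \<subseteq> U" "?f ` {..<n} \<subseteq> U"
        and br: "\<And>x y. x \<in> U \<Longrightarrow> y \<in> U \<Longrightarrow> x \<otimes>\<^bsub>?L\<^esub> y \<in> U" for U
    proof -
      have U0: "0 \<in> U" and Ua: "x \<in> U \<Longrightarrow> y \<in> U \<Longrightarrow> x + y \<in> U" and Us: "x \<in> U \<Longrightarrow> k *\<^sub>p x \<in> U" for x y k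
        using U(1) by (simp_all add: subspace_iff)
      have t: "tv i \<in> U" if "i < n" for i 
      proof -
        have "?\<tau> (h i) \<in> U" using U(2) h[OF that] by blast
        then show ?thesis unfolding \<tau>h[OF that] .
      qed
      have e: "rt (al i) \<in> U" if "i < n" for i using U(3) that by auto
      have f: "rt (- al i) \<in> U" if "i < n" for i
        using Us[of "?f i" "- 1"] U(4) that by auto
      have step: "rt (a + b) \<in> U" if "rt a \<in> U" "rt b \<in> U" "ip a a = 2" "ip b b = 2" "ip a b = - 1" for a b
      proof -
        have "of_int (sg a b) *\<^sub>p bk (rt a) (rt b) = (rt (a + b) :: 'q lattice_index \<Rightarrow>\<^sub>0 'k)"
          using that(3-5) sg_sq[of a b] by (simp add: bk_rt flip: of_int_mult)
        then show ?thesis using Us[OF br[OF that(1,2)], of "of_int (sg a b)"] by simp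
      qed
      have r: "rt a \<in> U" if "ip a a = 2" for a
        using that
      proof (induction rule: root_induct)
        case (raise i b)
        then show ?case using step[OF e] al_root by simp
      next
        case (lower i b)
        then show ?case using step[OF f] aln by simp
      qed (use e f in auto)
      show ?thesis
      proof
        fix x assume "x \<in> carrier ?L"
        then have "keys x \<subseteq> basis" by simp
        then show "x \<in> U"
        proof (induction rule: pm_induct)
          case (single k s)
          then have "single s 1 \<in> U" using t r by (auto simp: basis_def tv_def rt_def)
          then show ?case using Us[of "single s 1" k] by simp
        qed (use U0 Ua in auto)
      qed
    qed
    show "subspace class_ring (?D q) ?L" for q
      by (rule lattice_subspace) (auto simp: pm_component_def keys_sub_closed)
    show "?\<tau> x \<in> ?D 0" for x
      using \<tau>k[of x] by (auto simp: pm_component_def)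
    show "?e i \<in> ?D (single i 1)" "?f i \<in> ?D (single i (- 1))" if "i < n" for i
      using that al_root[OF that] dg_al[OF that]
      by (auto simp: pm_component_def rt_def basis_def dg_minus single_uminus)
    show "x \<otimes>\<^bsub>?L\<^esub> y \<in> ?D (q + r)" if "x \<in> ?D q" "y \<in> ?D r" for x y q r
      using bk_component[OF dg_add that] by simp
    show "?P q \<in> module_hom class_ring ?L ?L" for q
      by (auto simp: module_hom_iff pm_proj_linear keys_pm_proj)
    show "?P q x = (if q = r then x else \<zero>\<^bsub>?L\<^esub>)" if "x \<in> ?D r" for x q r
      using pm_proj_component[OF that] by simp
    show "\<exists>y\<in>?D (- q). y \<otimes>\<^bsub>?L\<^esub> x \<noteq> \<zero>\<^bsub>?L\<^esub>" if q: "q \<noteq> 0" and x: "x \<in> ?D q" "x \<noteq> \<zero>\<^bsub>?L\<^esub>" for q x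
    proof -
      have "keys x \<noteq> {}" using x(2) by simp
      then obtain s where s: "s \<in> keys x" by blast
      then have sb: "s \<in> basis" "ideg s = q" using x(1) by (auto simp: pm_component_def)
      then obtain a where a: "s = R a" "ip a a = 2" "q = dg a" using q by (auto simp: basis_def)
      \<comment> \<open>Distinct roots have distinct degrees and the torus has degree 0, so this
        component is a line.\<close>
      have "t = R a" if "t \<in> keys x" for t
      proof -
        have t: "t \<in> basis" "ideg t = dg a" using that x(1) a by (auto simp: pm_component_def)
        then show ?thesis using q a by (cases t) (auto simp: dg_inj)
      qed
      then have "keys x = {R a}" using s a(1) by blast
      then obtain k where k: "x = k *\<^sub>p rt a" "k \<noteq> 0"
      proof -
        have "lookup x (R a) \<noteq> 0" using \<open>keys x = {R a}\<close> by (simp flip: in_keys_iff)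
        then show ?thesis
          using that[of "lookup x (R a)"] poly_mapping_sum_single[of x] \<open>keys x = {R a}\<close>
          by (simp add: rt_def)
      qed
      have "bk (rt (- a)) (rt a) = (hv a :: 'q lattice_index \<Rightarrow>\<^sub>0 'k)"
        using a(2) by (simp add: bk_rt hv_minus)
      then have bx: "bk (rt (- a)) x = k *\<^sub>p hv a"
        by (simp only: k(1) bilin_ext_scale_right)
      from nz[OF a(2)] obtain i where i: "i < n" "(of_int (cf a i) :: 'k) \<noteq> 0" by (elim exE conjE)
      moreover have "lookup (hv a) (T i) = (of_int (cf a i) :: 'k)"
        using i by (simp add: hv_def lookup_sum lookup_single when_def)
      ultimately have "lookup (k *\<^sub>p hv a) (T i) \<noteq> 0" using k(2) by simp
      then have nz': "bk (rt (- a)) x \<noteq> 0" unfolding bx by (metis lookup_zero)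
      have "rt (- a) \<in> ?D (- q)"
        using a(2,3) by (simp add: pm_component_def rt_def basis_def dg_minus)
      with nz' show ?thesis by (intro bexI) simp_all
    qed
  qed (use H h lattice_algebra_lie par \<tau>k kr al_root aln in \<open>auto simp: rt_def basis_def\<close>)
qed

end

subsection \<open>Semisimplification for a pair of orthogonal roots\<close>

lemma three_zero: "CHAR('k :: field) = 3 \<Longrightarrow> (3 :: 'k) = 0"
  using of_nat_CHAR[where ?'a = 'k] by simp

lemma pm_component_closed:
  "0 \<in> pm_component S \<delta> q"
  "x \<in> pm_component S \<delta> q \<Longrightarrow> y \<in> pm_component S \<delta> q \<Longrightarrow> x + y \<in> pm_component S \<delta> q"
  "x \<in> pm_component S \<delta> q \<Longrightarrow> y \<in> pm_component S \<delta> q \<Longrightarrow> x - y \<in> pm_component S \<delta> q"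
  "x \<in> pm_component S \<delta> q \<Longrightarrow> c *\<^sub>p x \<in> pm_component S \<delta> q"
  "x \<in> pm_component S \<delta> q \<Longrightarrow> - x \<in> pm_component S \<delta> q"
  unfolding pm_component_def mem_Collect_eq by (simp_all only: keys_zero empty_subsetI keys_sub_closed keys_minus)

lemma pm_proj_in: "keys x \<subseteq> S \<Longrightarrow> pm_proj \<delta> q x \<in> pm_component S \<delta> q"
  by (auto simp: pm_component_def keys_pm_proj)

locale orthogonal_roots = even_lattice n ip sg al cf
  for n and ip :: "'q :: ab_group_add \<Rightarrow> 'q \<Rightarrow> int" and sg al cf +
  fixes b b' :: 'q
  assumes b: "ip b b = 2" and b': "ip b' b' = 2" and orth: "ip b b' = 0"
begin

definition wt :: "'q \<Rightarrow> int" where "wt a = ip b a + ip b' a"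

lemma wt_add: "wt (a + a') = wt a + wt a'"
  by (simp add: wt_def ip_add_right)

lemma orth': "ip b' b = 0"
  using orth ip_commute by simp

text \<open>A pairing 2 or -2 with one of the two roots means that a is plus or minus that root, and
  orthogonality makes the other pairing 0. Otherwise both pairings are at most 1 in absolute
  value.\<close>

lemma wt_bound: assumes "ip a a = 2" shows "\<bar>wt a\<bar> \<le> 2"
proof -
  note r = root_sum[OF b assms] and r' = root_sum[OF b' assms]
  have "wt a = 2" if "ip b a = 2" using that r(3) b orth' unfolding wt_def by auto
  moreover have "wt a = 2" if "ip b' a = 2" using that r'(3) b' orth unfolding wt_def by auto
  moreover have "wt a = - 2" if "ip b a = - 2"
  proof -
    have "a = - b" using that r(2) by (simp add: eq_neg_iff_add_eq_0 add.commute)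
    then show ?thesis using b orth' by (simp add: wt_def)
  qed
  moreover have "wt a = - 2" if "ip b' a = - 2"
  proof -
    have "a = - b'" using that r'(2) by (simp add: eq_neg_iff_add_eq_0 add.commute)
    then show ?thesis using b' orth by (simp add: wt_def)
  qed
  ultimately show ?thesis using r(4) r'(4) unfolding wt_def by linarith
qed

text \<open>An \<open>sl_2\<close>-triple, and the grading \<open>G m\<close> by its weights.\<close>

definition E :: "('q lattice_index \<Rightarrow>\<^sub>0 'k :: field) \<Rightarrow> ('q lattice_index \<Rightarrow>\<^sub>0 'k)" where
  "E x = bk (rt b + rt b') x"

definition F :: "('q lattice_index \<Rightarrow>\<^sub>0 'k :: field) \<Rightarrow> ('q lattice_index \<Rightarrow>\<^sub>0 'k)" where
  "F x = bk (- (rt (- b) + rt (- b'))) x"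

abbreviation G :: "int \<Rightarrow> ('q lattice_index \<Rightarrow>\<^sub>0 'k :: field) set" where
  "G \<equiv> pm_component basis (index_degree wt)"

abbreviation pr :: "int \<Rightarrow> ('q lattice_index \<Rightarrow>\<^sub>0 'k :: field) \<Rightarrow> ('q lattice_index \<Rightarrow>\<^sub>0 'k)" where
  "pr \<equiv> pm_proj (index_degree wt)"

lemma rt_component: "ip a a = 2 \<Longrightarrow> rt a \<in> pm_component basis (index_degree g) (g a)"
  by (simp add: rt_def pm_component_def basis_def)

lemma E_linear: "E (x + y) = E x + E y" "E (x - y) = E x - E y" "E (c *\<^sub>p x) = c *\<^sub>p E x" "E 0 = 0" "E (- x) = - E x"
  and F_linear: "F (x + y) = F x + F y" "F (x - y) = F x - F y" "F (c *\<^sub>p x) = c *\<^sub>p F x" "F 0 = 0" "F (- x) = - F x"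
  unfolding E_def F_def
  by (simp_all only: bilin_ext_add_right bilin_ext_scale_right bilin_ext_diff_right
      bilin_ext_uminus_right bilin_ext_simps)

lemma E_deriv: "E (bk x y) = bk (E x) y + bk x (E y)"
  unfolding E_def by (rule jacobi')

lemma E_basis: "keys (E x) \<subseteq> basis" "keys (F x) \<subseteq> basis"
  unfolding E_def F_def by (rule keys_bk)+

lemma E_G: "x \<in> G m \<Longrightarrow> E x \<in> G (m + 2)"
proof -
  assume x: "x \<in> G m"
  have "wt b = 2" "wt b' = 2" using b b' orth orth' by (simp_all add: wt_def)
  then have "rt b + rt b' \<in> G 2"
    using rt_component[OF b, of wt] rt_component[OF b', of wt]
    by (intro pm_component_closed) simp_all
  from bk_component[OF wt_add this x] show ?thesis by (simp add: E_def add.commute)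
qed

lemma F_G: "x \<in> G m \<Longrightarrow> F x \<in> G (m - 2)"
proof -
  assume x: "x \<in> G m"
  have "wt (- b) = - 2" "wt (- b') = - 2" using b b' orth orth' by (simp_all add: wt_def)
  then have "- (rt (- b) + rt (- b')) \<in> G (- 2)"
    using rt_component[of "- b" wt] rt_component[of "- b'" wt] b b'
    by (intro pm_component_closed) simp_all
  from bk_component[OF wt_add this x] show ?thesis unfolding F_def by simp
qed

lemma G_zero: "x \<in> G m \<Longrightarrow> \<bar>m\<bar> > 2 \<Longrightarrow> x = 0"
proof -
  assume x: "x \<in> G m" and m: "\<bar>m\<bar> > 2"
  have False if "s \<in> keys x" for s
  proof -
    have "s \<in> basis" "index_degree wt s = m" using x that by (auto simp: pm_component_def)
    then show False using m wt_bound by (cases s) (fastforce simp: basis_def)+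
  qed
  then have "keys x = {}" by blast
  then show ?thesis by simp
qed

lemma weight_decomposition:
  assumes "keys x \<subseteq> basis"
  shows "x = pr (- 2) x + pr (- 1) x + pr 0 x + pr 1 x + pr 2 x"
proof (rule poly_mapping_eqI)
  fix s
  have "\<bar>index_degree wt s\<bar> \<le> 2 \<or> lookup x s = 0"
    using assms wt_bound by (cases s) (auto simp: basis_def in_keys_iff subset_iff)
  then have "lookup x s = 0 \<or> index_degree wt s = - 2 \<or> index_degree wt s = - 1 \<or> index_degree wt s = 0 \<or>
      index_degree wt s = 1 \<or> index_degree wt s = 2" by linarith
  then show "lookup x s = lookup (pr (- 2) x + pr (- 1) x + pr 0 x + pr 1 x + pr 2 x) s"
    by (auto simp: lookup_add lookup_pm_proj)
qed

lemma pr_G: "x \<in> G r \<Longrightarrow> pr q x = (if q = r then x else 0)"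
  by (rule pm_proj_component)

lemma pr_in: "keys x \<subseteq> basis \<Longrightarrow> pr m x \<in> G m"
  by (rule pm_proj_in)

lemma pr_E:
  assumes x: "keys x \<subseteq> basis"
  shows "pr (m + 2) (E x) = E (pr m x)"
proof -
  have "E (pr j x) \<in> G (j + 2)" for j by (rule E_G[OF pr_in[OF x]])
  note p = pr_G[OF this]
  have "pr (m + 2) (E x) = pr (m + 2) (E (pr (- 2) x + pr (- 1) x + pr 0 x + pr 1 x + pr 2 x))"
    using weight_decomposition[OF x] by simp
  also have "\<dots> = (if m = - 2 then E (pr m x) else 0) + (if m = - 1 then E (pr m x) else 0) +
      (if m = 0 then E (pr m x) else 0) + (if m = 1 then E (pr m x) else 0) + (if m = 2 then E (pr m x) else 0)"
    by (simp add: E_linear pm_proj_linear p)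
  also have "\<dots> = E (pr m x)"
  proof (cases "\<bar>m\<bar> > 2")
    case True
    then have "pr m x = 0" using G_zero pr_in[OF x] by blast
    then show ?thesis using True by (auto simp: E_linear)
  next
    case False
    then have "m = - 2 \<or> m = - 1 \<or> m = 0 \<or> m = 1 \<or> m = 2" by linarith
    then show ?thesis by auto
  qed
  finally show ?thesis .
qed

text \<open>Orthogonality kills the cross brackets, so the two operators come from elements with
  bracket \<open>hv b + hv b'\<close>, which acts on weight m as the scalar m; the Jacobi identity
  does the rest.\<close>

lemma EF:
  fixes x :: "'q lattice_index \<Rightarrow>\<^sub>0 'a :: field"
  shows "x \<in> G m \<Longrightarrow> E (F x) = F (E x) + of_int m *\<^sub>p x"
proof -
  assume x: "x \<in> G m"
  have "bk (rt b + rt b') (- (rt (- b) + rt (- b'))) = (hv b + hv b' :: 'q lattice_index \<Rightarrow>\<^sub>0 'a)"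
    using b b' orth orth' by (simp add: bilin_ext_linear bk_rt)
  then have "E (F x) = bk (hv b + hv b') x + F (E x)"
    unfolding E_def F_def using jacobi'[of "rt b + rt b'" "- (rt (- b) + rt (- b'))" x] by simp
  moreover have "bk (hv b + hv b') x = of_int m *\<^sub>p x"
  proof -
    have "keys x \<subseteq> {s \<in> basis. index_degree wt s = m}" using x by (simp add: pm_component_def)
    then show ?thesis
    proof (induction rule: pm_induct)
      case (single c s)
      then consider i where "s = T i" "m = 0" | a where "s = R a" "ip a a = 2" "m = ip b a + ip b' a"
        by (auto simp: basis_def wt_def)
      then show ?case
      proof cases
        case 1
        have "single (T i) c = c *\<^sub>p tv i" by (simp add: tv_def)
        then show ?thesis using 1 by (simp only: bilin_ext_linear bk_tv) simp
      next
        case 2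
        then show ?thesis
          by (simp only: bilin_ext_add_left bk_hv) (simp add: distrib_right single_add)
      qed
    qed (auto simp: bilin_ext_linear pm.scale_right_distrib)
  qed
  ultimately show ?thesis by simp
qed

text \<open>By \<open>wt_bound\<close>, raising a positive weight by 2 leaves the range of weights,
  so such vectors are highest weight vectors and \<open>E F\<close> acts by the weight.\<close>

lemma G_pos:
  assumes x: "x \<in> G m" "m > 0"
  shows "E x = 0" and "E (F x) = of_int m *\<^sub>p x"
proof -
  show "E x = 0" using G_zero[OF E_G[OF x(1)]] x(2) by simp
  then show "E (F x) = of_int m *\<^sub>p x" using EF[OF x(1)] by (simp add: F_linear)
qed

lemma G_neg:
  assumes x: "x \<in> G m" "m < 0"
  shows "F x = 0" and "F (E x) = of_int (- m) *\<^sub>p x"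
proof -
  show "F x = 0" using G_zero[OF F_G[OF x(1)]] x(2) by simp
  then have "F (E x) + of_int m *\<^sub>p x = 0" using EF[OF x(1)] by (simp add: E_linear)
  then show "F (E x) = of_int (- m) *\<^sub>p x" by (simp add: eq_neg_iff_add_eq_0)
qed

text \<open>\<open>F E\<close> is 2 on weight -2, and \<open>E\<close> commutes with
  \<open>F\<close> on weight 0; applying \<open>F\<close> twice after \<open>E E\<close> therefore
  gives 2 times 2. In characteristic 3 this factor is 1.\<close>

lemma G_neg2:
  assumes x: "x \<in> G (- 2)"
  shows "F (F (E (E x))) = 4 *\<^sub>p x" and "F (E (E x)) = 2 *\<^sub>p E x"
proof -
  have e: "E x \<in> G 0" using E_G[OF x] by simp
  have "F (E (E x)) = E (F (E x))" using EF[OF e] by simp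
  also have "\<dots> = 2 *\<^sub>p E x" using G_neg(2)[OF x] by (simp add: E_linear)
  finally show "F (E (E x)) = 2 *\<^sub>p E x" .
  then show "F (F (E (E x))) = 4 *\<^sub>p x" using G_neg(2)[OF x] by (simp add: F_linear)
qed

lemma G_pos2:
  assumes x: "x \<in> G 2"
  shows "E (E (F (F x))) = 4 *\<^sub>p x"
proof -
  have e: "F x \<in> G 0" using F_G[OF x] by simp
  have "E (F (F x)) = F (E (F x))" using EF[OF e] by simp
  also have "\<dots> = 2 *\<^sub>p F x" using G_pos(2)[OF x] by (simp add: F_linear)
  finally show ?thesis using G_pos(2)[OF x] by (simp add: E_linear)
qed

lemma EEE: "keys x \<subseteq> basis \<Longrightarrow> E (E (E x)) = 0"
proof -
  assume x: "keys x \<subseteq> basis"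
  have "E (E (E (pr m x))) = 0" if "m \<ge> - 2" for m
    using G_zero[OF E_G[OF E_G[OF E_G[OF pr_in[OF x]]]]] that by simp
  then show ?thesis by (subst weight_decomposition[OF x]) (simp add: E_linear)
qed

end

section \<open>The block algebra in characteristic 3\<close>

locale orthogonal_roots_char3 = orthogonal_roots n ip sg al cf b b'
  for n and ip :: "'q :: ab_group_add \<Rightarrow> 'q \<Rightarrow> int" and sg al cf b b' +
  fixes ty :: "'k :: field itself"
  assumes char3: "CHAR('k) = 3"
begin

lemma three: "(3 :: 'k) = 0"
  by (rule three_zero[OF char3])

lemma four: "(4 :: 'k) = 1" and two: "(2 :: 'k) = - 1" "(2 :: 'k) \<noteq> 0"
proof -
  have "(4 :: 'k) = 3 + 1" "(2 :: 'k) = 3 - 1" by simp_all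
  then show "(4 :: 'k) = 1" and *: "(2 :: 'k) = - 1" unfolding three by simp_all
  show "(2 :: 'k) \<noteq> 0" unfolding * by simp
qed

lemma triple: "x + x + x = (0 :: 'i \<Rightarrow>\<^sub>0 'k)"
proof -
  have "x + x + x = (1 + 1 + 1) *\<^sub>p x" by (simp only: pm.scale_left_distrib pm.scale_one)
  also have "(1 + 1 + 1 :: 'k) = 0" using three by simp
  finally show ?thesis by (simp only: pm.scale_zero_left)
qed

text \<open>\<open>F E\<close> on weight -1 and \<open>F F E E\<close> on weight -2 are scalars
  equal to 1, so \<open>F\<close> and \<open>F F\<close> are left inverses.\<close>

lemma E_injective:
  fixes x :: "'q lattice_index \<Rightarrow>\<^sub>0 'k"
  shows "x \<in> G (- 1) \<Longrightarrow> E x = 0 \<Longrightarrow> x = 0" "x \<in> G (- 2) \<Longrightarrow> E (E x) = 0 \<Longrightarrow> x = 0"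
  using G_neg(2)[of x "- 1"] G_neg2(1)[of x] four by (auto simp: F_linear)

definition C0 :: "('q lattice_index \<Rightarrow>\<^sub>0 'k) set" where "C0 = {x \<in> G 0. E x = 0}"
abbreviation C1 :: "('q lattice_index \<Rightarrow>\<^sub>0 'k) set" where "C1 \<equiv> G (- 1)"

text \<open>\<open>C0\<close> and \<open>C1\<close> are spanned by tops of Jordan blocks of \<open>E\<close> of sizes 1 and 2; they form a
  subalgebra that maps isomorphically onto the semisimplification.\<close>

definition s :: "('q lattice_index \<Rightarrow>\<^sub>0 'k) \<Rightarrow> ('q lattice_index \<Rightarrow>\<^sub>0 'k) \<Rightarrow> ('q lattice_index \<Rightarrow>\<^sub>0 'k)" where
  "s y z = bk (E y) z - bk y (E z)"

definition cmul where
  "cmul = (\<lambda>(x, y) (x', y'). (bk x x' + s y y', bk x y' + bk y x'))"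

definition cscale :: "'k \<Rightarrow> ('q lattice_index \<Rightarrow>\<^sub>0 'k) \<times> ('q lattice_index \<Rightarrow>\<^sub>0 'k) \<Rightarrow> ('q lattice_index \<Rightarrow>\<^sub>0 'k) \<times> ('q lattice_index \<Rightarrow>\<^sub>0 'k)" where
  "cscale c = (\<lambda>(x, y). (c *\<^sub>p x, c *\<^sub>p y))"

definition block_algebra :: "('k, ('q lattice_index \<Rightarrow>\<^sub>0 'k) \<times> ('q lattice_index \<Rightarrow>\<^sub>0 'k)) superalgebra" where
  "block_algebra = \<lparr>carrier = C0 \<times> C1, mult = cmul, one = undefined, zero = 0, add = (+), smult = cscale,
     part = (\<lambda>i. if i = 0 then C0 \<times> {0} else {0} \<times> C1)\<rparr>"

lemma block_algebra_simps [simp]: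
  "carrier block_algebra = C0 \<times> C1" "mult block_algebra = cmul" "\<zero>\<^bsub>block_algebra\<^esub> = 0"
  "add block_algebra = (+)" "smult block_algebra = cscale"
  "part block_algebra i = (if i = 0 then C0 \<times> {0} else {0} \<times> C1)"
  by (simp_all add: block_algebra_def)

lemma cscale_vector_space: "Vector_Spaces.vector_space cscale"
  by unfold_locales
     (auto simp: cscale_def pm.scale_right_distrib pm.scale_left_distrib split: prod.splits)

lemma C0_iff: "x \<in> C0 \<longleftrightarrow> x \<in> G 0 \<and> E x = 0"
  by (simp add: C0_def)

lemma bk_G: "x \<in> G q \<Longrightarrow> y \<in> G r \<Longrightarrow> bk x y \<in> G (q + r)"
  by (rule bk_component[OF wt_add])

lemma EE_C1: "y \<in> C1 \<Longrightarrow> E (E y) = 0"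
  using G_zero[OF E_G[OF E_G]] by fastforce

text \<open>Applying the derivation \<open>E\<close> gives [E y, E z] - [E y, E z], since
  \<open>E E\<close> vanishes on weight -1.\<close>

lemma s_C0: assumes "y \<in> C1" "z \<in> C1" shows "s y z \<in> C0"
proof -
  have "E y \<in> G 1" "E z \<in> G 1" using E_G[OF assms(1)] E_G[OF assms(2)] by simp_all
  then have "s y z \<in> G 0" using bk_G[of "E y" 1 z "- 1"] bk_G[of y "- 1" "E z" 1] assms
    by (simp add: s_def pm_component_closed)
  then show ?thesis using EE_C1 assms by (simp add: C0_iff s_def E_linear E_deriv)
qed

lemma C_closed:
  "x \<in> C0 \<Longrightarrow> x' \<in> C0 \<Longrightarrow> bk x x' \<in> C0"
  "x \<in> C0 \<Longrightarrow> y \<in> C1 \<Longrightarrow> bk x y \<in> C1"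
  "x \<in> C0 \<Longrightarrow> y \<in> C1 \<Longrightarrow> bk y x \<in> C1"
  using bk_G[of x 0 x' 0] bk_G[of x 0 y "- 1"] bk_G[of y "- 1" x 0] by (simp_all add: C0_iff E_deriv)

lemma C0_linear: "0 \<in> C0" "x \<in> C0 \<Longrightarrow> y \<in> C0 \<Longrightarrow> x + y \<in> C0" "x \<in> C0 \<Longrightarrow> c *\<^sub>p x \<in> C0"
  by (simp_all add: C0_iff pm_component_closed E_linear)

lemma C1_linear: "0 \<in> C1" "x \<in> C1 \<Longrightarrow> y \<in> C1 \<Longrightarrow> x + y \<in> C1" "x \<in> C1 \<Longrightarrow> c *\<^sub>p x \<in> C1"
  by (simp_all add: pm_component_closed)

lemma s_linear: "s (x + x') y = s x y + s x' y" "s y (x + x') = s y x + s y x'"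
  "s (c *\<^sub>p x) y = c *\<^sub>p s x y" "s y (c *\<^sub>p x) = c *\<^sub>p s y x" "s 0 y = 0" "s y 0 = 0"
  by (simp_all add: s_def E_linear bilin_ext_linear pm.scale_right_diff_distrib)

lemma s_commute: "s y z = s z y"
  unfolding s_def using bk_skew[of "E y" z] bk_skew[of y "E z"] by simp

text \<open>Brackets of three elements of \<open>C1\<close> would have weight -3, hence vanish.
  Applying the derivation \<open>E\<close> to them gives two linear relations, and modulo these the
  defect of the identity is a sum of terms repeated three times, which is 0 in characteristic
  3.\<close>

lemma s_jacobi:
  assumes "x \<in> C1" "y \<in> C1" "z \<in> C1"
  shows "bk x (s y z) = bk (s x y) z - bk y (s x z)"
proof -
  have E0: "E (bk u (bk v w)) = 0" if "u \<in> C1" "v \<in> C1" "w \<in> C1" for u v w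
    using G_zero[OF bk_G[OF that(1) bk_G[OF that(2,3)]]] by (simp add: E_linear)
  have 1: "bk (E x) (bk y z) + bk x (bk (E y) z) + bk x (bk y (E z)) = 0"
    using E0[OF assms] by (simp add: E_deriv bilin_ext_linear add_ac)
  have 2: "bk (E y) (bk x z) + bk y (bk (E x) z) + bk y (bk x (E z)) = 0"
    using E0[OF assms(2,1,3)] by (simp add: E_deriv bilin_ext_linear add_ac)
  have j1: "bk (bk (E x) y) z = bk (E x) (bk y z) - bk y (bk (E x) z)"
    and j2: "bk (bk x (E y)) z = bk x (bk (E y) z) - bk (E y) (bk x z)"
    using jacobi'[of "E x" y z] jacobi'[of x "E y" z] by simp_all
  have "bk x (s y z) - (bk (s x y) z - bk y (s x z)) =
      (bk x (bk (E y) z) + bk x (bk (E y) z) + bk x (bk (E y) z)) +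
      (bk y (bk (E x) z) + bk y (bk (E x) z) + bk y (bk (E x) z)) -
      (bk (E x) (bk y z) + bk x (bk (E y) z) + bk x (bk y (E z))) -
      (bk (E y) (bk x z) + bk y (bk (E x) z) + bk y (bk x (E z)))"
    by (simp add: s_def bilin_ext_linear j1 j2 algebra_simps)
  then show ?thesis unfolding 1 2 triple by simp
qed

text \<open>Polarizing, the mixed terms of y to [y, s y y] cancel by \<open>s_jacobi\<close>, so
  this cubic map is additive and it suffices to treat multiples of root vectors. There already
  \<open>s y y\<close> vanishes, because no root can be added twice to a root other than its
  negative.\<close>

lemma s_cube: assumes "y \<in> C1" shows "bk y (s y y) = 0"
proof -
  have add: "bk (x + y) (s (x + y) (x + y)) = bk x (s x x) + bk y (s y y)" if "x \<in> C1" "y \<in> C1" for x y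
  proof -
    have J: "bk u (s u v) + bk u (s u v) + bk v (s u u) = 0" if "u \<in> C1" "v \<in> C1" for u v
      using s_jacobi[OF that(1,1,2)] bk_skew[of "s u u" v] by (simp add: algebra_simps)
    have "bk (x + y) (s (x + y) (x + y)) = bk x (s x x) + bk y (s y y) +
        (bk x (s x y) + bk x (s x y) + bk y (s x x)) + (bk y (s y x) + bk y (s y x) + bk x (s y y))"
      by (simp add: s_linear bilin_ext_linear s_commute[of y x] algebra_simps)
    then show ?thesis using J that by simp
  qed
  have "keys y \<subseteq> {t \<in> basis. index_degree wt t = - 1}" using assms by (simp add: pm_component_def)
  then have "y \<in> C1 \<and> bk y (s y y) = 0"
  proof (induction rule: pm_induct)
    case zero
    then show ?case by (simp add: pm_component_closed)
  next
    case (single c t)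
    then obtain a where a: "t = R a" "ip a a = 2" "wt a = - 1" by (auto simp: basis_def)
    have n: "ip b a \<noteq> - 2" "ip b' a \<noteq> - 2"
    proof -
      have "a = - b" if "ip b a = - 2"
        using root_sum(2)[OF b a(2)] that by (simp add: eq_neg_iff_add_eq_0 add.commute)
      then show "ip b a \<noteq> - 2" using a b orth' by (auto simp: wt_def)
      have "a = - b'" if "ip b' a = - 2"
        using root_sum(2)[OF b' a(2)] that by (simp add: eq_neg_iff_add_eq_0 add.commute)
      then show "ip b' a \<noteq> - 2" using a b' orth by (auto simp: wt_def)
    qed
    \<comment> \<open>If d + a is a root, it pairs to 1 with a, so a cannot be added a second
      time.\<close>
    have z: "bk (bk (rt d) (rt a)) (rt a) = (0 :: 'q lattice_index \<Rightarrow>\<^sub>0 'k)"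
      if "ip d d = 2" "ip d a \<noteq> - 2" for d
    proof (cases "ip d a = - 1")
      case True
      then have "ip (d + a) (d + a) = 2" "ip (d + a) a = 1"
        using root_sum(1)[OF that(1) a(2)] a(2) by (simp_all add: ip_add)
      then show ?thesis using that a True by (simp add: bk_rt bilin_ext_linear)
    qed (use that a in \<open>simp add: bk_rt\<close>)
    have "bk (E (rt a)) (rt a) = (0 :: 'q lattice_index \<Rightarrow>\<^sub>0 'k)"
      using z[OF b n(1)] z[OF b' n(2)] by (simp add: E_def bilin_ext_linear)
    then have "s (rt a) (rt a) = (0 :: 'q lattice_index \<Rightarrow>\<^sub>0 'k)"
      using bk_skew[of "rt a :: 'q lattice_index \<Rightarrow>\<^sub>0 'k" "E (rt a)"] by (simp add: s_def)
    then have "bk (c *\<^sub>p rt a) (s (c *\<^sub>p rt a) (c *\<^sub>p rt a)) = (0 :: 'q lattice_index \<Rightarrow>\<^sub>0 'k)"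
      by (simp add: s_linear bilin_ext_linear)
    moreover have "rt a \<in> C1" using rt_component[OF a(2), of wt] a(3) by simp
    then have "c *\<^sub>p rt a \<in> C1" by (rule pm_component_closed)
    ultimately show ?case using a(1) by (simp add: single_R)
  next
    case (add x y)
    then show ?case using \<open>\<And>y x. x \<in> C1 \<Longrightarrow> y \<in> C1 \<Longrightarrow> _\<close> by (simp add: pm_component_closed)
  qed
  then show ?thesis ..
qed

lemma block_algebra_vectorspace: "vectorspace class_ring block_algebra"
  and block_algebra_minus: "p \<in> C0 \<times> C1 \<Longrightarrow> q \<in> C0 \<times> C1 \<Longrightarrow> p \<ominus>\<^bsub>block_algebra\<^esub> q = p - q"
  using vectorspace_of_scale[OF cscale_vector_space, of block_algebra] C0_linear C1_linear
  by (auto simp: cscale_def zero_prod_def)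

lemma cmul_closed: "p \<in> C0 \<times> C1 \<Longrightarrow> q \<in> C0 \<times> C1 \<Longrightarrow> cmul p q \<in> C0 \<times> C1"
  using C_closed s_C0 C0_linear C1_linear by (auto simp: cmul_def)

lemma block_algebra_lie: "lie_superalgebra block_algebra"
proof (rule lie_superalgebra.intro)
  show "vectorspace class_ring block_algebra" by (rule block_algebra_vectorspace)
  show "subspace class_ring (part block_algebra i) block_algebra" for i
    using block_algebra_vectorspace C0_linear C1_linear
    by (auto simp: subspace_iff cscale_def zero_prod_def)
  show "\<exists>!p. p \<in> part block_algebra 0 \<times> part block_algebra 1 \<and> x = fst p \<oplus>\<^bsub>block_algebra\<^esub> snd p"
    if "x \<in> carrier block_algebra" for x
    using that by (intro ex1I[of _ "((fst x, 0), (0, snd x))"]) (auto simp: C0_linear C1_linear)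
  show "x \<otimes>\<^bsub>block_algebra\<^esub> y \<in> part block_algebra (i + j)"
    if "x \<in> part block_algebra i" "y \<in> part block_algebra j" for x y i j
    using that C_closed s_C0
    by (cases i; cases j) (auto simp: cmul_def s_linear C0_linear C1_linear)
  show "(\<lambda>y. x \<otimes>\<^bsub>block_algebra\<^esub> y) \<in> module_hom class_ring block_algebra block_algebra"
    if "x \<in> carrier block_algebra" for x
    unfolding module_hom_iff using that cmul_closed
    by (auto simp: cmul_def cscale_def s_linear bilin_ext_linear pm.scale_right_distrib add_ac)
  show "(\<lambda>x. x \<otimes>\<^bsub>block_algebra\<^esub> y) \<in> module_hom class_ring block_algebra block_algebra"
    if "y \<in> carrier block_algebra" for y
    unfolding module_hom_iff using that cmul_closed
    by (auto simp: cmul_def cscale_def s_linear bilin_ext_linear pm.scale_right_distrib add_ac)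
  show "lie_identities block_algebra \<subseteq> {\<zero>\<^bsub>block_algebra\<^esub>}"
  proof
    fix w assume "w \<in> lie_identities block_algebra"
    then show "w \<in> {\<zero>\<^bsub>block_algebra\<^esub>}"
      unfolding lie_identities_def
    proof (elim UnE CollectE exE conjE, goal_cases)
      case (1 i j p q)
      then show ?case
        using bk_skew[of "fst p" "fst q"] bk_skew[of "fst p" "snd q"] bk_skew[of "snd p" "fst q"] s_commute[of "snd p" "snd q"]
        by (cases i; cases j)
           (auto simp: cmul_def cscale_def ksign_def s_linear bilin_ext_linear zero_prod_def)
    next
      case (2 i j p q r)
      obtain p0 p1 q0 q1 r0 r1 where pqr: "p = (p0, p1)" "q = (q0, q1)" "r = (r0, r1)"
        by (cases p; cases q; cases r)
      have sub: "part block_algebra i \<subseteq> C0 \<times> C1" for i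
        using C0_linear(1) C1_linear(1) by auto
      have c: "p \<in> C0 \<times> C1" "q \<in> C0 \<times> C1" "r \<in> C0 \<times> C1" using 2 sub by auto
      have sc: "cscale k t \<in> C0 \<times> C1" if "t \<in> C0 \<times> C1" for k t
        using that by (auto simp: cscale_def C0_linear C1_linear)
      have add: "t + u \<in> C0 \<times> C1" if "t \<in> C0 \<times> C1" "u \<in> C0 \<times> C1" for t u
        using that by (auto simp: C0_linear C1_linear)
      have w: "w = cmul p (cmul q r) - (cmul (cmul p q) r + cscale (ksign i j) (cmul q (cmul p r)))"
        using 2(1) block_algebra_minus[OF cmul_closed[OF c(1) cmul_closed[OF c(2,3)]]
          add[OF cmul_closed[OF cmul_closed[OF c(1,2)] c(3)] sc[OF cmul_closed[OF c(2) cmul_closed[OF c(1,3)]]]]]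
        by simp
      have E0: "E p0 = 0" "E q0 = 0" "E r0 = 0" using c by (auto simp: pqr C0_iff)
      \<comment> \<open>The first two arguments are homogeneous, the third is arbitrary. Only the
        bracket of three odd elements needs \<open>s_jacobi\<close>; the remaining cases follow from
        the ordinary Jacobi identity and the derivation property, \<open>E\<close> being zero on the
        even part.\<close>
      consider "i = 0" "p1 = 0" "j = 0" "q1 = 0" | "i = 0" "p1 = 0" "j = 1" "q0 = 0"
        | "i = 1" "p0 = 0" "j = 0" "q1 = 0" | "i = 1" "p0 = 0" "j = 1" "q0 = 0"
        using 2(2,3) by (cases i; cases j) (auto simp: pqr)
      then have "w = 0"
      proof cases
        case 1
        then show ?thesis
          using jacobi'[of p0 q0 r0] jacobi'[of p0 q0 r1]
          by (simp add: w pqr cmul_def cscale_def ksign_def s_linear bilin_ext_linear zero_prod_def)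
      next
        case 2
        then show ?thesis
          using jacobi'[of p0 q1 r0] jacobi'[of p0 "E q1" r1] jacobi'[of p0 q1 "E r1"]
          by (simp add: w pqr cmul_def cscale_def ksign_def s_def E_linear E_deriv E0 bilin_ext_linear zero_prod_def)
      next
        case 3
        then show ?thesis
          using jacobi'[of p1 q0 r0] jacobi'[of "E p1" q0 r1] jacobi'[of p1 q0 "E r1"]
          by (simp add: w pqr cmul_def cscale_def ksign_def s_def E_linear E_deriv E0 bilin_ext_linear zero_prod_def)
      next
        case 4
        have "bk p1 (s q1 r1) = bk (s p1 q1) r1 - bk q1 (s p1 r1)"
          using c 4 by (intro s_jacobi) (auto simp: pqr)
        then show ?thesis
          using 4 jacobi'[of "E p1" q1 r0] jacobi'[of p1 "E q1" r0]
          by (simp add: w pqr cmul_def cscale_def ksign_def zero_prod_def E0 s_linear bilin_ext_linear)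
             (simp add: s_def E_deriv E0 bilin_ext_linear)
      qed
      then show ?case by simp
    next
      case (3 p)
      then have "p \<in> {0} \<times> C1" by simp
      then obtain y where "p = (0, y)" "y \<in> C1" by auto
      then show ?case using 3 s_cube[of y] by (simp add: cmul_def s_linear zero_prod_def)
    qed
  qed
qed

end

section \<open>Transport of structure and the weight filtration\<close>

text \<open>All axioms are equations, so an injective map respecting the operations reflects them.
  The map need not be onto, which allows a target larger than the structure to be verified.\<close>

lemma nonassoc_algebra_transport:
  fixes f :: "'a \<Rightarrow> 'b"
  assumes M: "nonassoc_algebra M" and inj: "inj_on f (carrier L)"
    and f: "\<And>x. x \<in> carrier L \<Longrightarrow> f x \<in> carrier M"
    and zero: "\<zero>\<^bsub>L\<^esub> \<in> carrier L" "f \<zero>\<^bsub>L\<^esub> = \<zero>\<^bsub>M\<^esub>"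
    and add: "\<And>x y. x \<in> carrier L \<Longrightarrow> y \<in> carrier L \<Longrightarrow> x \<oplus>\<^bsub>L\<^esub> y \<in> carrier L"
      "\<And>x y. x \<in> carrier L \<Longrightarrow> y \<in> carrier L \<Longrightarrow> f (x \<oplus>\<^bsub>L\<^esub> y) = f x \<oplus>\<^bsub>M\<^esub> f y"
    and smult: "\<And>c x. x \<in> carrier L \<Longrightarrow> c \<odot>\<^bsub>L\<^esub> x \<in> carrier L"
      "\<And>c x. x \<in> carrier L \<Longrightarrow> f (c \<odot>\<^bsub>L\<^esub> x) = c \<odot>\<^bsub>M\<^esub> f x"
    and mult: "\<And>x y. x \<in> carrier L \<Longrightarrow> y \<in> carrier L \<Longrightarrow> x \<otimes>\<^bsub>L\<^esub> y \<in> carrier L"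
      "\<And>x y. x \<in> carrier L \<Longrightarrow> y \<in> carrier L \<Longrightarrow> f (x \<otimes>\<^bsub>L\<^esub> y) = f x \<otimes>\<^bsub>M\<^esub> f y"
  shows "nonassoc_algebra L"
proof -
  interpret M: nonassoc_algebra M by (rule M)
  note closed = zero(1) add(1) smult(1) mult(1)
  note hom = zero(2) add(2) smult(2) mult(2)
  have eq: "x = y" if "f x = f y" "x \<in> carrier L" "y \<in> carrier L" for x y
    using inj that by (auto simp: inj_on_def)
  have g: "abelian_group L"
  proof (rule abelian_groupI)
    fix x assume x: "x \<in> carrier L"
    show "\<exists>y\<in>carrier L. y \<oplus>\<^bsub>L\<^esub> x = \<zero>\<^bsub>L\<^esub>"
    proof (rule bexI)
      show "((- 1) \<odot>\<^bsub>L\<^esub> x) \<oplus>\<^bsub>L\<^esub> x = \<zero>\<^bsub>L\<^esub>"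
        using x f[OF x] by (intro eq) (simp_all add: hom closed M.smult_minus_one M.V.l_neg)
    qed (use x closed in simp)
    show "\<zero>\<^bsub>L\<^esub> \<oplus>\<^bsub>L\<^esub> x = x" using x f[OF x] by (intro eq) (simp_all add: hom closed)
  next
    fix x y z assume x: "x \<in> carrier L" "y \<in> carrier L" "z \<in> carrier L"
    show "(x \<oplus>\<^bsub>L\<^esub> y) \<oplus>\<^bsub>L\<^esub> z = x \<oplus>\<^bsub>L\<^esub> (y \<oplus>\<^bsub>L\<^esub> z)"
      using x f by (intro eq) (simp_all add: hom closed M.V.a_assoc)
  next
    fix x y assume x: "x \<in> carrier L" "y \<in> carrier L"
    show "x \<oplus>\<^bsub>L\<^esub> y = y \<oplus>\<^bsub>L\<^esub> x"
      using x f M.V.a_comm by (intro eq) (simp_all add: hom closed)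
  qed (use closed in auto)
  have "module class_ring L"
    by (rule moduleI[OF domain.axioms(1)[OF field.axioms(1)[OF class_field]] g])
       (auto simp: class_ring_simps closed hom f M.add_smult M.smult_add M.smult_smult intro!: eq)
  then have "vectorspace class_ring L" by (simp add: vectorspace_def class_field)
  then show ?thesis
    by (intro nonassoc_algebra.intro)
       (auto simp: module_hom_iff closed hom f M.br_add_left M.br_add_right M.br_smult_left
          M.br_smult_right intro!: eq)
qed

context orthogonal_roots_char3 begin

text \<open>The filtration by weight. Kernel vectors of \<open>E\<close> and of \<open>E E\<close>
  may have components of higher weight, but only the lowest one matters, and a filtration bounds the
  weights of brackets from below.\<close>

definition high :: "int \<Rightarrow> ('q lattice_index \<Rightarrow>\<^sub>0 'k) set" where
  "high m = {x. keys x \<subseteq> {t \<in> basis. m \<le> index_degree wt t}}"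

lemma high_linear: "x \<in> high m \<Longrightarrow> y \<in> high m \<Longrightarrow> x + y \<in> high m"
  "x \<in> high m \<Longrightarrow> y \<in> high m \<Longrightarrow> x - y \<in> high m"
  by (simp_all add: high_def keys_sub_closed)

lemma high_mono: "x \<in> high m \<Longrightarrow> m' \<le> m \<Longrightarrow> x \<in> high m'"
  by (force simp: high_def)

lemma G_high: "x \<in> G m \<Longrightarrow> x \<in> high m"
  by (auto simp: high_def pm_component_def)

lemma pr_high: "x \<in> high m \<Longrightarrow> j < m \<Longrightarrow> pr j x = 0"
  by (rule poly_mapping_eqI) (force simp: high_def lookup_pm_proj in_keys_iff)

lemma bk_high: "x \<in> high p \<Longrightarrow> y \<in> high q \<Longrightarrow> bk x y \<in> high (p + q)"
proof -
  assume xy: "x \<in> high p" "y \<in> high q"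
  have "keys (bk x y) \<subseteq> {t. p + q \<le> index_degree wt t}"
  proof (rule keys_bilin_ext)
    fix t u assume "t \<in> keys x" "u \<in> keys y"
    then have "p \<le> index_degree wt t" "q \<le> index_degree wt u" using xy by (auto simp: high_def)
    moreover have "index_degree wt v = index_degree wt t + index_degree wt u"
      if "v \<in> keys (br t u :: 'q lattice_index \<Rightarrow>\<^sub>0 'k)" for v
      by (rule index_degree_br[OF wt_add that])
    ultimately show "keys (br t u :: 'q lattice_index \<Rightarrow>\<^sub>0 'k) \<subseteq> {t. p + q \<le> index_degree wt t}"
      by fastforce
  qed
  then show ?thesis using keys_bk[of x y] by (auto simp: high_def)
qed

lemma high_split: "x \<in> high m \<Longrightarrow> x - pr m x \<in> high (m + 1)"
proof -
  assume x: "x \<in> high m"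
  have "keys (x - pr m x) \<subseteq> {t \<in> keys x. index_degree wt t \<noteq> m}"
    by (auto simp: in_keys_iff lookup_minus lookup_pm_proj split: if_splits)
  then show ?thesis using x by (fastforce simp: high_def)
qed

text \<open>Passing to lowest components is multiplicative, as in an associated graded algebra: any
  factor of higher filtration pushes the bracket beyond weight p + q.\<close>

lemma pr_bk:
  assumes "x \<in> high p" "y \<in> high q"
  shows "pr (p + q) (bk x y) = bk (pr p x) (pr q y)"
proof -
  have p: "pr p x \<in> G p" "pr q y \<in> G q" using assms by (auto simp: high_def intro!: pr_in)
  have eq: "bk x y = bk (pr p x) (pr q y) + (bk (pr p x) (y - pr q y) + bk (x - pr p x) y)"
    by (simp add: bilin_ext_linear)
  have "bk (pr p x) (y - pr q y) + bk (x - pr p x) y \<in> high (p + q + 1)"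
    using bk_high[OF G_high[OF p(1)] high_split[OF assms(2)]] bk_high[OF high_split[OF assms(1)] assms(2)]
    by (intro high_linear) (simp_all add: add_ac)
  then have "pr (p + q) (bk (pr p x) (y - pr q y) + bk (x - pr p x) y) = 0"
    by (rule pr_high) simp
  moreover have "pr (p + q) (bk (pr p x) (pr q y)) = bk (pr p x) (pr q y)"
    using pr_G[OF bk_G[OF p]] by simp
  ultimately show ?thesis unfolding eq pm_proj_linear(1) by simp
qed

text \<open>\<open>E\<close> preserves the grading up to a shift, so a kernel condition holds for
  each weight component, and injectivity on weights -2 and -1 removes the low components.\<close>

lemma ker_high:
  fixes x :: "'q lattice_index \<Rightarrow>\<^sub>0 'k"
  assumes x: "keys x \<subseteq> basis"
  shows "E x = 0 \<Longrightarrow> x \<in> high 0" "E (E x) = 0 \<Longrightarrow> x \<in> high (- 1)"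
proof -
  have d: "x = pr (- 2) x + pr (- 1) x + pr 0 x + pr 1 x + pr 2 x" by (rule weight_decomposition[OF x])
  have "pr j x \<in> high 0" if "j \<ge> 0" for j
    by (rule high_mono[OF G_high[OF pr_in[OF x]] that])
  then have hi: "pr 0 x + pr 1 x + pr 2 x \<in> high 0"
    by (intro high_linear) simp_all
  have n: "pr (- 2) x = 0" if "E (E x) = 0"
    using E_injective(2)[OF pr_in[OF x]] pr_E[OF x, of "- 2"] pr_E[of "E x" 0] that E_basis(1)[of x]
    by (simp add: pm_proj_linear)
  show "x \<in> high 0" if "E x = 0"
  proof -
    have "pr (- 1) x = 0"
      using E_injective(1)[OF pr_in[OF x]] pr_E[OF x, of "- 1"] that by (simp add: pm_proj_linear)
    then show ?thesis using d hi n that by (simp add: E_linear)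
  qed
  show "x \<in> high (- 1)" if "E (E x) = 0"
  proof -
    have "pr (- 1) x + (pr 0 x + pr 1 x + pr 2 x) \<in> high (- 1)"
      by (rule high_linear(1)[OF G_high[OF pr_in[OF x]] high_mono[OF hi]]) simp
    then show ?thesis using d n that by (simp add: add.assoc)
  qed
qed

lemma E_high: "x \<in> high m \<Longrightarrow> E x \<in> high (m + 2)"
proof -
  assume x: "x \<in> high m"
  have "wt b = 2" "wt b' = 2" using b b' orth orth' by (simp_all add: wt_def)
  then have "rt b + rt b' \<in> high 2"
    using rt_component[OF b, of wt] rt_component[OF b', of wt] by (intro high_linear G_high) simp_all
  from bk_high[OF this x] show ?thesis by (simp add: E_def add.commute)
qed

lemma pr_E': "keys x \<subseteq> basis \<Longrightarrow> pr m (E x) = E (pr (m - 2) x)"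
  using pr_E[of x "m - 2"] by simp

end

section \<open>The semisimplification of a copy of the lattice algebra\<close>

text \<open>The contragredient algebra is known only up to isomorphism, so its semisimplification is
  computed for any algebra \<open>L\<close> with an isomorphism \<Phi> to the lattice algebra that
  carries z to the sum of the two root vectors.\<close>

locale alpha3_model = orthogonal_roots_char3 n ip sg al cf b b' ty + L: lie_superalgebra L
  for n and ip :: "'q :: ab_group_add \<Rightarrow> 'q \<Rightarrow> int" and sg al cf b b' and ty :: "'k :: field itself"
    and L :: "('k, 'a, 'm) superalgebra_scheme" +
  fixes \<Phi> and z
  assumes iso: "\<Phi> \<in> lie_superalgebra_iso L lattice_algebra"
    and z: "z \<in> carrier L" and \<Phi>_z: "\<Phi> z = rt b + rt b'" and finite_basis: "finite basis"
begin

sublocale nonassoc_algebra L by (rule L.is_nonassoc_algebra)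

definition d where "d y = z \<otimes>\<^bsub>L\<^esub> y"

lemma \<Phi>_keys: "x \<in> carrier L \<Longrightarrow> keys (\<Phi> x) \<subseteq> basis"
  and \<Phi>_add: "x \<in> carrier L \<Longrightarrow> y \<in> carrier L \<Longrightarrow> \<Phi> (x \<oplus>\<^bsub>L\<^esub> y) = \<Phi> x + \<Phi> y"
  and \<Phi>_smult: "x \<in> carrier L \<Longrightarrow> \<Phi> (c \<odot>\<^bsub>L\<^esub> x) = c *\<^sub>p \<Phi> x"
  and \<Phi>_br: "x \<in> carrier L \<Longrightarrow> y \<in> carrier L \<Longrightarrow> \<Phi> (x \<otimes>\<^bsub>L\<^esub> y) = bk (\<Phi> x) (\<Phi> y)"
  and \<Phi>_bij: "bij_betw \<Phi> (carrier L) {x. keys x \<subseteq> basis}"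
  using iso by (auto simp: lie_superalgebra_iso_def module_hom_iff)

lemma \<Phi>_eq: "x \<in> carrier L \<Longrightarrow> y \<in> carrier L \<Longrightarrow> \<Phi> x = \<Phi> y \<Longrightarrow> x = y"
  using \<Phi>_bij by (auto simp: bij_betw_def inj_on_def)

lemma \<Phi>_onto: "keys x \<subseteq> basis \<Longrightarrow> \<exists>u\<in>carrier L. \<Phi> u = x"
  using \<Phi>_bij by (auto simp: bij_betw_def image_iff) (metis (mono_tags, lifting) imageE mem_Collect_eq)

lemma \<Phi>_zero [simp]: "\<Phi> \<zero>\<^bsub>L\<^esub> = 0"
  using \<Phi>_smult[of "\<zero>\<^bsub>L\<^esub>" 0] by simp

lemma \<Phi>_minus: "x \<in> carrier L \<Longrightarrow> y \<in> carrier L \<Longrightarrow> \<Phi> (x \<ominus>\<^bsub>L\<^esub> y) = \<Phi> x - \<Phi> y"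
  by (simp add: a_minus_def \<Phi>_add \<Phi>_smult flip: smult_minus_one)

lemma d_closed [simp]: "x \<in> carrier L \<Longrightarrow> d x \<in> carrier L"
  using z by (simp add: d_def)

lemma \<Phi>_d [simp]: "x \<in> carrier L \<Longrightarrow> \<Phi> (d x) = E (\<Phi> x)"
  using z by (simp add: d_def \<Phi>_br \<Phi>_z E_def)

lemma d_hom: "d \<in> module_hom class_ring L L"
  using br_left[OF z] by (simp add: d_def[abs_def])

lemma zero_iff: "x \<in> carrier L \<Longrightarrow> x = \<zero>\<^bsub>L\<^esub> \<longleftrightarrow> \<Phi> x = 0"
  using \<Phi>_eq[of x "\<zero>\<^bsub>L\<^esub>"] by auto

lemma d_zero_iff: "x \<in> carrier L \<Longrightarrow> d x = \<zero>\<^bsub>L\<^esub> \<longleftrightarrow> E (\<Phi> x) = 0"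
  "x \<in> carrier L \<Longrightarrow> d (d x) = \<zero>\<^bsub>L\<^esub> \<longleftrightarrow> E (E (\<Phi> x)) = 0"
  using zero_iff[of "d x"] zero_iff[of "d (d x)"] by simp_all

lemma \<Phi>_finsum: "finite A \<Longrightarrow> (\<And>i. i \<in> A \<Longrightarrow> v i \<in> carrier L) \<Longrightarrow> \<Phi> (\<Oplus>\<^bsub>L\<^esub>i\<in>A. v i) = (\<Sum>i\<in>A. \<Phi> (v i))"
proof (induction A rule: finite_induct)
  case (insert i A)
  then have "v \<in> A \<rightarrow> carrier L" by auto
  then show ?case using insert by (simp add: V.finsum_insert \<Phi>_add)
qed simp

text \<open>The trace criteria need some pair of dual bases; the coordinates with respect to
  \<open>basis\<close>, pulled back along \<Phi>, provide one.\<close>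

lemma dual_bases_exist: "\<exists>N v \<phi>. dual_bases L N v \<phi>"
proof -
  obtain g where g: "bij_betw g {..<card basis} basis"
    using ex_bij_betw_nat_finite[OF finite_basis] by (auto simp: atLeast0LessThan)
  have gb: "g i \<in> basis" if "i < card basis" for i using g that by (auto simp: bij_betw_def)
  have "\<exists>u. i < card basis \<longrightarrow> u \<in> carrier L \<and> \<Phi> u = single (g i) 1" for i
    using \<Phi>_onto[of "single (g i) 1"] gb by auto
  then obtain v where v: "\<And>i. i < card basis \<Longrightarrow> v i \<in> carrier L \<and> \<Phi> (v i) = single (g i) 1" by metis
  have "dual_bases L (card basis) v (\<lambda>i x. lookup (\<Phi> x) (g i))"
    unfolding dual_bases_def
  proof (intro conjI allI impI ballI)
    show "v i \<in> carrier L" if "i < card basis" for i using v that by blast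
    show "linear_form L (\<lambda>x. lookup (\<Phi> x) (g i))" for i
      by (simp add: linear_form_def \<Phi>_add \<Phi>_smult lookup_add)
    show "lookup (\<Phi> (v j)) (g i) = (if i = j then 1 else 0)" if "i < card basis" "j < card basis" for i j
      using that v g by (auto simp: lookup_single when_def bij_betw_def inj_on_def)
    show "x = (\<Oplus>\<^bsub>L\<^esub>i\<in>{..<card basis}. lookup (\<Phi> x) (g i) \<odot>\<^bsub>L\<^esub> v i)" if x: "x \<in> carrier L" for x
    proof (rule \<Phi>_eq[OF x])
      show "(\<Oplus>\<^bsub>L\<^esub>i\<in>{..<card basis}. lookup (\<Phi> x) (g i) \<odot>\<^bsub>L\<^esub> v i) \<in> carrier L"
        using v by (intro V.finsum_closed) auto
      have "\<Phi> (\<Oplus>\<^bsub>L\<^esub>i\<in>{..<card basis}. lookup (\<Phi> x) (g i) \<odot>\<^bsub>L\<^esub> v i) =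
          (\<Sum>i<card basis. single (g i) (lookup (\<Phi> x) (g i)))"
        using v by (subst \<Phi>_finsum) (auto simp: \<Phi>_smult)
      also have "\<dots> = (\<Sum>t\<in>basis. single t (lookup (\<Phi> x) t))"
        by (rule sum.reindex_bij_betw[OF g])
      also have "\<dots> = (\<Sum>t\<in>keys (\<Phi> x). single t (lookup (\<Phi> x) t))"
        using finite_basis \<Phi>_keys[OF x] by (intro sum.mono_neutral_right) (auto simp: in_keys_iff)
      also have "\<dots> = \<Phi> x" by (rule poly_mapping_sum_single[symmetric])
      finally show "\<Phi> x = \<Phi> (\<Oplus>\<^bsub>L\<^esub>i\<in>{..<card basis}. lookup (\<Phi> x) (g i) \<odot>\<^bsub>L\<^esub> v i)" by simp
    qed
  qed
  then show ?thesis by blast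
qed

lemma finite_dimensional: "V.fin_dim"
proof -
  have "\<forall>t\<in>basis. \<exists>u\<in>carrier L. \<Phi> u = single t 1"
    using \<Phi>_onto by simp
  then obtain v where v: "\<And>t. t \<in> basis \<Longrightarrow> v t \<in> carrier L \<and> \<Phi> (v t) = single t 1"
    by metis
  have sub: "v ` basis \<subseteq> carrier L" using v by blast
  interpret sp: submodule class_ring "V.span (v ` basis)" L by (rule V.span_is_submodule[OF sub])
  have "\<exists>u\<in>V.span (v ` basis). \<Phi> u = y" if "keys y \<subseteq> basis" for y
    using that
  proof (induction rule: pm_induct)
    case zero
    then show ?case using sp.zero_closed by (intro bexI[of _ "\<zero>\<^bsub>L\<^esub>"]) auto
  next
    case (single c t)
    have "v t \<in> V.span (v ` basis)" using V.in_own_span[OF sub] single by blast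
    then have "c \<odot>\<^bsub>L\<^esub> v t \<in> V.span (v ` basis)" using sp.smult_closed by (simp add: class_ring_simps)
    then show ?case using v[OF single] by (intro bexI[of _ "c \<odot>\<^bsub>L\<^esub> v t"]) (simp add: \<Phi>_smult)
  next
    case (add x y)
    then obtain u w where "u \<in> V.span (v ` basis)" "\<Phi> u = x" "w \<in> V.span (v ` basis)" "\<Phi> w = y" by blast
    then show ?case using sp.m_closed sp.subset by (intro bexI[of _ "u \<oplus>\<^bsub>L\<^esub> w"]) (auto simp: \<Phi>_add subset_iff)
  qed
  note onto = this
  have "carrier L \<subseteq> V.span (v ` basis)"
  proof
    fix x assume x: "x \<in> carrier L"
    obtain u where u: "u \<in> V.span (v ` basis)" "\<Phi> u = \<Phi> x" using onto[OF \<Phi>_keys[OF x]] by blast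
    have "u = x" by (rule \<Phi>_eq[OF subsetD[OF sp.subset u(1)] x u(2)])
    then show "x \<in> V.span (v ` basis)" using u(1) by simp
  qed
  then have "V.span (v ` basis) = carrier L" using sp.subset by blast
  then show ?thesis using finite_basis sub unfolding V.fin_dim_def by blast
qed

lemma alpha3: "alpha3_lie_algebra L d"
  unfolding alpha3_lie_algebra_def alpha3_object_def
proof (intro conjI ballI)
  have sub: "part L 1 \<subseteq> carrier L" "\<zero>\<^bsub>L\<^esub> \<in> part L 1" using L.part_subspace by (simp_all add: subspace_iff)
  have "\<Phi> ` part L 1 = {0}" using iso by (simp add: lie_superalgebra_iso_def)
  then show "part L 1 = {\<zero>\<^bsub>L\<^esub>}" using sub zero_iff by blast
  show "d (d (d x)) = \<zero>\<^bsub>L\<^esub>" if "x \<in> carrier L" for x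
    using that EEE[OF \<Phi>_keys[OF that]] by (simp add: zero_iff)
  show "d (x \<otimes>\<^bsub>L\<^esub> y) = (d x \<otimes>\<^bsub>L\<^esub> y) \<oplus>\<^bsub>L\<^esub> (x \<otimes>\<^bsub>L\<^esub> d y)" if "x \<in> carrier L" "y \<in> carrier L" for x y
    using that by (intro \<Phi>_eq) (simp_all add: \<Phi>_br \<Phi>_add E_deriv)
qed (use L.lie_superalgebra_axioms vs finite_dimensional d_hom in auto)

text \<open>For a kernel vector the criterion asks that every form vanishing on the image of
  \<open>E\<close> kill it. Components of weight 1 and 2 always lie in the image. In weight 0 the
  kernel meets the image only in 0, as an explicit projection shows.\<close>

lemma negligible_1:
  "x \<in> negligible_space L d 1 \<longleftrightarrow> x \<in> carrier L \<and> E (\<Phi> x) = 0 \<and> pr 0 (\<Phi> x) = 0"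
proof -
  obtain N v \<phi> where dual: "dual_bases L N v \<phi>" using dual_bases_exist by blast
  have "(\<forall>l. linear_form L l \<longrightarrow> (\<forall>y\<in>carrier L. l (d y) = 0) \<longrightarrow> l x = 0) \<longleftrightarrow> pr 0 (\<Phi> x) = 0"
    if x: "x \<in> carrier L" "E (\<Phi> x) = 0"
  proof
    let ?x = "\<Phi> x"
    have k: "keys ?x \<subseteq> basis" by (rule \<Phi>_keys[OF x(1)])
    assume "pr 0 ?x = 0"
    moreover have "pr (- 1) ?x = 0" "pr (- 2) ?x = 0" using pr_high[OF ker_high(1)[OF k x(2)]] by simp_all
    ultimately have "?x = pr 1 ?x + pr 2 ?x" using weight_decomposition[OF k] by simp
    \<comment> \<open>\<open>E F\<close> is 1 on weight 1 and 2 = -1 on weight 2, whence the minus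
      sign.\<close>
    moreover have "E (F (pr 1 ?x) - F (pr 2 ?x)) = pr 1 ?x + pr 2 ?x"
      using G_pos(2)[OF pr_in[OF k], of 1] G_pos(2)[OF pr_in[OF k], of 2] by (simp add: E_linear two)
    ultimately have e: "?x = E (F (pr 1 ?x) - F (pr 2 ?x))" by simp
    obtain u where "u \<in> carrier L" "\<Phi> u = F (pr 1 ?x) - F (pr 2 ?x)"
      using \<Phi>_onto[OF keys_sub_closed(2)[OF E_basis(2) E_basis(2)]] by blast
    then have "x = d u" "u \<in> carrier L" using e x by (auto intro!: \<Phi>_eq)
    then show "\<forall>l. linear_form L l \<longrightarrow> (\<forall>y\<in>carrier L. l (d y) = 0) \<longrightarrow> l x = 0" by blast
  next
    assume forms: "\<forall>l. linear_form L l \<longrightarrow> (\<forall>y\<in>carrier L. l (d y) = 0) \<longrightarrow> l x = 0"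
    \<comment> \<open>\<open>1 + E F\<close> projects the weight-0 part onto the kernel of \<open>E\<close> along the image of \<open>E\<close>.\<close>
    define g where "g y = pr 0 y + E (F (pr 0 y))" for y :: "'q lattice_index \<Rightarrow>\<^sub>0 'k"
    have "lookup (g (\<Phi> x)) i = 0" for i
    proof -
      have "linear_form L (\<lambda>u. lookup (g (\<Phi> u)) i)"
        by (simp add: linear_form_def g_def \<Phi>_add \<Phi>_smult pm_proj_linear E_linear F_linear lookup_add distrib_left)
      moreover have "g (E y) = 0" if y: "keys y \<subseteq> basis" for y :: "'q lattice_index \<Rightarrow>\<^sub>0 'k"
      proof -
        have "pr 0 (E y) = E (pr (- 2) y)" using pr_E'[OF y, of 0] by simp
        moreover have "F (E (pr (- 2) y)) = 2 *\<^sub>p pr (- 2) y" using G_neg(2)[OF pr_in[OF y], of "- 2"] by simp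
        ultimately show ?thesis by (simp add: g_def E_linear two)
      qed
      then have "\<forall>y\<in>carrier L. lookup (g (\<Phi> (d y))) i = 0" using \<Phi>_keys by simp
      ultimately show ?thesis using forms by blast
    qed
    then have "g (\<Phi> x) = 0" by (intro poly_mapping_eqI) simp
    \<comment> \<open>On weight 0 the two operators commute, so \<open>E F\<close> vanishes on the
      kernel of \<open>E\<close> and g reduces to the weight 0 component.\<close>
    moreover have "E (pr 0 (\<Phi> x)) = 0" using pr_E[OF \<Phi>_keys[OF x(1)], of 0] x(2) by (simp add: pm_proj_linear)
    then have "E (F (pr 0 (\<Phi> x))) = 0" using EF[OF pr_in[OF \<Phi>_keys[OF x(1)]], of 0] by (simp add: F_linear)
    ultimately show "pr 0 (\<Phi> x) = 0" by (simp add: g_def)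
  qed
  then show ?thesis unfolding negligible_space_1[OF vs dual d_hom] using d_zero_iff(1)[of x] by blast
qed

text \<open>Without a component of weight -1, the image \<open>E x\<close> comes from weight 0 and
  has weight 2, where \<open>E E F F\<close> is 4 = 1; so it lies in the image of
  \<open>E E\<close>. Conversely, coordinates of the weight 1 part are forms vanishing on the image
  of \<open>E E\<close>, since that part would come from weight -3.\<close>

lemma negligible_2:
  "x \<in> negligible_space L d 2 \<longleftrightarrow> x \<in> carrier L \<and> E (E (\<Phi> x)) = 0 \<and> pr (- 1) (\<Phi> x) = 0"
proof -
  obtain N v \<phi> where dual: "dual_bases L N v \<phi>" using dual_bases_exist by blast
  have "(\<forall>l. linear_form L l \<longrightarrow> (\<forall>y\<in>carrier L. l (d (d y)) = 0) \<longrightarrow> l (d x) = 0) \<longleftrightarrow> pr (- 1) (\<Phi> x) = 0"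
    if x: "x \<in> carrier L" "E (E (\<Phi> x)) = 0"
  proof
    let ?x = "\<Phi> x"
    have k: "keys ?x \<subseteq> basis" by (rule \<Phi>_keys[OF x(1)])
    assume "pr (- 1) ?x = 0"
    moreover have "pr (- 2) ?x = 0" using pr_high[OF ker_high(2)[OF k x(2)]] by simp
    ultimately have "?x = pr 0 ?x + pr 1 ?x + pr 2 ?x" using weight_decomposition[OF k] by simp
    then have "E ?x = E (pr 0 ?x + pr 1 ?x + pr 2 ?x)" by simp
    also have "\<dots> = E (pr 0 ?x)"
      using G_pos(1)[OF pr_in[OF k], of 1] G_pos(1)[OF pr_in[OF k], of 2] by (simp add: E_linear)
    finally have e: "E ?x = E (pr 0 ?x)" .
    have "E (pr 0 ?x) \<in> G 2" using E_G[OF pr_in[OF k], of 0] by simp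
    then have "E (E (F (F (E (pr 0 ?x))))) = 4 *\<^sub>p E (pr 0 ?x)" by (rule G_pos2)
    then have e2: "E ?x = E (E (F (F (E (pr 0 ?x)))))" unfolding e four by simp
    obtain u where "u \<in> carrier L" "\<Phi> u = F (F (E (pr 0 ?x)))"
      using \<Phi>_onto[OF E_basis(2)] by blast
    then have "d x = d (d u)" "u \<in> carrier L" using e2 x by (auto intro!: \<Phi>_eq)
    then show "\<forall>l. linear_form L l \<longrightarrow> (\<forall>y\<in>carrier L. l (d (d y)) = 0) \<longrightarrow> l (d x) = 0" by auto
  next
    assume forms: "\<forall>l. linear_form L l \<longrightarrow> (\<forall>y\<in>carrier L. l (d (d y)) = 0) \<longrightarrow> l (d x) = 0"
    have "lookup (pr 1 (\<Phi> (d x))) i = 0" for i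
    proof -
      have "linear_form L (\<lambda>u. lookup (pr 1 (\<Phi> u)) i)"
        by (simp add: linear_form_def \<Phi>_add \<Phi>_smult pm_proj_linear lookup_add)
      moreover have "pr 1 (E (E y)) = 0" if y: "keys y \<subseteq> basis" for y :: "'q lattice_index \<Rightarrow>\<^sub>0 'k"
        using pr_E'[OF E_basis(1)[of y], of 1] pr_E'[OF y, of "- 1"] G_zero[OF pr_in[OF y], of "- 3"]
        by (simp add: E_linear)
      then have "\<forall>y\<in>carrier L. lookup (pr 1 (\<Phi> (d (d y)))) i = 0" using \<Phi>_keys by simp
      ultimately show ?thesis using forms by blast
    qed
    then have "pr 1 (E (\<Phi> x)) = 0" using x(1) by (intro poly_mapping_eqI) simp
    then have "E (pr (- 1) (\<Phi> x)) = 0" using pr_E'[OF \<Phi>_keys[OF x(1)], of 1] by simp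
    then show "pr (- 1) (\<Phi> x) = 0" by (rule E_injective(1)[OF pr_in[OF \<Phi>_keys[OF x(1)]]])
  qed
  then show ?thesis unfolding negligible_space_2[OF vs dual d_hom two(2)] using d_zero_iff(2)[of x] by blast
qed

abbreviation HS where "HS \<equiv> hom_superalgebra L d"

lemma hom_space_iff:
  "x \<in> hom_space L d 1 \<longleftrightarrow> x \<in> carrier L \<and> E (\<Phi> x) = 0"
  "x \<in> hom_space L d (Suc 0) \<longleftrightarrow> x \<in> carrier L \<and> E (\<Phi> x) = 0"
  "x \<in> hom_space L d 2 \<longleftrightarrow> x \<in> carrier L \<and> E (E (\<Phi> x)) = 0"
  using d_zero_iff[of x] by (auto simp: hom_space_def numeral_2_eq_2)

lemma HS_simps:
  "carrier HS = hom_space L d 1 \<times> hom_space L d 2" "\<zero>\<^bsub>HS\<^esub> = (\<zero>\<^bsub>L\<^esub>, \<zero>\<^bsub>L\<^esub>)"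
  "(x, y) \<oplus>\<^bsub>HS\<^esub> (x', y') = (x \<oplus>\<^bsub>L\<^esub> x', y \<oplus>\<^bsub>L\<^esub> y')"
  "c \<odot>\<^bsub>HS\<^esub> (x, y) = (c \<odot>\<^bsub>L\<^esub> x, c \<odot>\<^bsub>L\<^esub> y)"
  "(x, y) \<otimes>\<^bsub>HS\<^esub> (x', y') = ((x \<otimes>\<^bsub>L\<^esub> x') \<oplus>\<^bsub>L\<^esub> ((d y \<otimes>\<^bsub>L\<^esub> y') \<ominus>\<^bsub>L\<^esub> (y \<otimes>\<^bsub>L\<^esub> d y')), (x \<otimes>\<^bsub>L\<^esub> y') \<oplus>\<^bsub>L\<^esub> (y \<otimes>\<^bsub>L\<^esub> x'))"
  "part HS i = (if i = 0 then hom_space L d 1 \<times> {\<zero>\<^bsub>L\<^esub>} else {\<zero>\<^bsub>L\<^esub>} \<times> hom_space L d 2)"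
  by (simp_all add: hom_superalgebra_def)

text \<open>The operations of the block algebra on all pairs. They are bilinear everywhere, and this
  larger carrier also receives the kernel vectors with components of higher weight.\<close>

definition pair_algebra :: "('k, ('q lattice_index \<Rightarrow>\<^sub>0 'k) \<times> ('q lattice_index \<Rightarrow>\<^sub>0 'k)) superalgebra" where
  "pair_algebra = block_algebra\<lparr>carrier := UNIV\<rparr>"

lemma pair_algebra_nonassoc: "nonassoc_algebra pair_algebra"
proof (rule nonassoc_algebra.intro)
  show "vectorspace class_ring pair_algebra"
    by (rule vectorspace_of_scale[OF cscale_vector_space]) (simp_all add: pair_algebra_def)
qed (auto simp: pair_algebra_def module_hom_iff cmul_def cscale_def s_linear bilin_ext_linear
    pm.scale_right_distrib add_ac)

abbreviation \<Phi>\<Phi> where "\<Phi>\<Phi> \<equiv> map_prod \<Phi> \<Phi>"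

lemma HS_hom:
  assumes "p \<in> carrier HS" "q \<in> carrier HS"
  shows "\<Phi>\<Phi> (p \<oplus>\<^bsub>HS\<^esub> q) = \<Phi>\<Phi> p + \<Phi>\<Phi> q" "\<Phi>\<Phi> (c \<odot>\<^bsub>HS\<^esub> p) = cscale c (\<Phi>\<Phi> p)"
    "\<Phi>\<Phi> (p \<otimes>\<^bsub>HS\<^esub> q) = cmul (\<Phi>\<Phi> p) (\<Phi>\<Phi> q)"
  using assms
  by (auto simp: HS_simps hom_space_iff \<Phi>_add \<Phi>_smult \<Phi>_br \<Phi>_minus cscale_def cmul_def s_def)

lemma HS_closed:
  assumes "p \<in> carrier HS" "q \<in> carrier HS"
  shows "\<zero>\<^bsub>HS\<^esub> \<in> carrier HS" "p \<oplus>\<^bsub>HS\<^esub> q \<in> carrier HS" "c \<odot>\<^bsub>HS\<^esub> p \<in> carrier HS" "p \<otimes>\<^bsub>HS\<^esub> q \<in> carrier HS"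
proof -
  obtain x y x' y' where pq: "p = (x, y)" "q = (x', y')" by (cases p; cases q)
  have c: "x \<in> carrier L" "y \<in> carrier L" "x' \<in> carrier L" "y' \<in> carrier L" "E (\<Phi> x) = 0" "E (\<Phi> x') = 0"
    "E (E (\<Phi> y)) = 0" "E (E (\<Phi> y')) = 0"
    using assms by (auto simp: pq HS_simps hom_space_iff)
  show "\<zero>\<^bsub>HS\<^esub> \<in> carrier HS" "p \<oplus>\<^bsub>HS\<^esub> q \<in> carrier HS" "c \<odot>\<^bsub>HS\<^esub> p \<in> carrier HS" "p \<otimes>\<^bsub>HS\<^esub> q \<in> carrier HS"
    using c by (simp_all add: pq HS_simps hom_space_iff \<Phi>_add \<Phi>_smult \<Phi>_br \<Phi>_minus E_linear E_deriv)
qed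

lemma HS_nonassoc: "nonassoc_algebra HS"
proof (rule nonassoc_algebra_transport[OF pair_algebra_nonassoc, where f = \<Phi>\<Phi>])
  show "inj_on \<Phi>\<Phi> (carrier HS)"
    by (auto simp: inj_on_def HS_simps hom_space_iff intro: \<Phi>_eq)
  have "(\<zero>\<^bsub>L\<^esub>, \<zero>\<^bsub>L\<^esub>) \<in> carrier HS" by (simp add: HS_simps hom_space_iff E_linear)
  from HS_closed(1)[OF this this] show "\<zero>\<^bsub>HS\<^esub> \<in> carrier HS" .
qed (auto simp: pair_algebra_def HS_hom HS_closed HS_simps(2) zero_prod_def)

definition \<pi> where "\<pi> = map_prod (\<lambda>x. pr 0 (\<Phi> x)) (\<lambda>y. pr (- 1) (\<Phi> y))"

lemma \<pi>_closed: "p \<in> carrier HS \<Longrightarrow> \<pi> p \<in> C0 \<times> C1"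
proof -
  have "E (pr 0 (\<Phi> x)) = 0" if "x \<in> carrier L" "E (\<Phi> x) = 0" for x
    using pr_E[OF \<Phi>_keys[OF that(1)], of 0] that(2) by (simp add: pm_proj_linear)
  then show "p \<in> carrier HS \<Longrightarrow> \<pi> p \<in> C0 \<times> C1"
    using pr_in[OF \<Phi>_keys] by (auto simp: \<pi>_def HS_simps hom_space_iff C0_iff)
qed

text \<open>In each of the five brackets the weight read off is the sum of the lowest possible
  weights of the factors: 0 + 0, 1 - 1 and -1 + 1 in the even part, 0 - 1 and -1 + 0 in the odd
  part. So \<open>pr_bk\<close> applies to all of them.\<close>

lemma \<pi>_mult: assumes "p \<in> carrier HS" "q \<in> carrier HS" shows "\<pi> (p \<otimes>\<^bsub>HS\<^esub> q) = cmul (\<pi> p) (\<pi> q)"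
proof -
  obtain x y x' y' where pq: "p = (x, y)" "q = (x', y')" by (cases p; cases q)
  have c: "x \<in> carrier L" "y \<in> carrier L" "x' \<in> carrier L" "y' \<in> carrier L" "E (\<Phi> x) = 0" "E (\<Phi> x') = 0"
    "E (E (\<Phi> y)) = 0" "E (E (\<Phi> y')) = 0"
    using assms by (auto simp: pq HS_simps hom_space_iff)
  have h: "\<Phi> x \<in> high 0" "\<Phi> x' \<in> high 0" "\<Phi> y \<in> high (- 1)" "\<Phi> y' \<in> high (- 1)"
    using c ker_high \<Phi>_keys by blast+
  have hE: "E (\<Phi> y) \<in> high 1" "E (\<Phi> y') \<in> high 1" using E_high[OF h(3)] E_high[OF h(4)] by simp_all
  have pE: "pr 1 (E (\<Phi> y)) = E (pr (- 1) (\<Phi> y))" "pr 1 (E (\<Phi> y')) = E (pr (- 1) (\<Phi> y'))"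
    using pr_E'[OF \<Phi>_keys, of _ 1] c by simp_all
  show ?thesis
    using c pr_bk[OF h(1,2)] pr_bk[OF h(1,4)] pr_bk[OF h(3,2)] pr_bk[OF hE(1) h(4)] pr_bk[OF h(3) hE(2)]
    by (simp add: pq HS_simps \<pi>_def cmul_def s_def \<Phi>_add \<Phi>_br \<Phi>_minus pm_proj_linear pE)
qed

sublocale \<pi>: nonassoc_hom HS block_algebra \<pi>
proof (intro nonassoc_hom.intro nonassoc_hom_axioms.intro)
  show "nonassoc_algebra HS" by (rule HS_nonassoc)
  show "nonassoc_algebra block_algebra"
    by (rule lie_superalgebra.is_nonassoc_algebra[OF block_algebra_lie])
  show "\<pi> \<in> module_hom class_ring HS block_algebra"
    unfolding module_hom_iff using \<pi>_closed
    by (auto simp: \<pi>_def HS_simps hom_space_iff \<Phi>_add \<Phi>_smult pm_proj_linear cscale_def)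
qed (use \<pi>_mult in simp)

text \<open>The two negligibility criteria ask precisely for vanishing lowest components. The
  negligible part is thus the kernel of a homomorphism, and in particular an ideal.\<close>

lemma negligible_kernel:
  "negligible_space L d 1 \<times> negligible_space L d 2 = {p \<in> carrier HS. \<pi> p = \<zero>\<^bsub>block_algebra\<^esub>}"
  by (auto simp: negligible_1[unfolded One_nat_def] negligible_2 \<pi>_def HS_simps hom_space_iff zero_prod_def)

lemma \<pi>_part: "\<pi> ` part HS i = part block_algebra i"
proof -
  have 0: "\<exists>u\<in>hom_space L d 1. pr 0 (\<Phi> u) = x" if x: "x \<in> C0" for x
  proof -
    have "keys x \<subseteq> basis" using x by (auto simp: C0_iff pm_component_def)
    then obtain u where "u \<in> carrier L" "\<Phi> u = x" using \<Phi>_onto by blast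
    then show ?thesis using x pr_G[of x 0 0] by (intro bexI[of _ u]) (auto simp: hom_space_iff C0_iff)
  qed
  have 1: "\<exists>u\<in>hom_space L d 2. pr (- 1) (\<Phi> u) = x" if x: "x \<in> C1" for x
  proof -
    have "keys x \<subseteq> basis" using x by (auto simp: pm_component_def)
    then obtain u where "u \<in> carrier L" "\<Phi> u = x" using \<Phi>_onto by blast
    then show ?thesis using x pr_G[of x "- 1" "- 1"] EE_C1 by (intro bexI[of _ u]) (auto simp: hom_space_iff)
  qed
  have sub: "part HS i \<subseteq> carrier HS"
    using HS_closed(1)[of "\<zero>\<^bsub>HS\<^esub>" "\<zero>\<^bsub>HS\<^esub>"] by (auto simp: HS_simps hom_space_iff E_linear)
  show ?thesis
  proof
    show "\<pi> ` part HS i \<subseteq> part block_algebra i"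
      using sub \<pi>_closed by (force simp: HS_simps \<pi>_def pm_proj_linear)
    show "part block_algebra i \<subseteq> \<pi> ` part HS i"
    proof
      fix w assume w: "w \<in> part block_algebra i"
      show "w \<in> \<pi> ` part HS i"
      proof (cases "i = 0")
        case True
        then obtain x where x: "x \<in> C0" "w = (x, 0)" using w by auto
        obtain u where "u \<in> hom_space L d 1" "pr 0 (\<Phi> u) = x" using 0[OF x(1)] by blast
        then have "w = \<pi> (u, \<zero>\<^bsub>L\<^esub>)" "(u, \<zero>\<^bsub>L\<^esub>) \<in> part HS i"
          using x True by (simp_all add: \<pi>_def HS_simps pm_proj_linear)
        then show ?thesis by blast
      next
        case False
        then obtain x where x: "x \<in> C1" "w = (0, x)" using w by auto
        obtain u where "u \<in> hom_space L d 2" "pr (- 1) (\<Phi> u) = x" using 1[OF x(1)] by blast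
        then have "w = \<pi> (\<zero>\<^bsub>L\<^esub>, u)" "(\<zero>\<^bsub>L\<^esub>, u) \<in> part HS i"
          using x False by (simp_all add: \<pi>_def HS_simps pm_proj_linear)
        then show ?thesis by blast
      qed
    qed
  qed
qed

sublocale \<pi>Q: nonassoc_quotient_hom HS block_algebra \<pi> "negligible_space L d 1 \<times> negligible_space L d 2"
  by (intro nonassoc_quotient_hom.intro nonassoc_ideal.intro \<pi>.nonassoc_hom_axioms HS_nonassoc
      nonassoc_ideal_axioms.intro nonassoc_quotient_hom_axioms.intro)
     (use \<pi>.kernel_ideal negligible_kernel in auto)

theorem semisimplification_iso:
  "lie_superalgebra (semisimplification L d)"
  "quot_map \<pi> \<in> lie_superalgebra_iso (semisimplification L d) block_algebra"
proof -
  have onto: "\<pi> ` carrier HS = carrier block_algebra"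
  proof
    show "carrier block_algebra \<subseteq> \<pi> ` carrier HS"
    proof
      fix w assume "w \<in> carrier block_algebra"
      then obtain x y where w: "w = (x, y)" "x \<in> C0" "y \<in> C1" by auto
      have "(x, 0) \<in> \<pi> ` part HS 0" "(0, y) \<in> \<pi> ` part HS 1" using w by (auto simp: \<pi>_part)
      then obtain u v where "u \<in> hom_space L d 1" "pr 0 (\<Phi> u) = x" "v \<in> hom_space L d 2" "pr (- 1) (\<Phi> v) = y"
        by (auto simp: HS_simps \<pi>_def)
      then have "w = \<pi> (u, v)" "(u, v) \<in> carrier HS" by (simp_all add: w \<pi>_def HS_simps)
      then show "w \<in> \<pi> ` carrier HS" by blast
    qed
  qed (use \<pi>_closed in \<open>simp add: image_subset_iff\<close>)
  have ker: "p \<in> negligible_space L d 1 \<times> negligible_space L d 2"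
    if "p \<in> carrier HS" "\<pi> p = \<zero>\<^bsub>block_algebra\<^esub>" for p
    unfolding negligible_kernel using that by blast
  have sub: "part HS i \<subseteq> carrier HS" for i
    by (auto simp: HS_simps hom_space_iff E_linear)
  show "lie_superalgebra (semisimplification L d)"
    unfolding semisimplification_def by (rule \<pi>Q.quot_map_iso(1)[OF block_algebra_lie onto ker sub \<pi>_part])
  show "quot_map \<pi> \<in> lie_superalgebra_iso (semisimplification L d) block_algebra"
    unfolding semisimplification_def by (rule \<pi>Q.quot_map_iso(2)[OF block_algebra_lie onto ker sub \<pi>_part])
qed

end

subsection \<open>The lattice of type \<open>E_7\<close>\<close>

type_synonym q7 = "int \<times> int \<times> int \<times> int \<times> int \<times> int \<times> int"

fun e7_form :: "q7 \<Rightarrow> q7 \<Rightarrow> int" where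
  "e7_form (a, b, c, d, e, f, g) (a', b', c', d', e', f', g') =
     2 * a * a' + 2 * b * b' + 2 * c * c' + 2 * d * d' + 2 * e * e' + 2 * f * f' + 2 * g * g'
     - (a * c' + c * a') - (b * d' + d * b') - (c * d' + d * c') - (d * e' + e * d')
     - (e * f' + f * e') - (f * g' + g * f')"

text \<open>Half of the form: each edge of the diagram is oriented and each diagonal entry halved,
  so that the symmetrization is \<open>e7_form\<close>. Its parity gives the sign required by the
  Frenkel-Kac construction.\<close>

fun e7_exponent :: "q7 \<Rightarrow> q7 \<Rightarrow> int" where
  "e7_exponent (a, b, c, d, e, f, g) (a', b', c', d', e', f', g') =
     a * a' + b * b' + c * c' + d * d' + e * e' + f * f' + g * g'
     - (a * c' + b * d' + c * d' + d * e' + e * f' + f * g')"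

definition e7_sign :: "q7 \<Rightarrow> q7 \<Rightarrow> int" where
  "e7_sign x y = (if even (e7_exponent x y) then 1 else - 1)"

definition e7_simple :: "nat \<Rightarrow> q7" where
  "e7_simple i = (of_bool (i = 0), of_bool (i = 1), of_bool (i = 2), of_bool (i = 3),
     of_bool (i = 4), of_bool (i = 5), of_bool (i = 6))"

fun e7_coord :: "q7 \<Rightarrow> nat \<Rightarrow> int" where
  "e7_coord (a, b, c, d, e, f, g) i = (if i = 0 then a else if i = 1 then b else if i = 2 then c
     else if i = 3 then d else if i = 4 then e else if i = 5 then f else if i = 6 then g else 0)"

lemma less7: "i < 7 \<longleftrightarrow> i = 0 \<or> i = 1 \<or> i = 2 \<or> i = 3 \<or> i = 4 \<or> i = 5 \<or> i = (6 :: nat)"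
  by arith

lemma sum7: "(\<Sum>i<7. f i) = f 0 + f 1 + f 2 + f 3 + f 4 + f 5 + f (6 :: nat)"
  by (simp add: eval_nat_numeral)

text \<open>The pairings of a vector with seven orthogonal roots. Twice the form is the sum of their squares, so the
  roots correspond to certain integer vectors of square sum 4 and can be enumerated.\<close>

fun e7_orth :: "q7 \<Rightarrow> int list" where
  "e7_orth (a, b, c, d, e, f, g) = [2 * a - c, 2 * g - f, d - c, c - d + f, c - f, 2 * b - d, 2 * e - d - f]"

definition sum_sq :: "int list \<Rightarrow> int" where
  "sum_sq xs = sum_list (map (\<lambda>x. x * x) xs)"

lemma sum_sq_simps: "sum_sq [] = 0" "sum_sq (x # xs) = x * x + sum_sq xs" "sum_sq xs \<ge> 0"
proof -
  show "sum_sq xs \<ge> 0" by (induction xs) (simp_all add: sum_sq_def)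
qed (simp_all add: sum_sq_def)

lemma sum_sq_zero: "sum_sq xs = 0 \<Longrightarrow> x \<in> set xs \<Longrightarrow> x = 0"
proof (induction xs)
  case (Cons y xs)
  then have "y * y = 0" "sum_sq xs = 0" using sum_sq_simps(3)[of xs] zero_le_square[of y]
    unfolding sum_sq_simps by linarith+
  then show ?case using Cons by auto
qed simp

lemma e7_form_sum_sq: "2 * e7_form x x = sum_sq (e7_orth x)"
  by (cases x rule: prod_cases7) (simp add: sum_sq_simps algebra_simps)

lemma e7_even_lattice: "even_lattice 7 e7_form e7_sign e7_simple e7_coord"
proof
  fix x y z :: q7
  show "e7_form (x + y) z = e7_form x z + e7_form y z"
    by (cases x rule: prod_cases7; cases y rule: prod_cases7; cases z rule: prod_cases7)
       (simp add: algebra_simps)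
  show "e7_form x y = e7_form y x"
    by (cases x rule: prod_cases7; cases y rule: prod_cases7) (simp add: algebra_simps)
  show "e7_form x x > 0" if "x \<noteq> 0"
  proof -
    have "sum_sq (e7_orth x) \<noteq> 0"
    proof
      assume "sum_sq (e7_orth x) = 0"
      then have "\<forall>y\<in>set (e7_orth x). y = 0" using sum_sq_zero by blast
      then show False using that by (cases x rule: prod_cases7) (simp add: zero_prod_def)
    qed
    then show ?thesis using sum_sq_simps(3)[of "e7_orth x"] e7_form_sum_sq[of x] by linarith
  qed
  have l: "e7_exponent (x + y) z = e7_exponent x z + e7_exponent y z"
    and r: "e7_exponent z (x + y) = e7_exponent z x + e7_exponent z y"
    by (cases x rule: prod_cases7; cases y rule: prod_cases7; cases z rule: prod_cases7;
        simp add: algebra_simps)+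
  show "e7_sign (x + y) z = e7_sign x z * e7_sign y z" "e7_sign z (x + y) = e7_sign z x * e7_sign z y"
    by (simp_all add: e7_sign_def l r)
  show "e7_sign x y * e7_sign x y = 1" by (simp add: e7_sign_def)
  have "e7_form x x = 2 * e7_exponent x x"
    by (cases x rule: prod_cases7) (simp add: algebra_simps)
  then show "e7_sign x x = - 1" if "e7_form x x = 2"
    using that by (simp add: e7_sign_def)
  have "e7_form x y = e7_exponent x y + e7_exponent y x"
    by (cases x rule: prod_cases7; cases y rule: prod_cases7) (simp add: algebra_simps)
  then show "e7_sign x y * e7_sign y x = (if even (e7_form x y) then 1 else - 1)"
    by (simp add: e7_sign_def)
  show "e7_coord (x + y) i = e7_coord x i + e7_coord y i" for i
    by (cases x rule: prod_cases7; cases y rule: prod_cases7) simp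
  show "e7_coord (e7_simple i) j = (if i = j then 1 else 0)" if "i < 7" "j < 7" for i j
    using that unfolding less7 by (elim disjE) (simp_all add: e7_simple_def)
  show "e7_form x y = (\<Sum>i<7. e7_coord x i * e7_form (e7_simple i) y)"
    by (cases x rule: prod_cases7; cases y rule: prod_cases7)
       (simp add: sum7 e7_simple_def algebra_simps)
  show "e7_form (e7_simple i) (e7_simple i) = 2" if "i < 7" for i
    using that unfolding less7 by (elim disjE) (simp_all add: e7_simple_def)
  show "e7_form (e7_simple i) (e7_simple j) \<le> 0" if "i < 7" "j < 7" "i \<noteq> j" for i j
    using that unfolding less7 by (elim disjE) (simp_all add: e7_simple_def)
qed

text \<open>Candidates for an entry are limited to five values because a larger one has square
  beyond 4, the total that belongs to a root.\<close>

fun sq_lists :: "nat \<Rightarrow> int \<Rightarrow> int list list" where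
  "sq_lists 0 m = (if m = 0 then [[]] else [])"
| "sq_lists (Suc k) m = concat (map (\<lambda>x. if x * x \<le> m then map ((#) x) (sq_lists k (m - x * x)) else []) [-2, -1, 0, 1, 2])"

lemma sq_lists: "sum_sq xs = m \<Longrightarrow> m \<le> 4 \<Longrightarrow> xs \<in> set (sq_lists (length xs) m)"
proof (induction xs arbitrary: m)
  case (Cons x xs)
  have m: "x * x + sum_sq xs = m" using Cons.prems by (simp add: sum_sq_simps)
  have "x * x \<le> 4" using m Cons.prems sum_sq_simps(3)[of xs] by linarith
  then have "\<bar>x\<bar> \<le> 2" using abs_le_square_iff[of x 2] by (simp add: power2_eq_square)
  then have "x = - 2 \<or> x = - 1 \<or> x = 0 \<or> x = 1 \<or> x = 2" by arith
  moreover have "m - x * x \<le> 4" using Cons.prems(2) zero_le_square[of x] by linarith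
  then have "xs \<in> set (sq_lists (length xs) (m - x * x))"
    using m by (intro Cons.IH) auto
  moreover have "x * x \<le> m" using m sum_sq_simps(3)[of xs] by linarith
  ultimately show ?case by (elim disjE) simp_all
qed (simp add: sum_sq_simps)

fun from_orth :: "int list \<Rightarrow> q7" where
  "from_orth [p, q, r, s, t, u, v] = (let f = r + s; c = t + f; d = r + c in
     ((p + c) div 2, (u + d) div 2, c, d, (v + d + f) div 2, f, (q + f) div 2))"
| "from_orth _ = 0"

text \<open>Not every integer vector of square sum 4 is a vector of pairings. The integer divisions
  in \<open>from_orth\<close> drop remainders, and the round trip discards the vectors for which
  this happens.\<close>

definition e7_roots :: "q7 list" where
  "e7_roots = map from_orth (filter (\<lambda>u. e7_orth (from_orth u) = u) (sq_lists 7 4))"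

lemma from_orth: "from_orth (e7_orth x) = x"
  by (cases x rule: prod_cases7) simp

lemma e7_roots: "e7_form x x = 2 \<Longrightarrow> x \<in> set e7_roots"
proof -
  assume "e7_form x x = 2"
  then have "sum_sq (e7_orth x) = 4" using e7_form_sum_sq[of x] by simp
  moreover have "length (e7_orth x) = 7" by (cases x rule: prod_cases7) simp
  ultimately have "e7_orth x \<in> set (sq_lists 7 4)" using sq_lists[of "e7_orth x" 4] by (simp only:)
  then show ?thesis unfolding e7_roots_def set_map set_filter
    by (intro image_eqI[of _ _ "e7_orth x"]) (simp_all add: from_orth del: sq_lists.simps)
qed

text \<open>Computations with integral coefficients: a list of pairs \<open>(s, c)\<close> stands for the sum of the \<open>c\<close> times the
  basis vector \<open>s\<close>, with repetitions allowed, and \<open>l_zero\<close> tests whether it vanishes modulo 3.\<close>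

type_synonym e7_list = "(q7 lattice_index \<times> int) list"

fun l_br :: "q7 lattice_index \<Rightarrow> q7 lattice_index \<Rightarrow> e7_list" where
  "l_br (T i) (T j) = []"
| "l_br (T i) (R b) = (if i < 7 \<and> e7_form b b = 2 then [(R b, e7_form (e7_simple i) b)] else [])"
| "l_br (R b) (T i) = (if i < 7 \<and> e7_form b b = 2 then [(R b, - e7_form (e7_simple i) b)] else [])"
| "l_br (R a) (R b) = (if e7_form a a = 2 \<and> e7_form b b = 2 then
     if e7_form (a + b) (a + b) = 2 then [(R (a + b), e7_sign a b)]
     else if a + b = 0 then map (\<lambda>i. (T i, e7_sign a b * e7_coord a i)) [0..<7] else [] else [])"

definition l_scale :: "int \<Rightarrow> e7_list \<Rightarrow> e7_list" where
  "l_scale c x = map (\<lambda>(s, d). (s, c * d)) x"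

definition l_bk :: "e7_list \<Rightarrow> e7_list \<Rightarrow> e7_list" where
  "l_bk x y = concat (map (\<lambda>(s, c). concat (map (\<lambda>(t, d). l_scale (c * d) (l_br s t)) y)) x)"

definition l_E :: "e7_list \<Rightarrow> e7_list" where
  "l_E x = l_bk [(R (e7_simple 0), 1), (R (e7_simple 6), 1)] x"

definition l_mul :: "e7_list \<times> e7_list \<Rightarrow> e7_list \<times> e7_list \<Rightarrow> e7_list \<times> e7_list" where
  "l_mul p q = (case (p, q) of ((x, y), (x', y')) \<Rightarrow>
     (l_bk x x' @ l_bk (l_E y) y' @ l_scale (- 1) (l_bk y (l_E y')), l_bk x y' @ l_bk y x'))"

definition l_sub :: "e7_list \<times> e7_list \<Rightarrow> int \<Rightarrow> e7_list \<times> e7_list \<Rightarrow> e7_list \<times> e7_list" where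
  "l_sub p c q = (fst p @ l_scale (- c) (fst q), snd p @ l_scale (- c) (snd q))"

definition l_zero :: "e7_list \<Rightarrow> bool" where
  "l_zero x \<longleftrightarrow> list_all (\<lambda>(s, _). sum_list (map (\<lambda>(t, c). if t = s then c else 0) x) mod 3 = 0) x"

definition l_zero2 :: "e7_list \<times> e7_list \<Rightarrow> bool" where
  "l_zero2 p = (if l_zero (fst p) then l_zero (snd p) else False)"

text \<open>The degree that is left when the coordinates at the two ends \<open>0\<close> and \<open>6\<close> are forgotten.\<close>

fun rho :: "q7 \<Rightarrow> int list" where
  "rho (a, b, c, d, e, f, g) = [b, c, d, e, f]"

definition e7_type :: "q7 \<Rightarrow> int \<times> int" where
  "e7_type a = (e7_form (e7_simple 0) a, e7_form (e7_simple 6) a)"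

text \<open>The types listed are those of weight -1 and 0, except for (-1, 1). A root of that type
  shares its degree with one of type (1, -1), and one representative per degree is wanted.\<close>

definition is_block_root :: "q7 \<Rightarrow> bool" where
  "is_block_root a \<longleftrightarrow> e7_form a a = 2 \<and> (e7_type a = (- 1, 0) \<or> e7_type a = (0, - 1) \<or> e7_type a = (0, 0) \<or> e7_type a = (1, - 1))"

definition block_roots :: "q7 list" where
  "block_roots = filter is_block_root e7_roots"

lemma block_roots: "a \<in> set block_roots \<longleftrightarrow> is_block_root a"
  using e7_roots[of a] by (auto simp: block_roots_def is_block_root_def)

text \<open>The kernel of \<open>E\<close> on a root space of type \<open>(1, -1)\<close> plus its partner of type \<open>(-1, 1)\<close>, which has
  the same degree, is the line spanned by the combination below.\<close>

definition block_vector :: "q7 \<Rightarrow> e7_list \<times> e7_list" where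
  "block_vector a = (case e7_type a of (p, q) \<Rightarrow> if p + q = - 1 then ([], [(R a, 1)]) else if p = 0 then ([(R a, 1)], [])
     else let b = a - e7_simple 0 + e7_simple 6 in
       ([(R a, e7_sign (e7_simple 0) b), (R b, - e7_sign (e7_simple 6) a)], []))"

text \<open>The negative Chevalley generators are signed block vectors. At the odd nodes the bracket of \<open>C1\<close> with
  itself involves \<open>E\<close>, so the degree must be reached by a root shifted by an end of the diagram.\<close>

definition neg_root :: "nat \<Rightarrow> int \<times> q7" where
  "neg_root i = (if i = 1 then (- 1, - e7_simple 0 - e7_simple 2) else if i = 4 then (1, - e7_simple 5 - e7_simple 6)
     else (- 1, - e7_simple (Suc i)))"

definition l_e :: "nat \<Rightarrow> e7_list \<times> e7_list" where
  "l_e i = block_vector (e7_simple (Suc i))"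

definition l_f :: "nat \<Rightarrow> e7_list \<times> e7_list" where
  "l_f i = (case neg_root i of (c, a) \<Rightarrow> (l_scale c (fst (block_vector a)), l_scale c (snd (block_vector a))))"

text \<open>Toral elements commuting with both end root vectors modulo 3. The coroot next to an end
  pairs to -1 with it, and adding c times the end coroot changes this to 2 c - 1, which is 0 modulo
  3 for c = -1.\<close>

definition l_t :: "nat \<Rightarrow> e7_list" where
  "l_t i = (T (Suc i), 1) # (if i = 1 then [(T 0, - 1)] else if i = 4 then [(T 6, - 1)] else [])"

definition rho_norm :: "q7 \<Rightarrow> nat" where
  "rho_norm a = sum_list (map (\<lambda>x. nat \<bar>x\<bar>) (rho a))"

definition unit5 :: "nat \<Rightarrow> int list" where
  "unit5 i = map (\<lambda>j. of_bool (i = j)) [0..<5]"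

definition l_multiple :: "e7_list \<times> e7_list \<Rightarrow> e7_list \<times> e7_list \<Rightarrow> bool" where
  "l_multiple p q = (if l_zero2 (l_sub p 1 q) then True else l_zero2 (l_sub p (- 1) q))"

text \<open>The argument \<open>C\<close> is a table of roots with degrees and vectors. The
  conditions are nested so that a bracket is tested only against an entry of fitting degree and
  smaller norm.\<close>

definition l_reach :: "(q7 \<times> int list \<times> e7_list \<times> e7_list) list \<Rightarrow> q7 \<Rightarrow> e7_list \<times> e7_list \<Rightarrow> int list \<Rightarrow> bool" where
  "l_reach C a g r = list_ex (\<lambda>(b, r', v). if r' = r then
     if rho_norm b < rho_norm a then l_multiple (l_mul g v) (block_vector a) else False else False) C"

text \<open>Descent on the absolute values of the five coordinates: a degree is reached from one
  closer to 0 by a raising generator at a positive coordinate or a lowering generator at a negative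
  one.\<close>

definition l_generated :: "(q7 \<times> int list \<times> e7_list \<times> e7_list) list \<Rightarrow> q7 \<Rightarrow> bool" where
  "l_generated C a = (if list_ex (\<lambda>i. a = e7_simple (Suc i) \<or> a = snd (neg_root i)) [0..<5] then True else list_ex (\<lambda>i.
    if rho a ! i > 0 then l_reach C a (l_e i) (map2 (-) (rho a) (unit5 i))
    else if rho a ! i < 0 then l_reach C a (l_f i) (map2 (+) (rho a) (unit5 i)) else False) [0..<5])"

definition l_separated :: "(q7 \<times> int list \<times> e7_list \<times> e7_list) list \<Rightarrow> q7 \<Rightarrow> bool" where
  "l_separated C a = list_ex (\<lambda>(b, r, v). if r = map uminus (rho a) then \<not> l_zero2 (l_mul v (block_vector a)) else False) C"

definition block_data :: "(q7 \<times> int list \<times> e7_list \<times> e7_list) list" where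
  "block_data = map (\<lambda>a. (a, rho a, block_vector a)) block_roots"

text \<open>The representative of the degree of a root: adding one end and subtracting the other
  exchanges the types (-1, 1) and (1, -1) and leaves the five coordinates unchanged.\<close>

definition block_top :: "q7 \<Rightarrow> q7" where
  "block_top a = (if e7_type a = (- 1, 1) then a + e7_simple 0 - e7_simple 6 else a)"

definition el53_entry :: "nat \<Rightarrow> nat \<Rightarrow> int" where
  "el53_entry i j = [[2, 0, - 1, 0, 0], [0, 0, - 1, 0, 0], [- 1, - 1, 2, - 1, 0], [0, 0, - 1, 2, - 1], [0, 0, 0, - 1, 0]] ! i ! j"

subsection \<open>Gradings of the block algebra\<close>

context orthogonal_roots_char3
begin

definition block_component :: "('q \<Rightarrow> 'd :: ab_group_add) \<Rightarrow> 'd \<Rightarrow> (('q lattice_index \<Rightarrow>\<^sub>0 'k) \<times> ('q lattice_index \<Rightarrow>\<^sub>0 'k)) set" where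
  "block_component g q = (C0 \<inter> pm_component basis (index_degree g) q) \<times> (C1 \<inter> pm_component basis (index_degree g) q)"

definition block_proj :: "('q \<Rightarrow> 'd :: ab_group_add) \<Rightarrow> 'd \<Rightarrow> ('q lattice_index \<Rightarrow>\<^sub>0 'k) \<times> ('q lattice_index \<Rightarrow>\<^sub>0 'k) \<Rightarrow> ('q lattice_index \<Rightarrow>\<^sub>0 'k) \<times> ('q lattice_index \<Rightarrow>\<^sub>0 'k)" where
  "block_proj g q = map_prod (pm_proj (index_degree g) q) (pm_proj (index_degree g) q)"

lemma block_component_subspace: "subspace class_ring (block_component g q) block_algebra"
  using block_algebra_vectorspace C0_linear C1_linear
  by (auto simp: subspace_iff block_component_def cscale_def zero_prod_def pm_component_closed)

lemma block_proj_component: "u \<in> block_component g r \<Longrightarrow> block_proj g q u = (if q = r then u else 0)"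
  by (cases u) (auto simp: block_component_def block_proj_def pm_proj_component zero_prod_def)

context
  fixes g :: "'q \<Rightarrow> 'd :: ab_group_add"
  assumes add: "\<And>x y. g (x + y) = g x + g y" and gb: "g b = 0" "g b' = 0"
begin

text \<open>As g vanishes on both roots, \<open>E\<close> has degree 0. This is why the grading
  passes to the block algebra, whose odd brackets involve \<open>E\<close>.\<close>

lemma E_component:
  fixes x :: "'q lattice_index \<Rightarrow>\<^sub>0 'k"
  assumes "x \<in> pm_component basis (index_degree g) q"
  shows "E x \<in> pm_component basis (index_degree g) q"
proof -
  have "(rt b + rt b' :: 'q lattice_index \<Rightarrow>\<^sub>0 'k) \<in> pm_component basis (index_degree g) 0"
    using rt_component[OF b, of g] rt_component[OF b', of g] by (intro pm_component_closed) (simp_all add: gb)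
  from bk_component[OF add this assms] show ?thesis by (simp add: E_def)
qed

lemma block_component_mult:
  assumes "u \<in> block_component g q" "v \<in> block_component g r"
  shows "cmul u v \<in> block_component g (q + r)"
proof -
  have C: "u \<in> C0 \<times> C1" "v \<in> C0 \<times> C1" using assms by (auto simp: block_component_def)
  have "fst (cmul u v) \<in> pm_component basis (index_degree g) (q + r)" "snd (cmul u v) \<in> pm_component basis (index_degree g) (q + r)"
    using assms by (auto simp: block_component_def cmul_def s_def
        intro!: pm_component_closed bk_component[OF add] E_component)
  then show ?thesis using cmul_closed[OF C] by (auto simp: block_component_def mem_Times_iff)
qed

lemma E_proj:
  fixes x :: "'q lattice_index \<Rightarrow>\<^sub>0 'k"
  assumes "keys x \<subseteq> basis"
  shows "E (pm_proj (index_degree g) q x) = pm_proj (index_degree g) q (E x)"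
  using assms
proof (induction rule: pm_induct)
  case (single c t)
  have "single t c \<in> pm_component basis (index_degree g) (index_degree g t)"
    using single by (auto simp: pm_component_def)
  from pm_proj_component[OF this] pm_proj_component[OF E_component[OF this]]
  show ?case by (simp add: E_linear)
qed (simp_all add: pm_proj_linear E_linear)

lemma block_proj_in: assumes "u \<in> C0 \<times> C1" shows "block_proj g q u \<in> block_component g q"
proof -
  obtain x y where u: "u = (x, y)" "x \<in> G 0" "E x = 0" "y \<in> G (- 1)" using assms by (auto simp: C0_iff)
  then have k: "keys x \<subseteq> basis" "keys y \<subseteq> basis" by (auto simp: pm_component_def)
  have "pm_proj (index_degree g) q x \<in> G 0" "pm_proj (index_degree g) q y \<in> G (- 1)"
    using u by (auto simp: pm_component_def keys_pm_proj)
  moreover have "E (pm_proj (index_degree g) q x) = 0" using E_proj[OF k(1)] u by (simp add: pm_proj_linear)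
  ultimately show ?thesis using pm_proj_in[OF k(1), of "index_degree g" q] pm_proj_in[OF k(2), of "index_degree g" q]
    by (simp add: u(1) block_component_def block_proj_def C0_iff)
qed

lemma block_proj_hom: "block_proj g q \<in> module_hom class_ring block_algebra block_algebra"
  using block_proj_in by (fastforce simp: module_hom_iff block_component_def block_proj_def cscale_def pm_proj_linear)

text \<open>Only finitely many degrees occur in the supports of a given pair, so it is a finite sum
  of its projections.\<close>

lemma block_components_span:
  assumes U: "0 \<in> U" "\<And>u v. u \<in> U \<Longrightarrow> v \<in> U \<Longrightarrow> u + v \<in> U" and c: "\<And>q. block_component g q \<subseteq> U"
  shows "C0 \<times> C1 \<subseteq> U"
proof
  fix u assume u: "u \<in> C0 \<times> C1"
  define Q where "Q = index_degree g ` (keys (fst u) \<union> keys (snd u))"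
  have fin: "finite Q" by (simp add: Q_def)
  have split: "x = (\<Sum>q\<in>Q. pm_proj (index_degree g) q x)" if "keys x \<subseteq> keys (fst u) \<union> keys (snd u)" for x
  proof (rule poly_mapping_eqI)
    fix t
    have "lookup (\<Sum>q\<in>Q. pm_proj (index_degree g) q x) t = (\<Sum>q\<in>Q. if index_degree g t = q then lookup x t else 0)"
      by (simp add: lookup_sum lookup_pm_proj)
    also have "\<dots> = (if index_degree g t \<in> Q then lookup x t else 0)" using fin by (simp add: sum.delta)
    also have "\<dots> = lookup x t" using that by (auto simp: Q_def in_keys_iff)
    finally show "lookup x t = lookup (\<Sum>q\<in>Q. pm_proj (index_degree g) q x) t" by simp
  qed
  have "u = (\<Sum>q\<in>Q. block_proj g q u)"
    using split[of "fst u"] split[of "snd u"]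
    by (cases u) (simp add: block_proj_def sum_prod)
  moreover have "(\<Sum>q\<in>Q'. block_proj g q u) \<in> U" if "finite Q'" for Q'
    using that
  proof (induction Q')
    case (insert q Q')
    then show ?case using U(2)[OF subsetD[OF c block_proj_in[OF u]]] by simp
  qed (simp add: U)
  ultimately show "u \<in> U" using fin by metis
qed

end

end

section \<open>Evaluation of integral computations in characteristic 3\<close>

locale e7_char3 =
  fixes ty :: "'k :: field itself"
  assumes CHAR_3: "CHAR('k) = 3"

sublocale e7_char3 \<subseteq> orthogonal_roots_char3 7 e7_form e7_sign e7_simple e7_coord "e7_simple 0" "e7_simple 6" ty
  by (intro orthogonal_roots_char3.intro orthogonal_roots.intro orthogonal_roots_axioms.intro
      orthogonal_roots_char3_axioms.intro e7_even_lattice CHAR_3) (simp_all add: e7_simple_def)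

context e7_char3
begin

definition ev :: "e7_list \<Rightarrow> (q7 lattice_index \<Rightarrow>\<^sub>0 'k)" where
  "ev x = sum_list (map (\<lambda>(s, c). single s (of_int c)) x)"

definition ev2 :: "e7_list \<times> e7_list \<Rightarrow> (q7 lattice_index \<Rightarrow>\<^sub>0 'k) \<times> (q7 lattice_index \<Rightarrow>\<^sub>0 'k)" where
  "ev2 p = (ev (fst p), ev (snd p))"

lemma ev_simps [simp]: "ev [] = 0" "ev (sc # x) = single (fst sc) (of_int (snd sc)) + ev x" "ev (x @ y) = ev x + ev y"
  by (simp_all add: ev_def case_prod_beta)

lemma ev_scale [simp]: "ev (l_scale c x) = of_int c *\<^sub>p ev x"
  by (induction x) (auto simp: l_scale_def pm.scale_right_distrib)

lemma ev_map: "ev (map (\<lambda>i. (f i, g i)) [0..<m]) = (\<Sum>i<m. single (f i) (of_int (g i)))"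
  by (induction m) (simp_all add: add.commute)

lemma ev_l_br: "ev (l_br u t) = br u t"
proof (cases u; cases t)
  fix a b assume [simp]: "u = R a" "t = R b"
  have "ev (map (\<lambda>i. (T i, e7_sign a b * e7_coord a i)) [0..<7]) = of_int (e7_sign a b) *\<^sub>p hv a"
    unfolding ev_map hv_def pm.scale_sum_right by (simp add:)
  then show ?thesis by (simp del: upt_Suc)
qed simp_all

lemma ev_l_bk: "ev (l_bk x y) = bk (ev x) (ev y)"
proof (induction x)
  case (Cons sc x)
  have "ev (concat (map (\<lambda>(t, d). l_scale (snd sc * d) (l_br (fst sc) t)) y)) = bk (single (fst sc) (of_int (snd sc))) (ev y)"
    by (induction y) (auto simp: bilin_ext_linear bilin_ext_simps ev_l_br)
  then show ?case using Cons by (simp add: l_bk_def bilin_ext_linear case_prod_beta)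
qed (simp add: l_bk_def bilin_ext_linear)

lemma ev_l_E: "ev (l_E x) = E (ev x)"
  by (simp add: l_E_def ev_l_bk E_def rt_def)

lemma ev2_l_mul: "ev2 (l_mul p q) = cmul (ev2 p) (ev2 q)"
  by (cases p; cases q) (simp add: ev2_def l_mul_def cmul_def s_def ev_l_bk ev_l_E)

lemma ev2_l_sub: "ev2 (l_sub p c q) = ev2 p - cscale (of_int c) (ev2 q)"
  by (simp add: ev2_def l_sub_def cscale_def)

lemma lookup_ev: "lookup (ev x) u = of_int (sum_list (map (\<lambda>(t, c). if t = u then c else 0) x))"
  by (induction x) (auto simp: lookup_add lookup_single when_def)

text \<open>Coefficients at indices absent from the list are 0, so it suffices to test those
  present; an integer vanishes in the field exactly when 3 divides it.\<close>

lemma l_zero_iff: "l_zero x \<longleftrightarrow> ev x = 0"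
proof -
  have "lookup (ev x) u = 0" if "u \<notin> fst ` set x" for u
  proof -
    have "map (\<lambda>(t, c). if t = u then c else 0) x = map (\<lambda>_. 0) x" using that by force
    then show ?thesis unfolding lookup_ev by (simp only: sum_list_0 of_int_0)
  qed
  moreover have "ev x = 0 \<longleftrightarrow> (\<forall>u. lookup (ev x) u = 0)"
    by (auto simp: poly_mapping_eq_iff fun_eq_iff)
  ultimately have "ev x = 0 \<longleftrightarrow> (\<forall>u\<in>fst ` set x. lookup (ev x) u = 0)" by blast
  then show ?thesis
    unfolding l_zero_def list_all_iff lookup_ev of_int_eq_0_iff_char_dvd CHAR_3
    by (auto simp: case_prod_beta dvd_eq_mod_eq_0)
qed

lemma l_zero2_iff: "l_zero2 p \<longleftrightarrow> ev2 p = 0"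
  by (simp add: l_zero2_def l_zero_iff ev2_def zero_prod_def)

text \<open>The degree \<open>rho\<close> in the form of a finitely supported function, as the
  recognition of contragredient algebras demands; \<open>rho\<close> serves for computation.\<close>

definition rdg :: "q7 \<Rightarrow> (nat \<Rightarrow>\<^sub>0 int)" where
  "rdg a = (\<Sum>i<5. single i (e7_coord a (Suc i)))"

lemma lookup_rdg: "lookup (rdg a) i = (if i < 5 then e7_coord a (Suc i) else 0)"
  by (simp add: rdg_def lookup_sum lookup_single when_def)

lemma rdg_add: "rdg (a + a') = rdg a + rdg a'"
  by (rule poly_mapping_eqI) (simp add: lookup_rdg lookup_add cf_add)

lemma rdg_simple: "i < 5 \<Longrightarrow> rdg (e7_simple (Suc i)) = single i 1"
  "rdg (e7_simple 0) = 0" "rdg (e7_simple 6) = 0"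
  by (auto intro!: poly_mapping_eqI simp: lookup_rdg lookup_single when_def cf_al)

lemma rdg_minus: "rdg (- a) = - rdg a" "rdg (a - a') = rdg a - rdg a'"
  by (rule poly_mapping_eqI; simp add: lookup_rdg lookup_minus cf_minus cf_diff)+

lemma rho_eq_iff: "rho a = rho a' \<longleftrightarrow> rdg a = rdg a'"
proof -
  have "rho x = map (lookup (rdg x)) [0..<5]" for x
    by (cases x rule: prod_cases7) (simp add: lookup_rdg upt_conv_Cons)
  moreover have "rdg a = rdg a'" if "\<forall>i<5. lookup (rdg a) i = lookup (rdg a') i"
    by (rule poly_mapping_eqI) (use that in \<open>auto simp: lookup_rdg\<close>)
  ultimately show ?thesis by auto
qed

end

section \<open>Finite checks over roots, degrees and generators\<close>

lemma block_generated: "list_all (\<lambda>(a, _). l_generated block_data a) block_data"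
proof -
  \<comment> \<open>Binding the table first shares its entries among all the tests.\<close>
  have "let C = block_data in list_all (\<lambda>(a, _). l_generated C a) C" by code_simp
  then show ?thesis by (simp only: Let_def)
qed

lemma block_separated: "list_all (\<lambda>(a, _). l_separated block_data a) block_data"
proof -
  have "let C = block_data in list_all (\<lambda>(a, _). l_separated C a) C" by code_simp
  then show ?thesis by (simp only: Let_def)
qed

text \<open>This gives multiplicity one: a block root is determined by its degree, so the components
  outside degree 0 turn out to be lines.\<close>

lemma rho_distinct: "distinct (map rho block_roots)"
  by code_simp

text \<open>Needed to see that the degree 0 component of the block algebra is purely toral and that
  every root occurring in it elsewhere shares its degree with a block root.\<close>

lemma block_top_check: "list_all (\<lambda>a. case e7_type a of (p, q) \<Rightarrow> if p + q = 0 \<or> p + q = - 1 then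
    is_block_root (block_top a) \<and> rho a \<noteq> [0, 0, 0, 0, 0] else True) e7_roots"
  by code_simp

lemma torus_check: "list_all (\<lambda>i. l_zero (l_E (l_t i))) [0..<5]"
  by code_simp

lemma generator_check: "list_all (\<lambda>i. is_block_root (e7_simple (Suc i)) \<and> is_block_root (snd (neg_root i)) \<and>
    (if parity_el53 i = 1 then fst (l_e i) = [] \<and> fst (l_f i) = [] else snd (l_e i) = [] \<and> snd (l_f i) = [])) [0..<5]"
  by code_simp

lemma relation_check: "list_all (\<lambda>i. list_all (\<lambda>j.
    l_zero2 (l_sub (l_mul (l_t i, []) (l_e j)) (el53_entry i j) (l_e j)) \<and>
    l_zero2 (l_sub (l_mul (l_t i, []) (l_f j)) (- el53_entry i j) (l_f j)) \<and>
    l_zero2 (l_sub (l_mul (l_e i) (l_f j)) (of_bool (i = j)) (l_t i, []))) [0..<5]) [0..<5]"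
  by code_simp

section \<open>Homogeneous components of the block algebra for type E_7\<close>

context e7_char3
begin

abbreviation "\<beta> \<equiv> e7_simple 0"
abbreviation "\<beta>' \<equiv> e7_simple 6"

lemma form_simple [simp]: "e7_form \<beta> \<beta> = 2" "e7_form \<beta>' \<beta>' = 2" "e7_form \<beta> \<beta>' = 0" "e7_form \<beta>' \<beta> = 0"
  by (simp_all add: e7_simple_def)

lemma wt_type: "wt a = fst (e7_type a) + snd (e7_type a)"
  by (simp add: wt_def e7_type_def)

abbreviation "partner a \<equiv> a - \<beta> + \<beta>'"

lemma E_rt: "e7_form a a = 2 \<Longrightarrow> E (rt a) = bk (rt \<beta>) (rt a) + bk (rt \<beta>') (rt a)"
  by (simp add: E_def bilin_ext_linear)

text \<open>The partner is the image under the two commuting reflections in \<beta> and \<beta>',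
  which subtract \<beta> and add \<beta>' for this type. Raising a by \<beta>' or the partner by
  \<beta> gives the same root.\<close>

lemma partner:
  assumes "e7_form a a = 2" "e7_type a = (1, - 1)"
  shows "e7_form (partner a) (partner a) = 2" "e7_type (partner a) = (- 1, 1)" "rdg (partner a) = rdg a" "partner a \<noteq> a"
    "\<beta> + partner a = a + \<beta>'"
proof -
  have t: "e7_form \<beta> a = 1" "e7_form \<beta>' a = - 1" using assms(2) by (simp_all add: e7_type_def)
  then have t': "e7_form a \<beta> = 1" "e7_form a \<beta>' = - 1" by (simp_all only: ip_commute[of a])
  show "e7_form (partner a) (partner a) = 2"
    by (simp only: ip_add ip_add_right ip_diff t t' assms(1) form_simple)
  show p: "e7_type (partner a) = (- 1, 1)"
    by (simp add: e7_type_def ip_add_right ip_diff t)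
  show "rdg (partner a) = rdg a" by (simp add: rdg_add rdg_minus rdg_simple)
  show "partner a \<noteq> a" using p assms(2) by auto
qed (simp add: algebra_simps)

lemma block_vector_cases:
  assumes "is_block_root a"
  obtains
    (odd) "wt a = - 1" "ev2 (block_vector a) = (0, rt a)"
  | (single) "e7_type a = (0, 0)" "ev2 (block_vector a) = (rt a, 0)"
  | (pair) "e7_type a = (1, - 1)"
      "ev2 (block_vector a) = (of_int (e7_sign \<beta> (partner a)) *\<^sub>p rt a - of_int (e7_sign \<beta>' a) *\<^sub>p rt (partner a), 0)"
  using assms by (auto simp: is_block_root_def wt_type block_vector_def ev2_def rt_def Let_def single_uminus)

lemma E_single: "e7_form a a = 2 \<Longrightarrow> e7_type a = (0, 0) \<Longrightarrow> E (rt a) = (0 :: q7 lattice_index \<Rightarrow>\<^sub>0 'k)"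
  by (simp add: E_rt bk_rt e7_type_def)

lemma E_pair:
  assumes "e7_form a a = 2" "e7_type a = (1, - 1)"
  shows "E (rt a) = (of_int (e7_sign \<beta>' a) *\<^sub>p rt (a + \<beta>') :: q7 lattice_index \<Rightarrow>\<^sub>0 'k)"
    "E (rt (partner a)) = (of_int (e7_sign \<beta> (partner a)) *\<^sub>p rt (a + \<beta>') :: q7 lattice_index \<Rightarrow>\<^sub>0 'k)"
  using assms partner[OF assms] by (simp_all add: E_rt bk_rt e7_type_def add.commute)

lemma block_vector_component:
  assumes "is_block_root a"
  shows "ev2 (block_vector a) \<in> block_component rdg (rdg a)"
proof -
  have r: "e7_form a a = 2" using assms by (simp add: is_block_root_def)
  show ?thesis
    using assms
  proof (cases rule: block_vector_cases)
    case odd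
    then show ?thesis using rt_component[OF r, of wt] rt_component[OF r, of rdg]
      by (simp add: block_component_def C0_linear pm_component_closed)
  next
    case single
    then have "rt a \<in> G 0" using rt_component[OF r, of wt] by (simp add: wt_type)
    then show ?thesis using single E_single[OF r] rt_component[OF r, of rdg]
      by (simp add: block_component_def C0_iff C1_linear pm_component_closed)
  next
    case pair
    note p = partner[OF r pair(1)]
    have "rt a \<in> (G 0 :: (q7 lattice_index \<Rightarrow>\<^sub>0 'k) set)" "rt (partner a) \<in> (G 0 :: (q7 lattice_index \<Rightarrow>\<^sub>0 'k) set)"
      using rt_component[OF r, of wt] rt_component[OF p(1), of wt] pair(1) p(2) by (simp_all add: wt_type)
    moreover have "(rt (partner a) :: q7 lattice_index \<Rightarrow>\<^sub>0 'k) \<in> pm_component basis (index_degree rdg) (rdg a)"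
      using rt_component[OF p(1), of rdg] p(3) by simp
    moreover have "(rt a :: q7 lattice_index \<Rightarrow>\<^sub>0 'k) \<in> pm_component basis (index_degree rdg) (rdg a)"
      by (rule rt_component[OF r])
    ultimately show ?thesis unfolding pair(2)
      using E_pair[OF r pair(1)]
      by (simp add: block_component_def C0_iff C1_linear pm_component_closed E_linear mult.commute)
  qed
qed

lemma weight_root:
  assumes "e7_form a a = 2" "wt a = 0 \<or> wt a = - 1"
  shows "is_block_root (block_top a)" "rdg (block_top a) = rdg a" "rdg a \<noteq> 0"
proof -
  have "a \<in> set e7_roots" by (rule e7_roots[OF assms(1)])
  then have *: "is_block_root (block_top a) \<and> rho a \<noteq> [0, 0, 0, 0, 0]"
    using block_top_check assms(2) unfolding list_all_iff wt_type by (cases "e7_type a") force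
  show "is_block_root (block_top a)" using * by blast
  have "rho a \<noteq> rho 0" using * by (simp add: zero_prod_def)
  then have "rdg a \<noteq> rdg 0" using rho_eq_iff by blast
  moreover have "rdg 0 = 0" using rdg_add[of 0 0] by simp
  ultimately show "rdg a \<noteq> 0" by metis
  show "rdg (block_top a) = rdg a" by (simp add: block_top_def rdg_add rdg_minus rdg_simple)
qed

lemma rdg_inj: "is_block_root a \<Longrightarrow> is_block_root a' \<Longrightarrow> rdg a = rdg a' \<Longrightarrow> a = a'"
proof -
  have "inj_on rho (set block_roots)" using rho_distinct by (simp only: distinct_map)
  then show "is_block_root a \<Longrightarrow> is_block_root a' \<Longrightarrow> rdg a = rdg a' \<Longrightarrow> a = a'"
    by (elim inj_onD) (simp_all only: rho_eq_iff block_roots)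
qed

text \<open>All roots in the support of u have the degree q, hence the same representative a. So the
  support lies in a, or in a and its partner; in the second case the condition
  \<open>E x = 0\<close> is one linear equation in two coefficients and again leaves a line.\<close>

lemma block_component_cases:
  assumes u: "u \<in> block_component rdg q" "u \<noteq> 0" and q: "q \<noteq> 0"
  obtains a c where "is_block_root a" "rdg a = q" "u = cscale c (ev2 (block_vector a))"
proof -
  obtain x y where xy: "u = (x, y)" "x \<in> G 0" "E x = 0" "y \<in> G (- 1)"
    and k: "keys x \<subseteq> {t \<in> basis. index_degree rdg t = q}" "keys y \<subseteq> {t \<in> basis. index_degree rdg t = q}"
    using u by (cases u) (auto simp: block_component_def C0_iff pm_component_def)
  have key: "\<exists>a. t = R a \<and> e7_form a a = 2 \<and> rdg a = q" if "t \<in> keys x \<union> keys y" for t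
    using that k q by (cases t) (auto simp: basis_def)
  have wx: "wt a = 0" if "R a \<in> keys x" for a using that xy(2) by (auto simp: pm_component_def)
  have wy: "wt a = - 1" if "R a \<in> keys y" for a using that xy(4) by (auto simp: pm_component_def)
  have ne: "\<exists>t. t \<in> keys z" if "z \<noteq> 0" for z :: "q7 lattice_index \<Rightarrow>\<^sub>0 'k"
    using that keys_eq_empty[of z] by blast
  obtain t where "t \<in> keys x \<union> keys y" using u(2) xy(1) ne by (auto simp: zero_prod_def)
  with key obtain a0 where a0: "R a0 \<in> keys x \<union> keys y" "e7_form a0 a0 = 2" "rdg a0 = q" by blast
  define a where "a = block_top a0"
  note wr0 = weight_root[OF a0(2)]
  have w0: "wt a0 = 0 \<or> wt a0 = - 1" using a0(1) wx wy by blast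
  have a: "is_block_root a" "rdg a = q" using wr0(1,2)[OF w0] a0(3) by (simp_all add: a_def)
  have ra: "e7_form a a = 2" using a(1) by (simp add: is_block_root_def)
  have top: "block_top a' = a" if "R a' \<in> keys x \<union> keys y" for a'
  proof -
    have "e7_form a' a' = 2" "rdg a' = q" using key[OF that] by auto
    moreover have "wt a' = 0 \<or> wt a' = - 1" using that wx wy by blast
    ultimately show ?thesis using weight_root[of a'] a by (intro rdg_inj) simp_all
  qed
  have one: "z = lookup z (R a) *\<^sub>p rt a" if "keys z \<subseteq> {R a}" for z :: "q7 lattice_index \<Rightarrow>\<^sub>0 'k"
  proof (rule poly_mapping_eqI)
    show "lookup z t = lookup (lookup z (R a) *\<^sub>p rt a) t" for t
      using that by (auto simp: rt_def lookup_single when_def in_keys_iff)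
  qed
  have nontop: "a' = a" if "R a' \<in> keys x \<union> keys y" "e7_type a' \<noteq> (- 1, 1)" for a'
    using top[OF that(1)] that(2) by (simp add: block_top_def)
  have ky: "keys y \<subseteq> {R a}"
    using key nontop wy by (fastforce simp: wt_type)
  show ?thesis
    using a(1)
  proof (cases rule: block_vector_cases)
    case odd
    \<comment> \<open>Passing to the representative preserves weight 0, whereas here a has weight
      -1.\<close>
    have "x = 0"
    proof (rule ccontr)
      assume "x \<noteq> 0"
      then obtain t where "t \<in> keys x" using ne by blast
      with key obtain a' where a': "R a' \<in> keys x" by blast
      then have "wt (block_top a') = 0" using wx[OF a']
        by (auto simp: block_top_def wt_type e7_type_def ip_add_right ip_diff)
      then show False using top a' odd(1) by simp
    qed
    then show ?thesis using that[OF a, of "lookup y (R a)"] odd one[OF ky] by (simp add: xy(1) cscale_def)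
  next
    case single
    have "y = 0"
    proof (rule ccontr)
      assume "y \<noteq> 0"
      then have "R a \<in> keys y" using ky ne by blast
      then show False using wy single(1) by (fastforce simp: wt_type)
    qed
    moreover have "keys x \<subseteq> {R a}"
    proof
      fix t assume t: "t \<in> keys x"
      with key obtain a' where a': "t = R a'" by blast
      have "e7_type a' \<noteq> (- 1, 1)"
      proof
        assume "e7_type a' = (- 1, 1)"
        then have "e7_type (block_top a') = (1, - 1)"
          by (auto simp: block_top_def e7_type_def ip_add_right ip_diff)
        then show False using top[of a'] t a' single(1) by simp
      qed
      then show "t \<in> {R a}" using nontop[of a'] t a' by simp
    qed
    ultimately show ?thesis using that[OF a, of "lookup x (R a)"] single one[of x] by (simp add: xy(1) cscale_def)
  next
    case pair
    note p = partner[OF ra pair(1)] and Ep = E_pair[OF ra pair(1)]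
    have y0: "y = 0"
    proof (rule ccontr)
      assume "y \<noteq> 0"
      then have "R a \<in> keys y" using ky ne by blast
      then show False using wy pair(1) by (fastforce simp: wt_type)
    qed
    define k1 k2 where "k1 = lookup x (R a)" and "k2 = lookup x (R (partner a))"
    have kx: "keys x \<subseteq> {R a, R (partner a)}"
    proof
      fix t assume t: "t \<in> keys x"
      with key obtain a' where a': "t = R a'" by blast
      have "a' = partner a" if "e7_type a' = (- 1, 1)"
        using top[of a'] t a' that by (auto simp: block_top_def)
      then show "t \<in> {R a, R (partner a)}" using nontop[of a'] t a' by blast
    qed
    have x: "x = k1 *\<^sub>p rt a + k2 *\<^sub>p rt (partner a)"
    proof (rule poly_mapping_eqI)
      show "lookup x t = lookup (k1 *\<^sub>p rt a + k2 *\<^sub>p rt (partner a)) t" for t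
        using kx p(4) by (auto simp: k1_def k2_def rt_def lookup_add lookup_single when_def in_keys_iff)
    qed
    define g1 g2 :: 'k where "g1 = of_int (e7_sign \<beta> (partner a))" and "g2 = of_int (e7_sign \<beta>' a)"
    have sq: "g1 * g1 = 1" "g2 * g2 = 1" by (simp_all add: g1_def g2_def sg_sq flip: of_int_mult)
    have "E x = (k1 * g2 + k2 * g1) *\<^sub>p rt (a + \<beta>')"
      by (simp add: x E_linear Ep g1_def g2_def pm.scale_left_distrib)
    then have "(k1 * g2 + k2 * g1) *\<^sub>p rt (a + \<beta>') = 0"
      by (rule trans[OF sym xy(3)])
    then have "lookup ((k1 * g2 + k2 * g1) *\<^sub>p rt (a + \<beta>')) (R (a + \<beta>')) = 0"
      by (simp only: lookup_zero)
    then have "k1 * g2 + k2 * g1 = 0" by (simp only: rt_def scale_single lookup_single_eq mult_1_right)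
    \<comment> \<open>Multiplying by the sign g1, whose square is 1, solves the equation for k2 and
      shows that u is k1 g1 times the block vector.\<close>
    then have "k1 * g1 * g2 + k2 * (g1 * g1) = 0" by (metis distrib_right mult.assoc mult.commute mult_zero_left)
    then have "k2 = - (k1 * g1 * g2)" by (simp add: sq(1) eq_neg_iff_add_eq_0 add.commute)
    moreover have "k1 = k1 * g1 * g1" using sq(1) by (simp add: mult.assoc)
    ultimately have "u = cscale (k1 * g1) (ev2 (block_vector a))"
      unfolding xy(1) y0 x pair(2) by (simp add: cscale_def pm.scale_right_diff_distrib flip: g1_def g2_def)
    then show ?thesis using that[OF a] by blast
  qed
qed

definition torus :: "nat \<Rightarrow> (q7 lattice_index \<Rightarrow>\<^sub>0 'k) \<times> (q7 lattice_index \<Rightarrow>\<^sub>0 'k)" where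
  "torus i = (ev (l_t i), 0)"

lemma torus_component: assumes "i < 5" shows "torus i \<in> block_component rdg 0"
proof -
  have "l_zero (l_E (l_t i))"
    using torus_check assms by (simp add: list_all_iff del: upt_Suc)
  then have "E (ev (l_t i)) = 0" by (simp only: l_zero_iff ev_l_E)
  moreover have "keys (ev (l_t i)) \<subseteq> T ` {..<7}"
    using assms by (auto simp: l_t_def intro!: order_trans[OF keys_add])
  ultimately show ?thesis
    by (auto simp: torus_def block_component_def C0_iff pm_component_def basis_def)
qed

text \<open>No root of weight 0 or -1 has degree 0, so such an element is toral. Commuting with the
  two end root vectors imposes two independent conditions on seven coordinates and leaves the five
  elements \<open>torus i\<close>.\<close>

lemma block_component_zero:
  assumes u: "u \<in> block_component rdg 0"
  obtains c where "u = (\<Sum>i<5. cscale (c i) (torus i))"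
proof -
  obtain x y where xy: "u = (x, y)" "x \<in> G 0" "E x = 0" "y \<in> G (- 1)"
    and k: "keys x \<subseteq> {t \<in> basis. index_degree rdg t = 0}" "keys y \<subseteq> {t \<in> basis. index_degree rdg t = 0}"
    using u by (cases u) (auto simp: block_component_def C0_iff pm_component_def)
  have no_root: False if "R a \<in> keys x \<union> keys y" for a
  proof -
    have "e7_form a a = 2" "rdg a = 0" "wt a = 0 \<or> wt a = - 1"
      using that k xy(2,4) by (auto simp: basis_def pm_component_def)
    then show False using weight_root(3)[of a] by blast
  qed
  have "keys y = {}"
  proof (rule ccontr)
    assume "keys y \<noteq> {}"
    then obtain t where t: "t \<in> keys y" by blast
    with no_root obtain i where "t = T i" by (metis UnI2 lattice_index.exhaust)
    with t xy(4) show False by (auto simp: pm_component_def)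
  qed
  then have y: "y = 0" by simp
  have kx: "t \<in> T ` {..<7}" if "t \<in> keys x" for t
  proof -
    have "t \<in> basis" using k(1) that by blast
    then show ?thesis using no_root that unfolding basis_def by blast
  qed
  have x: "x = (\<Sum>i<7. lookup x (T i) *\<^sub>p tv i)"
  proof (rule poly_mapping_eqI)
    fix t
    have "lookup (\<Sum>i<7. lookup x (T i) *\<^sub>p tv i) t = (\<Sum>i<7. if T i = t then lookup x t else 0)"
      unfolding lookup_sum by (intro sum.cong) (auto simp: tv_def lookup_single when_def)
    also have "\<dots> = lookup x t"
    proof (cases "t \<in> T ` {..<7}")
      case True
      then show ?thesis by auto
    next
      case False
      then have "lookup x t = 0" using kx by (auto simp: in_keys_iff)
      then show ?thesis by simp
    qed
    finally show "lookup x t = lookup (\<Sum>i<7. lookup x (T i) *\<^sub>p tv i) t" by simp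
  qed
  define k where "k i = lookup x (T i)" for i
  have Et: "E (tv i) = - (of_int (e7_form (e7_simple i) \<beta>) *\<^sub>p rt \<beta>) - of_int (e7_form (e7_simple i) \<beta>') *\<^sub>p rt \<beta>'"
    if "i < 7" for i using that by (simp add: E_def bilin_ext_linear tv_def rt_def single_uminus)
  have "E x = (\<Sum>i<7. k i *\<^sub>p E (tv i))"
    by (subst x) (simp add: sum7 E_linear k_def)
  also have "\<dots> = (k 2 - 2 * k 0) *\<^sub>p rt \<beta> + (k 5 - 2 * k 6) *\<^sub>p rt \<beta>'"
    unfolding sum7 by (simp add: Et) (simp add: e7_simple_def pm.scale_left_diff_distrib mult.commute)
  finally have "(k 2 - 2 * k 0) *\<^sub>p rt \<beta> + (k 5 - 2 * k 6) *\<^sub>p rt \<beta>' = 0"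
    using xy(3) by simp
  then have "lookup ((k 2 - 2 * k 0) *\<^sub>p rt \<beta> + (k 5 - 2 * k 6) *\<^sub>p rt \<beta>') t = 0" for t
    by (simp only: lookup_zero)
  from this[of "R \<beta>"] this[of "R \<beta>'"]
  have "k 2 = 2 * k 0" "k 5 = 2 * k 6"
    by (simp_all add: e7_simple_def rt_def lookup_add lookup_single when_def)
  \<comment> \<open>With 2 = -1 the end coordinates become the negatives of their neighbours, which
    is where the corrections in \<open>l_t\<close> come from.\<close>
  then have k06: "k 0 = - k 2" "k 6 = - k 5"
    unfolding two(1) by simp_all
  have "x = k 1 *\<^sub>p ev (l_t 0) + k 2 *\<^sub>p ev (l_t 1) + k 3 *\<^sub>p ev (l_t 2) + k 4 *\<^sub>p ev (l_t 3) + k 5 *\<^sub>p ev (l_t 4)"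
    using x unfolding k_def[symmetric] sum7 k06 by (simp add: l_t_def tv_def single_uminus eval_nat_numeral pm.scale_right_diff_distrib)
  then have "u = (\<Sum>i<5. cscale (k (Suc i)) (torus i))"
    by (simp add: xy(1) y torus_def cscale_def eval_nat_numeral zero_prod_def)
  then show ?thesis by (rule that)
qed

end

section \<open>Chevalley generators and relations of the second algebra\<close>

context e7_char3
begin

lemma cscale_one [simp]: "cscale 1 u = u" "cscale c 0 = 0" "cscale c (u + v) = cscale c u + cscale c v"
    "cscale c (cscale c' u) = cscale (c * c') u" "cscale (c + c') u = cscale c u + cscale c' u" "cscale 0 u = 0"
    "cscale c (u - v) = cscale c u - cscale c v" "cscale (- c) u = - cscale c u" "cscale c (- u) = - cscale c u"
  by (simp_all add: cscale_def case_prod_beta prod_eq_iff pm.scale_right_distrib pm.scale_left_distrib pm.scale_right_diff_distrib)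

lemma cmul_scale: "cmul (cscale c u) v = cscale c (cmul u v)" "cmul u (cscale c v) = cscale c (cmul u v)"
  by (cases u; cases v; simp add: cmul_def cscale_def s_def bilin_ext_linear E_linear pm.scale_right_distrib pm.scale_right_diff_distrib)+

lemma cmul_add: "cmul (u + u') v = cmul u v + cmul u' v" "cmul v (u + u') = cmul v u + cmul v u'" "cmul 0 v = 0" "cmul v 0 = 0"
  by (simp_all add: cmul_def s_linear bilin_ext_linear case_prod_beta prod_eq_iff s_def E_linear)

lemma cmul_sum: "cmul (\<Sum>i\<in>A. w i) v = (\<Sum>i\<in>A. cmul (w i) v)" "cmul v (\<Sum>i\<in>A. w i) = (\<Sum>i\<in>A. cmul v (w i))"
  by (induction A rule: infinite_finite_induct; simp add: cmul_add)+

abbreviation "el_e i \<equiv> ev2 (l_e i)"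
abbreviation "el_f i \<equiv> ev2 (l_f i)"

lemma el_f: "el_f i = cscale (of_int (fst (neg_root i))) (ev2 (block_vector (snd (neg_root i))))"
  by (simp add: l_f_def ev2_def cscale_def split: prod.split)

lemma less5: "i < 5 \<longleftrightarrow> i = 0 \<or> i = 1 \<or> i = 2 \<or> i = 3 \<or> i = (4 :: nat)"
  by arith

lemma neg_root:
  assumes "i < 5"
  shows "rdg (snd (neg_root i)) = single i (- 1)" "fst (neg_root i) = 1 \<or> fst (neg_root i) = - 1"
proof -
  show "fst (neg_root i) = 1 \<or> fst (neg_root i) = - 1" by (simp add: neg_root_def)
  have "rdg (e7_simple 2) = single 1 1" "rdg (e7_simple 5) = single 4 1"
    using rdg_simple(1)[of 1] rdg_simple(1)[of 4] by (simp_all add: eval_nat_numeral)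
  then show "rdg (snd (neg_root i)) = single i (- 1)"
    using assms rdg_simple by (simp add: neg_root_def rdg_minus single_uminus)
qed

lemma generators:
  assumes "i < 5"
  shows "el_e i \<in> block_component rdg (single i 1)" "el_f i \<in> block_component rdg (single i (- 1))"
    "el_e i \<in> part block_algebra (parity_el53 i)" "el_f i \<in> part block_algebra (parity_el53 i)"
proof -
  have g: "is_block_root (e7_simple (Suc i))" "is_block_root (snd (neg_root i))"
    and p: "if parity_el53 i = 1 then fst (l_e i) = [] \<and> fst (l_f i) = [] else snd (l_e i) = [] \<and> snd (l_f i) = []"
    using generator_check assms by (simp_all add: list_all_iff del: upt_Suc)
  show e: "el_e i \<in> block_component rdg (single i 1)"
    using block_vector_component[OF g(1)] assms by (simp add: l_e_def rdg_simple)
  show f: "el_f i \<in> block_component rdg (single i (- 1))"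
    using block_vector_component[OF g(2)] block_component_subspace[of rdg "single i (- 1)"]
    by (simp add: el_f neg_root[OF assms] subspace_iff)
  have "el_e i \<in> C0 \<times> C1" "el_f i \<in> C0 \<times> C1" using e f by (auto simp: block_component_def)
  then show "el_e i \<in> part block_algebra (parity_el53 i)" "el_f i \<in> part block_algebra (parity_el53 i)"
    using p by (auto simp: ev2_def parity_el53_def split: if_splits)
qed

lemma relations:
  assumes "i < 5" "j < 5"
  shows "cmul (torus i) (el_e j) = cscale (of_int (el53_entry i j)) (el_e j)"
    "cmul (torus i) (el_f j) = cscale (- of_int (el53_entry i j)) (el_f j)"
    "cmul (el_e i) (el_f j) = (if i = j then torus i else 0)"
proof -
  have t: "torus k = ev2 (l_t k, [])" for k by (simp add: torus_def ev2_def)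
  note r = relation_check[unfolded list_all_iff, rule_format, of i j]
  show "cmul (torus i) (el_e j) = cscale (of_int (el53_entry i j)) (el_e j)"
    "cmul (torus i) (el_f j) = cscale (- of_int (el53_entry i j)) (el_f j)"
    "cmul (el_e i) (el_f j) = (if i = j then torus i else 0)"
    using r assms by (simp_all add: t l_zero2_iff ev2_l_sub ev2_l_mul eq_neg_iff_add_eq_0 del: upt_Suc)
qed

lemma cartan_el53_entry: "i < 5 \<Longrightarrow> j < 5 \<Longrightarrow> cartan_el53 $$ (i, j) = el53_entry i j"
  by (simp add: cartan_el53_def el53_entry_def mat_of_rows_list_def)

lemma torus_torus: "i < 5 \<Longrightarrow> j < 5 \<Longrightarrow> cmul (torus i) (torus j) = 0"
  by (auto simp: torus_def l_t_def cmul_def s_def zero_prod_def bilin_ext_linear E_linear)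

text \<open>Induction on the norm of the degree: by the finite check a block vector is a generator
  up to sign, or up to sign the bracket of a generator with a block vector of smaller norm.\<close>

lemma block_vectors_generate:
  assumes U0: "0 \<in> U" and Us: "\<And>c u. u \<in> U \<Longrightarrow> cscale c u \<in> U" and Um: "\<And>u v. u \<in> U \<Longrightarrow> v \<in> U \<Longrightarrow> cmul u v \<in> U"
    and gens: "\<And>i. i < 5 \<Longrightarrow> el_e i \<in> U" "\<And>i. i < 5 \<Longrightarrow> el_f i \<in> U"
    and a: "is_block_root a"
  shows "ev2 (block_vector a) \<in> U"
  using a
proof (induction "rho_norm a" arbitrary: a rule: less_induct)
  case less
  have reach: "ev2 (block_vector a) \<in> U" if lr: "l_reach block_data a g r" and gU: "ev2 g \<in> U" for g r
  proof -
    obtain a' where a': "is_block_root a'" "rho_norm a' < rho_norm a" "l_multiple (l_mul g (block_vector a')) (block_vector a)"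
    proof -
      from lr obtain a' where "a' \<in> set block_roots"
          "if rho a' = r then if rho_norm a' < rho_norm a then l_multiple (l_mul g (block_vector a')) (block_vector a) else False else False"
        unfolding l_reach_def list_ex_iff block_data_def set_map by blast
      then show ?thesis by (intro that[of a']) (auto simp: block_roots split: if_splits)
    qed
    have "cmul (ev2 g) (ev2 (block_vector a')) \<in> U" using Um[OF gU less.hyps[OF a'(2,1)]] .
    \<comment> \<open>The check accepts both signs, since structure constants are only determined up
      to sign by the choice of block vectors.\<close>
    moreover have "cmul (ev2 g) (ev2 (block_vector a')) = cscale 1 (ev2 (block_vector a)) \<or>
        cmul (ev2 g) (ev2 (block_vector a')) = cscale (- 1) (ev2 (block_vector a))"
      using a'(3) by (auto simp: l_multiple_def l_zero2_iff ev2_l_sub ev2_l_mul eq_neg_iff_add_eq_0 split: if_splits)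
    ultimately show ?thesis using Us[of "cscale (- 1) (ev2 (block_vector a))" "- 1"] by auto
  qed
  have "l_generated block_data a"
    using block_generated less.prems by (auto simp: list_all_iff block_data_def block_roots)
  then consider i where "i < 5" "a = e7_simple (Suc i)" | i where "i < 5" "a = snd (neg_root i)"
    | i r where "i < 5" "l_reach block_data a (l_e i) r \<or> l_reach block_data a (l_f i) r"
    unfolding l_generated_def list_ex_iff by (auto split: if_splits simp del: upt_Suc) metis+
  then show ?case
  proof cases
    case 1
    then show ?thesis using gens(1)[of i] by (simp add: l_e_def)
  next
    case 2
    let ?c = "of_int (fst (neg_root i)) :: 'k"
    have "?c * ?c = 1" using neg_root(2)[OF 2(1)] by auto
    then have "cscale ?c (el_f i) = ev2 (block_vector a)" using 2(2) by (simp add: el_f)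
    then show ?thesis using Us[OF gens(2)[OF 2(1)], of ?c] by simp
  next
    case 3
    then show ?thesis using reach gens by blast
  qed
qed

lemma block_vector_separated:
  assumes "is_block_root a"
  obtains a' where "is_block_root a'" "rdg a' = - rdg a" "cmul (ev2 (block_vector a')) (ev2 (block_vector a)) \<noteq> 0"
proof -
  have "l_separated block_data a"
    using block_separated assms by (auto simp: list_all_iff block_data_def block_roots)
  then obtain a' where a': "is_block_root a'" "rho a' = map uminus (rho a)"
      "\<not> l_zero2 (l_mul (block_vector a') (block_vector a))"
    by (auto simp: l_separated_def list_ex_iff block_data_def block_roots split: if_splits)
  have "map uminus (rho a) = rho (- a)"
    by (cases a rule: prod_cases7) simp
  then have "rdg a' = - rdg a" using a'(2) rho_eq_iff rdg_minus(1) by metis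
  then show ?thesis using that a' by (simp add: l_zero2_iff ev2_l_mul)
qed

lemma block_components_generated:
  assumes U: "subspace class_ring U block_algebra" and Um: "\<And>u v. u \<in> U \<Longrightarrow> v \<in> U \<Longrightarrow> cmul u v \<in> U"
    and gens: "\<And>i. i < 5 \<Longrightarrow> torus i \<in> U" "\<And>i. i < 5 \<Longrightarrow> el_e i \<in> U" "\<And>i. i < 5 \<Longrightarrow> el_f i \<in> U"
  shows "C0 \<times> C1 \<subseteq> U"
proof (rule block_components_span[OF rdg_add rdg_simple(2,3)])
  show U0: "0 \<in> U" and Ua: "u \<in> U \<Longrightarrow> v \<in> U \<Longrightarrow> u + v \<in> U" for u v
    using U by (simp_all add: subspace_iff)
  have Us: "u \<in> U \<Longrightarrow> cscale c u \<in> U" for c u using U by (simp add: subspace_iff)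
  show "block_component rdg q \<subseteq> U" for q
  proof
    fix u assume u: "u \<in> block_component rdg q"
    consider "u = 0" | "q = 0" | "u \<noteq> 0" "q \<noteq> 0" by blast
    then show "u \<in> U"
    proof cases
      case 2
      then obtain c where c: "u = (\<Sum>i<5. cscale (c i) (torus i))" using block_component_zero u by blast
      have "(\<Sum>i<m. cscale (c i) (torus i)) \<in> U" if "m \<le> 5" for m
        using that by (induction m) (auto intro!: U0 Ua Us gens(1))
      then show ?thesis using c by blast
    next
      case 3
      then obtain a c where "is_block_root a" "u = cscale c (ev2 (block_vector a))"
        using block_component_cases[OF u] by blast
      then show ?thesis using block_vectors_generate[OF U0 Us Um gens(2,3)] Us by blast
    qed (use U0 in simp)
  qed
qed

text \<open>Outside degree 0 each component consists of multiples of one block vector, so separation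
  has to be known for block vectors only; in degree 0 the elements \<open>torus i\<close> span. Thus
  the finite checks cover all hypotheses about generation and separation.\<close>

lemma block_contragredient_model:
  fixes H :: "('k, 'h) module"
  assumes H: "vectorspace class_ring H" and c: "dual_bases H 5 h c"
    and alpha: "\<And>j. j < 5 \<Longrightarrow> linear_form H (\<alpha> j)"
    and cartan: "\<And>i j. i < 5 \<Longrightarrow> j < 5 \<Longrightarrow> \<alpha> j (h i) = of_int (cartan_el53 $$ (i, j))"
  shows "contragredient_model 5 parity_el53 H h \<alpha> block_algebra (\<lambda>x. \<Sum>i<5. cscale (c i x) (torus i))
    (\<lambda>i. el_e i) (\<lambda>i. el_f i) (block_component rdg) (block_proj rdg)"
    (is "contragredient_model 5 ?par H h \<alpha> ?L ?\<tau> ?e ?f ?D ?P")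
proof -
  interpret HV: vectorspace class_ring H by (rule H)
  have h: "i < 5 \<Longrightarrow> h i \<in> carrier H" and cl: "i < 5 \<Longrightarrow> linear_form H (c i)"
    and ch: "i < 5 \<Longrightarrow> j < 5 \<Longrightarrow> c i (h j) = (if i = j then 1 else 0)" for i j
    using c by (auto simp: dual_bases_def)
  have D_sub: "u \<in> ?D q \<Longrightarrow> u \<in> C0 \<times> C1" for u q by (auto simp: block_component_def)
  have D_lin: "0 \<in> ?D q" "u \<in> ?D q \<Longrightarrow> v \<in> ?D q \<Longrightarrow> u + v \<in> ?D q" "u \<in> ?D q \<Longrightarrow> cscale k u \<in> ?D q" for u v q k
    using block_component_subspace[of rdg q] by (simp_all add: subspace_iff)
  have \<tau>D: "?\<tau> x \<in> ?D 0" for x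
  proof -
    have "(\<Sum>i<m. cscale (c i x) (torus i)) \<in> ?D 0" if "m \<le> 5" for m
      using that by (induction m) (auto intro!: D_lin torus_component)
    then show ?thesis by blast
  qed
  have snd_\<tau>: "snd (?\<tau> x) = 0" for x
    by (simp add: snd_sum cscale_def torus_def)
  \<comment> \<open>The corrections in \<open>l_t\<close> occupy only \<open>T 0\<close> and
    \<open>T 6\<close>, so the five middle coordinates recover the coefficients.\<close>
  have \<tau>l: "lookup (fst (?\<tau> x)) (T (Suc i)) = c i x" if "i < 5" for x i
    using that unfolding less5
    by (elim disjE; simp add: fst_sum cscale_def torus_def l_t_def eval_nat_numeral lookup_add lookup_single when_def)
  have \<tau>h: "?\<tau> (h i) = torus i" if "i < 5" for i
  proof -
    have "?\<tau> (h i) = (\<Sum>j<5. if j = i then torus j else 0)" using that ch by (intro sum.cong) auto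
    then show ?thesis using that by simp
  qed
  have csum: "(\<Sum>i<5. cscale (k i) u) = cscale (\<Sum>i<5. k i) u" for k :: "nat \<Rightarrow> 'k" and u
    by (simp add: eval_nat_numeral)
  have ax: "(\<Sum>i<5. c i x * of_int (el53_entry i j)) = \<alpha> j x" if "x \<in> carrier H" "j < 5" for x j
  proof -
    have "(\<Sum>i<5. c i x * of_int (el53_entry i j)) = (\<Sum>i<5. c i x * \<alpha> j (h i))"
      using that cartan cartan_el53_entry by (intro sum.cong) auto
    then show ?thesis using dual_bases_expand[OF H c alpha[OF that(2)] that(1)] by simp
  qed
  show ?thesis
  proof (rule contragredient_model.intro)
    show "?\<tau> \<in> module_hom class_ring H ?L"
    proof -
      have "?\<tau> (x \<oplus>\<^bsub>H\<^esub> y) = (\<Sum>i<5. cscale (c i x) (torus i) + cscale (c i y) (torus i))"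
        if "x \<in> carrier H" "y \<in> carrier H" for x y
        using cl that by (intro sum.cong) (auto simp: linear_form_def)
      moreover have "?\<tau> (k \<odot>\<^bsub>H\<^esub> x) = (\<Sum>i<5. cscale k (cscale (c i x) (torus i)))"
        if "x \<in> carrier H" for x k
        using cl that by (intro sum.cong) (auto simp: linear_form_def)
      moreover have "cscale k (\<Sum>i<5. w i) = (\<Sum>i<5. cscale k (w i))" for k and w :: "nat \<Rightarrow> _"
        by (simp add: eval_nat_numeral)
      ultimately show ?thesis using D_sub[OF \<tau>D] by (simp add: module_hom_iff sum.distrib)
    qed
    show "?\<tau> x \<in> part ?L 0" for x
      using D_sub[OF \<tau>D, of x] snd_\<tau>[of x] by (simp add: mem_Times_iff)
    show "x = \<zero>\<^bsub>H\<^esub>" if "x \<in> carrier H" "?\<tau> x = \<zero>\<^bsub>?L\<^esub>" for x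
    proof -
      have "c i x = 0" if "i < 5" for i
        using \<tau>l[OF that, of x] \<open>?\<tau> x = \<zero>\<^bsub>?L\<^esub>\<close> by simp
      moreover have "x = (\<Oplus>\<^bsub>H\<^esub>i\<in>{..<5}. c i x \<odot>\<^bsub>H\<^esub> h i)" using c that by (auto simp: dual_bases_def)
      moreover have "(\<Oplus>\<^bsub>H\<^esub>i\<in>{..<5}. c i x \<odot>\<^bsub>H\<^esub> h i) = (\<Oplus>\<^bsub>H\<^esub>i\<in>{..<5 :: nat}. \<zero>\<^bsub>H\<^esub>)"
        using calculation(1) HV.smult_l_null h by (intro HV.finsum_cong') (auto simp: class_ring_simps)
      ultimately show ?thesis by simp
    qed
    show "?e i \<in> part ?L (?par i)" "?f i \<in> part ?L (?par i)" if "i < 5" for i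
      by (rule generators[OF that])+
    show "?\<tau> x \<otimes>\<^bsub>?L\<^esub> ?\<tau> y = \<zero>\<^bsub>?L\<^esub>" for x y
      by (simp add: cmul_sum cmul_scale torus_torus)
    show "?\<tau> x \<otimes>\<^bsub>?L\<^esub> ?e j = \<alpha> j x \<odot>\<^bsub>?L\<^esub> ?e j" if "x \<in> carrier H" "j < 5" for x j
      using relations(1)[OF _ that(2)] ax[OF that] by (simp add: cmul_sum cmul_scale csum)
    show "?\<tau> x \<otimes>\<^bsub>?L\<^esub> ?f j = (- \<alpha> j x) \<odot>\<^bsub>?L\<^esub> ?f j" if "x \<in> carrier H" "j < 5" for x j
      using relations(2)[OF _ that(2)] ax[OF that] by (simp add: cmul_sum cmul_scale csum sum_negf)
    show "?e i \<otimes>\<^bsub>?L\<^esub> ?f j = (if i = j then ?\<tau> (h i) else \<zero>\<^bsub>?L\<^esub>)" if ij: "i < 5" "j < 5" for i j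
      using relations(3)[OF ij] \<tau>h[OF ij(1)] by (cases "i = j") simp_all
    show "carrier ?L \<subseteq> U"
      if U: "subspace class_ring U ?L" "?\<tau> ` carrier H \<subseteq> U" "?e ` {..<5} \<subseteq> U" "?f ` {..<5} \<subseteq> U"
        and br: "\<And>x y. x \<in> U \<Longrightarrow> y \<in> U \<Longrightarrow> x \<otimes>\<^bsub>?L\<^esub> y \<in> U" for U
    proof -
      have "torus i \<in> U" if "i < 5" for i
      proof -
        have "?\<tau> (h i) \<in> U" using U(2) h[OF that] by blast
        then show ?thesis unfolding \<tau>h[OF that] .
      qed
      moreover have "el_e i \<in> U" "el_f i \<in> U" if "i < 5" for i using U(3,4) that by auto
      ultimately show ?thesis using block_components_generated[OF U(1)] br by simp
    qed
    show "subspace class_ring (?D q) ?L" for q by (rule block_component_subspace)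
    show "?\<tau> x \<in> ?D 0" for x by (rule \<tau>D)
    show "?e i \<in> ?D (single i 1)" "?f i \<in> ?D (single i (- 1))" if "i < 5" for i
      by (rule generators[OF that])+
    show "u \<otimes>\<^bsub>?L\<^esub> v \<in> ?D (q + r)" if "u \<in> ?D q" "v \<in> ?D r" for u v q r
      using block_component_mult[OF rdg_add rdg_simple(2,3) that] by simp
    show "?P q \<in> module_hom class_ring ?L ?L" for q
      by (rule block_proj_hom[OF rdg_add rdg_simple(2,3)])
    show "?P q u = (if q = r then u else \<zero>\<^bsub>?L\<^esub>)" if "u \<in> ?D r" for u q r
      using block_proj_component[OF that] by simp
    show "\<exists>v\<in>?D (- q). v \<otimes>\<^bsub>?L\<^esub> u \<noteq> \<zero>\<^bsub>?L\<^esub>" if q: "q \<noteq> 0" and u: "u \<in> ?D q" "u \<noteq> \<zero>\<^bsub>?L\<^esub>" for q u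
    proof -
      obtain a k where a: "is_block_root a" "rdg a = q" "u = cscale k (ev2 (block_vector a))"
        using block_component_cases[OF u(1) _ q] u(2) unfolding block_algebra_simps by blast
      obtain a' where a': "is_block_root a'" "rdg a' = - rdg a" "cmul (ev2 (block_vector a')) (ev2 (block_vector a)) \<noteq> 0"
        using block_vector_separated[OF a(1)] by blast
      let ?v = "ev2 (block_vector a')"
      have "k \<noteq> 0" using u(2) a(3) by auto
      have "cmul ?v u = cscale k (cmul ?v (ev2 (block_vector a)))" by (simp only: a(3) cmul_scale)
      moreover have "cscale (inverse k) (cscale k w) = w" for w using \<open>k \<noteq> 0\<close> by simp
      ultimately have "cmul ?v u \<noteq> 0" using a'(3) cscale_one(2) by metis
      moreover have "?v \<in> ?D (- q)" using block_vector_component[OF a'(1)] a(2) a'(2) by simp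
      ultimately show ?thesis by (intro bexI) simp_all
    qed
  qed (use H h block_algebra_lie in auto)
qed

end

subsection \<open>Realizations of matrices of full rank\<close>

text \<open>A singular matrix has a nonzero kernel vector, so solving a homogeneous system replaces
  the computation of a determinant.\<close>

lemma rank_fullI:
  fixes A :: "'k :: field mat"
  assumes A: "A \<in> carrier_mat n n"
    and inj: "\<And>v. (\<And>i. i < n \<Longrightarrow> (\<Sum>j<n. A $$ (i, j) * v j) = 0) \<Longrightarrow> \<forall>j<n. v j = 0"
  shows "vec_space.rank n A = n"
proof (rule vec_space.low_rank_det_zero[OF A])
  show "det A \<noteq> 0"
  proof
    assume "det A = 0"
    then obtain v where v: "v \<in> carrier_vec n" "v \<noteq> 0\<^sub>v n" "A *\<^sub>v v = 0\<^sub>v n"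
      using det_0_iff_vec_prod_zero_field[OF A] by blast
    have "(\<Sum>j<n. A $$ (i, j) * v $ j) = 0" if "i < n" for i
    proof -
      have "(A *\<^sub>v v) $ i = 0" using v(3) that by simp
      then show ?thesis using A v(1) that by (simp add: scalar_prod_def atLeast0LessThan)
    qed
    then have "\<forall>j<n. v $ j = 0" by (rule inj)
    then show False using v(1,2) by (auto intro: eq_vecI)
  qed
qed

text \<open>At full rank the torus has dimension 2 n - n = n, so the independent elements h i form a
  basis and have dual coordinates. This reduces an arbitrary realization to coordinates.\<close>

lemma realization_dual_bases:
  fixes H :: "('k :: field, 'h) module"
  assumes r: "realization n A H h \<alpha>" and rank: "vec_space.rank n (map_mat of_int A :: 'k mat) = n"
  shows "\<exists>\<phi>. dual_bases H n h \<phi>"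
proof -
  interpret vectorspace class_ring H using r by (simp add: realization_def)
  have fd: "fin_dim" and dim: "dim = n" and h: "\<And>i. i < n \<Longrightarrow> h i \<in> carrier H"
    and inj: "inj_on h {..<n}" and li: "lin_indpt (h ` {..<n})"
    using r rank by (auto simp: realization_def)
  let ?B = "h ` {..<n}"
  have B: "finite ?B" "?B \<subseteq> carrier H" using h by auto
  have "LinearCombinations.module.span class_ring H ?B = carrier H"
    using dim_li_is_basis[OF fd B li] dim card_image[OF inj] by (simp add: basis_def)
  then have "\<exists>a. x = lincomb a ?B" if "x \<in> carrier H" for x
    using that finite_span[OF B] by auto
  then obtain c where c: "\<And>x. x \<in> carrier H \<Longrightarrow> x = lincomb (c x) ?B" by metis
  have K: "a \<in> ?B \<rightarrow> carrier class_ring" for a :: "'h \<Rightarrow> 'k" by (simp add: class_ring_simps)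
  have uniq: "a (h i) = a' (h i)" if "lincomb a ?B = lincomb a' ?B" "i < n" for a a' i
  proof -
    have "lincomb (\<lambda>v. a v \<oplus>\<^bsub>class_ring\<^esub> (- 1 \<otimes>\<^bsub>class_ring\<^esub> a' v)) ?B = lincomb a ?B \<oplus>\<^bsub>H\<^esub> lincomb (\<lambda>v. - 1 \<otimes>\<^bsub>class_ring\<^esub> a' v) ?B"
      by (rule lincomb_sum[OF B K K])
    also have "\<dots> = lincomb (\<lambda>v. a' v \<oplus>\<^bsub>class_ring\<^esub> (- 1 \<otimes>\<^bsub>class_ring\<^esub> a' v)) ?B"
      unfolding that(1) by (rule lincomb_sum[OF B K K, symmetric])
    also have "\<dots> = lincomb (\<lambda>v. 0 \<otimes>\<^bsub>class_ring\<^esub> a' v) ?B" by (simp add: class_ring_simps)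
    also have "\<dots> = 0 \<odot>\<^bsub>H\<^esub> lincomb a' ?B" by (rule lincomb_smult[OF B(2) K]) (simp add: class_ring_simps)
    also have "\<dots> = \<zero>\<^bsub>H\<^esub>" using smult_l_null[OF lincomb_closed[OF B(2) K]] by (simp add: class_ring_simps)
    finally have "lincomb (\<lambda>v. a v \<oplus>\<^bsub>class_ring\<^esub> (- 1 \<otimes>\<^bsub>class_ring\<^esub> a' v)) ?B = \<zero>\<^bsub>H\<^esub>" .
    from not_lindepD[OF li B(1) subset_refl K this] that(2) show ?thesis
      by (auto simp: class_ring_simps Pi_iff)
  qed
  have "dual_bases H n h (\<lambda>i x. c x (h i))"
    unfolding dual_bases_def
  proof (intro conjI allI impI ballI)
    show "h i \<in> carrier H" if "i < n" for i by (rule h[OF that])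
    show "linear_form H (\<lambda>x. c x (h i))" if "i < n" for i
      unfolding linear_form_def
    proof (intro conjI ballI allI)
      fix x y assume xy: "x \<in> carrier H" "y \<in> carrier H"
      have "lincomb (c (x \<oplus>\<^bsub>H\<^esub> y)) ?B = lincomb (\<lambda>v. c x v \<oplus>\<^bsub>class_ring\<^esub> c y v) ?B"
        using c xy lincomb_sum[OF B K K, of "c x" "c y"] by (metis M.add.m_closed)
      from uniq[OF this that] show "c (x \<oplus>\<^bsub>H\<^esub> y) (h i) = c x (h i) + c y (h i)" by (simp add: class_ring_simps)
    next
      fix k x assume x: "x \<in> carrier H"
      have kx: "k \<odot>\<^bsub>H\<^esub> x \<in> carrier H" using smult_closed[of k x] x by (simp add: class_ring_simps)
      have "lincomb (c (k \<odot>\<^bsub>H\<^esub> x)) ?B = lincomb (\<lambda>v. k \<otimes>\<^bsub>class_ring\<^esub> c x v) ?B"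
        using c[OF kx] c[OF x] lincomb_smult[OF B(2) K, of k "c x"] by (simp add: class_ring_simps)
      from uniq[OF this that] show "c (k \<odot>\<^bsub>H\<^esub> x) (h i) = k * c x (h i)" by (simp add: class_ring_simps)
    qed
    show "c (h j) (h i) = (if i = j then 1 else 0)" if "i < n" "j < n" for i j
    proof -
      let ?a = "\<lambda>v. if v = h j then 1 else 0 :: 'k"
      have "lincomb ?a ?B = (\<Oplus>\<^bsub>H\<^esub>v\<in>?B. if h j = v then v else \<zero>\<^bsub>H\<^esub>)"
        unfolding lincomb_def using B(2) h smult_one smult_l_null
        by (intro finsum_cong') (auto simp: class_ring_simps)
      also have "\<dots> = h j"
        using B that h by (subst M.finsum_singleton) auto
      finally have "lincomb (c (h j)) ?B = lincomb ?a ?B" using c[OF h[OF that(2)]] by simp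
      from uniq[OF this that(1)] show ?thesis using inj that by (auto simp: inj_on_def)
    qed
    show "x = (\<Oplus>\<^bsub>H\<^esub>i\<in>{..<n}. c x (h i) \<odot>\<^bsub>H\<^esub> h i)" if x: "x \<in> carrier H" for x
    proof -
      have sc: "k \<odot>\<^bsub>H\<^esub> v \<in> carrier H" if "v \<in> carrier H" for k v
        using smult_closed[of k v] that by (simp add: class_ring_simps)
      have "x = (\<Oplus>\<^bsub>H\<^esub>v\<in>?B. c x v \<odot>\<^bsub>H\<^esub> v)" using c[OF x] by (simp add: lincomb_def)
      also have "\<dots> = (\<Oplus>\<^bsub>H\<^esub>i\<in>{..<n}. c x (h i) \<odot>\<^bsub>H\<^esub> h i)"
        using sc B(2) by (intro M.finsum_reindex[OF _ inj]) auto
      finally show ?thesis .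
    qed
  qed
  then show ?thesis by blast
qed

section \<open>Comparison of the two algebras through a common model\<close>

text \<open>Both algebras come with maps to an explicit model, so the second map has to be inverted.
  Equations for the inverse on the carrier of \<open>M\<close> follow from injectivity of g.\<close>

lemma isomorphic_lie_superalgebrasI:
  fixes M :: "('k :: field, 'c, 'm) superalgebra_scheme"
  assumes L: "lie_superalgebra L" and N: "lie_superalgebra N" and M: "lie_superalgebra M"
    and f: "f \<in> lie_superalgebra_iso L M" and g: "g \<in> lie_superalgebra_iso N M"
  shows "isomorphic_lie_superalgebras L N"
proof -
  interpret L: lie_superalgebra L by (rule L)
  interpret N: lie_superalgebra N by (rule N)
  interpret L: nonassoc_algebra L by (rule L.is_nonassoc_algebra)
  interpret N: nonassoc_algebra N by (rule N.is_nonassoc_algebra)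
  define g' where "g' = inv_into (carrier N) g"
  have fb: "bij_betw f (carrier L) (carrier M)" and gb: "bij_betw g (carrier N) (carrier M)"
    and fh: "f \<in> module_hom class_ring L M" and gh: "g \<in> module_hom class_ring N M"
    and fm: "x \<in> carrier L \<Longrightarrow> y \<in> carrier L \<Longrightarrow> f (x \<otimes>\<^bsub>L\<^esub> y) = f x \<otimes>\<^bsub>M\<^esub> f y"
    and gm: "u \<in> carrier N \<Longrightarrow> v \<in> carrier N \<Longrightarrow> g (u \<otimes>\<^bsub>N\<^esub> v) = g u \<otimes>\<^bsub>M\<^esub> g v"
    and fp: "f ` part L i = part M i" and gp: "g ` part N i = part M i" for x y u v i
    using f g by (auto simp: lie_superalgebra_iso_def)
  have fc: "f x \<in> carrier M" if "x \<in> carrier L" for x using fb that by (auto simp: bij_betw_def)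
  have g'c: "g' w \<in> carrier N" and gg': "g (g' w) = w" if "w \<in> carrier M" for w
    using gb that unfolding g'_def by (auto simp: bij_betw_def inv_into_into f_inv_into_f)
  have g'I: "g' w = u" if "u \<in> carrier N" "g u = w" for u w
    using gb that unfolding g'_def by (auto simp: bij_betw_def)
  have "g' \<circ> f \<in> lie_superalgebra_iso L N"
    unfolding lie_superalgebra_iso_def
  proof (intro CollectI conjI ballI allI)
    show "g' \<circ> f \<in> module_hom class_ring L N"
      unfolding module_hom_iff
    proof (intro conjI ballI allI)
      show "g' \<circ> f \<in> carrier L \<rightarrow> carrier N" using fc g'c by simp
      show "(g' \<circ> f) (x \<oplus>\<^bsub>L\<^esub> y) = (g' \<circ> f) x \<oplus>\<^bsub>N\<^esub> (g' \<circ> f) y" if "x \<in> carrier L" "y \<in> carrier L" for x y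
        unfolding o_def by (rule g'I) (use that fh gh fc g'c gg' in \<open>simp_all add: module_hom_iff\<close>)
      show "(g' \<circ> f) (c \<odot>\<^bsub>L\<^esub> x) = c \<odot>\<^bsub>N\<^esub> (g' \<circ> f) x" if "x \<in> carrier L" for c x
        unfolding o_def by (rule g'I) (use that fh gh fc g'c gg' in \<open>simp_all add: module_hom_iff\<close>)
    qed
    show "bij_betw (g' \<circ> f) (carrier L) (carrier N)"
      unfolding g'_def by (rule bij_betw_trans[OF fb bij_betw_inv_into[OF gb]])
    show "(g' \<circ> f) (x \<otimes>\<^bsub>L\<^esub> y) = (g' \<circ> f) x \<otimes>\<^bsub>N\<^esub> (g' \<circ> f) y" if "x \<in> carrier L" "y \<in> carrier L" for x y
      unfolding o_def by (rule g'I) (use that fm gm fc g'c gg' in simp_all)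
    show "(g' \<circ> f) ` part L i = part N i" for i
    proof -
      have "part N i \<subseteq> carrier N" using N.part_subspace[of i] by (simp add: subspace_iff)
      then have "g' ` g ` part N i = part N i"
        unfolding image_image using g'I by (intro trans[OF image_cong image_ident]) auto
      then show ?thesis unfolding image_comp[symmetric] fp gp .
    qed
  qed
  then show ?thesis using L N by (auto simp: isomorphic_lie_superalgebras_def)
qed

context e7_char3
begin

lemma rank_el53: "vec_space.rank 5 (map_mat of_int cartan_el53 :: 'k mat) = 5"
proof (rule rank_fullI)
  have d: "cartan_el53 \<in> carrier_mat 5 5" by (intro carrier_matI) (simp_all add: cartan_el53_def mat_of_rows_list_def)
  then show "map_mat of_int cartan_el53 \<in> carrier_mat 5 5" by simp
  fix v :: "nat \<Rightarrow> 'k"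
  assume v: "\<And>i. i < 5 \<Longrightarrow> (\<Sum>j<5. map_mat of_int cartan_el53 $$ (i, j) * v j) = 0"
  have e: "(\<Sum>j<5. of_int (el53_entry i j) * v j) = 0" if "i < 5" for i
    using v[OF that] that d by (simp add: cartan_el53_entry)
  from e[of 0] e[of 1] e[of 2] e[of 3] e[of 4]
  have "2 * v 0 = v 2" "v 2 = 0" "- v 0 - v 1 + 2 * v 2 - v 3 = 0" "- v 2 + 2 * v 3 - v 4 = 0" "v 3 = 0"
    by (simp_all add: el53_entry_def eval_nat_numeral)
  then show "\<forall>j<5. v j = 0" using two(2) by (simp add: less5)
qed

lemma cartan_e7_entry: "i < 7 \<Longrightarrow> j < 7 \<Longrightarrow> cartan_e7 $$ (i, j) = e7_form (e7_simple i) (e7_simple j)"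
  unfolding less7 by (elim disjE) (simp_all add: cartan_e7_def mat_of_rows_list_def e7_simple_def)

lemma rank_e7: "vec_space.rank 7 (map_mat of_int cartan_e7 :: 'k mat) = 7"
proof (rule rank_fullI)
  have d: "cartan_e7 \<in> carrier_mat 7 7" by (intro carrier_matI) (simp_all add: cartan_e7_def mat_of_rows_list_def)
  then show "map_mat of_int cartan_e7 \<in> carrier_mat 7 7" by simp
  fix v :: "nat \<Rightarrow> 'k"
  assume v: "\<And>i. i < 7 \<Longrightarrow> (\<Sum>j<7. map_mat of_int cartan_e7 $$ (i, j) * v j) = 0"
  have e: "(\<Sum>j<7. of_int (e7_form (e7_simple i) (e7_simple j)) * v j) = 0" if "i < 7" for i
    using v[OF that] that d by (simp add: cartan_e7_entry)
  from e[of 0] e[of 1] e[of 2] e[of 3] e[of 4] e[of 5] e[of 6]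
  \<comment> \<open>The rows with 2 replaced by -1. The first five express everything but the last
    entry through \<open>v 0\<close>; the remaining two give \<open>v 6 = 0\<close> and
    \<open>v 6 = v 0\<close>.\<close>
  have "v 2 = - v 0" "v 3 = - v 1" "- v 0 - v 2 - v 3 = 0" "- v 1 - v 2 - v 3 - v 4 = 0"
      "- v 3 - v 4 - v 5 = 0" "- v 4 - v 5 - v 6 = 0" "- v 5 - v 6 = 0"
    unfolding sum7 by (simp_all add: e7_simple_def two(1) eq_neg_iff_add_eq_0 algebra_simps)
  then have "v 3 = 0" "v 1 = 0" "v 4 = v 0" "v 5 = - v 0" "v 6 = v 0" "v 0 = 0"
    by (simp_all add: algebra_simps)
  then show "\<forall>j<7. v j = 0" using \<open>v 2 = - v 0\<close> by (simp add: less7)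
qed

text \<open>If 3 divided all coordinates it would divide the square length, which is 2.\<close>

lemma root_nonzero: "e7_form a a = 2 \<Longrightarrow> \<exists>i<7. (of_int (e7_coord a i) :: 'k) \<noteq> 0"
proof (rule ccontr)
  assume a: "e7_form a a = 2" and "\<not> (\<exists>i<7. (of_int (e7_coord a i) :: 'k) \<noteq> 0)"
  then have "3 dvd e7_coord a i" if "i < 7" for i
    using that unfolding of_int_eq_0_iff_char_dvd CHAR_3 by simp
  then have "3 dvd e7_form a a"
    by (subst ip_cf) (auto intro!: dvd_sum)
  then show False using a by simp
qed

lemma finite_basis: "finite basis"
proof (rule finite_subset)
  show "basis \<subseteq> T ` {..<7} \<union> R ` set e7_roots" using e7_roots by (auto simp: basis_def simp del: e7_form.simps)
qed simp

text \<open>Each contragredient algebra is recognized through its model for the given realization.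
  The first isomorphism carries the sum of the two generators to a sum of orthogonal root vectors,
  so \<open>alpha3_model\<close> applies, and \<open>block_algebra\<close> is the common target of
  both sides.\<close>

theorem semisimplification_e7:
  fixes H :: "('k, 'h) module" and H' :: "('k, 'h') module"
  assumes r: "realization 7 cartan_e7 H h \<alpha>" and r': "realization 5 cartan_el53 H' h' \<alpha>'"
  defines "L \<equiv> contragredient 7 parity_e7 H h \<alpha>" and "e \<equiv> contragredient_e 7 parity_e7 H h \<alpha>"
  shows "alpha3_lie_algebra L (\<lambda>y. (e 0 \<oplus>\<^bsub>L\<^esub> e 6) \<otimes>\<^bsub>L\<^esub> y)"
    and "isomorphic_lie_superalgebras (semisimplification L (\<lambda>y. (e 0 \<oplus>\<^bsub>L\<^esub> e 6) \<otimes>\<^bsub>L\<^esub> y))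
      (contragredient 5 parity_el53 H' h' \<alpha>')"
proof -
  obtain c c' where c: "dual_bases H 7 h c" and c': "dual_bases H' 5 h' c'"
    using realization_dual_bases[OF r rank_e7] realization_dual_bases[OF r' rank_el53] by blast
  interpret E: contragredient_model 7 parity_e7 H h \<alpha> lattice_algebra "\<lambda>x. \<Sum>i<7. c i x *\<^sub>p tv i"
    "\<lambda>i. rt (e7_simple i)" "\<lambda>i. - rt (- e7_simple i)" "pm_component basis ideg" "pm_proj ideg"
    by (rule lattice_contragredient_model[OF _ c])
       (use r root_nonzero cartan_e7_entry in \<open>auto simp: realization_def parity_e7_def\<close>)
  interpret B: contragredient_model 5 parity_el53 H' h' \<alpha>' block_algebra "\<lambda>x. \<Sum>i<5. cscale (c' i x) (torus i)"
    el_e el_f "block_component rdg" "block_proj rdg"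
    by (rule block_contragredient_model[OF _ c']) (use r' in \<open>auto simp: realization_def\<close>)
  have L: "lie_superalgebra L" and \<Phi>: "E.\<Phi> \<in> lie_superalgebra_iso L lattice_algebra"
    unfolding L_def by (rule E.contragredient_iso)+
  have e: "e i \<in> carrier L" "E.\<Phi> (e i) = rt (e7_simple i)" if "i < 7" for i
    unfolding L_def e_def by (rule E.contragredient_e[OF that])+
  have hom: "E.\<Phi> (e 0 \<oplus>\<^bsub>L\<^esub> e 6) = rt \<beta> + rt \<beta>'" "e 0 \<oplus>\<^bsub>L\<^esub> e 6 \<in> carrier L"
  proof -
    interpret lie_superalgebra L by (rule L)
    interpret nonassoc_algebra L by (rule is_nonassoc_algebra)
    show "e 0 \<oplus>\<^bsub>L\<^esub> e 6 \<in> carrier L" using e by simp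
    show "E.\<Phi> (e 0 \<oplus>\<^bsub>L\<^esub> e 6) = rt \<beta> + rt \<beta>'"
      using \<Phi> e by (simp add: lie_superalgebra_iso_def module_hom_iff)
  qed
  interpret A: alpha3_model 7 e7_form e7_sign e7_simple e7_coord \<beta> \<beta>' ty L E.\<Phi> "e 0 \<oplus>\<^bsub>L\<^esub> e 6"
    by (intro alpha3_model.intro alpha3_model_axioms.intro L \<Phi> hom finite_basis orthogonal_roots_char3_axioms)
  have d: "(\<lambda>y. (e 0 \<oplus>\<^bsub>L\<^esub> e 6) \<otimes>\<^bsub>L\<^esub> y) = A.d"
    by (simp add: A.d_def fun_eq_iff)
  show "alpha3_lie_algebra L (\<lambda>y. (e 0 \<oplus>\<^bsub>L\<^esub> e 6) \<otimes>\<^bsub>L\<^esub> y)"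
    unfolding d by (rule A.alpha3)
  show "isomorphic_lie_superalgebras (semisimplification L (\<lambda>y. (e 0 \<oplus>\<^bsub>L\<^esub> e 6) \<otimes>\<^bsub>L\<^esub> y))
      (contragredient 5 parity_el53 H' h' \<alpha>')"
    unfolding d by (rule isomorphic_lie_superalgebrasI[OF A.semisimplification_iso(1) B.contragredient_iso(1)
        block_algebra_lie A.semisimplification_iso(2) B.contragredient_iso(2)])
qed

end

theorem corollary4p5p2:
  fixes H :: "('k :: alg_closed_field, 'h) module" and h :: "nat \<Rightarrow> 'h" and \<alpha> :: "nat \<Rightarrow> 'h \<Rightarrow> 'k"
    and H' :: "('k, 'h') module" and h' :: "nat \<Rightarrow> 'h'" and \<alpha>' :: "nat \<Rightarrow> 'h' \<Rightarrow> 'k"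
  assumes "CHAR('k) = 3"
    and "realization 7 cartan_e7 H h \<alpha>"
    and "realization 5 cartan_el53 H' h' \<alpha>'"
  shows "let e7 = contragredient 7 parity_e7 H h \<alpha>;
             e = contragredient_e 7 parity_e7 H h \<alpha>;
             d = (\<lambda>y. (e 0 \<oplus>\<^bsub>e7\<^esub> e 6) \<otimes>\<^bsub>e7\<^esub> y);
             el53 = contragredient 5 parity_el53 H' h' \<alpha>'
         in alpha3_lie_algebra e7 d \<and>
            isomorphic_lie_superalgebras (semisimplification e7 d) el53"
proof -
  interpret e7_char3 "TYPE('k)" by unfold_locales (rule assms)
  show ?thesis unfolding Let_def using semisimplification_e7[OF assms(2,3)] by blast
qed

end
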